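(* Let $G$ be a Carnot group, let $U,V\subset G$ be open, and let $f:U\to V$ be a $C^1$-contact diffeomorphism. Then the push-forward by $f$ maps contact fields to weak contact fields; that is, for every contact field $Z$ on $U$, the vector field $f_*Z$ on $V$ given by $(f_*Z)_{f(x)}=d_xf(Z_x)$, $x\in U$, is a weak contact field on $V$.
   Context: A Carnot group $G$ is a connected, simply connected (real) Lie group whose Lie algebra has a stratification $\mathfrak g=\mathfrak g_{-1}\oplus\dots\oplus\mathfrak g_{-s}$ with $[\mathfrak g_{-1},\mathfrak g_{-i}]=\mathfrak g_{-i-1}$ for $i=1,\dots,s$, where $\mathfrak g_{-s-1}=\{0\}$. Put $n=\dim\mathfrak g$, $d_l=\dim\mathfrak g_{-l}$, $\nu=\sum_{l=1}^s l\,d_l$. Fix a basis $\{X_{-l,v}: 1\le l\le s,\ 1\le v\le d_l\}$ of $\mathfrak g$ adapted to the stratification (with $X_{-l,v}\in\mathfrak g_{-l}$), identified with left-invariant vector fields, and let $\{\sigma_{-l,v}\}$ be the dual basis of left-invariant 1-forms. The group $G$ is oriented by the left-invariant volume form $\bigwedge_{(l,v)}\sigma_{-l,v}$. The horizontal bundle $\mathcal H\subset TG$ is the left-invariant subbundle whose fiber at $x$ is the left translate of $\mathfrak g_{-1}$ to $T_xG$. $C^1$-contact diffeomorphism $f:U\to V$: a $C^1$-diffeomorphism from $U$ onto $V$ with $d_xf(\mathcal H_x)\subset\mathcal H_{f(x)}$ for every $x\in U$. Contact field: a $C^1$ vector field $Z$ on an open set $W\subset G$ is a contact field if $[Z,X]$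 is a section of $\mathcal H$ for every smooth section $X$ of $\mathcal H$ over an open subset of $W$ (equivalently, $[Z,X](x)\in\mathcal H_x$ for all $x\in W$ and all left-invariant $X\in\mathfrak g_{-1}$). This is the infinitesimal form of the condition that the local flow of $Z$ consists of contact maps. A 1-form $\eta$ on an open set $W$ is vertical if $\eta_x(X_x)=0$ for a.e. $x\in W$ and every $X_x\in\mathcal H_x$. An $(n-1)$-form $\beta$ is said to be of weight $-\nu+1$ if it can be written $\beta=\sum_{i=1}^{d_1}\beta_i\,\hat\sigma_{-1,i}$ with functions $\beta_i$, where $\hat\sigma_{-1,i}=\bigwedge_{(l,v)\ne(1,i)}\sigma_{-l,v}$. $i_Y$ denotes interior multiplication. Weak contact field: a measurable vector field $Y$ on an open set $W\subset G$ whose coefficients in the frame $\{X_{-l,v}\}$ are in $L^1_{\mathrm{loc}}(W)$ is a weak contact field on $W$ if $$\int_W i_Y(d\eta)\wedge\beta-\int_W i_Y(\eta)\wedge d\beta=0$$ for every smooth vertical 1-form $\eta$ on $W$ and every smooth compactly supported $(n-1)$-form $\beta$ on $W$ of weight $-\nu+1$. *)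

theory Defs
  imports "HOL-Analysis.Analysis" "HOL-Algebra.Group"
begin

section \<open>Functions of class C^k on open subsets of Euclidean space\<close>

text \<open>Intended for open sets \<open>S\<close> only.\<close>

primrec Ck_on :: "nat \<Rightarrow> 'a::euclidean_space set \<Rightarrow> ('a \<Rightarrow> 'b::real_normed_vector) \<Rightarrow> bool" where
  "Ck_on 0 S f \<longleftrightarrow> continuous_on S f"
| "Ck_on (Suc k) S f \<longleftrightarrow>
     (\<forall>x\<in>S. f differentiable (at x)) \<and> (\<forall>v. Ck_on k S (\<lambda>x. frechet_derivative f (at x) v))"

definition smooth_on :: "'a::euclidean_space set \<Rightarrow> ('a \<Rightarrow> 'b::real_normed_vector) \<Rightarrow> bool" where
  "smooth_on S f \<longleftrightarrow> (\<forall>k. Ck_on k S f)"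


section \<open>Alternating forms on a vector space\<close>

text \<open>
  A k-form on a vector space is a function on lists of vectors which is alternating multilinear on
  lists of length k and, by convention, vanishes on all lists of other lengths. A 0-form is
  thus determined by its value on the empty list.
\<close>

definition alt_form :: "nat \<Rightarrow> ('e::real_vector list \<Rightarrow> real) \<Rightarrow> bool" where
  "alt_form k \<alpha> \<longleftrightarrow>
     (\<forall>vs. length vs \<noteq> k \<longrightarrow> \<alpha> vs = 0) \<and>
     (\<forall>vs i. length vs = k \<and> i < k \<longrightarrow> linear (\<lambda>v. \<alpha> (vs[i := v]))) \<and>
     (\<forall>vs i j. length vs = k \<and> i < j \<and> j < k \<and> vs ! i = vs ! j \<longrightarrow> \<alpha> vs = 0)"

text \<open>Normalised so that \<open>\<sigma>\<^sub>1 \<and> \<dots> \<and> \<sigma>\<^sub>m\<close> evaluated at \<open>v\<^sub>1, \<dots>, v\<^sub>m\<close> is the determinant of \<open>\<sigma>\<^sub>i (v\<^sub>j)\<close>.\<close>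

definition wedge ::
  "nat \<Rightarrow> nat \<Rightarrow> ('e list \<Rightarrow> real) \<Rightarrow> ('e list \<Rightarrow> real) \<Rightarrow> 'e list \<Rightarrow> real" where
  "wedge k l \<alpha> \<beta> = (\<lambda>vs. if length vs = k + l
     then (\<Sum>\<pi> | \<pi> permutes {..<k + l}.
             of_int (sign \<pi>) * \<alpha> (map (\<lambda>i. vs ! \<pi> i) [0..<k]) * \<beta> (map (\<lambda>i. vs ! \<pi> i) [k..<k + l]))
          / (fact k * fact l)
     else 0)"

primrec wedge_list :: "('e list \<Rightarrow> real) list \<Rightarrow> 'e list \<Rightarrow> real" where
  "wedge_list [] = (\<lambda>vs. if vs = [] then 1 else 0)"
| "wedge_list (\<alpha> # \<alpha>s) = wedge 1 (length \<alpha>s) \<alpha> (wedge_list \<alpha>s)"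


section \<open>Smooth manifolds\<close>

type_synonym ('g, 'e) chart = "'g set \<times> ('g \<Rightarrow> 'e)"

text \<open>Only the values of a chart map on its domain \<open>fst c\<close> are relevant.\<close>

abbreviation chart_inv :: "('g, 'e) chart \<Rightarrow> 'e \<Rightarrow> 'g" where
  "chart_inv c \<equiv> inv_into (fst c) (snd c)"

definition smooth_atlas ::
  "('g::topological_space, 'e::euclidean_space) chart set \<Rightarrow> bool" where
  "smooth_atlas A \<longleftrightarrow>
     (\<forall>x. \<exists>c\<in>A. x \<in> fst c) \<and>
     (\<forall>c\<in>A. open (fst c) \<and> open (snd c ` fst c) \<and>
        homeomorphism (fst c) (snd c ` fst c) (snd c) (chart_inv c)) \<and>
     (\<forall>c\<in>A. \<forall>c'\<in>A. smooth_on (snd c ` (fst c \<inter> fst c')) (snd c' \<circ> chart_inv c))"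

text \<open>
  A Lie group is a group on the whole type \<open>'g\<close>, whose topology is that of the type. The
  model space is \<open>'e\<close>. Tangent vectors: at every point \<open>x\<close> a chart \<open>chart_at G x\<close> around \<open>x\<close>
  is selected, and a tangent vector at \<open>x\<close> is represented by its coordinate vector in \<open>'e\<close>
  with respect to this chart. Hence every tangent space has underlying type \<open>'e\<close>, a vector field is a
  function \<open>'g \<Rightarrow> 'e\<close> and a differential k-form is a function
  \<open>'g \<Rightarrow> 'e list \<Rightarrow> real\<close>. The selected chart varies with the point (in general discontinuously), so
  differentiability of vector fields and forms is expressed after changing to a fixed chart.
  Fields and forms on an open set \<open>W\<close> are total functions of which only the values on \<open>W\<close> matter.
\<close>

record ('g, 'e) lie_struct = "'g monoid" +
  atlas :: "('g, 'e) chart set"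

definition chart_at :: "('g, 'e, 'z) lie_struct_scheme \<Rightarrow> 'g \<Rightarrow> ('g, 'e) chart" where
  "chart_at G x = (SOME c. c \<in> atlas G \<and> x \<in> fst c)"

text \<open>Change of coordinates, from the chart \<open>c\<close> to the chart \<open>c'\<close>, of tangent vectors at \<open>x\<close>.\<close>

definition change_coords ::
  "('g, 'e::euclidean_space) chart \<Rightarrow> ('g, 'e) chart \<Rightarrow> 'g \<Rightarrow> 'e \<Rightarrow> 'e" where
  "change_coords c c' x = frechet_derivative (snd c' \<circ> chart_inv c) (at (snd c x))"

definition field_in_chart ::
  "('g, 'e::euclidean_space, 'z) lie_struct_scheme \<Rightarrow> ('g, 'e) chart \<Rightarrow> ('g \<Rightarrow> 'e) \<Rightarrow> 'e \<Rightarrow> 'e" where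
  "field_in_chart G c X = (\<lambda>u. let x = chart_inv c u in change_coords (chart_at G x) c x (X x))"

definition form_in_chart ::
  "('g, 'e::euclidean_space, 'z) lie_struct_scheme \<Rightarrow> ('g, 'e) chart \<Rightarrow> ('g \<Rightarrow> 'e list \<Rightarrow> real)
     \<Rightarrow> 'e \<Rightarrow> 'e list \<Rightarrow> real" where
  "form_in_chart G c \<omega> =
     (\<lambda>u vs. let x = chart_inv c u in \<omega> x (map (change_coords c (chart_at G x) x) vs))"

definition Ck_field ::
  "nat \<Rightarrow> ('g, 'e::euclidean_space, 'z) lie_struct_scheme \<Rightarrow> 'g set \<Rightarrow> ('g \<Rightarrow> 'e) \<Rightarrow> bool" where
  "Ck_field k G W X \<longleftrightarrow> (\<forall>c\<in>atlas G. Ck_on k (snd c ` (W \<inter> fst c)) (field_in_chart G c X))"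

definition smooth_field ::
  "('g, 'e::euclidean_space, 'z) lie_struct_scheme \<Rightarrow> 'g set \<Rightarrow> ('g \<Rightarrow> 'e) \<Rightarrow> bool" where
  "smooth_field G W X \<longleftrightarrow> (\<forall>k. Ck_field k G W X)"

definition smooth_form ::
  "('g, 'e::euclidean_space, 'z) lie_struct_scheme \<Rightarrow> nat \<Rightarrow> 'g set
     \<Rightarrow> ('g \<Rightarrow> 'e list \<Rightarrow> real) \<Rightarrow> bool" where
  "smooth_form G k W \<omega> \<longleftrightarrow>
     (\<forall>x\<in>W. alt_form k (\<omega> x)) \<and>
     (\<forall>c\<in>atlas G. \<forall>vs. smooth_on (snd c ` (W \<inter> fst c)) (\<lambda>u. form_in_chart G c \<omega> u vs))"

definition Ck_map ::
  "nat \<Rightarrow> ('g::topological_space, 'e::euclidean_space, 'z) lie_struct_scheme \<Rightarrow> 'g set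
     \<Rightarrow> ('g \<Rightarrow> 'g) \<Rightarrow> bool" where
  "Ck_map k G W f \<longleftrightarrow>
     continuous_on W f \<and>
     (\<forall>c\<in>atlas G. \<forall>c'\<in>atlas G.
        Ck_on k (snd c ` (W \<inter> fst c \<inter> f -` fst c')) (snd c' \<circ> f \<circ> chart_inv c))"

definition differential ::
  "('g, 'e::euclidean_space, 'z) lie_struct_scheme \<Rightarrow> ('g \<Rightarrow> 'g) \<Rightarrow> 'g \<Rightarrow> 'e \<Rightarrow> 'e" where
  "differential G f x =
     frechet_derivative (snd (chart_at G (f x)) \<circ> f \<circ> chart_inv (chart_at G x))
       (at (snd (chart_at G x) x))"

text \<open>
  The Lie bracket at \<open>x\<close>, computed in the chart selected at \<open>x\<close>; the sign is that of
  \<open>[X, Y] h = X (Y h) - Y (X h)\<close>.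
\<close>

definition field_bracket ::
  "('g, 'e::euclidean_space, 'z) lie_struct_scheme \<Rightarrow> ('g \<Rightarrow> 'e) \<Rightarrow> ('g \<Rightarrow> 'e) \<Rightarrow> 'g \<Rightarrow> 'e" where
  "field_bracket G X Y x =
     (let c = chart_at G x; u = snd c x in
        frechet_derivative (field_in_chart G c Y) (at u) (X x)
        - frechet_derivative (field_in_chart G c X) (at u) (Y x))"

text \<open>
  The exterior derivative at \<open>x\<close>, computed in the chart selected at \<open>x\<close>:
  the value on \<open>v\<^sub>0, \<dots>, v\<^sub>k\<close> is the alternating sum of the derivatives
  in direction \<open>v\<^sub>i\<close> of the coefficient on the list with \<open>v\<^sub>i\<close> omitted.
\<close>

definition ext_deriv ::
  "('g, 'e::euclidean_space, 'z) lie_struct_scheme \<Rightarrow> ('g \<Rightarrow> 'e list \<Rightarrow> real)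
     \<Rightarrow> 'g \<Rightarrow> 'e list \<Rightarrow> real" where
  "ext_deriv G \<omega> x vs =
     (let c = chart_at G x in
        \<Sum>i<length vs. (-1) ^ i *
          frechet_derivative (\<lambda>u. form_in_chart G c \<omega> u (take i vs @ drop (Suc i) vs))
            (at (snd c x)) (vs ! i))"

definition interior_mult ::
  "('g \<Rightarrow> 'e) \<Rightarrow> ('g \<Rightarrow> 'e list \<Rightarrow> real) \<Rightarrow> 'g \<Rightarrow> 'e list \<Rightarrow> real" where
  "interior_mult Y \<omega> = (\<lambda>x vs. \<omega> x (Y x # vs))"


section \<open>Lie groups and Carnot groups\<close>

definition lie_group ::
  "('g::{t2_space, second_countable_topology}, 'e::euclidean_space, 'z) lie_struct_scheme
     \<Rightarrow> bool" where
  "lie_group G \<longleftrightarrow>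
     group G \<and> carrier G = UNIV \<and> smooth_atlas (atlas G) \<and>
     continuous_on UNIV (\<lambda>(x, y). x \<otimes>\<^bsub>G\<^esub> y) \<and>
     (\<forall>c1\<in>atlas G. \<forall>c2\<in>atlas G. \<forall>c3\<in>atlas G.
        smooth_on {(snd c1 x, snd c2 y) | x y. x \<in> fst c1 \<and> y \<in> fst c2 \<and> x \<otimes>\<^bsub>G\<^esub> y \<in> fst c3}
          (\<lambda>(u, w). snd c3 (chart_inv c1 u \<otimes>\<^bsub>G\<^esub> chart_inv c2 w))) \<and>
     (\<forall>k. Ck_map k G UNIV (\<lambda>x. inv\<^bsub>G\<^esub> x))"

text \<open>
  The Lie algebra is the tangent space at the identity, identified
  with the space of left-invariant vector fields via \<open>left_field\<close>.
\<close>

definition left_field ::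
  "('g, 'e::euclidean_space, 'z) lie_struct_scheme \<Rightarrow> 'e \<Rightarrow> 'g \<Rightarrow> 'e" where
  "left_field G v = (\<lambda>x. differential G (\<lambda>y. x \<otimes>\<^bsub>G\<^esub> y) \<one>\<^bsub>G\<^esub> v)"

definition lie_bracket ::
  "('g, 'e::euclidean_space, 'z) lie_struct_scheme \<Rightarrow> 'e \<Rightarrow> 'e \<Rightarrow> 'e" where
  "lie_bracket G v w = field_bracket G (left_field G v) (left_field G w) \<one>\<^bsub>G\<^esub>"

text \<open>
  \<open>layer G l\<close> is the stratum of degree \<open>-l\<close>, and \<open>frame G l v\<close>, for
  \<open>1 \<le> l \<le> step G\<close> and \<open>1 \<le> v \<le> dim (layer G l)\<close>, is the basis
  vector indexed by \<open>(-l, v)\<close>, as an element of the tangent space at the identity.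
\<close>

record ('g, 'e) carnot_struct = "('g, 'e) lie_struct" +
  step :: nat
  layer :: "nat \<Rightarrow> 'e set"
  frame :: "nat \<Rightarrow> nat \<Rightarrow> 'e"

definition stratified ::
  "('g, 'e::euclidean_space, 'z) carnot_struct_scheme \<Rightarrow> bool" where
  "stratified G \<longleftrightarrow>
     1 \<le> step G \<and>
     (\<forall>l\<in>{1..step G}. subspace (layer G l)) \<and>
     (\<forall>w. \<exists>!p. (\<forall>l\<in>{1..step G}. p l \<in> layer G l) \<and> (\<forall>l. l \<notin> {1..step G} \<longrightarrow> p l = 0) \<and>
        w = (\<Sum>l = 1..step G. p l)) \<and>
     layer G (step G + 1) = {0} \<and>
     (\<forall>i\<in>{1..step G}.
        span {lie_bracket G v w | v w. v \<in> layer G 1 \<and> w \<in> layer G i} = layer G (i + 1))"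

definition adapted_frame ::
  "('g, 'e::euclidean_space, 'z) carnot_struct_scheme \<Rightarrow> bool" where
  "adapted_frame G \<longleftrightarrow>
     (\<forall>l\<in>{1..step G}.
        inj_on (frame G l) {1..dim (layer G l)} \<and>
        independent (frame G l ` {1..dim (layer G l)}) \<and>
        span (frame G l ` {1..dim (layer G l)}) = layer G l)"

definition carnot_group ::
  "('g::{t2_space, second_countable_topology}, 'e::euclidean_space, 'z) carnot_struct_scheme
     \<Rightarrow> bool" where
  "carnot_group G \<longleftrightarrow>
     lie_group G \<and> connected (UNIV :: 'g set) \<and> simply_connected (UNIV :: 'g set) \<and>
     stratified G \<and> adapted_frame G"

definition frame_index ::
  "('g, 'e::euclidean_space, 'z) carnot_struct_scheme \<Rightarrow> (nat \<times> nat) list" where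
  "frame_index G = [(l, v). l \<leftarrow> [1..<Suc (step G)], v \<leftarrow> [1..<Suc (dim (layer G l))]]"

definition frame_field ::
  "('g, 'e::euclidean_space, 'z) carnot_struct_scheme \<Rightarrow> nat \<times> nat \<Rightarrow> 'g \<Rightarrow> 'e" where
  "frame_field G = (\<lambda>(l, v). left_field G (frame G l v))"

text \<open>The coefficient of the vector \<open>w\<close> at \<open>x\<close> along the basis vector with index \<open>a\<close>.\<close>

definition frame_coeff ::
  "('g, 'e::euclidean_space, 'z) carnot_struct_scheme \<Rightarrow> nat \<times> nat \<Rightarrow> 'g \<Rightarrow> 'e \<Rightarrow> real" where
  "frame_coeff G a x w =
     representation ((\<lambda>b. frame_field G b x) ` set (frame_index G)) w (frame_field G a x)"

definition coframe ::
  "('g, 'e::euclidean_space, 'z) carnot_struct_scheme \<Rightarrow> nat \<times> nat \<Rightarrow> 'g \<Rightarrow> 'e list \<Rightarrow> real" where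
  "coframe G a x = (\<lambda>vs. if length vs = 1 then frame_coeff G a x (hd vs) else 0)"

definition volume_form ::
  "('g, 'e::euclidean_space, 'z) carnot_struct_scheme \<Rightarrow> 'g \<Rightarrow> 'e list \<Rightarrow> real" where
  "volume_form G x = wedge_list (map (\<lambda>a. coframe G a x) (frame_index G))"

definition hat_coframe ::
  "('g, 'e::euclidean_space, 'z) carnot_struct_scheme \<Rightarrow> nat \<Rightarrow> 'g \<Rightarrow> 'e list \<Rightarrow> real" where
  "hat_coframe G i x =
     wedge_list (map (\<lambda>a. coframe G a x) (filter (\<lambda>a. a \<noteq> (1, i)) (frame_index G)))"

definition horizontal ::
  "('g, 'e::euclidean_space, 'z) carnot_struct_scheme \<Rightarrow> 'g \<Rightarrow> 'e set" where
  "horizontal G x = (\<lambda>v. left_field G v x) ` layer G 1"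


section \<open>Integration of top-degree forms\<close>

definition basis_list :: "'e::euclidean_space list" where
  "basis_list = (SOME bs. distinct bs \<and> set bs = Basis)"

text \<open>
  The Borel measure induced by the volume form; in a chart it has density
  \<open>\<bar>volume_form (\<partial>\<^sub>1, \<dots>, \<partial>\<^sub>n)\<bar>\<close> with respect to Lebesgue measure. These local conditions
  are compatible on overlaps of charts and determine the measure.
\<close>

definition volume_measure ::
  "('g::topological_space, 'e::euclidean_space, 'z) carnot_struct_scheme \<Rightarrow> 'g measure" where
  "volume_measure G = (THE \<mu>. sets \<mu> = sets borel \<and>
     (\<forall>c\<in>atlas G. \<forall>S\<in>sets borel. S \<subseteq> fst c \<longrightarrow>
        emeasure \<mu> S =
          (\<integral>\<^sup>+ u \<in> snd c ` S. ennreal \<bar>form_in_chart G c (volume_form G) u basis_list\<bar> \<partial>lborel)))"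

text \<open>
  A top-degree form is \<open>\<omega> = g \<cdot> volume_form\<close>, where \<open>g\<close> is the value of \<open>\<omega>\<close> on the frame, and as
  \<open>G\<close> is oriented by the volume form, the integral of \<open>\<omega>\<close> is that of \<open>g\<close> for the volume measure.
\<close>

definition form_integral ::
  "('g::topological_space, 'e::euclidean_space, 'z) carnot_struct_scheme \<Rightarrow> 'g set
     \<Rightarrow> ('g \<Rightarrow> 'e list \<Rightarrow> real) \<Rightarrow> real" where
  "form_integral G W \<omega> =
     set_lebesgue_integral (volume_measure G) W
       (\<lambda>x. \<omega> x (map (\<lambda>a. frame_field G a x) (frame_index G)))"


section \<open>Contact maps and contact fields\<close>

definition contact_diffeo ::
  "('g::topological_space, 'e::euclidean_space, 'z) carnot_struct_scheme \<Rightarrow> 'g set \<Rightarrow> 'g set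
     \<Rightarrow> ('g \<Rightarrow> 'g) \<Rightarrow> bool" where
  "contact_diffeo G U V f \<longleftrightarrow>
     bij_betw f U V \<and> Ck_map 1 G U f \<and> Ck_map 1 G V (inv_into U f) \<and>
     (\<forall>x\<in>U. differential G f x ` horizontal G x \<subseteq> horizontal G (f x))"

definition push_forward ::
  "('g, 'e::euclidean_space, 'z) lie_struct_scheme \<Rightarrow> 'g set \<Rightarrow> ('g \<Rightarrow> 'g) \<Rightarrow> ('g \<Rightarrow> 'e)
     \<Rightarrow> 'g \<Rightarrow> 'e" where
  "push_forward G U f Z y = (let x = inv_into U f y in differential G f x (Z x))"

definition contact_field ::
  "('g::topological_space, 'e::euclidean_space, 'z) carnot_struct_scheme \<Rightarrow> 'g set
     \<Rightarrow> ('g \<Rightarrow> 'e) \<Rightarrow> bool" where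
  "contact_field G W Z \<longleftrightarrow>
     Ck_field 1 G W Z \<and>
     (\<forall>W' X. open W' \<and> W' \<subseteq> W \<and> smooth_field G W' X \<and> (\<forall>x\<in>W'. X x \<in> horizontal G x) \<longrightarrow>
        (\<forall>x\<in>W'. field_bracket G Z X x \<in> horizontal G x))"

definition vertical_form ::
  "('g::topological_space, 'e::euclidean_space, 'z) carnot_struct_scheme \<Rightarrow> 'g set
     \<Rightarrow> ('g \<Rightarrow> 'e list \<Rightarrow> real) \<Rightarrow> bool" where
  "vertical_form G W \<eta> \<longleftrightarrow>
     (AE x in volume_measure G. x \<in> W \<longrightarrow> (\<forall>w\<in>horizontal G x. \<eta> x [w] = 0))"

text \<open>The \<open>(n - 1)\<close>-forms of weight \<open>-\<nu> + 1\<close>.\<close>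

definition codegree_one_weight ::
  "('g, 'e::euclidean_space, 'z) carnot_struct_scheme \<Rightarrow> 'g set
     \<Rightarrow> ('g \<Rightarrow> 'e list \<Rightarrow> real) \<Rightarrow> bool" where
  "codegree_one_weight G W \<beta> \<longleftrightarrow>
     (\<exists>b. \<forall>x\<in>W. \<beta> x = (\<lambda>vs. \<Sum>i = 1..dim (layer G 1). b i x * hat_coframe G i x vs))"

definition compact_support_form ::
  "'g::topological_space set \<Rightarrow> ('g \<Rightarrow> 'e list \<Rightarrow> real) \<Rightarrow> bool" where
  "compact_support_form W \<omega> \<longleftrightarrow>
     (\<exists>K. compact K \<and> K \<subseteq> W \<and> (\<forall>x\<in>W - K. \<omega> x = (\<lambda>vs. 0)))"

definition L1_loc_field ::
  "('g::topological_space, 'e::euclidean_space, 'z) carnot_struct_scheme \<Rightarrow> 'g set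
     \<Rightarrow> ('g \<Rightarrow> 'e) \<Rightarrow> bool" where
  "L1_loc_field G W Y \<longleftrightarrow>
     (\<forall>a\<in>set (frame_index G).
        set_borel_measurable borel W (\<lambda>x. frame_coeff G a x (Y x)) \<and>
        (\<forall>K. compact K \<and> K \<subseteq> W \<longrightarrow>
           set_integrable (volume_measure G) K (\<lambda>x. frame_coeff G a x (Y x))))"

definition weak_contact_field ::
  "('g::topological_space, 'e::euclidean_space, 'z) carnot_struct_scheme \<Rightarrow> 'g set
     \<Rightarrow> ('g \<Rightarrow> 'e) \<Rightarrow> bool" where
  "weak_contact_field G W Y \<longleftrightarrow>
     L1_loc_field G W Y \<and>
     (\<forall>\<eta> \<beta>. smooth_form G 1 W \<eta> \<and> vertical_form G W \<eta> \<and>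
        smooth_form G (DIM('e) - 1) W \<beta> \<and> compact_support_form W \<beta> \<and>
        codegree_one_weight G W \<beta> \<longrightarrow>
        form_integral G W
          (\<lambda>x. wedge 1 (DIM('e) - 1) (interior_mult Y (ext_deriv G \<eta>) x) (\<beta> x))
        - form_integral G W
          (\<lambda>x. wedge 0 DIM('e) (interior_mult Y \<eta> x) (ext_deriv G \<beta> x)) = 0)"

end

theory Submission
  imports Defs
begin

text \<open>
  The field \<open>Y = f\<^sub>* Z\<close> is only continuous, so it cannot be inserted into a Lie bracket. Instead consider in
  charts the maps \<open>\<psi>\<^sub>t = f \<circ> (id + t Z) \<circ> f\<^sup>-\<^sup>1\<close>, which are of class C^1 and have derivative \<open>Y\<close> at
  \<open>t = 0\<close>. Since \<open>Z\<close> is a contact field, \<open>d(id + t Z)\<close> preserves the horizontal bundle up to \<open>o(t)\<close>;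
  as \<open>f\<close> is a contact map, \<open>\<eta>(d\<psi>\<^sub>t B) = o(t)\<close> for every vertical \<open>\<eta>\<close> and every horizontal field \<open>B\<close>,
  locally uniformly. A form \<open>\<beta>\<close> of weight \<open>-\<nu> + 1\<close> is the contraction of the Euclidean volume form with such a
  \<open>B\<close>. Integrating \<open>\<eta>(d\<psi>\<^sub>t B)\<close> by parts moves the derivative of \<open>\<psi>\<^sub>t\<close> to \<open>\<eta>\<close> and \<open>B\<close>, and
  dividing by \<open>t\<close> and letting \<open>t \<rightarrow> 0\<close> gives the weak contact equation for \<open>\<beta>\<close> supported in one chart.
  A partition of unity of class C^1 reduces the general case to this one.
\<close>

section \<open>Alternating forms\<close>

text \<open>The maps id + t Z replace the flow of Z: no differential equation has to be solved, but
  they make sense only in coordinates, which is why the argument is local. The error o(t) is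
  explicit. If X is the field with constant coordinates h in the left-invariant frame, h horizontal,
  then the contact condition gives the bracket of Z with X horizontal coordinates k at each point;
  the vector with coordinates h - t k at the displaced point is horizontal and differs by o(t) from
  the image of X under the derivative of id + t Z. The derivative of f is merely continuous, so the
  derivative of the quotient (\<open>\<psi>\<^sub>t\<close> - id) / t cannot be expected to
  converge. Hence the integration by parts takes place at fixed t > 0, where all maps are C^1, and
  the limit is taken afterwards by dominated convergence. Two facts prepare this: the differential
  of f maps horizontal spaces onto horizontal spaces, which follows from the assumed inclusion by a
  dimension count, and a vertical form, given only almost everywhere, vanishes on the horizontal
  bundle everywhere by continuity.\<close>

definition omit :: "nat \<Rightarrow> 'a list \<Rightarrow> 'a list" where
  "omit i vs = take i vs @ drop (Suc i) vs"

lemma length_omit: "i < length vs \<Longrightarrow> length (omit i vs) = length vs - 1"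
  by (simp add: omit_def)

lemma map_omit: "map f (omit i vs) = omit i (map f vs)"
  by (simp add: omit_def take_map drop_map)

lemma nth_omit:
  "i < length vs \<Longrightarrow> j < length vs - 1 \<Longrightarrow> omit i vs ! j = (if j < i then vs ! j else vs ! Suc j)"
  by (auto simp: omit_def nth_append min_def)

lemma omit_update_same: "omit i (vs[i := v]) = omit i vs"
  by (simp add: omit_def)

lemma omit_update_less: "j < i \<Longrightarrow> i < length vs \<Longrightarrow> omit i (vs[j := v]) = (omit i vs)[j := v]"
  by (intro nth_equalityI) (auto simp: length_omit nth_omit nth_list_update)

lemma omit_update_greater:
  "i < j \<Longrightarrow> j < length vs \<Longrightarrow> omit i (vs[j := v]) = (omit i vs)[j - 1 := v]"
  by (intro nth_equalityI) (auto simp: length_omit nth_omit nth_list_update)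

lemma omit_0: "omit 0 (v # vs) = vs"
  by (simp add: omit_def)

lemma alt_form_length: "alt_form k \<alpha> \<Longrightarrow> length vs \<noteq> k \<Longrightarrow> \<alpha> vs = 0"
  by (auto simp: alt_form_def)

lemma alt_form_linear: "alt_form k \<alpha> \<Longrightarrow> length vs = k \<Longrightarrow> i < k \<Longrightarrow> linear (\<lambda>v. \<alpha> (vs[i := v]))"
  by (auto simp: alt_form_def)

lemma alt_form_repeat:
  "alt_form k \<alpha> \<Longrightarrow> length vs = k \<Longrightarrow> i < j \<Longrightarrow> j < k \<Longrightarrow> vs ! i = vs ! j \<Longrightarrow> \<alpha> vs = 0"
  unfolding alt_form_def by blast

lemma alt_form_repeat':
  assumes "alt_form k \<alpha>" "length vs = k" "i \<noteq> j" "i < k" "j < k" "vs ! i = vs ! j"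
  shows "\<alpha> vs = 0"
  using assms alt_form_repeat[of k \<alpha> vs i j] alt_form_repeat[of k \<alpha> vs j i] by (cases "i < j") auto

text \<open>Polarisation: with the sum of the two vectors in both slots the form vanishes, and so do
  the two diagonal terms of the expansion.\<close>

lemma alt_form_swap:
  assumes a: "alt_form k \<alpha>" and l: "length vs = k" and "i \<noteq> j" "i < k" "j < k"
  shows "\<alpha> (vs[i := vs ! j, j := vs ! i]) = - \<alpha> vs"
proof -
  let ?u = "vs ! i" and ?w = "vs ! j"
  let ?A = "\<lambda>x y. \<alpha> (vs[i := x, j := y])"
  have L1: "linear (\<lambda>x. ?A x y)" for y
    using alt_form_linear[OF a, of "vs[j := y]" i] l assms(3-5) by (simp add: list_update_swap)
  have L2: "linear (\<lambda>y. ?A x y)" for x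
    using alt_form_linear[OF a, of "vs[i := x]" j] l assms(3-5) by simp
  have z: "?A x x = 0" for x
    by (rule alt_form_repeat'[OF a _ assms(3-5)]) (use l assms in auto)
  have "0 = ?A (?u + ?w) (?u + ?w)" using z by simp
  also have "\<dots> = ?A ?u ?u + ?A ?u ?w + (?A ?w ?u + ?A ?w ?w)"
    by (simp only: linear_add[OF L1] linear_add[OF L2])
  also have "\<dots> = ?A ?u ?w + ?A ?w ?u" using z[of ?u] z[of ?w] by simp
  finally show ?thesis using assms(3) by simp
qed

lemma alt_form_swap_adjacent:
  assumes "alt_form k \<alpha>"
  shows "\<alpha> (xs @ a # b # zs) = - \<alpha> (xs @ b # a # zs)"
proof (cases "length (xs @ a # b # zs) = k")
  case True
  then show ?thesis
    using alt_form_swap[OF assms, of "xs @ b # a # zs" "length xs" "Suc (length xs)"]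
    by (simp add: list_update_append nth_append)
next
  case False
  then show ?thesis using alt_form_length[OF assms] by simp
qed

lemma alt_form_move:
  assumes "alt_form k \<alpha>"
  shows "\<alpha> (xs @ a # ys @ zs) = (-1) ^ length ys * \<alpha> (xs @ ys @ a # zs)"
proof (induction ys arbitrary: xs)
  case (Cons b ys)
  have "\<alpha> (xs @ a # (b # ys) @ zs) = - \<alpha> ((xs @ [b]) @ a # ys @ zs)"
    using alt_form_swap_adjacent[OF assms, of xs a b "ys @ zs"] by (simp only: append_Cons append_assoc append_Nil)
  also have "\<dots> = (-1) ^ length (b # ys) * \<alpha> (xs @ (b # ys) @ a # zs)"
    unfolding Cons.IH by simp
  finally show ?case .
qed simp

text \<open>Deleting either copy of the repeated vector leaves lists that differ by moving this
  vector across the j - i - 1 entries in between; that sign is opposite to the ratio (-1)^(j - i) of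
  the prefactors.\<close>

lemma alt_form_omit_repeat:
  assumes a: "alt_form k \<alpha>" and ij: "i < j" "j < length vs" and eq: "vs ! i = vs ! j"
  shows "(-1) ^ i * \<alpha> (omit i vs) + (-1) ^ j * \<alpha> (omit j vs) = 0"
proof -
  define xs ys zs where "xs = take i vs" and "ys = take (j - i - 1) (drop (Suc i) vs)"
    and "zs = drop (Suc j) vs"
  have ly: "length ys = j - i - 1" using ij by (simp add: ys_def)
  have "drop (Suc i) vs = ys @ drop (j - i - 1) (drop (Suc i) vs)"
    unfolding ys_def by (rule append_take_drop_id[symmetric])
  also have "drop (j - i - 1) (drop (Suc i) vs) = drop j vs" using ij by simp
  also have "\<dots> = vs ! j # zs" using ij by (simp add: zs_def Cons_nth_drop_Suc)
  finally have d: "drop (Suc i) vs = ys @ vs ! j # zs" .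
  have 1: "omit i vs = xs @ ys @ vs ! j # zs" by (simp add: omit_def xs_def d)
  have vs: "vs = xs @ vs ! i # ys @ vs ! j # zs"
    using d id_take_nth_drop[of i vs] ij by (simp add: xs_def)
  have "take j vs = xs @ vs ! i # ys"
  proof -
    have "length xs = i" "j = i + Suc (length ys)" using ij ly by (auto simp: xs_def)
    then show ?thesis by (subst vs) simp
  qed
  then have 2: "omit j vs = xs @ vs ! j # ys @ zs" by (simp add: omit_def zs_def eq)
  have s: "(-1::real) ^ j = - ((-1) ^ i * (-1) ^ length ys)"
  proof -
    have "j = Suc (i + length ys)" using ij ly by simp
    then show ?thesis by (simp add: power_add)
  qed
  have "(-1::real) ^ length ys * (-1) ^ length ys = 1"
    by (simp flip: power_add)
  then show ?thesis unfolding 1 2 alt_form_move[OF a] s by (simp add: algebra_simps)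
qed

text \<open>Induction over a factorisation of q into transpositions. \<open>g\<close> is generalised
  so that it can absorb a transposition, and distinctness of \<open>js\<close> turns a transposition
  of indices into one exchange of two list positions.\<close>

lemma alt_form_permute:
  assumes a: "alt_form k \<alpha>" and "distinct js" "q permutes set js"
  shows "\<alpha> (map (\<lambda>i. g (q i)) js) = of_int (sign q) * \<alpha> (map g js)"
  using assms(3) finite_set[of js]
proof (induction q arbitrary: g rule: permutes_induct)
  case id
  then show ?case by (simp add: sign_id)
next
  case (swap b c p)
  then have "permutation p" using permutation_permutes[of p] by blast
  then have s: "sign (Transposition.transpose b c \<circ> p) = - sign p"
    using swap.hyps by (simp add: sign_compose permutation_swap_id sign_swap_id)
  obtain i j where ij: "i < length js" "j < length js" "b = js ! i" "c = js ! j"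
    using swap.hyps(1,2) unfolding in_set_conv_nth by blast
  have ix: "js ! l = b \<longleftrightarrow> l = i" "js ! l = c \<longleftrightarrow> l = j" if "l < length js" for l
    using ij that \<open>distinct js\<close> by (auto simp: nth_eq_iff_index_eq)
  have "\<alpha> (map (\<lambda>l. g ((Transposition.transpose b c \<circ> p) l)) js) = of_int (sign p) * \<alpha> (map (\<lambda>l. g (Transposition.transpose b c l)) js)"
    using swap.IH[of "\<lambda>l. g (Transposition.transpose b c l)"] by simp
  also have "map (\<lambda>l. g (Transposition.transpose b c l)) js = (map g js)[i := map g js ! j, j := map g js ! i]"
  proof (rule nth_equalityI)
    fix l assume "l < length (map (\<lambda>l. g (Transposition.transpose b c l)) js)"
    then have l: "l < length js" by simp
    have "i \<noteq> j" using ij \<open>b \<noteq> c\<close> by auto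
    then show "map (\<lambda>l. g (Transposition.transpose b c l)) js ! l
        = (map g js)[i := map g js ! j, j := map g js ! i] ! l"
      using l ij(1,2) ix[OF l] ij(3,4)[symmetric]
      by (cases "l = i"; cases "l = j") (simp_all add: nth_list_update transpose_def)
  qed simp
  also have "\<alpha> \<dots> = - \<alpha> (map g js)"
  proof (cases "length js = k")
    case True
    then show ?thesis using alt_form_swap[OF a, of "map g js" i j] ij \<open>b \<noteq> c\<close> by auto
  next
    case False
    then show ?thesis using alt_form_length[OF a] by simp
  qed
  finally show ?case unfolding s by simp
qed

lemma alt_form_map:
  assumes a: "alt_form k \<alpha>" and A: "linear A"
  shows "alt_form k (\<lambda>vs. \<alpha> (map A vs))"
  unfolding alt_form_def
proof (intro conjI allI impI)
  fix vs :: "'b list" and i assume *: "length vs = k \<and> i < k"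
  then have "linear (\<lambda>v. \<alpha> ((map A vs)[i := v]))" by (intro alt_form_linear[OF a]) auto
  then have "linear ((\<lambda>v. \<alpha> ((map A vs)[i := v])) \<circ> A)" by (intro linear_compose A)
  then show "linear (\<lambda>v. \<alpha> (map A (vs[i := v])))" by (simp add: o_def map_update)
next
  fix vs :: "'b list" and i j assume *: "length vs = k \<and> i < j \<and> j < k \<and> vs ! i = vs ! j"
  then show "\<alpha> (map A vs) = 0" by (intro alt_form_repeat[OF a, of _ i j]) auto
qed (use alt_form_length[OF a] in simp)

lemma alt_form_sum:
  assumes "finite I" "\<And>i. i \<in> I \<Longrightarrow> alt_form k (\<alpha> i)"
  shows "alt_form k (\<lambda>vs. \<Sum>i\<in>I. c i * \<alpha> i vs)"
  unfolding alt_form_def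
proof (intro conjI allI impI)
  fix vs :: "'b list" and i assume *: "length vs = k \<and> i < k"
  show "linear (\<lambda>v. \<Sum>j\<in>I. c j * \<alpha> j (vs[i := v]))"
  proof (rule linear_compose_sum, safe)
    fix j assume "j \<in> I"
    then have "linear (\<lambda>v. \<alpha> j (vs[i := v]))" using * alt_form_linear[OF assms(2)] by blast
    from linear_compose_scale_right[OF this, of "c j"] show "linear (\<lambda>v. c j * \<alpha> j (vs[i := v]))"
      by simp
  qed
next
  fix vs :: "'b list" and i j assume "length vs = k \<and> i < j \<and> j < k \<and> vs ! i = vs ! j"
  then show "(\<Sum>i\<in>I. c i * \<alpha> i vs) = 0"
    by (intro sum.neutral ballI) (auto intro!: alt_form_repeat[OF assms(2)])
qed (use alt_form_length[OF assms(2)] in simp)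

lemma linear_comp_real: "linear f \<Longrightarrow> linear (\<lambda>v. c * f v :: real)"
  using linear_compose_scale_right[of f c] by simp

text \<open>Both the exterior derivative and the wedge product with a 1-form arise in this way.\<close>

lemma alt_form_antisymmetrize:
  assumes a: "\<And>v. alt_form k (\<Phi> v)" and l: "\<And>ws. linear (\<lambda>v. \<Phi> v ws)"
  shows "alt_form (Suc k) (\<lambda>vs. if length vs = Suc k
           then \<Sum>i<length vs. (-1) ^ i * \<Phi> (vs ! i) (omit i vs) else 0)"
  unfolding alt_form_def
proof (intro conjI allI impI)
  fix vs :: "'a list" and j assume *: "length vs = Suc k \<and> j < Suc k"
  have "linear (\<lambda>v. \<Sum>i<Suc k. (-1) ^ i * \<Phi> (vs[j := v] ! i) (omit i (vs[j := v])))"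
  proof (rule linear_compose_sum, safe)
    fix i assume i: "i < Suc k"
    consider "i = j" | "j < i" | "i < j" by linarith
    then show "linear (\<lambda>v. (-1) ^ i * \<Phi> (vs[j := v] ! i) (omit i (vs[j := v])))"
    proof cases
      case 1
      then show ?thesis using * by (auto simp: omit_update_same intro: linear_comp_real l)
    next
      case 2
      then have "linear (\<lambda>v. \<Phi> (vs ! i) ((omit i vs)[j := v]))"
        using * i by (intro alt_form_linear[OF a]) (auto simp: length_omit)
      then show ?thesis using 2 * i by (auto simp: omit_update_less intro: linear_comp_real)
    next
      case 3
      then have "linear (\<lambda>v. \<Phi> (vs ! i) ((omit i vs)[j - 1 := v]))"
        using * i by (intro alt_form_linear[OF a]) (auto simp: length_omit)
      then show ?thesis using 3 * i by (auto simp: omit_update_greater intro: linear_comp_real)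
    qed
  qed
  then show "linear (\<lambda>v. if length (vs[j := v]) = Suc k
      then \<Sum>i<length (vs[j := v]). (-1) ^ i * \<Phi> (vs[j := v] ! i) (omit i (vs[j := v])) else 0)"
    using * by simp
next
  fix vs :: "'a list" and i j
  assume *: "length vs = Suc k \<and> i < j \<and> j < Suc k \<and> vs ! i = vs ! j"
  let ?t = "\<lambda>m. (-1) ^ m * \<Phi> (vs ! m) (omit m vs)"
  \<comment> \<open>Deleting any entry other than the two equal ones keeps both copies, at the
    positions \<open>i'\<close> and \<open>j'\<close>, so only two terms remain and these
    cancel.\<close>
  have "(\<Sum>m<Suc k. ?t m) = (\<Sum>m\<in>{i, j}. ?t m)"
  proof (rule sum.mono_neutral_right)
    show "\<forall>m\<in>{..<Suc k} - {i, j}. ?t m = 0"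
    proof
      fix m assume m: "m \<in> {..<Suc k} - {i, j}"
      define i' j' where "i' = (if i < m then i else i - 1)" and "j' = (if j < m then j else j - 1)"
      have "\<Phi> (vs ! m) (omit m vs) = 0"
      proof (rule alt_form_repeat'[OF a])
        show "length (omit m vs) = k" using m * by (simp add: length_omit)
        show "i' \<noteq> j'" "i' < k" "j' < k" using m * by (auto simp: i'_def j'_def)
        show "omit m vs ! i' = omit m vs ! j'"
          using m * by (subst (1 2) nth_omit) (auto simp: i'_def j'_def)
      qed
      then show "?t m = 0" by simp
    qed
  qed (use * in auto)
  also have "\<dots> = (-1) ^ i * \<Phi> (vs ! i) (omit i vs) + (-1) ^ j * \<Phi> (vs ! i) (omit j vs)"
    using * by simp
  also have "\<dots> = 0" using * by (intro alt_form_omit_repeat[OF a]) auto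
  finally show "(if length vs = Suc k then \<Sum>i<length vs. ?t i else 0) = 0" using * by simp
qed simp

text \<open>Permutations are grouped by their value at 0, which selects the argument fed to
  \<alpha>. Each group consists of the compositions of one transposition with the permutations
  fixing 0; its k! members give equal terms, and this cancels the factor \<open>fact k\<close> in
  the normalisation of \<open>wedge\<close>.\<close>

lemma wedge_1_eq:
  assumes b: "alt_form k \<beta>" and vs: "length vs = Suc k"
  shows "wedge 1 k \<alpha> \<beta> vs = (\<Sum>i<Suc k. (-1) ^ i * (\<alpha> [vs ! i] * \<beta> (omit i vs)))"
proof -
  let ?S = "{1..<Suc k}"
  have U: "{..<1 + k} = insert 0 ?S" by auto
  have tm: "(\<Sum>q | q permutes ?S. of_int (sign (Transposition.transpose 0 b \<circ> q))
        * \<alpha> (map (\<lambda>i. vs ! (Transposition.transpose 0 b \<circ> q) i) [0..<1])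
        * \<beta> (map (\<lambda>i. vs ! (Transposition.transpose 0 b \<circ> q) i) [1..<1 + k]))
      = fact k * ((-1) ^ b * (\<alpha> [vs ! b] * \<beta> (omit b vs)))" (is "(\<Sum>q | _. ?t q) = _")
    if b': "b \<in> insert 0 ?S" for b
  proof -
    let ?g = "\<lambda>i. vs ! Transposition.transpose 0 b i"
    \<comment> \<open>On 1, ..., k the map \<open>?g\<close> runs through the arguments with
      \<open>vs ! 0\<close> standing where \<open>vs ! b\<close> was. Bringing \<open>vs ! 0\<close>
      to the front takes b - 1 adjacent exchanges, and for b > 0 the transposition contributes
      another -1.\<close>
    have e: "of_int (sign (Transposition.transpose 0 b)) * \<beta> (map ?g [1..<Suc k]) = (-1) ^ b * \<beta> (omit b vs)"
    proof (cases "b = 0")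
      case True
      have "map ((!) vs) [1..<Suc k] = omit 0 vs"
        using vs by (intro nth_equalityI) (auto simp: length_omit nth_omit simp del: upt_Suc)
      then show ?thesis using True by (simp del: upt_Suc)
    next
      case False
      let ?ys = "take (b - 1) (tl vs)" and ?zs = "drop (Suc b) vs"
      have bk: "0 < b" "b < Suc k" using b' False by auto
      have 1: "omit b vs = [] @ vs ! 0 # ?ys @ ?zs"
        using vs bk by (cases vs; cases b) (auto simp: omit_def)
      have 2: "map ?g [1..<Suc k] = [] @ ?ys @ vs ! 0 # ?zs"
      proof (rule nth_equalityI)
        fix i assume "i < length (map ?g [1..<Suc k])"
        then have i: "i < k" by (simp del: upt_Suc)
        have "(?ys @ vs ! 0 # ?zs) ! i = (if i = b - 1 then vs ! 0 else vs ! Suc i)"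
        proof -
          have l: "length ?ys = b - 1" using vs bk by auto
          consider "i < b - 1" | "i = b - 1" | j where "i = b + j"
            using bk by (metis One_nat_def Suc_pred le_add_diff_inverse less_Suc_eq not_less)
          then show ?thesis
            using vs bk i l by cases (auto simp: nth_append nth_tl)
        qed
        moreover have "map ?g [1..<Suc k] ! i = ?g (Suc i)" using i by (simp del: upt_Suc)
        moreover have "?g (Suc i) = (if i = b - 1 then vs ! 0 else vs ! Suc i)"
          using bk by (auto simp: transpose_def)
        ultimately show "map ?g [1..<Suc k] ! i = ([] @ ?ys @ vs ! 0 # ?zs) ! i" by simp
      qed (use vs bk in \<open>auto simp del: upt_Suc\<close>)
      have "length ?ys = b - 1" using vs bk by auto
      then have "(-1) ^ b * \<beta> (omit b vs) = (-1) ^ b * (-1) ^ (b - 1) * \<beta> (map ?g [1..<Suc k])"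
        unfolding 1 2 alt_form_move[OF b] by simp
      also have "(-1) ^ b * (-1) ^ (b - 1) = (-1 :: real)"
        using bk by (cases b) (auto simp flip: power_add power_mult_distrib)
      finally show ?thesis using bk by (simp add: sign_swap_id)
    qed
    have "?t q = (-1) ^ b * (\<alpha> [vs ! b] * \<beta> (omit b vs))" if q: "q permutes ?S" for q
    proof -
      have "permutation q" using q permutation_permutes by blast
      then have s: "sign (Transposition.transpose 0 b \<circ> q) = sign (Transposition.transpose 0 b) * sign q"
        by (simp add: sign_compose permutation_swap_id)
      have q0: "q 0 = 0" using q by (simp add: permutes_def)
      have "\<beta> (map (\<lambda>i. ?g (q i)) [1..<Suc k]) = of_int (sign q) * \<beta> (map ?g [1..<Suc k])"
        by (rule alt_form_permute[OF b]) (use q in \<open>simp_all del: upt_Suc\<close>)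
      moreover have ss: "real_of_int (sign q) * real_of_int (sign q) = 1" by (simp add: sign_def)
      moreover have a0: "\<alpha> (map (\<lambda>i. vs ! (Transposition.transpose 0 b \<circ> q) i) [0..<1]) = \<alpha> [vs ! b]"
        by (simp add: q0)
      ultimately have "?t q = of_int (sign q * sign q) * \<alpha> [vs ! b]
          * (of_int (sign (Transposition.transpose 0 b)) * \<beta> (map ?g [1..<Suc k]))"
        unfolding s a0 using ss by (simp del: upt_Suc)
      also have "sign q * sign q = 1" by (simp add: sign_def)
      finally show ?thesis unfolding e of_int_1 mult_1 by (simp only: ac_simps)
    qed
    then have "(\<Sum>q | q permutes ?S. ?t q)
        = of_nat (card {q. q permutes ?S}) * ((-1) ^ b * (\<alpha> [vs ! b] * \<beta> (omit b vs)))"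
      by simp
    also have "card {q. q permutes ?S} = fact k" by (subst card_permutations[of _ k]) auto
    finally show ?thesis unfolding of_nat_fact .
  qed
  let ?W = "\<lambda>\<pi>. of_int (sign \<pi>) * \<alpha> (map (\<lambda>i. vs ! \<pi> i) [0..<1]) * \<beta> (map (\<lambda>i. vs ! \<pi> i) [1..<1 + k])"
  have l: "length vs = 1 + k" using vs by simp
  have "wedge 1 k \<alpha> \<beta> vs = (\<Sum>\<pi> | \<pi> permutes insert 0 ?S. ?W \<pi>) / fact k"
    unfolding wedge_def U if_P[OF l] fact_1 mult_1 ..
  also have "\<dots> = (\<Sum>b\<in>insert 0 ?S. \<Sum>q | q permutes ?S. ?W (Transposition.transpose 0 b \<circ> q)) / fact k"
    by (subst sum_over_permutations_insert) auto
  also have "\<dots> = (\<Sum>b\<in>insert 0 ?S. fact k * ((-1) ^ b * (\<alpha> [vs ! b] * \<beta> (omit b vs)))) / fact k"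
    by (intro arg_cong[where f = "\<lambda>x. x / fact k"] sum.cong refl tm)
  also have "\<dots> = (\<Sum>b<Suc k. (-1) ^ b * (\<alpha> [vs ! b] * \<beta> (omit b vs)))"
    using U by (simp flip: sum_distrib_left)
  finally show ?thesis .
qed

text \<open>All k! permutations contribute the same term, because the sign of the permutation occurs
  twice.\<close>

lemma wedge_0_eq:
  assumes b: "alt_form k \<beta>" and vs: "length vs = k"
  shows "wedge 0 k \<alpha> \<beta> vs = \<alpha> [] * \<beta> vs"
proof -
  have *: "of_int (sign q) * \<alpha> [] * \<beta> (map (\<lambda>i. vs ! q i) [0..<k]) = \<alpha> [] * \<beta> vs"
    if "q permutes {..<k}" for q
  proof -
    have "\<beta> (map (\<lambda>i. vs ! q i) [0..<k]) = of_int (sign q) * \<beta> (map (\<lambda>i. vs ! i) [0..<k])"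
      by (rule alt_form_permute[OF b]) (use that in \<open>auto simp: lessThan_atLeast0\<close>)
    moreover have "map (\<lambda>i. vs ! i) [0..<k] = vs" using vs map_nth by blast
    ultimately have "of_int (sign q) * \<alpha> [] * \<beta> (map (\<lambda>i. vs ! q i) [0..<k])
        = of_int (sign q * sign q) * (\<alpha> [] * \<beta> vs)" by (simp only: of_int_mult ac_simps)
    also have "real_of_int (sign q * sign q) = 1" by (simp add: sign_def)
    finally show ?thesis by simp
  qed
  have "(\<Sum>q | q permutes {..<k}. of_int (sign q) * \<alpha> [] * \<beta> (map (\<lambda>i. vs ! q i) [0..<k]))
      = (\<Sum>q | q permutes {..<k}. \<alpha> [] * \<beta> vs)" by (intro sum.cong refl, drule CollectD) (rule *)
  also have "\<dots> = of_nat (card {q. q permutes {..<k}}) * (\<alpha> [] * \<beta> vs)" by simp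
  also have "card {q. q permutes {..<k}} = fact k" by (subst card_permutations[of _ k]) auto
  finally show ?thesis using vs by (simp add: wedge_def)
qed

lemma alt_form_wedge_1:
  assumes "alt_form 1 \<alpha>" and b: "alt_form k \<beta>"
  shows "alt_form (Suc k) (wedge 1 k \<alpha> \<beta>)"
proof -
  have "linear (\<lambda>v. \<alpha> [v])" using alt_form_linear[OF assms(1), of "[0]" 0] by simp
  then have "linear (\<lambda>v. \<alpha> [v] * \<beta> ws)" for ws
    using linear_comp_real[of "\<lambda>v. \<alpha> [v]" "\<beta> ws"] by (simp add: mult.commute)
  moreover have "alt_form k (\<lambda>ws. \<alpha> [v] * \<beta> ws)" for v
    using alt_form_sum[of "{()}" k "\<lambda>_. \<beta>" "\<lambda>_. \<alpha> [v]"] b by simp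
  ultimately have *: "alt_form (Suc k) (\<lambda>vs. if length vs = Suc k
      then \<Sum>i<length vs. (-1) ^ i * (\<alpha> [vs ! i] * \<beta> (omit i vs)) else 0)"
    by (intro alt_form_antisymmetrize)
  have "wedge 1 k \<alpha> \<beta> = (\<lambda>vs. if length vs = Suc k
      then \<Sum>i<length vs. (-1) ^ i * (\<alpha> [vs ! i] * \<beta> (omit i vs)) else 0)"
  proof
    fix vs show "wedge 1 k \<alpha> \<beta> vs = (if length vs = Suc k
      then \<Sum>i<length vs. (-1) ^ i * (\<alpha> [vs ! i] * \<beta> (omit i vs)) else 0)"
    proof (cases "length vs = Suc k")
      case True
      then show ?thesis using wedge_1_eq[OF b True, of \<alpha>] by simp
    next
      case False
      then show ?thesis by (simp add: wedge_def)
    qed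
  qed
  with * show ?thesis by simp
qed

lemma alt_form_wedge_list:
  assumes "\<And>\<alpha>. \<alpha> \<in> set \<alpha>s \<Longrightarrow> alt_form 1 \<alpha>"
  shows "alt_form (length \<alpha>s) (wedge_list \<alpha>s)"
  using assms
proof (induction \<alpha>s)
  case Nil
  then show ?case by (auto simp: alt_form_def)
next
  case (Cons \<alpha> \<alpha>s)
  then show ?case using alt_form_wedge_1[of \<alpha> "length \<alpha>s" "wedge_list \<alpha>s"] by simp
qed

text \<open>In the expansion along the first factor, either the deleted entry is v, which this
  factor annihilates, or v survives in the shorter list and the induction hypothesis
  applies.\<close>

lemma wedge_list_eq_0:
  assumes "\<And>\<alpha>. \<alpha> \<in> set \<alpha>s \<Longrightarrow> alt_form 1 \<alpha>"
    and "v \<in> set vs" "\<And>\<alpha>. \<alpha> \<in> set \<alpha>s \<Longrightarrow> \<alpha> [v] = 0"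
  shows "wedge_list \<alpha>s vs = 0"
  using assms
proof (induction \<alpha>s arbitrary: vs)
  case Nil
  then show ?case by auto
next
  case (Cons \<alpha> \<alpha>s)
  show ?case
  proof (cases "length vs = Suc (length \<alpha>s)")
    case True
    have a: "alt_form (length \<alpha>s) (wedge_list \<alpha>s)" using Cons.prems by (intro alt_form_wedge_list) auto
    have "\<alpha> [vs ! i] * wedge_list \<alpha>s (omit i vs) = 0" if "i < Suc (length \<alpha>s)" for i
    proof (cases "vs ! i = v")
      case False
      obtain j where j: "j < length vs" "vs ! j = v" using Cons.prems(2) by (meson in_set_conv_nth)
      have "v \<in> set (omit i vs)"
      proof (cases "j < i")
        case True
        then have "omit i vs ! j = v" "j < length (omit i vs)"
          using j that \<open>length vs = _\<close> by (auto simp: nth_omit length_omit)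
        then show ?thesis by (metis nth_mem)
      next
        case False
        then have "i < j" using j \<open>vs ! i \<noteq> v\<close> by (metis linorder_neqE_nat)
        then have "omit i vs ! (j - 1) = v" "j - 1 < length (omit i vs)"
          using j that by (auto simp: nth_omit length_omit)
        then show ?thesis by (metis nth_mem)
      qed
      then show ?thesis using Cons by simp
    qed (use Cons.prems in simp)
    then have "(\<Sum>i<Suc (length \<alpha>s). (-1) ^ i * (\<alpha> [vs ! i] * wedge_list \<alpha>s (omit i vs))) = 0"
      by (intro sum.neutral) simp
    then show ?thesis using wedge_1_eq[OF a True, of \<alpha>] by simp
  next
    case False
    then show ?thesis by (simp add: wedge_def)
  qed
qed

text \<open>Only the term i = 0 of the expansion along the first factor is nonzero: the determinant
  of the identity matrix, peeled off along its diagonal.\<close>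

lemma wedge_list_dual:
  assumes "\<And>i. i < length \<alpha>s \<Longrightarrow> alt_form 1 (\<alpha>s ! i)" and "length vs = length \<alpha>s"
    and "\<And>i j. i < length \<alpha>s \<Longrightarrow> j < length \<alpha>s \<Longrightarrow> (\<alpha>s ! i) [vs ! j] = (if i = j then 1 else 0)"
  shows "wedge_list \<alpha>s vs = 1"
  using assms
proof (induction \<alpha>s arbitrary: vs)
  case (Cons \<alpha> \<alpha>s)
  obtain v ws where vs: "vs = v # ws" using Cons.prems by (cases vs) auto
  have a: "alt_form (length \<alpha>s) (wedge_list \<alpha>s)"
    using Cons.prems(1)[of "Suc _"] by (intro alt_form_wedge_list) (auto simp: in_set_conv_nth)
  have l: "length vs = Suc (length \<alpha>s)" using Cons.prems by simp
  have "wedge_list (\<alpha> # \<alpha>s) vs = (\<Sum>i<Suc (length \<alpha>s). (-1) ^ i * (\<alpha> [vs ! i] * wedge_list \<alpha>s (omit i vs)))"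
    using wedge_1_eq[OF a l] by simp
  also have "\<dots> = (\<Sum>i<Suc (length \<alpha>s). if i = 0 then wedge_list \<alpha>s (omit i vs) else 0)"
    using Cons.prems(3)[of 0] by (intro sum.cong) auto
  also have "\<dots> = wedge_list \<alpha>s ws" by (simp add: vs omit_0)
  also have "\<dots> = 1"
    using Cons.prems(1)[of "Suc _"] Cons.prems(2) Cons.prems(3)[of "Suc _" "Suc _"] vs by (intro Cons.IH) auto
  finally show ?case .
qed simp

text \<open>If an entry is a combination of the others, linearity in its slot leads to lists with a
  repeated entry. Repetitions in \<open>vs\<close> itself are a separate case, since dependence is a
  property of the set of entries.\<close>

lemma alt_form_dependent:
  assumes a: "alt_form k \<alpha>" and d: "dependent (set vs)"
  shows "\<alpha> vs = 0"
proof (cases "length vs = k \<and> distinct vs")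
  case True
  obtain v where v: "v \<in> set vs" "v \<in> span (set vs - {v})" using d by (auto simp: dependent_def)
  obtain i where i: "i < k" "vs ! i = v" using v True by (metis in_set_conv_nth)
  have "\<alpha> (vs[i := v]) = 0"
  proof (rule linear_eq_0_on_span[OF alt_form_linear[OF a] _ v(2)])
    fix w assume w: "w \<in> set vs - {v}"
    then obtain j where j: "j < k" "vs ! j = w" using True by (metis DiffD1 in_set_conv_nth)
    moreover have "i \<noteq> j" using w i j by auto
    ultimately show "\<alpha> (vs[i := w]) = 0"
      using w i True by (intro alt_form_repeat'[OF a, of _ i j]) auto
  qed (use True i in auto)
  then show ?thesis using i by (metis list_update_id)
next
  case False
  then show ?thesis
    using alt_form_length[OF a, of vs] alt_form_repeat'[OF a, of vs] by (auto simp: distinct_conv_nth)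
qed

section \<open>Functions of class C^1\<close>

text \<open>\<open>Ck_on 1\<close> gives continuity of a derivative only in each fixed direction;
  expanding \<open>h x\<close> in the basis upgrades this to directions that vary with the
  point.\<close>

lemma continuous_on_linear_apply:
  fixes A :: "'t::topological_space \<Rightarrow> 'a::euclidean_space \<Rightarrow> 'b::real_normed_vector"
  assumes "\<And>x. x \<in> S \<Longrightarrow> linear (A x)" "\<And>v. continuous_on S (\<lambda>x. A x v)" "continuous_on S h"
  shows "continuous_on S (\<lambda>x. A x (h x))"
proof -
  have "A x (h x) = (\<Sum>b\<in>Basis. (h x \<bullet> b) *\<^sub>R A x b)" if "x \<in> S" for x
  proof -
    have "A x (\<Sum>b\<in>Basis. (h x \<bullet> b) *\<^sub>R b) = (\<Sum>b\<in>Basis. (h x \<bullet> b) *\<^sub>R A x b)"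
      by (simp add: linear_sum[OF assms(1)[OF that]] linear_scale[OF assms(1)[OF that]])
    then show ?thesis by (simp add: euclidean_representation)
  qed
  moreover have "continuous_on S (\<lambda>x. \<Sum>b\<in>Basis. (h x \<bullet> b) *\<^sub>R A x b)"
    by (intro continuous_intros assms)
  ultimately show ?thesis by (intro continuous_on_eq[of S _ "\<lambda>x. A x (h x)"]) auto
qed

lemma frechet_derivative_cong_open:
  assumes "open S" "x \<in> S" "\<And>y. y \<in> S \<Longrightarrow> f y = g y"
  shows "frechet_derivative f (at x) = frechet_derivative g (at x)"
proof -
  have "(f has_derivative f') (at x) \<longleftrightarrow> (g has_derivative f') (at x)" for f'
    using assms has_derivative_transform_within_open[of f f' x UNIV S g]
      has_derivative_transform_within_open[of g f' x UNIV S f] by auto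
  then show ?thesis by (simp add: frechet_derivative_def)
qed

lemma differentiable_cong_open:
  assumes "f differentiable (at x)" "open S" "x \<in> S" "\<And>y. y \<in> S \<Longrightarrow> f y = g y"
  shows "g differentiable (at x)"
  using assms has_derivative_transform_within_open unfolding differentiable_def by blast

lemma Ck_on_cong:
  assumes "open S" "\<And>x. x \<in> S \<Longrightarrow> f x = g x" "Ck_on k S f"
  shows "Ck_on k S g"
  using assms(2,3)
proof (induction k arbitrary: f g)
  case 0
  then show ?case using continuous_on_cong by force
next
  case (Suc k)
  show ?case unfolding Ck_on.simps
  proof (intro conjI ballI allI)
    fix x assume "x \<in> S"
    then show "g differentiable (at x)"
      using Suc.prems(2) differentiable_cong_open[OF _ assms(1) \<open>x \<in> S\<close> Suc.prems(1)] by simp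
  next
    fix v
    show "Ck_on k S (\<lambda>x. frechet_derivative g (at x) v)"
    proof (rule Suc.IH)
      show "Ck_on k S (\<lambda>x. frechet_derivative f (at x) v)" using Suc.prems by simp
    qed (use frechet_derivative_cong_open[OF assms(1) _ Suc.prems(1)] in simp)
  qed
qed

lemma Ck_on_subset: "Ck_on k S f \<Longrightarrow> T \<subseteq> S \<Longrightarrow> Ck_on k T f"
  by (induction k arbitrary: f) (auto intro: continuous_on_subset)

lemma Ck_on_Suc_imp: "Ck_on (Suc k) S f \<Longrightarrow> Ck_on k S f"
proof (induction k arbitrary: f)
  case 0
  then show ?case
    by (auto intro!: continuous_at_imp_continuous_on differentiable_imp_continuous_within)
qed simp

lemma Ck_on_imp_continuous_on: "Ck_on k S f \<Longrightarrow> continuous_on S f"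
  by (induction k) (use Ck_on_Suc_imp in auto)

lemma Ck_on_mono: "Ck_on k S f \<Longrightarrow> j \<le> k \<Longrightarrow> Ck_on j S f"
  by (induction k) (metis le_zero_eq, metis Ck_on_Suc_imp le_SucE)

lemma Ck1_has_derivative:
  "Ck_on 1 S f \<Longrightarrow> x \<in> S \<Longrightarrow> (f has_derivative frechet_derivative f (at x)) (at x)"
  using frechet_derivative_works by auto

lemma Ck1_continuous_derivative:
  "Ck_on 1 S f \<Longrightarrow> continuous_on S (\<lambda>x. frechet_derivative f (at x) v)"
  by simp

lemma Ck1I:
  assumes "\<And>x. x \<in> S \<Longrightarrow> (f has_derivative f' x) (at x)" "\<And>v. continuous_on S (\<lambda>x. f' x v)"
  shows "Ck_on 1 S f"
proof -
  have "frechet_derivative f (at x) = f' x" if "x \<in> S" for x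
    using frechet_derivative_at[OF assms(1)[OF that]] by simp
  then have "continuous_on S (\<lambda>x. frechet_derivative f (at x) v) \<longleftrightarrow> continuous_on S (\<lambda>x. f' x v)" for v
    by (intro continuous_on_cong) auto
  then have "continuous_on S (\<lambda>x. frechet_derivative f (at x) v)" for v
    using assms(2) by blast
  moreover have "\<forall>x\<in>S. f differentiable (at x)" using assms(1) differentiable_def by blast
  ultimately show ?thesis by simp
qed

lemma has_derivative_slice:
  fixes g :: "'a::euclidean_space \<times> 'b::euclidean_space \<Rightarrow> 'c::real_normed_vector"
  assumes "(g has_derivative g') (at (u, w))"
  shows "((\<lambda>u. g (u, w)) has_derivative (\<lambda>v. g' (v, 0))) (at u)"
    and "((\<lambda>w. g (u, w)) has_derivative (\<lambda>v. g' (0, v))) (at w)"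
proof -
  show "((\<lambda>u. g (u, w)) has_derivative (\<lambda>v. g' (v, 0))) (at u)"
    by (rule has_derivative_compose[where f = "\<lambda>u. (u, w)" and g = g])
       (auto intro!: derivative_eq_intros assms)
  show "((\<lambda>w. g (u, w)) has_derivative (\<lambda>v. g' (0, v))) (at w)"
    by (rule has_derivative_compose[where f = "\<lambda>w. (u, w)" and g = g])
       (auto intro!: derivative_eq_intros assms)
qed

text \<open>For freezing the second factor of the group multiplication at the identity, see
  \<open>left_mat_smooth\<close>.\<close>

lemma Ck_on_slice:
  fixes g :: "'a::euclidean_space \<times> 'b::euclidean_space \<Rightarrow> 'c::real_normed_vector"
  assumes "open S" "Ck_on k S g"
  shows "Ck_on k {u. (u, w) \<in> S} (\<lambda>u. g (u, w))"
  using assms(2)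
proof (induction k arbitrary: g)
  case 0
  then have "continuous_on {u. (u, w) \<in> S} (g \<circ> (\<lambda>u. (u, w)))"
    by (intro continuous_on_compose continuous_intros) (auto elim: continuous_on_subset)
  then show ?case by (simp add: o_def)
next
  case (Suc k)
  have o: "open {u. (u, w) \<in> S}"
    using continuous_open_preimage[of UNIV "\<lambda>u. (u, w)" S] assms(1)
    by (simp add: vimage_def continuous_intros)
  have d: "((\<lambda>u. g (u, w)) has_derivative (\<lambda>v. frechet_derivative g (at (u, w)) (v, 0))) (at u)"
    if "(u, w) \<in> S" for u
    using Suc.prems that frechet_derivative_works by (intro has_derivative_slice) auto
  have "Ck_on k {u. (u, w) \<in> S} (\<lambda>u. frechet_derivative (\<lambda>u. g (u, w)) (at u) v)" for v
  proof (rule Ck_on_cong[OF o])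
    show "Ck_on k {u. (u, w) \<in> S} (\<lambda>u. frechet_derivative g (at (u, w)) (v, 0))"
      using Suc.IH[of "\<lambda>p. frechet_derivative g (at p) (v, 0)"] Suc.prems by simp
    show "frechet_derivative g (at (u, w)) (v, 0) = frechet_derivative (\<lambda>u. g (u, w)) (at u) v"
      if "u \<in> {u. (u, w) \<in> S}" for u
      using fun_cong[OF frechet_derivative_at[OF d], of u v] that by simp
  qed
  moreover have "\<forall>u\<in>{u. (u, w) \<in> S}. (\<lambda>u. g (u, w)) differentiable at u"
    using d differentiable_def by blast
  ultimately show ?case by simp
qed

lemma Ck1_compose:
  fixes f :: "'a::euclidean_space \<Rightarrow> 'b::euclidean_space"
  assumes f: "Ck_on 1 S f" and g: "Ck_on 1 T g" and im: "f ` S \<subseteq> T"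
  shows "Ck_on 1 S (\<lambda>x. g (f x))"
proof (rule Ck1I)
  fix x assume "x \<in> S"
  then show "((\<lambda>x. g (f x)) has_derivative
      (\<lambda>v. frechet_derivative g (at (f x)) (frechet_derivative f (at x) v))) (at x)"
    using im by (intro has_derivative_compose[OF Ck1_has_derivative[OF f]
        Ck1_has_derivative[OF g]]) auto
next
  fix v
  have cf: "continuous_on S f" using f Ck_on_imp_continuous_on by blast
  show "continuous_on S (\<lambda>x. frechet_derivative g (at (f x)) (frechet_derivative f (at x) v))"
  proof (rule continuous_on_linear_apply)
    fix x assume "x \<in> S"
    then show "linear (frechet_derivative g (at (f x)))"
      using im has_derivative_linear[OF Ck1_has_derivative[OF g]] by blast
  next
    fix v
    have "continuous_on S ((\<lambda>y. frechet_derivative g (at y) v) \<circ> f)"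
      using continuous_on_subset[OF Ck1_continuous_derivative[OF g] im]
      by (intro continuous_on_compose cf)
    then show "continuous_on S (\<lambda>x. frechet_derivative g (at (f x)) v)" by (simp add: o_def)
  qed (use Ck1_continuous_derivative[OF f] in simp)
qed

lemma Ck1_add:
  assumes f: "Ck_on 1 S f" and g: "Ck_on 1 S g" shows "Ck_on 1 S (\<lambda>x. f x + g x)"
proof (rule Ck1I)
  show "((\<lambda>x. f x + g x) has_derivative
      (\<lambda>v. frechet_derivative f (at x) v + frechet_derivative g (at x) v)) (at x)" if "x \<in> S" for x
    using that by (intro has_derivative_add Ck1_has_derivative[OF f] Ck1_has_derivative[OF g])
  show "continuous_on S (\<lambda>x. frechet_derivative f (at x) v + frechet_derivative g (at x) v)" for v
    by (intro continuous_on_add Ck1_continuous_derivative f g)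
qed

lemma Ck1_sum:
  fixes f :: "'i \<Rightarrow> 'a::euclidean_space \<Rightarrow> 'b::real_normed_vector"
  assumes "\<And>i. i \<in> I \<Longrightarrow> Ck_on 1 S (f i)" shows "Ck_on 1 S (\<lambda>x. \<Sum>i\<in>I. f i x)"
proof -
  have "Ck_on 1 S (\<lambda>x. 0 :: 'b)" by (rule Ck1I[where f' = "\<lambda>_ _. 0"]) auto
  with assms show ?thesis
  proof (induction I rule: infinite_finite_induct)
    case (insert i I)
    then have "Ck_on 1 S (\<lambda>x. f i x + (\<Sum>i\<in>I. f i x))" by (intro Ck1_add) blast+
    then show ?case using insert.hyps by (simp del: Ck_on.simps)
  qed simp_all
qed

lemma Ck1_scaleR:
  assumes f: "Ck_on 1 S f" and g: "Ck_on 1 S g" shows "Ck_on 1 S (\<lambda>x. f x *\<^sub>R g x)"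
proof (rule Ck1I)
  show "((\<lambda>x. f x *\<^sub>R g x) has_derivative (\<lambda>v. f x *\<^sub>R frechet_derivative g (at x) v
      + frechet_derivative f (at x) v *\<^sub>R g x)) (at x)" if "x \<in> S" for x
    using that by (intro has_derivative_scaleR Ck1_has_derivative[OF f] Ck1_has_derivative[OF g])
  show "continuous_on S (\<lambda>x. f x *\<^sub>R frechet_derivative g (at x) v
      + frechet_derivative f (at x) v *\<^sub>R g x)" for v
    by (intro continuous_intros Ck1_continuous_derivative f g
        Ck_on_imp_continuous_on[OF f] Ck_on_imp_continuous_on[OF g])
qed

lemma Ck1_mult:
  fixes f g :: "'a::euclidean_space \<Rightarrow> real"
  shows "Ck_on 1 S f \<Longrightarrow> Ck_on 1 S g \<Longrightarrow> Ck_on 1 S (\<lambda>x. f x * g x)"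
  using Ck1_scaleR[of S f g] by simp

lemma Ck1_inverse:
  fixes f :: "'a::euclidean_space \<Rightarrow> real"
  assumes f: "Ck_on 1 S f" and nz: "\<And>x. x \<in> S \<Longrightarrow> f x \<noteq> 0"
  shows "Ck_on 1 S (\<lambda>x. inverse (f x))"
proof (rule Ck1I)
  show "((\<lambda>x. inverse (f x)) has_derivative
      (\<lambda>v. - (inverse (f x) * frechet_derivative f (at x) v * inverse (f x)))) (at x)"
    if "x \<in> S" for x
    using that nz by (intro Deriv.has_derivative_inverse Ck1_has_derivative[OF f])
  show "continuous_on S (\<lambda>x. - (inverse (f x) * frechet_derivative f (at x) v * inverse (f x)))" for v
    by (intro continuous_intros Ck1_continuous_derivative f Ck_on_imp_continuous_on[OF f] ballI nz)
qed

section \<open>Symmetry of second derivatives\<close>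

lemma second_difference_mean_value:
  fixes f :: "'a::euclidean_space \<Rightarrow> real"
  assumes D: "\<And>y. y \<in> S \<Longrightarrow> (f has_derivative (\<lambda>w. D w y)) (at y)"
    and D2: "\<And>w y. y \<in> S \<Longrightarrow> (D w has_derivative (\<lambda>z. D2 w z y)) (at y)"
    and h: "h > 0" and seg: "\<And>s t. 0 \<le> s \<Longrightarrow> s \<le> h \<Longrightarrow> 0 \<le> t \<Longrightarrow> t \<le> h \<Longrightarrow> x + s *\<^sub>R u + t *\<^sub>R v \<in> S"
  obtains s t where "0 < s" "s < h" "0 < t" "t < h"
    "f (x + h *\<^sub>R u + h *\<^sub>R v) - f (x + h *\<^sub>R u) - f (x + h *\<^sub>R v) + f x
       = h * (h * D2 u v (x + s *\<^sub>R u + t *\<^sub>R v))"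
proof -
  have deriv: "((\<lambda>s. g (p + s *\<^sub>R w)) has_real_derivative G w) (at s)"
    if "(g has_derivative G) (at (p + s *\<^sub>R w))" for g :: "'a \<Rightarrow> real" and G p w s
  proof -
    have "((\<lambda>s. g (p + s *\<^sub>R w)) has_derivative (\<lambda>r. G (r *\<^sub>R w))) (at s)"
      by (rule has_derivative_compose[where f = "\<lambda>s. p + s *\<^sub>R w" and g = g and g' = G])
         (auto intro!: derivative_eq_intros that)
    moreover have "G (r *\<^sub>R w) = G w * r" for r
      using linear_scale[OF has_derivative_linear[OF that]] by simp
    ultimately show ?thesis by (simp add: has_field_derivative_def)
  qed
  let ?\<phi> = "\<lambda>s. f (x + h *\<^sub>R v + s *\<^sub>R u) - f (x + s *\<^sub>R u)"
  have "\<exists>s. 0 < s \<and> s < h \<and> ?\<phi> h - ?\<phi> 0 = (h - 0) * (D u (x + h *\<^sub>R v + s *\<^sub>R u) - D u (x + s *\<^sub>R u))"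
  proof (rule MVT2[OF h])
    fix s assume s: "0 \<le> s" "s \<le> h"
    have "x + h *\<^sub>R v + s *\<^sub>R u \<in> S" "x + s *\<^sub>R u \<in> S"
      using seg[of s h] seg[of s 0] s h by (auto simp: algebra_simps)
    then show "DERIV ?\<phi> s :> D u (x + h *\<^sub>R v + s *\<^sub>R u) - D u (x + s *\<^sub>R u)"
      by (intro DERIV_diff deriv D)
  qed
  then obtain s where s: "0 < s" "s < h"
    and 1: "?\<phi> h - ?\<phi> 0 = h * (D u (x + h *\<^sub>R v + s *\<^sub>R u) - D u (x + s *\<^sub>R u))" by auto
  have "\<exists>t. 0 < t \<and> t < h \<and> D u (x + s *\<^sub>R u + h *\<^sub>R v) - D u (x + s *\<^sub>R u + 0 *\<^sub>R v)
      = (h - 0) * D2 u v (x + s *\<^sub>R u + t *\<^sub>R v)"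
    using s seg by (intro MVT2[OF h] deriv D2) auto
  then obtain t where "0 < t" "t < h"
    "D u (x + s *\<^sub>R u + h *\<^sub>R v) - D u (x + s *\<^sub>R u) = h * D2 u v (x + s *\<^sub>R u + t *\<^sub>R v)" by auto
  with s 1 that show ?thesis by (simp add: algebra_simps)
qed

text \<open>The second difference over a small parallelogram is symmetric in u and v. By the mean
  value theorem it is h^2 times either mixed derivative at some nearby point, so both mixed
  derivatives at x lie within e of one common value; e is half of their supposed distance.\<close>

lemma symmetric_second_derivative_real:
  fixes f :: "'a::euclidean_space \<Rightarrow> real"
  assumes S: "open S" "x \<in> S"
    and D: "\<And>y. y \<in> S \<Longrightarrow> (f has_derivative (\<lambda>w. D w y)) (at y)"
    and D2: "\<And>w y. y \<in> S \<Longrightarrow> (D w has_derivative (\<lambda>z. D2 w z y)) (at y)"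
    and cont: "\<And>w z. continuous_on S (D2 w z)"
  shows "D2 u v x = D2 v u x"
proof (rule ccontr)
  assume ne: "D2 u v x \<noteq> D2 v u x"
  define e where "e = \<bar>D2 u v x - D2 v u x\<bar> / 2"
  have e: "e > 0" using ne by (simp add: e_def)
  have "\<forall>\<^sub>F y in at x. y \<in> S \<and> dist (D2 u v y) (D2 u v x) < e \<and> dist (D2 v u y) (D2 v u x) < e"
    using S cont e
    by (intro eventually_conj eventually_at_in_open' tendstoD)
       (auto simp: continuous_on_eq_continuous_at continuous_at)
  then obtain d where d: "d > 0"
    and near: "\<And>y. dist y x < d \<Longrightarrow> y \<in> S \<and> dist (D2 u v y) (D2 u v x) < e \<and> dist (D2 v u y) (D2 v u x) < e"
    unfolding eventually_at using S e by (metis dist_self UNIV_I)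
  \<comment> \<open>The summand 1 keeps the denominator positive; the whole parallelogram with sides
    h u and h v stays at distance less than d from x.\<close>
  define h where "h = d / (2 * (norm u + norm v + 1))"
  have h: "h > 0" using d by (auto simp: h_def intro!: divide_pos_pos add_nonneg_pos)
  have close: "dist (x + s *\<^sub>R u + t *\<^sub>R v) x < d" if "0 \<le> s" "s \<le> h" "0 \<le> t" "t \<le> h" for s t
  proof -
    have "norm (s *\<^sub>R u + t *\<^sub>R v) \<le> s * norm u + t * norm v"
      using that norm_triangle_ineq[of "s *\<^sub>R u" "t *\<^sub>R v"] by simp
    also have "\<dots> \<le> h * norm u + h * norm v" using that by (intro add_mono mult_right_mono) auto
    also have "\<dots> < h * (2 * (norm u + norm v + 1))"
    proof -
      have "0 < h * norm u + (h * norm v + h * 2)" using h by (intro add_nonneg_pos) auto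
      then show ?thesis by (simp add: algebra_simps)
    qed
    also have "\<dots> = d"
    proof -
      have "2 * (norm u + norm v + 1) > 0" by (auto intro: add_nonneg_pos)
      then show ?thesis by (simp add: h_def)
    qed
    finally show ?thesis by (simp add: dist_norm add.assoc)
  qed
  obtain s t where st: "0 < s" "s < h" "0 < t" "t < h"
    "f (x + h *\<^sub>R u + h *\<^sub>R v) - f (x + h *\<^sub>R u) - f (x + h *\<^sub>R v) + f x
       = h * (h * D2 u v (x + s *\<^sub>R u + t *\<^sub>R v))"
    by (rule second_difference_mean_value[OF D D2 h, of S x u v]) (use near close in auto)
  have seg: "x + s *\<^sub>R v + t *\<^sub>R u \<in> S" if "0 \<le> s" "s \<le> h" "0 \<le> t" "t \<le> h" for s t
    using near[OF close[of t s]] that by (simp add: algebra_simps)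
  obtain s' t' where st': "0 < s'" "s' < h" "0 < t'" "t' < h"
    "f (x + h *\<^sub>R v + h *\<^sub>R u) - f (x + h *\<^sub>R v) - f (x + h *\<^sub>R u) + f x
       = h * (h * D2 v u (x + s' *\<^sub>R v + t' *\<^sub>R u))"
    by (rule second_difference_mean_value[OF D D2 h, of S x v u]) (use seg in auto)
  have "D2 u v (x + s *\<^sub>R u + t *\<^sub>R v) = D2 v u (x + s' *\<^sub>R v + t' *\<^sub>R u)"
    using st(5) st'(5) h by (simp add: algebra_simps)
  moreover have "dist (D2 u v (x + s *\<^sub>R u + t *\<^sub>R v)) (D2 u v x) < e"
    using near[OF close[of s t]] st by auto
  moreover have "dist (D2 v u (x + s' *\<^sub>R v + t' *\<^sub>R u)) (D2 v u x) < e"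
    using near[OF close[of t' s']] st' by (auto simp: algebra_simps)
  ultimately show False unfolding dist_real_def e_def by argo
qed

lemma symmetric_second_derivative:
  fixes f :: "'a::euclidean_space \<Rightarrow> 'b::euclidean_space"
  assumes S: "open S" "x \<in> S" and f: "Ck_on 2 S f"
  shows "frechet_derivative (\<lambda>y. frechet_derivative f (at y) u) (at x) v
       = frechet_derivative (\<lambda>y. frechet_derivative f (at y) v) (at x) u"
proof (rule euclidean_eqI)
  fix b :: 'b assume "b \<in> Basis"
  have f1: "Ck_on 1 S f" by (rule Ck_on_mono[OF f]) simp
  have f2: "Ck_on 1 S (\<lambda>y. frechet_derivative f (at y) w)" for w
    using f by (simp add: numeral_2_eq_2)
  show "frechet_derivative (\<lambda>y. frechet_derivative f (at y) u) (at x) v \<bullet> b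
       = frechet_derivative (\<lambda>y. frechet_derivative f (at y) v) (at x) u \<bullet> b"
    by (rule symmetric_second_derivative_real[OF S, where f = "\<lambda>y. f y \<bullet> b"
          and D = "\<lambda>w y. frechet_derivative f (at y) w \<bullet> b"])
       (intro has_derivative_inner_left Ck1_has_derivative[OF f1] Ck1_has_derivative[OF f2]
          continuous_intros Ck1_continuous_derivative[OF f2]; assumption)+
qed

text \<open>\<open>A x0\<close> is bounded below by some m > 0. Near x0 the operator norm of
  \<open>A x - A x0\<close> is below m / 2, so \<open>A x\<close> is bounded below by m / 2, and the
  difference of the inverses at w is at most 2 / m times the norm of
  \<open>w - A x (B x0 w)\<close>, which tends to 0. No formula for the inverse matrix
  enters.\<close>

lemma continuous_on_inverse_apply:
  fixes A :: "'t::topological_space \<Rightarrow> 'a::euclidean_space \<Rightarrow> 'a"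
  assumes lin: "\<And>x. x \<in> S \<Longrightarrow> linear (A x)" and cont: "\<And>v. continuous_on S (\<lambda>x. A x v)"
    and inv: "\<And>x w. x \<in> S \<Longrightarrow> A x (B x w) = w" "\<And>x v. x \<in> S \<Longrightarrow> B x (A x v) = v"
  shows "continuous_on S (\<lambda>x. B x w)"
  unfolding continuous_on_def
proof
  fix x0 assume x0: "x0 \<in> S"
  have "bounded_linear (A x0)" using lin[OF x0] linear_conv_bounded_linear by blast
  moreover have "inj (A x0)" using inv(2)[OF x0] by (metis injI)
  ultimately obtain m where m: "m > 0" "\<And>v. m * norm v \<le> norm (A x0 v)"
    using linear_inj_bounded_below_pos[OF lin[OF x0]] by (metis mult.commute)
  let ?e = "\<lambda>x. \<Sum>b\<in>Basis. norm (A x b - A x0 b)"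
  have diff: "norm (A x v - A x0 v) \<le> ?e x * norm v" if "x \<in> S" for x v
  proof -
    have "A y v = (\<Sum>b\<in>Basis. (v \<bullet> b) *\<^sub>R A y b)" if "y \<in> S" for y
    proof -
      have "A y (\<Sum>b\<in>Basis. (v \<bullet> b) *\<^sub>R b) = (\<Sum>b\<in>Basis. (v \<bullet> b) *\<^sub>R A y b)"
        by (simp add: linear_sum[OF lin[OF that]] linear_scale[OF lin[OF that]])
      then show ?thesis by (simp add: euclidean_representation)
    qed
    then have "A x v - A x0 v = (\<Sum>b\<in>Basis. (v \<bullet> b) *\<^sub>R (A x b - A x0 b))"
      using that x0 by (simp add: sum_subtractf scaleR_diff_right)
    also have "norm \<dots> \<le> (\<Sum>b\<in>Basis. norm v * norm (A x b - A x0 b))"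
      by (intro sum_norm_le) (auto intro!: mult_right_mono Basis_le_norm)
    finally show ?thesis by (simp add: sum_distrib_left mult.commute)
  qed
  have "((\<lambda>x. A x b) \<longlongrightarrow> A x0 b) (at x0 within S)" for b
    using cont x0 by (auto simp: continuous_on_def)
  then have e0: "(?e \<longlongrightarrow> (\<Sum>b\<in>Basis. norm (A x0 b - A x0 b))) (at x0 within S)"
    by (intro tendsto_intros)
  then have "\<forall>\<^sub>F x in at x0 within S. ?e x < m / 2"
    using order_tendstoD(2)[OF e0, of "m / 2"] m by simp
  moreover have "\<forall>\<^sub>F x in at x0 within S. x \<in> S" by (simp add: eventually_at_topological) blast
  ultimately have "\<forall>\<^sub>F x in at x0 within S. norm (B x w - B x0 w) \<le> (2 / m) * norm (w - A x (B x0 w))"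
  proof eventually_elim
    case (elim x)
    let ?v = "B x w - B x0 w"
    have "m * norm ?v \<le> norm (A x0 ?v)" by (rule m)
    also have "\<dots> \<le> norm (A x ?v) + norm (A x ?v - A x0 ?v)"
      using norm_triangle_ineq2[of "A x0 ?v" "A x ?v"] norm_minus_commute[of "A x0 ?v" "A x ?v"] by linarith
    also have "\<dots> \<le> norm (A x ?v) + (m / 2) * norm ?v"
      using diff[of x ?v] elim mult_right_mono[of "?e x" "m / 2" "norm ?v"] by fastforce
    finally have "(m / 2) * norm ?v \<le> norm (A x ?v)" by simp
    moreover have "A x ?v = w - A x (B x0 w)"
      using elim lin[of x] by (simp add: linear_diff inv)
    ultimately show ?case using m by (simp add: field_simps)
  qed
  moreover have "((\<lambda>x. (2 / m) * norm (w - A x (B x0 w))) \<longlongrightarrow> (2 / m) * norm (w - A x0 (B x0 w))) (at x0 within S)"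
    using cont x0 by (intro tendsto_intros) (auto simp: continuous_on_def)
  then have "((\<lambda>x. (2 / m) * norm (w - A x (B x0 w))) \<longlongrightarrow> 0) (at x0 within S)"
    using inv(1)[OF x0] by simp
  ultimately have "((\<lambda>x. B x w - B x0 w) \<longlongrightarrow> 0) (at x0 within S)"
    by (rule Lim_null_comparison)
  then show "((\<lambda>x. B x w) \<longlongrightarrow> B x0 w) (at x0 within S)" by (rule LIM_zero_cancel)
qed

text \<open>Off K the derivative vanishes because h is locally 0 there; on K the finitely many
  continuous functions given by the basis directions are bounded.\<close>

lemma has_derivative_compact_support_bounded:
  fixes h :: "'a::euclidean_space \<Rightarrow> real"
  assumes d: "\<And>x. (h has_derivative h' x) (at x)" and c: "\<And>v. continuous_on UNIV (\<lambda>x. h' x v)"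
    and K: "compact K" "\<And>x. x \<notin> K \<Longrightarrow> h x = 0"
  shows "\<exists>C. \<forall>x v. \<bar>h' x v\<bar> \<le> C * norm v"
proof -
  have "h' x v = 0" if "x \<notin> K" for x v
  proof -
    have o: "open (- K)" using K by (simp add: open_Compl compact_imp_closed)
    have "(h has_derivative (\<lambda>_. 0)) (at x)"
      by (rule has_derivative_transform_within_open[of "\<lambda>_. 0" _ x UNIV "- K"]) (use that K o in auto)
    from has_derivative_unique[OF d this] show ?thesis by simp
  qed note z = this
  have "compact ((\<lambda>x. h' x b) ` K)" for b
    using c[of b] K by (intro compact_continuous_image) (auto elim: continuous_on_subset)
  then have "bounded ((\<lambda>x. h' x b) ` K)" for b by (rule compact_imp_bounded)
  then have "\<forall>b. \<exists>C. \<forall>x\<in>K. \<bar>h' x b\<bar> \<le> C" by (simp add: bounded_iff)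
  then obtain C where C: "\<And>b x. x \<in> K \<Longrightarrow> \<bar>h' x b\<bar> \<le> C b" by metis
  have "\<bar>h' x v\<bar> \<le> (\<Sum>b\<in>Basis. \<bar>C b\<bar>) * norm v" for x v
  proof (cases "x \<in> K")
    case True
    have l: "linear (h' x)" using d has_derivative_linear by blast
    have "h' x (\<Sum>b\<in>Basis. (v \<bullet> b) *\<^sub>R b) = (\<Sum>b\<in>Basis. (v \<bullet> b) * h' x b)"
      by (simp add: linear_sum[OF l] linear_scale[OF l])
    then have "\<bar>h' x v\<bar> \<le> (\<Sum>b\<in>Basis. \<bar>(v \<bullet> b) * h' x b\<bar>)"
      by (simp add: euclidean_representation sum_abs)
    also have "\<dots> \<le> (\<Sum>b\<in>Basis. norm v * \<bar>C b\<bar>)"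
      using C[OF True] unfolding abs_mult
      by (intro sum_mono mult_mono) (auto intro: Basis_le_norm order_trans[OF _ abs_ge_self])
    finally show ?thesis by (simp add: sum_distrib_left mult.commute)
  qed (auto simp: z intro!: mult_nonneg_nonneg sum_nonneg)
  then show ?thesis by blast
qed

text \<open>Proved by differentiating the translation invariance of the Lebesgue integral.\<close>

lemma integral_derivative_compact_support:
  fixes h :: "'a::euclidean_space \<Rightarrow> real"
  assumes d: "\<And>x. (h has_derivative h' x) (at x)" and c: "\<And>v. continuous_on UNIV (\<lambda>x. h' x v)"
    and K: "compact K" "\<And>x. x \<notin> K \<Longrightarrow> h x = 0"
  shows "integrable lborel (\<lambda>x. h' x v)" "(LINT x|lborel. h' x v) = 0"
proof -
  obtain C where C: "\<And>x v. \<bar>h' x v\<bar> \<le> C * norm v"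
    using has_derivative_compact_support_bounded[OF d c K] by blast
  have conth: "continuous_on UNIV h"
    using d has_derivative_continuous continuous_at_imp_continuous_on by blast
  \<comment> \<open>Difference quotients with step 1 / (n + 1). As the step is at most 1, all of
    them vanish off the ball \<open>W\<close> introduced below, so that \<open>C * norm v\<close> on
    \<open>W\<close> is an integrable bound for dominated convergence.\<close>
  define q where "q n x = real (Suc n) * (h (x + (1 / real (Suc n)) *\<^sub>R v) - h x)" for n x
  have C0: "C * norm w \<ge> 0" for w :: 'a using C[of undefined w] abs_ge_zero order_trans by blast
  have lip: "\<bar>h (x + w) - h x\<bar> \<le> C * norm w" for x w
  proof (cases "norm w = 0")
    case False
    then have "C \<ge> 0" using C0[of w] by (simp add: zero_le_mult_iff)
    then have "norm (h (x + w) - h x) \<le> C * norm (x + w - x)"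
      using C d by (intro differentiable_bound[where S = UNIV and f' = h'])
        (auto intro!: onorm_le simp: has_derivative_at_withinI)
    then show ?thesis by simp
  qed simp
  obtain R where R: "\<And>x. x \<in> K \<Longrightarrow> norm x \<le> R" using K compact_imp_bounded bounded_iff by metis
  define W where "W = cball (0::'a) (R + norm v)"
  have supp: "q n x = 0" if "x \<notin> W" for n x
  proof -
    have "norm (x + (1 / real (Suc n)) *\<^sub>R v) > R"
    proof -
      have "norm ((1 / real (Suc n)) *\<^sub>R v) \<le> norm v"
        by (simp add: divide_le_eq mult_le_cancel_left1)
      moreover have "norm x > R + norm v" using that by (simp add: W_def)
      moreover have "norm x \<le> norm (x + (1 / real (Suc n)) *\<^sub>R v) + norm ((1 / real (Suc n)) *\<^sub>R v)"
        using norm_triangle_ineq4[of "x + (1 / real (Suc n)) *\<^sub>R v" "(1 / real (Suc n)) *\<^sub>R v"] by simp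
      ultimately show ?thesis by linarith
    qed
    moreover have "norm x > R" using that norm_ge_zero[of v] unfolding W_def mem_cball_0 by linarith
    ultimately have "x \<notin> K" "x + (1 / real (Suc n)) *\<^sub>R v \<notin> K" using R by force+
    then show ?thesis using K by (simp add: q_def)
  qed
  have qb: "\<bar>q n x\<bar> \<le> indicator W x * (C * norm v)" for n x
  proof (cases "x \<in> W")
    case True
    have "\<bar>q n x\<bar> \<le> real (Suc n) * (C * norm ((1 / real (Suc n)) *\<^sub>R v))"
      unfolding q_def abs_mult by (intro mult_mono lip) auto
    also have "\<dots> = C * norm v" by simp
    finally show ?thesis using True by simp
  qed (simp add: supp)
  have lim: "(\<lambda>n. q n x) \<longlonglongrightarrow> h' x v" for x
  proof -
    have "((\<lambda>t. h (x + t *\<^sub>R v)) has_derivative (\<lambda>r. h' x (r *\<^sub>R v))) (at 0)"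
      by (rule has_derivative_compose[where g = h and g' = "h' x"]) (auto intro!: derivative_eq_intros d)
    moreover have "h' x (r *\<^sub>R v) = h' x v * r" for r
      using linear_scale[OF has_derivative_linear[OF d]] by simp
    ultimately have "((\<lambda>t. h (x + t *\<^sub>R v)) has_field_derivative h' x v) (at 0)"
      by (simp add: has_field_derivative_def)
    then have "((\<lambda>t. (h (x + t *\<^sub>R v) - h x) / t) \<longlongrightarrow> h' x v) (at 0)"
      by (simp add: DERIV_def)
    moreover have "filterlim (\<lambda>n. 1 / real (Suc n)) (at 0) sequentially"
      using LIMSEQ_Suc[OF lim_1_over_n] by (auto simp: filterlim_at intro!: eventuallyI)
    ultimately have "(\<lambda>n. (h (x + (1 / real (Suc n)) *\<^sub>R v) - h x) / (1 / real (Suc n))) \<longlonglongrightarrow> h' x v"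
      by (rule filterlim_compose)
    then show ?thesis by (simp add: q_def mult.commute)
  qed
  have qm: "q n \<in> borel_measurable lborel" for n
  proof -
    have "continuous_on UNIV (q n)" unfolding q_def
      by (intro continuous_intros continuous_on_compose2[OF conth] conth) auto
    then show ?thesis using borel_measurable_continuous_onI by simp
  qed
  have hm: "(\<lambda>x. h' x v) \<in> borel_measurable lborel"
    using borel_measurable_continuous_onI[OF c] by simp
  have W: "integrable lborel (\<lambda>x. indicator W x * (C * norm v))"
    by (intro integrable_mult_left integrable_real_indicator)
       (simp_all add: W_def emeasure_bounded_finite[unfolded infinity_ennreal_def])
  show "integrable lborel (\<lambda>x. h' x v)"
    by (rule integrable_dominated_convergence[where s = q, OF hm qm W]) (use lim qb in auto)
  have L: "(\<lambda>n. LINT x|lborel. q n x) \<longlonglongrightarrow> (LINT x|lborel. h' x v)"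
    by (rule integral_dominated_convergence[where s = q, OF hm qm W]) (use lim qb in auto)
  have hi: "integrable lborel h"
  proof -
    have "integrable lborel (\<lambda>x. indicator K x *\<^sub>R h x)"
      using borel_integrable_compact[OF K(1), of h] continuous_on_subset[OF conth, of K] by simp
    moreover have "(\<lambda>x. indicator K x *\<^sub>R h x) = h" using K by (auto simp: fun_eq_iff indicator_def)
    ultimately show ?thesis by (simp only:)
  qed
  have "(LINT x|lborel. q n x) = 0" for n
  proof -
    let ?w = "(1 / real (Suc n)) *\<^sub>R v"
    have e: "integrable lborel (\<lambda>x. h (?w + x))"
      "(LINT x|lborel. h (?w + x)) = (LINT x|lborel. h x)"
    proof -
      have m: "h \<in> borel_measurable borel" using conth borel_measurable_continuous_onI by blast
      have t: "(+) ?w \<in> measurable lborel borel" by simp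
      show "integrable lborel (\<lambda>x. h (?w + x))"
        using integrable_distr_eq[OF t m] hi by (simp add: lborel_distr_plus)
      show "(LINT x|lborel. h (?w + x)) = (LINT x|lborel. h x)"
        using integral_distr[OF t m] by (simp add: lborel_distr_plus)
    qed
    have "q n = (\<lambda>x. real (Suc n) * (h (?w + x) - h x))" by (simp add: q_def add.commute fun_eq_iff)
    then show ?thesis using e hi by simp
  qed
  then have "(\<lambda>n. 0) \<longlonglongrightarrow> (LINT x|lborel. h' x v)" using L by simp
  then show "(LINT x|lborel. h' x v) = 0" using LIMSEQ_unique tendsto_const by blast
qed

section \<open>Determinants and change of variables\<close>

lemma alt_form_scale_list:
  assumes a: "alt_form k \<alpha>"
  shows "\<alpha> (pre @ map (\<lambda>b. d b *\<^sub>R b) bs) = (\<Prod>b\<leftarrow>bs. d b) * \<alpha> (pre @ bs)"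
proof (induction bs arbitrary: pre)
  case (Cons b bs)
  have "\<alpha> (pre @ d b *\<^sub>R b # bs) = d b * \<alpha> (pre @ b # bs)"
  proof (cases "length (pre @ b # bs) = k")
    case True
    then have "linear (\<lambda>v. \<alpha> ((pre @ b # bs)[length pre := v]))"
      by (intro alt_form_linear[OF a]) auto
    from linear_scale[OF this, of "d b" b] show ?thesis by simp
  next
    case False
    then show ?thesis using alt_form_length[OF a] by simp
  qed
  then show ?case using Cons.IH[of "pre @ [d b *\<^sub>R b]"] by simp
qed simp

lemma basis_list: "distinct (basis_list :: 'e::euclidean_space list)" "set (basis_list :: 'e list) = Basis"
proof -
  have "\<exists>bs :: 'e list. distinct bs \<and> set bs = Basis"
    using finite_distinct_list[OF finite_Basis] by blast
  from someI_ex[OF this] show "distinct (basis_list :: 'e list)" "set (basis_list :: 'e list) = Basis"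
    by (simp_all add: basis_list_def)
qed

lemma length_basis_list: "length (basis_list :: 'e::euclidean_space list) = DIM('e)"
  using distinct_card[of "basis_list :: 'e list"] by (simp add: basis_list)

text \<open>The change of variables formula of the library is about \<open>real ^ 'n\<close> with a well-ordered index
  type; the following index type makes it available on every Euclidean space.\<close>

typedef (overloaded) ('e::euclidean_space) bidx = "Basis :: 'e set"
  using nonempty_Basis by blast

instance bidx :: (euclidean_space) finite
proof
  have "(UNIV :: 'a bidx set) = Abs_bidx ` Basis"
    using Abs_bidx_cases by blast
  then show "finite (UNIV :: 'a bidx set)" by (metis finite_imageI finite_Basis)
qed

instantiation bidx :: (euclidean_space) wellorder
begin

text \<open>The order is pulled back along the injection \<open>to_nat\<close> of a finite, hence
  countable, type, which makes it a well-order.\<close>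

definition less_eq_bidx :: "'a bidx \<Rightarrow> 'a bidx \<Rightarrow> bool" where "(a :: 'a bidx) \<le> b \<longleftrightarrow> to_nat a \<le> to_nat b"
definition less_bidx :: "'a bidx \<Rightarrow> 'a bidx \<Rightarrow> bool" where "(a :: 'a bidx) < b \<longleftrightarrow> to_nat a < to_nat b"

instance
proof
  fix x y z :: "'a bidx"
  show "x < y \<longleftrightarrow> x \<le> y \<and> \<not> y \<le> x" unfolding less_eq_bidx_def less_bidx_def by linarith
  show "x \<le> x" unfolding less_eq_bidx_def by simp
  show "x \<le> y \<Longrightarrow> y \<le> z \<Longrightarrow> x \<le> z" unfolding less_eq_bidx_def by linarith
  show "x \<le> y \<Longrightarrow> y \<le> x \<Longrightarrow> x = y"
    unfolding less_eq_bidx_def using injD[OF inj_to_nat, of x y] by simp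
  show "x \<le> y \<or> y \<le> x" unfolding less_eq_bidx_def by linarith
next
  fix P :: "'a bidx \<Rightarrow> bool" and a
  assume *: "\<And>x. (\<And>y. y < x \<Longrightarrow> P y) \<Longrightarrow> P x"
  show "P a"
  proof (induction a rule: measure_induct_rule[of to_nat])
    case (less x)
    show ?case by (rule *, rule less) (simp add: less_bidx_def)
  qed
qed

end

definition of_vec :: "real ^ ('e::euclidean_space bidx) \<Rightarrow> 'e" where
  "of_vec x = (\<Sum>i\<in>UNIV. (x $ i) *\<^sub>R Rep_bidx i)"

definition to_vec :: "'e::euclidean_space \<Rightarrow> real ^ ('e bidx)" where
  "to_vec v = (\<chi> i. v \<bullet> Rep_bidx i)"

lemma Rep_bidx_Basis [simp]: "Rep_bidx i \<in> Basis"
  using Rep_bidx by blast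

lemma inner_Rep_bidx: "Rep_bidx i \<bullet> Rep_bidx j = (if i = j then 1 else 0)"
  by (simp add: inner_Basis Rep_bidx_inject)

lemma bij_betw_Rep_bidx: "bij_betw Rep_bidx UNIV (Basis :: 'e::euclidean_space set)"
  unfolding bij_betw_def
  by (auto intro!: injI simp: Rep_bidx_inject image_iff) (metis Abs_bidx_inverse)

lemma of_vec_inner: "of_vec x \<bullet> Rep_bidx j = x $ j"
  by (simp add: of_vec_def inner_sum_left inner_Rep_bidx if_distrib cong: if_cong)

lemma to_vec_of_vec [simp]: "to_vec (of_vec x) = x"
  by (simp add: to_vec_def of_vec_inner vec_eq_iff)

lemma of_vec_to_vec [simp]: "of_vec (to_vec v) = v"
proof -
  have "of_vec (to_vec v) = (\<Sum>b\<in>Basis. (v \<bullet> b) *\<^sub>R b)"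
    unfolding of_vec_def to_vec_def by (subst sum.reindex_bij_betw[OF bij_betw_Rep_bidx, symmetric]) simp
  then show ?thesis by (simp add: euclidean_representation)
qed

lemma linear_of_vec: "linear of_vec"
  by (auto intro!: linearI simp: of_vec_def scaleR_add_left sum.distrib scaleR_right.sum)

lemma linear_to_vec: "linear to_vec"
  by (auto intro!: linearI simp: to_vec_def vec_eq_iff inner_add_left)

lemma of_vec_axis: "of_vec (axis j 1) = Rep_bidx j"
proof -
  have "of_vec (axis j 1) = (\<Sum>i\<in>UNIV. if i = j then Rep_bidx j else 0)"
    unfolding of_vec_def by (intro sum.cong) (auto simp: axis_def)
  then show ?thesis by simp
qed

lemma to_vec_Rep_bidx: "to_vec (Rep_bidx j) = axis j 1"
  by (metis of_vec_axis to_vec_of_vec)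

text \<open>The preimage of a box in these coordinates is a box with the same side lengths, and the
  values on boxes determine Lebesgue measure.\<close>

lemma distr_of_vec: "distr lborel borel of_vec = (lborel :: 'e::euclidean_space measure)"
proof (rule lborel_eqI[symmetric])
  fix l u :: 'e assume le: "\<And>b. b \<in> Basis \<Longrightarrow> l \<bullet> b \<le> u \<bullet> b"
  have m: "of_vec \<in> measurable borel (borel :: 'e measure)"
    using linear_of_vec linear_continuous_on linear_conv_bounded_linear borel_measurable_continuous_onI by blast
  have "of_vec -` box l u = box (to_vec l) (to_vec u)"
  proof -
    have "(\<forall>b\<in>Basis. l \<bullet> b < of_vec x \<bullet> b \<and> of_vec x \<bullet> b < u \<bullet> b)
        \<longleftrightarrow> (\<forall>i. to_vec l $ i < x $ i \<and> x $ i < to_vec u $ i)" for x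
    proof -
      have "(\<forall>b\<in>Basis. Q b) \<longleftrightarrow> (\<forall>i. Q (Rep_bidx i))" for Q :: "'e \<Rightarrow> bool"
      proof -
        have b: "(Basis :: 'e set) = range Rep_bidx" using bij_betw_Rep_bidx[where 'e = 'e] by (simp add: bij_betw_def)
        show ?thesis unfolding b by simp
      qed
      then show ?thesis by (simp add: of_vec_inner to_vec_def)
    qed
    then show ?thesis unfolding set_eq_iff vimage_eq mem_box_cart mem_box(1)[where 'a = 'e] by blast
  qed
  then have "emeasure (distr lborel borel of_vec) (box l u) = emeasure lborel (box (to_vec l) (to_vec u))"
    using m by (simp add: emeasure_distr)
  also have "\<dots> = ennreal (\<Prod>b\<in>Basis. (to_vec u - to_vec l) \<bullet> b)"
  proof (rule emeasure_lborel_box)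
    fix b :: "real ^ 'e bidx" assume "b \<in> Basis"
    then obtain i where "b = axis i 1" by (auto simp: Basis_vec_def)
    then show "to_vec l \<bullet> b \<le> to_vec u \<bullet> b" using le by (simp add: inner_axis to_vec_def)
  qed
  also have "(\<Prod>b\<in>Basis. (to_vec u - to_vec l) \<bullet> b) = (\<Prod>i\<in>UNIV. (to_vec u - to_vec l) $ i)"
  proof -
    have "bij_betw (\<lambda>i. axis i (1::real)) UNIV (Basis :: (real ^ 'e bidx) set)"
      by (auto simp: bij_betw_def Basis_vec_def inj_on_def axis_eq_axis)
    from prod.reindex_bij_betw[OF this, of "\<lambda>b. (to_vec u - to_vec l) \<bullet> b", symmetric] show ?thesis
      by (simp add: inner_axis)
  qed
  also have "\<dots> = (\<Prod>b\<in>Basis. (u - l) \<bullet> b)"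
    using prod.reindex_bij_betw[OF bij_betw_Rep_bidx, of "\<lambda>b. (u - l) \<bullet> b"]
    by (simp add: to_vec_def inner_diff_left)
  finally show "emeasure (distr lborel borel of_vec) (box l u) = ennreal (\<Prod>b\<in>Basis. (u - l) \<bullet> b)" .
qed simp

definition lin_det :: "('e::euclidean_space \<Rightarrow> 'e) \<Rightarrow> real" where
  "lin_det A = det (matrix (\<lambda>x. to_vec (A (of_vec x))))"

text \<open>A nonzero value would make the entries independent, but a hyperplane has room for only n
  - 1 independent vectors.\<close>

lemma alt_form_eq_0_hyperplane:
  fixes vs :: "'e::euclidean_space list"
  assumes a: "alt_form DIM('e) \<alpha>" and "a \<noteq> 0" and "\<And>v. v \<in> set vs \<Longrightarrow> a \<bullet> v = 0"
  shows "\<alpha> vs = 0"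
proof (rule ccontr)
  assume nz: "\<alpha> vs \<noteq> 0"
  then have l: "length vs = DIM('e)" using alt_form_length[OF a] by blast
  have "distinct vs" unfolding distinct_conv_nth using nz alt_form_repeat'[OF a l] l by auto
  then have "card (set vs) = DIM('e)" using l distinct_card[of vs] by simp
  moreover have "card (set vs) \<le> dim {v. a \<bullet> v = 0}"
    using nz alt_form_dependent[OF a] assms(3) by (intro independent_card_le_dim) auto
  ultimately show False using dim_hyperplane[OF \<open>a \<noteq> 0\<close>] DIM_positive[where 'a = 'e] by linarith
qed

text \<open>Induction over elementary matrices instead of an expansion into a sum over permutations:
  the cases are a product, a zero row, a diagonal matrix, an exchange and a shear. The statement
  quantifies over \<alpha> because the product case applies one hypothesis to \<alpha> composed with
  the other matrix.\<close>

lemma alt_form_matrix: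
  fixes M :: "real ^ ('e::euclidean_space bidx) ^ ('e bidx)"
  shows "\<forall>\<alpha>. alt_form DIM('e) \<alpha> \<longrightarrow>
    \<alpha> (map (\<lambda>v. of_vec (M *v to_vec v)) basis_list) = det M * \<alpha> basis_list" (is "?P M")
proof (rule induct_matrix_elementary[of ?P])
  let ?T = "\<lambda>(M :: real ^ 'e bidx ^ 'e bidx) v. of_vec (M *v to_vec v)"
  let ?bs = "basis_list :: 'e list"
  let ?n = "DIM('e)"
  have lin: "linear (?T M)" for M
    using linear_compose[OF linear_compose[OF linear_to_vec matrix_vector_mul_linear[of M]] linear_of_vec]
    by (simp add: o_def)
  have TR: "?T M (Rep_bidx j) = (\<Sum>i\<in>UNIV. (M $ i $ j) *\<^sub>R Rep_bidx i)" for M j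
    by (simp add: to_vec_Rep_bidx matrix_vector_mult_basis of_vec_def column_def)
  \<comment> \<open>\<open>basis_list\<close> is an arbitrary enumeration of the basis, so list
    positions have to be translated into matrix indices.\<close>
  define ix where "ix k = Abs_bidx (?bs ! k)" for k
  have ix: "Rep_bidx (ix k) = ?bs ! k" if "k < ?n" for k
    using nth_mem[of k ?bs] that by (simp add: ix_def Abs_bidx_inverse basis_list length_basis_list)
  have ix_eq: "ix k = ix l \<longleftrightarrow> k = l" if "k < ?n" "l < ?n" for k l
    using Rep_bidx_inject[of "ix k" "ix l"] ix[OF that(1)] ix[OF that(2)]
      nth_eq_iff_index_eq[of ?bs k l] that by (simp add: basis_list length_basis_list)
  have ix_ex: "\<exists>k<?n. ix k = i" for i :: "'e bidx"
  proof -
    have "Rep_bidx i \<in> set ?bs" by (simp add: basis_list(2))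
    then obtain k where "k < length ?bs" "?bs ! k = Rep_bidx i" unfolding in_set_conv_nth by blast
    then have "k < ?n" "ix k = i" by (simp_all add: ix_def length_basis_list Rep_bidx_inverse)
    then show ?thesis by blast
  qed
  show "?P (A ** B)" if A: "?P A" and B: "?P B" for A B
  proof (intro allI impI)
    fix \<alpha> :: "'e list \<Rightarrow> real" assume a: "alt_form ?n \<alpha>"
    have "\<alpha> (map (?T (A ** B)) ?bs) = \<alpha> (map (?T A) (map (?T B) ?bs))"
      by (simp add: matrix_vector_mul_assoc o_def)
    also have "\<dots> = det B * \<alpha> (map (?T A) ?bs)"
      using B alt_form_map[OF a lin[of A]] by blast
    also have "\<dots> = det (A ** B) * \<alpha> ?bs" using A a by (simp add: det_mul)
    finally show "\<alpha> (map (?T (A ** B)) ?bs) = det (A ** B) * \<alpha> ?bs" .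
  qed
  show "?P A" if r: "row i A = 0" for A i
  proof (intro allI impI)
    fix \<alpha> :: "'e list \<Rightarrow> real" assume a: "alt_form ?n \<alpha>"
    \<comment> \<open>A zero row puts the image into the hyperplane orthogonal to the i-th basis
      vector.\<close>
    have "A $ i = 0" using r by (simp add: row_def vec_eq_iff)
    then have "Rep_bidx i \<bullet> ?T A v = 0" for v
      by (simp add: of_vec_inner inner_commute[of "Rep_bidx i"] matrix_vector_mult_def)
    moreover have "Rep_bidx i \<noteq> 0" using nonzero_Basis[OF Rep_bidx_Basis] by blast
    ultimately have "\<alpha> (map (?T A) ?bs) = 0" by (intro alt_form_eq_0_hyperplane[OF a]) auto
    then show "\<alpha> (map (?T A) ?bs) = det A * \<alpha> ?bs" using det_zero_row(1)[OF r] by simp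
  qed
  show "?P A" if d: "\<And>i j. i \<noteq> j \<Longrightarrow> A $ i $ j = 0" for A
  proof (intro allI impI)
    fix \<alpha> :: "'e list \<Rightarrow> real" assume a: "alt_form ?n \<alpha>"
    let ?d = "\<lambda>b. A $ Abs_bidx b $ Abs_bidx b"
    have "?T A (Rep_bidx j) = (\<Sum>i\<in>UNIV. if i = j then (A $ j $ j) *\<^sub>R Rep_bidx j else 0)" for j
      unfolding TR by (intro sum.cong) (auto simp: d)
    then have T: "?T A (Rep_bidx j) = (A $ j $ j) *\<^sub>R Rep_bidx j" for j by simp
    have "?T A b = ?d b *\<^sub>R b" if "b \<in> Basis" for b
      using T[of "Abs_bidx b"] Abs_bidx_inverse[OF that] by simp
    then have m: "map (?T A) ?bs = map (\<lambda>b. ?d b *\<^sub>R b) ?bs" using basis_list(2) by (intro map_cong) auto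
    have "\<alpha> (map (?T A) ?bs) = (\<Prod>b\<leftarrow>?bs. ?d b) * \<alpha> ?bs"
      unfolding m using alt_form_scale_list[OF a, of "[]"] by simp
    also have "(\<Prod>b\<leftarrow>?bs. ?d b) = (\<Prod>b\<in>Basis. ?d b)"
      using prod.distinct_set_conv_list[of ?bs ?d] by (simp add: basis_list)
    also have "\<dots> = (\<Prod>i\<in>UNIV. A $ i $ i)"
      using prod.reindex_bij_betw[OF bij_betw_Rep_bidx, of ?d] by (simp add: Rep_bidx_inverse)
    also have "\<dots> = det A" using det_diagonal[of A] d by simp
    finally show "\<alpha> (map (?T A) ?bs) = det A * \<alpha> ?bs" .
  qed
  show "?P (\<chi> i j. mat 1 $ i $ Transposition.transpose m n j)" if mn: "m \<noteq> n" for m n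
  proof (intro allI impI)
    fix \<alpha> :: "'e list \<Rightarrow> real" assume a: "alt_form ?n \<alpha>"
    let ?S = "\<chi> i j. mat 1 $ i $ Transposition.transpose m n j :: real ^ 'e bidx ^ 'e bidx"
    have T: "?T ?S (Rep_bidx j) = Rep_bidx (Transposition.transpose m n j)" for j
    proof -
      have "?T ?S (Rep_bidx j) = (\<Sum>i\<in>UNIV. if i = Transposition.transpose m n j
          then Rep_bidx (Transposition.transpose m n j) else 0)"
        unfolding TR by (intro sum.cong) (auto simp: mat_def)
      then show ?thesis by simp
    qed
    obtain p q where pq: "p < ?n" "ix p = m" "q < ?n" "ix q = n" using ix_ex[of m] ix_ex[of n] by blast
    have "map (?T ?S) ?bs = ?bs[p := ?bs ! q, q := ?bs ! p]"
    proof (rule nth_equalityI)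
      fix k assume "k < length (map (?T ?S) ?bs)"
      then have k: "k < ?n" by (simp add: length_basis_list)
      have "map (?T ?S) ?bs ! k = Rep_bidx (Transposition.transpose m n (ix k))"
        using k T[of "ix k"] by (simp add: length_basis_list ix)
      also have "\<dots> = ?bs[p := ?bs ! q, q := ?bs ! p] ! k"
        using k pq mn ix_eq[OF k pq(1)] ix_eq[OF k pq(3)] ix[OF k] ix[OF pq(1)] ix[OF pq(3)]
        by (auto simp: transpose_def nth_list_update length_basis_list)
      finally show "map (?T ?S) ?bs ! k = ?bs[p := ?bs ! q, q := ?bs ! p] ! k" .
    qed simp
    moreover have "p \<noteq> q" using pq mn by auto
    ultimately have "\<alpha> (map (?T ?S) ?bs) = - \<alpha> ?bs"
      using alt_form_swap[OF a length_basis_list] pq by simp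
    moreover have "det ?S = - 1"
      using det_permute_columns[of "Transposition.transpose m n" "mat 1 :: real ^ 'e bidx ^ 'e bidx"] mn
      by (simp add: permutes_swap_id sign_swap_id)
    ultimately show "\<alpha> (map (?T ?S) ?bs) = det ?S * \<alpha> ?bs" by simp
  qed
  show "?P (\<chi> i j. if i = m \<and> j = n then c else of_bool (i = j))" if mn: "m \<noteq> n" for m n c
  proof (intro allI impI)
    fix \<alpha> :: "'e list \<Rightarrow> real" assume a: "alt_form ?n \<alpha>"
    let ?S = "\<chi> i j. if i = m \<and> j = n then c else of_bool (i = j) :: real ^ 'e bidx ^ 'e bidx"
    have T: "?T ?S (Rep_bidx j) = Rep_bidx j + (if j = n then c *\<^sub>R Rep_bidx m else 0)" for j
    proof -
      have "?T ?S (Rep_bidx j) = (\<Sum>i\<in>UNIV. (if i = j then Rep_bidx j else 0)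
          + (if i = m then (if j = n then c *\<^sub>R Rep_bidx m else 0) else 0))"
        unfolding TR using mn by (intro sum.cong) auto
      then show ?thesis by (simp add: sum.distrib)
    qed
    obtain p q where pq: "p < ?n" "ix p = m" "q < ?n" "ix q = n" using ix_ex[of m] ix_ex[of n] by blast
    have ne: "p \<noteq> q" using pq mn by auto
    \<comment> \<open>Only the basis vector with index n is changed; it gains c times the one with
      index m, and the corresponding extra term of \<alpha> has a repeated entry.\<close>
    have "map (?T ?S) ?bs = ?bs[q := ?bs ! q + c *\<^sub>R ?bs ! p]"
    proof (rule nth_equalityI)
      fix k assume "k < length (map (?T ?S) ?bs)"
      then have k: "k < ?n" by (simp add: length_basis_list)
      have "map (?T ?S) ?bs ! k = Rep_bidx (ix k) + (if ix k = n then c *\<^sub>R Rep_bidx m else 0)"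
        using k T[of "ix k"] by (simp add: length_basis_list ix)
      also have "\<dots> = ?bs[q := ?bs ! q + c *\<^sub>R ?bs ! p] ! k"
        using k pq ix_eq[OF k pq(3)] ix[OF k] ix[OF pq(1)]
        by (auto simp: nth_list_update length_basis_list)
      finally show "map (?T ?S) ?bs ! k = ?bs[q := ?bs ! q + c *\<^sub>R ?bs ! p] ! k" .
    qed simp
    moreover have l: "linear (\<lambda>v. \<alpha> (?bs[q := v]))"
      using pq by (intro alt_form_linear[OF a]) (auto simp: length_basis_list)
    moreover have "\<alpha> (?bs[q := ?bs ! p]) = 0"
      using ne pq by (intro alt_form_repeat'[OF a _ ne]) (auto simp: length_basis_list)
    ultimately have "\<alpha> (map (?T ?S) ?bs) = \<alpha> ?bs"
      by (simp add: linear_add[OF l] linear_scale[OF l])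
    moreover have "det ?S = 1"
    proof -
      have "?S = (\<chi> k. if k = m then row m (mat 1) + c *s row n (mat 1) else row k (mat 1))"
        using mn by (auto simp: vec_eq_iff row_def mat_def)
      then show ?thesis using det_row_operation[OF mn, of "mat 1" c] by simp
    qed
    ultimately show "\<alpha> (map (?T ?S) ?bs) = det ?S * \<alpha> ?bs" by simp
  qed
qed

lemma alt_form_linear_image:
  fixes A :: "'e::euclidean_space \<Rightarrow> 'e"
  assumes "alt_form DIM('e) \<alpha>" "linear A"
  shows "\<alpha> (map A basis_list) = lin_det A * \<alpha> basis_list"
proof -
  have "linear (\<lambda>x. to_vec (A (of_vec x)))"
    using linear_compose[OF linear_compose[OF linear_of_vec assms(2)] linear_to_vec] by (simp add: o_def)
  then have "of_vec (matrix (\<lambda>x. to_vec (A (of_vec x))) *v to_vec v) = A v" for v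
    by (simp add: matrix_works)
  then show ?thesis using alt_form_matrix[of "matrix (\<lambda>x. to_vec (A (of_vec x)))"] assms(1)
    by (simp add: lin_det_def)
qed

lemma linear_map_basis_list:
  fixes vs :: "'e::euclidean_space list"
  assumes "length vs = DIM('e)"
  obtains A where "linear A" "map A (basis_list :: 'e list) = vs"
proof -
  let ?bs = "basis_list :: 'e list"
  obtain A where A: "linear A" "\<And>b. b \<in> Basis \<Longrightarrow> A b = vs ! (SOME k. k < DIM('e) \<and> ?bs ! k = b)"
    using linear_independent_extend[OF independent_Basis] by meson
  have "map A ?bs = vs"
  proof (rule nth_equalityI)
    fix i assume "i < length (map A ?bs)"
    then have i: "i < DIM('e)" by (simp add: length_basis_list)
    have "k = i" if "k < DIM('e)" "?bs ! k = ?bs ! i" for k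
      using that i basis_list(1)[where 'e = 'e] by (simp add: nth_eq_iff_index_eq length_basis_list)
    then have "(SOME k. k < DIM('e) \<and> ?bs ! k = ?bs ! i) = i" using i by (intro some_equality) auto
    then show "map A ?bs ! i = vs ! i"
      using i A(2)[of "?bs ! i"] nth_mem[of i ?bs] by (simp add: length_basis_list basis_list)
  qed (simp add: assms length_basis_list)
  with A(1) that show ?thesis by blast
qed

text \<open>Passing from the basis list to \<open>vs\<close> multiplies both forms by the same
  \<open>lin_det\<close>. Cross-multiplication expresses that top forms span a line without a
  division.\<close>

lemma alt_form_top_proportional:
  fixes vs :: "'e::euclidean_space list"
  assumes "alt_form DIM('e) \<alpha>" "alt_form DIM('e) \<omega>"
  shows "\<alpha> vs * \<omega> basis_list = \<alpha> basis_list * \<omega> vs"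
proof (cases "length vs = DIM('e)")
  case True
  then obtain A where A: "linear A" "map A (basis_list :: 'e list) = vs" by (rule linear_map_basis_list)
  show ?thesis unfolding A(2)[symmetric]
    using alt_form_linear_image[OF assms(1) A(1)] alt_form_linear_image[OF assms(2) A(1)] by simp
next
  case False
  then show ?thesis using alt_form_length[OF assms(1)] alt_form_length[OF assms(2)] by simp
qed

section \<open>Jacobian determinants and change of variables\<close>

lemma continuous_on_lin_det:
  fixes A :: "'t::topological_space \<Rightarrow> 'e::euclidean_space \<Rightarrow> 'e"
  assumes "\<And>v. continuous_on S (\<lambda>x. A x v)"
  shows "continuous_on S (\<lambda>x. lin_det (A x))"
proof -
  have "lin_det (A x) = (\<Sum>p | p permutes UNIV. of_int (sign p)
      * (\<Prod>i\<in>UNIV. A x (Rep_bidx (p i)) \<bullet> Rep_bidx i))" for x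
    by (simp add: lin_det_def det_def matrix_def to_vec_def of_vec_axis)
  then show ?thesis by (simp add: assms continuous_intros)
qed

text \<open>The theorem on differentiable images is phrased with gauge integrals and finite measure.
  Its equivalence between finite measure of the image and integrability of the Jacobian also settles
  the remaining case, in which both sides are infinite.\<close>

lemma emeasure_differentiable_image_vec:
  fixes g :: "real ^ 'n::{finite,wellorder} \<Rightarrow> real ^ 'n::_"
  assumes S: "S \<in> sets borel" "g ` S \<in> sets borel"
    and der: "\<And>x. x \<in> S \<Longrightarrow> (g has_derivative g' x) (at x within S)" and inj: "inj_on g S"
    and m: "(\<lambda>x. indicator S x * \<bar>det (matrix (g' x))\<bar>) \<in> borel_measurable borel"
  shows "emeasure lborel (g ` S) = (\<integral>\<^sup>+x. ennreal (indicator S x * \<bar>det (matrix (g' x))\<bar>) \<partial>lborel)"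
proof -
  let ?D = "\<lambda>x. \<bar>det (matrix (g' x))\<bar>"
  have SL: "S \<in> sets lebesgue" using S by simp
  have iff: "g ` S \<in> lmeasurable \<longleftrightarrow> integrable lborel (\<lambda>x. indicator S x * ?D x)"
  proof -
    have "integrable lborel (\<lambda>x. indicator S x * ?D x) \<longleftrightarrow> ?D absolutely_integrable_on S"
      using integrable_completion[of "\<lambda>x. indicator S x * ?D x" lborel] m by (simp add: set_integrable_def)
    also have "\<dots> \<longleftrightarrow> ?D integrable_on S" by (simp add: absolutely_integrable_on_iff_nonneg)
    finally show ?thesis using measurable_differentiable_image_eq[OF SL der inj] by simp
  qed
  show ?thesis
  proof (cases "g ` S \<in> lmeasurable")
    case True
    have i: "integrable lborel (\<lambda>x. indicator S x * ?D x)" using iff True by simp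
    have "?D absolutely_integrable_on S"
      using integrable_completion[of "\<lambda>x. indicator S x * ?D x" lborel] m i by (simp add: set_integrable_def)
    then have "integral S ?D = (LINT x|lebesgue. indicator S x * ?D x)"
      using set_lebesgue_integral_eq_integral(2) by (fastforce simp: set_lebesgue_integral_def)
    also have "\<dots> = (LINT x|lborel. indicator S x * ?D x)"
      using m by (intro integral_completion) simp
    finally have int: "integral S ?D = (LINT x|lborel. indicator S x * ?D x)" .
    have "?D integrable_on S" using True measurable_differentiable_image_eq[OF SL der inj] by simp
    then have "measure lebesgue (g ` S) = integral S ?D"
      using measure_differentiable_image_eq[OF SL der inj] by simp
    then have "emeasure lborel (g ` S) = ennreal (integral S ?D)"
      using True S emeasure_eq_measure2[OF True] by simp
    also have "\<dots> = (\<integral>\<^sup>+x. ennreal (indicator S x * ?D x) \<partial>lborel)"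
      unfolding int using i by (intro nn_integral_eq_integral[symmetric]) auto
    finally show ?thesis .
  next
    case False
    then have "emeasure lborel (g ` S) = \<infinity>"
      using S by (auto simp: fmeasurable_def not_less top_unique)
    moreover have "(\<integral>\<^sup>+x. ennreal (indicator S x * ?D x) \<partial>lborel) = \<infinity>"
    proof (rule ccontr)
      assume "(\<integral>\<^sup>+x. ennreal (indicator S x * ?D x) \<partial>lborel) \<noteq> \<infinity>"
      then have "integrable lborel (\<lambda>x. indicator S x * ?D x)"
        using m by (intro integrableI_nonneg) (auto simp: top.not_eq_extremum)
      then show False using iff False by simp
    qed
    ultimately show ?thesis by simp
  qed
qed

lemma emeasure_differentiable_image:
  fixes g :: "'e::euclidean_space \<Rightarrow> 'e"
  assumes S: "S \<in> sets borel" "g ` S \<in> sets borel"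
    and der: "\<And>x. x \<in> S \<Longrightarrow> (g has_derivative g' x) (at x)" and inj: "inj_on g S"
    and m: "(\<lambda>x. indicator S x * \<bar>lin_det (g' x)\<bar>) \<in> borel_measurable borel"
  shows "emeasure lborel (g ` S) = (\<integral>\<^sup>+x. ennreal (indicator S x * \<bar>lin_det (g' x)\<bar>) \<partial>lborel)"
proof -
  let ?h = "\<lambda>x. to_vec (g (of_vec x))" and ?h' = "\<lambda>x v. to_vec (g' (of_vec x) (of_vec v))"
  let ?S = "of_vec -` S :: (real ^ 'e bidx) set"
  have bl: "bounded_linear (of_vec :: real ^ 'e bidx \<Rightarrow> 'e)" "bounded_linear (to_vec :: 'e \<Rightarrow> _)"
    using linear_of_vec linear_to_vec linear_conv_bounded_linear by blast+
  have mo: "of_vec \<in> measurable borel (borel :: 'e measure)"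
    by (intro borel_measurable_continuous_onI linear_continuous_on bl)
  have im: "?h ` ?S = of_vec -` (g ` S)"
  proof
    show "of_vec -` (g ` S) \<subseteq> ?h ` ?S"
    proof
      fix x :: "real ^ 'e bidx" assume "x \<in> of_vec -` (g ` S)"
      then obtain z where z: "z \<in> S" "of_vec x = g z" by auto
      then have "x = ?h (to_vec z)" by (metis of_vec_to_vec to_vec_of_vec)
      moreover have "to_vec z \<in> ?S" using z by simp
      ultimately show "x \<in> ?h ` ?S" by blast
    qed
  qed auto
  have Sv: "?S \<in> sets borel" "of_vec -` (g ` S) \<in> sets (borel :: (real ^ 'e bidx) measure)"
    using measurable_sets[OF mo S(1)] measurable_sets[OF mo S(2)] by auto
  have eq: "indicator ?S x * \<bar>det (matrix (?h' x))\<bar> = indicator S (of_vec x) * \<bar>lin_det (g' (of_vec x))\<bar>" for x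
    by (simp add: lin_det_def indicator_def)
  have "emeasure lborel (g ` S) = emeasure (distr lborel borel of_vec) (g ` S)" by (simp add: distr_of_vec)
  also have "\<dots> = emeasure lborel (?h ` ?S)" using mo S by (simp add: emeasure_distr im)
  also have "\<dots> = (\<integral>\<^sup>+x. ennreal (indicator ?S x * \<bar>det (matrix (?h' x))\<bar>) \<partial>lborel)"
  proof (rule emeasure_differentiable_image_vec)
    fix x :: "real ^ 'e bidx" assume "x \<in> ?S"
    then have "(g has_derivative g' (of_vec x)) (at (of_vec x))" using der by simp
    then have "((\<lambda>x. g (of_vec x)) has_derivative (\<lambda>v. g' (of_vec x) (of_vec v))) (at x)"
      by (rule has_derivative_compose[rotated]) (intro bounded_linear_imp_has_derivative bl)
    then have "(?h has_derivative ?h' x) (at x)"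
      by (rule bounded_linear.has_derivative[OF bl(2)])
    then show "(?h has_derivative ?h' x) (at x within ?S)" by (rule has_derivative_at_withinI)
  next
    show "inj_on ?h ?S"
    proof (rule inj_onI)
      fix x y assume *: "x \<in> ?S" "y \<in> ?S" "?h x = ?h y"
      then have "g (of_vec x) = g (of_vec y)" by (metis of_vec_to_vec)
      then have "of_vec x = of_vec y" using inj * by (auto dest: inj_onD)
      then show "x = y" by (metis to_vec_of_vec)
    qed
    show "(\<lambda>x. indicator ?S x * \<bar>det (matrix (?h' x))\<bar>) \<in> borel_measurable borel"
      unfolding eq using measurable_compose[OF mo m] .
  qed (use Sv im in simp_all)
  also have "\<dots> = (\<integral>\<^sup>+x. ennreal (indicator S x * \<bar>lin_det (g' x)\<bar>) \<partial>distr lborel borel of_vec)"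
    unfolding eq by (subst nn_integral_distr) (use mo m in auto)
  finally show ?thesis by (simp add: distr_of_vec)
qed

text \<open>By the formula for images of Borel sets, the measure on R whose density is the Jacobian
  is pushed forward by g to Lebesgue measure on the image of R; the claim is this equality of
  measures, integrated.\<close>

lemma nn_integral_change_of_variables:
  fixes g k :: "'e::euclidean_space \<Rightarrow> 'e"
  assumes X: "open X" and Y: "open Y" and g: "Ck_on 1 X g" and k: "continuous_on Y k"
    and gk: "\<And>x. x \<in> X \<Longrightarrow> g x \<in> Y \<and> k (g x) = x" "\<And>y. y \<in> Y \<Longrightarrow> k y \<in> X \<and> g (k y) = y"
    and R: "R \<in> sets borel" "R \<subseteq> X" and f: "f \<in> borel_measurable borel"
  shows "(\<integral>\<^sup>+y. f y * indicator (g ` R) y \<partial>lborel)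
       = (\<integral>\<^sup>+x. f (g x) * ennreal \<bar>lin_det (frechet_derivative g (at x))\<bar> * indicator R x \<partial>lborel)"
proof -
  let ?J = "\<lambda>x. \<bar>lin_det (frechet_derivative g (at x))\<bar>"
  \<comment> \<open>Both maps are extended by 0 to the whole space, where Borel measurability is
    expressed. Images under g are Borel because they are preimages under the extended
    inverse.\<close>
  define h where "h x = (if x \<in> X then g x else 0)" for x
  define l where "l y = (if y \<in> Y then k y else 0)" for y
  have cg: "continuous_on X g" by (rule Ck_on_imp_continuous_on[OF g])
  have hm: "h \<in> borel_measurable borel" unfolding h_def
    by (rule borel_measurable_continuous_on_if) (use X cg in auto)
  have lm: "l \<in> borel_measurable borel" unfolding l_def
    by (rule borel_measurable_continuous_on_if) (use Y k in auto)
  have imB: "g ` T \<in> sets borel" if T: "T \<in> sets borel" "T \<subseteq> X" for T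
  proof -
    have "g ` T = Y \<inter> l -` T"
    proof
      show "g ` T \<subseteq> Y \<inter> l -` T" using T gk(1) by (auto simp: l_def)
      show "Y \<inter> l -` T \<subseteq> g ` T"
      proof
        fix y assume y: "y \<in> Y \<inter> l -` T"
        then have "y = g (k y)" "k y \<in> T" using gk(2)[of y] by (auto simp: l_def)
        then show "y \<in> g ` T" by blast
      qed
    qed
    moreover have "l -` T \<in> sets borel" using measurable_sets[OF lm T(1)] by simp
    ultimately show ?thesis using Y by simp
  qed
  have Jm: "(\<lambda>x. indicator T x * ?J x) \<in> borel_measurable borel" if T: "T \<in> sets borel" "T \<subseteq> X" for T
  proof -
    have "continuous_on X ?J"
      by (intro continuous_intros continuous_on_lin_det Ck1_continuous_derivative[OF g])
    then have "(\<lambda>x. if x \<in> X then ?J x else 0) \<in> borel_measurable borel"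
      by (intro borel_measurable_continuous_on_if) (use X in auto)
    then have "(\<lambda>x. indicator T x * (if x \<in> X then ?J x else 0)) \<in> borel_measurable borel"
      using T(1) by (intro borel_measurable_times borel_measurable_indicator) auto
    moreover have "(\<lambda>x. indicator T x * (if x \<in> X then ?J x else 0)) = (\<lambda>x. indicator T x * ?J x)"
      using T(2) by (auto simp: fun_eq_iff indicator_def)
    ultimately show ?thesis by simp
  qed
  have em: "emeasure lborel (g ` T) = (\<integral>\<^sup>+x. ennreal (indicator T x * ?J x) \<partial>lborel)"
    if T: "T \<in> sets borel" "T \<subseteq> X" for T
  proof (rule emeasure_differentiable_image[OF T(1) imB[OF T]])
    show "inj_on g T"
    proof (rule inj_onI)
      fix x y assume "x \<in> T" "y \<in> T" "g x = g y"
      then show "x = y" using T gk(1)[of x] gk(1)[of y] by auto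
    qed
    show "(g has_derivative frechet_derivative g (at x)) (at x)" if "x \<in> T" for x
      using that T by (intro Ck1_has_derivative[OF g]) blast
  qed (rule Jm[OF T])
  let ?N = "density lborel (\<lambda>x. ennreal (indicator R x * ?J x))"
  have N: "distr ?N borel h = density lborel (\<lambda>y. indicator (g ` R) y)"
  proof (rule measure_eqI)
    fix B assume "B \<in> sets (distr ?N borel h)"
    then have B: "B \<in> sets borel" by simp
    let ?T = "R \<inter> h -` B"
    have T: "?T \<in> sets borel" "?T \<subseteq> X" using measurable_sets[OF hm B] R by auto
    have gT: "g ` ?T = g ` R \<inter> B" using R by (auto simp: h_def)
    have "emeasure (distr ?N borel h) B = emeasure ?N (h -` B)"
      using B hm by (simp add: emeasure_distr)
    also have "\<dots> = (\<integral>\<^sup>+x. ennreal (indicator R x * ?J x) * indicator (h -` B) x \<partial>lborel)"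
      using measurable_sets[OF hm B] Jm[OF R] by (intro emeasure_density) auto
    also have "\<dots> = (\<integral>\<^sup>+x. ennreal (indicator ?T x * ?J x) \<partial>lborel)"
      by (intro nn_integral_cong) (auto simp: indicator_def)
    also have "\<dots> = emeasure lborel (g ` R \<inter> B)" using em[OF T] gT by simp
    also have "\<dots> = (\<integral>\<^sup>+y. indicator (g ` R \<inter> B) y \<partial>lborel)"
      using imB[OF R] B by (intro nn_integral_indicator[symmetric]) auto
    also have "\<dots> = (\<integral>\<^sup>+y. indicator (g ` R) y * indicator B y \<partial>lborel)"
      by (simp only: indicator_inter_arith)
    also have "\<dots> = emeasure (density lborel (\<lambda>y. indicator (g ` R) y)) B"
      using imB[OF R] B by (intro emeasure_density[symmetric]) auto
    finally show "emeasure (distr ?N borel h) B = emeasure (density lborel (\<lambda>y. indicator (g ` R) y)) B" .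
  qed simp
  have "(\<integral>\<^sup>+y. f y * indicator (g ` R) y \<partial>lborel) = (\<integral>\<^sup>+y. f y \<partial>density lborel (\<lambda>y. indicator (g ` R) y))"
    using imB[OF R] f by (simp add: nn_integral_density mult.commute)
  also have "\<dots> = (\<integral>\<^sup>+x. f (h x) \<partial>?N)"
    unfolding N[symmetric] by (rule nn_integral_distr) (use hm f in auto)
  also have "\<dots> = (\<integral>\<^sup>+x. ennreal (indicator R x * ?J x) * f (h x) \<partial>lborel)"
    using Jm[OF R] measurable_compose[OF hm f] by (intro nn_integral_density) auto
  also have "\<dots> = (\<integral>\<^sup>+x. f (g x) * ennreal (?J x) * indicator R x \<partial>lborel)"
    using R(2) by (intro nn_integral_cong) (auto simp: indicator_def h_def mult.commute)
  finally show ?thesis .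
qed

section \<open>The weak contact equation in Euclidean space\<close>

text \<open>Continuity, a uniform bound and pointwise convergence are what dominated convergence on
  a compact set asks for. Unlike a bare limit of integrals, this notion is stable under the sums and
  bilinear products from which the integrands below are assembled.\<close>

definition bdd_conv ::
  "'a::topological_space set \<Rightarrow> (nat \<Rightarrow> 'a \<Rightarrow> 'b::real_normed_vector) \<Rightarrow> ('a \<Rightarrow> 'b) \<Rightarrow> bool" where
  "bdd_conv K f l \<longleftrightarrow> (\<forall>n. continuous_on K (f n)) \<and> (\<exists>c. \<forall>n. \<forall>y\<in>K. norm (f n y) \<le> c) \<and>
     (\<forall>y\<in>K. (\<lambda>n. f n y) \<longlonglongrightarrow> l y)"

lemma bdd_convI:
  assumes "\<And>n. continuous_on K (f n)" "\<And>n y. y \<in> K \<Longrightarrow> norm (f n y) \<le> c"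
    and "\<And>y. y \<in> K \<Longrightarrow> (\<lambda>n. f n y) \<longlonglongrightarrow> l y"
  shows "bdd_conv K f l"
  using assms unfolding bdd_conv_def by blast

lemma bdd_convE:
  assumes "bdd_conv K f l"
  obtains c where "c > 0" "\<And>n. continuous_on K (f n)" "\<And>n y. y \<in> K \<Longrightarrow> norm (f n y) \<le> c"
    "\<And>y. y \<in> K \<Longrightarrow> (\<lambda>n. f n y) \<longlonglongrightarrow> l y"
proof -
  obtain c where c: "\<And>n y. y \<in> K \<Longrightarrow> norm (f n y) \<le> c" using assms unfolding bdd_conv_def by blast
  show ?thesis
  proof (rule that[of "\<bar>c\<bar> + 1"])
    show "norm (f n y) \<le> \<bar>c\<bar> + 1" if "y \<in> K" for n y using c[OF that, of n] by linarith
  qed (use assms in \<open>auto simp: bdd_conv_def\<close>)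
qed

lemma bdd_conv_const:
  assumes "compact K" "continuous_on K g"
  shows "bdd_conv K (\<lambda>n. g) g"
proof -
  have "bounded (g ` K)" using assms compact_continuous_image compact_imp_bounded by blast
  then obtain c where "\<And>y. y \<in> K \<Longrightarrow> norm (g y) \<le> c" by (auto simp: bounded_iff)
  then show ?thesis using assms by (intro bdd_convI[where c = c]) auto
qed

lemma bdd_conv_add:
  assumes "bdd_conv K f l" "bdd_conv K g m"
  shows "bdd_conv K (\<lambda>n y. f n y + g n y) (\<lambda>y. l y + m y)"
proof -
  obtain c where c: "c > 0" "\<And>n. continuous_on K (f n)" "\<And>n y. y \<in> K \<Longrightarrow> norm (f n y) \<le> c"
    "\<And>y. y \<in> K \<Longrightarrow> (\<lambda>n. f n y) \<longlonglongrightarrow> l y" by (rule bdd_convE[OF assms(1)]) blast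
  obtain d where d: "d > 0" "\<And>n. continuous_on K (g n)" "\<And>n y. y \<in> K \<Longrightarrow> norm (g n y) \<le> d"
    "\<And>y. y \<in> K \<Longrightarrow> (\<lambda>n. g n y) \<longlonglongrightarrow> m y" by (rule bdd_convE[OF assms(2)]) blast
  show ?thesis
  proof (rule bdd_convI)
    show "norm (f n y + g n y) \<le> c + d" if "y \<in> K" for n y
      using norm_triangle_mono[OF c(3)[OF that] d(3)[OF that]] .
  qed (use c d in \<open>auto intro!: continuous_intros tendsto_intros\<close>)
qed

lemma bdd_conv_bilinear:
  assumes b: "bounded_bilinear p" and "bdd_conv K f l" "bdd_conv K g m"
  shows "bdd_conv K (\<lambda>n y. p (f n y) (g n y)) (\<lambda>y. p (l y) (m y))"
proof -
  obtain c where c: "c > 0" "\<And>n. continuous_on K (f n)" "\<And>n y. y \<in> K \<Longrightarrow> norm (f n y) \<le> c"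
    "\<And>y. y \<in> K \<Longrightarrow> (\<lambda>n. f n y) \<longlonglongrightarrow> l y" by (rule bdd_convE[OF assms(2)]) blast
  obtain d where d: "d > 0" "\<And>n. continuous_on K (g n)" "\<And>n y. y \<in> K \<Longrightarrow> norm (g n y) \<le> d"
    "\<And>y. y \<in> K \<Longrightarrow> (\<lambda>n. g n y) \<longlonglongrightarrow> m y" by (rule bdd_convE[OF assms(3)]) blast
  obtain C where C: "C \<ge> 0" "\<And>a b. norm (p a b) \<le> norm a * norm b * C"
    using bounded_bilinear.nonneg_bounded[OF b] by blast
  show ?thesis
  proof (rule bdd_convI)
    fix n y assume y: "y \<in> K"
    have "norm (p (f n y) (g n y)) \<le> norm (f n y) * norm (g n y) * C" by (rule C)
    also have "\<dots> \<le> c * d * C" using c(1,3) d(1,3) C(1) y by (intro mult_mono) auto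
    finally show "norm (p (f n y) (g n y)) \<le> c * d * C" .
  qed (use c d b in \<open>auto intro: bounded_bilinear.continuous_on bounded_bilinear.tendsto\<close>)
qed

lemmas bdd_conv_scaleR = bdd_conv_bilinear[OF bounded_bilinear_scaleR]
lemmas bdd_conv_mult = bdd_conv_bilinear[OF bounded_bilinear_mult]
lemmas bdd_conv_inner = bdd_conv_bilinear[OF bounded_bilinear_inner]

lemma bdd_conv_uminus:
  assumes "bdd_conv K f l" shows "bdd_conv K (\<lambda>n y. - f n y) (\<lambda>y. - l y)"
  using assms by (auto simp: bdd_conv_def intro!: continuous_intros tendsto_intros)

lemma bdd_conv_diff:
  assumes "bdd_conv K f l" "bdd_conv K g m"
  shows "bdd_conv K (\<lambda>n y. f n y - g n y) (\<lambda>y. l y - m y)"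
  using bdd_conv_add[OF assms(1) bdd_conv_uminus[OF assms(2)]] by simp

lemma bdd_conv_sum:
  assumes "\<And>i. i \<in> I \<Longrightarrow> bdd_conv K (f i) (l i)"
  shows "bdd_conv K (\<lambda>n y. \<Sum>i\<in>I. f i n y) (\<lambda>y. \<Sum>i\<in>I. l i y)"
proof -
  have z: "bdd_conv K (\<lambda>n y. 0) (\<lambda>y. 0)" by (rule bdd_convI[where c = 0]) auto
  show ?thesis using assms
  proof (induction I rule: infinite_finite_induct)
    case (insert i I)
    then have "bdd_conv K (\<lambda>n y. f i n y + (\<Sum>i\<in>I. f i n y)) (\<lambda>y. l i y + (\<Sum>i\<in>I. l i y))"
      by (intro bdd_conv_add) blast+
    then show ?case using insert.hyps by simp
  qed (use z in simp_all)
qed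

lemma bdd_conv_cong:
  assumes "bdd_conv K f l" "\<And>n y. y \<in> K \<Longrightarrow> f n y = g n y" "\<And>y. y \<in> K \<Longrightarrow> l y = m y"
  shows "bdd_conv K g m"
proof -
  obtain c where c: "c > 0" "\<And>n. continuous_on K (f n)" "\<And>n y. y \<in> K \<Longrightarrow> norm (f n y) \<le> c"
    "\<And>y. y \<in> K \<Longrightarrow> (\<lambda>n. f n y) \<longlonglongrightarrow> l y" by (rule bdd_convE[OF assms(1)]) blast
  show ?thesis
  proof (rule bdd_convI)
    show "continuous_on K (g n)" for n
      using continuous_on_eq[OF c(2)[of n]] assms(2) by blast
    show "norm (g n y) \<le> c" if "y \<in> K" for n y using c(3)[OF that, of n] assms(2)[OF that] by simp
    show "(\<lambda>n. g n y) \<longlonglongrightarrow> m y" if "y \<in> K" for y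
      using c(4)[OF that] assms(2,3)[OF that] by simp
  qed
qed

text \<open>The hypotheses control \<open>A n y\<close> on fixed vectors only; the varying argument
  \<open>q n y\<close> is expanded in the basis.\<close>

lemma bdd_conv_linear:
  fixes A :: "nat \<Rightarrow> 't::topological_space \<Rightarrow> 'a::euclidean_space \<Rightarrow> 'b::real_normed_vector"
  assumes A: "\<And>v. bdd_conv K (\<lambda>n y. A n y v) (\<lambda>y. A' y v)" and q: "bdd_conv K q q'"
    and lin: "\<And>n y. y \<in> K \<Longrightarrow> linear (A n y)" "\<And>y. y \<in> K \<Longrightarrow> linear (A' y)"
  shows "bdd_conv K (\<lambda>n y. A n y (q n y)) (\<lambda>y. A' y (q' y))"
proof -
  have e: "T w = (\<Sum>b\<in>Basis. (w \<bullet> b) *\<^sub>R T b)" if "linear T" for T :: "'a \<Rightarrow> 'b" and w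
  proof -
    have "T (\<Sum>b\<in>Basis. (w \<bullet> b) *\<^sub>R b) = (\<Sum>b\<in>Basis. (w \<bullet> b) *\<^sub>R T b)"
      by (simp add: linear_sum[OF that] linear_scale[OF that])
    then show ?thesis by (simp add: euclidean_representation)
  qed
  have "bdd_conv K (\<lambda>n y. q n y \<bullet> b) (\<lambda>y. q' y \<bullet> b)" for b
    using q by (auto simp: bdd_conv_def intro!: continuous_intros tendsto_intros)
      (meson Cauchy_Schwarz_ineq2 mult_right_mono norm_ge_zero order_trans)
  then have "bdd_conv K (\<lambda>n y. \<Sum>b\<in>Basis. (q n y \<bullet> b) *\<^sub>R A n y b)
      (\<lambda>y. \<Sum>b\<in>Basis. (q' y \<bullet> b) *\<^sub>R A' y b)"
    by (intro bdd_conv_sum bdd_conv_scaleR A)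
  then show ?thesis
    by (rule bdd_conv_cong) (use e[OF lin(1)] e[OF lin(2)] in auto)
qed

lemma bdd_conv_integral:
  fixes f :: "nat \<Rightarrow> 'a::euclidean_space \<Rightarrow> real"
  assumes K: "compact K" and "bdd_conv K f l"
  shows "integrable lborel (\<lambda>y. indicator K y * l y)" "\<And>n. integrable lborel (\<lambda>y. indicator K y * f n y)"
    "(\<lambda>n. LINT y|lborel. indicator K y * f n y) \<longlonglongrightarrow> (LINT y|lborel. indicator K y * l y)"
proof -
  obtain c where c: "c > 0" "\<And>n. continuous_on K (f n)" "\<And>n y. y \<in> K \<Longrightarrow> norm (f n y) \<le> c"
    "\<And>y. y \<in> K \<Longrightarrow> (\<lambda>n. f n y) \<longlonglongrightarrow> l y" by (rule bdd_convE[OF assms(2)]) blast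
  show i: "integrable lborel (\<lambda>y. indicator K y * f n y)" for n
    using borel_integrable_compact[OF K c(2)[of n]] by simp
  have lim: "(\<lambda>n. indicator K y * f n y) \<longlonglongrightarrow> indicator K y * l y" for y
    using c(4)[of y] by (cases "y \<in> K") auto
  have fm: "(\<lambda>y. indicator K y * f n y) \<in> borel_measurable lborel" for n
    using i borel_measurable_integrable by blast
  have lm: "(\<lambda>y. indicator K y * l y) \<in> borel_measurable lborel"
    by (rule borel_measurable_LIMSEQ_real[OF lim fm])
  have w: "integrable lborel (\<lambda>y. indicator K y * c)"
    using borel_integrable_compact[OF K, of "\<lambda>_. c"] by simp
  have b: "AE y in lborel. norm (indicator K y * f n y) \<le> indicator K y * c" for n
    using c(3)[of _ n] by (intro AE_I2) (auto simp: indicator_def)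
  show "integrable lborel (\<lambda>y. indicator K y * l y)"
    by (rule integrable_dominated_convergence[where s = "\<lambda>n y. indicator K y * f n y", OF lm fm w])
       (use lim b in auto)
  show "(\<lambda>n. LINT y|lborel. indicator K y * f n y) \<longlonglongrightarrow> (LINT y|lborel. indicator K y * l y)"
    by (rule integral_dominated_convergence[where s = "\<lambda>n y. indicator K y * f n y", OF lm fm w])
       (use lim b in auto)
qed

section \<open>Difference quotients along segments\<close>

lemma Ck1_bound_on_compact:
  fixes f :: "'a::euclidean_space \<Rightarrow> 'b::real_normed_vector"
  assumes f: "Ck_on 1 U f" and N: "compact N" "N \<subseteq> U"
  obtains c where "c \<ge> 0" "\<And>x v. x \<in> N \<Longrightarrow> norm (frechet_derivative f (at x) v) \<le> c * norm v"
proof -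
  have "compact ((\<lambda>x. frechet_derivative f (at x) b) ` N)" for b
    by (intro compact_continuous_image N continuous_on_subset[OF Ck1_continuous_derivative[OF f]])
  then have "bounded ((\<lambda>x. frechet_derivative f (at x) b) ` N)" for b by (rule compact_imp_bounded)
  then have "\<forall>b. \<exists>C. \<forall>x\<in>N. norm (frechet_derivative f (at x) b) \<le> C" by (simp add: bounded_iff)
  then obtain C where C: "\<And>b x. x \<in> N \<Longrightarrow> norm (frechet_derivative f (at x) b) \<le> C b" by metis
  show ?thesis
  proof (rule that[of "\<Sum>b\<in>Basis. \<bar>C b\<bar>"])
    fix x v assume x: "x \<in> N"
    have l: "linear (frechet_derivative f (at x))"
      using has_derivative_linear[OF Ck1_has_derivative[OF f]] x N by blast
    have "frechet_derivative f (at x) (\<Sum>b\<in>Basis. (v \<bullet> b) *\<^sub>R b)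
        = (\<Sum>b\<in>Basis. (v \<bullet> b) *\<^sub>R frechet_derivative f (at x) b)"
      by (simp add: linear_sum[OF l] linear_scale[OF l])
    then have "norm (frechet_derivative f (at x) v) \<le> (\<Sum>b\<in>Basis. norm ((v \<bullet> b) *\<^sub>R frechet_derivative f (at x) b))"
      using norm_sum[of "\<lambda>b. (v \<bullet> b) *\<^sub>R frechet_derivative f (at x) b" Basis]
      by (simp add: euclidean_representation)
    also have "\<dots> \<le> (\<Sum>b\<in>Basis. norm v * \<bar>C b\<bar>)"
      using C[OF x] unfolding norm_scaleR
      by (intro sum_mono mult_mono) (auto intro: Basis_le_norm order_trans[OF _ abs_ge_self])
    finally show "norm (frechet_derivative f (at x) v) \<le> (\<Sum>b\<in>Basis. \<bar>C b\<bar>) * norm v"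
      by (simp add: sum_distrib_left mult.commute)
  qed (simp add: sum_nonneg)
qed

text \<open>The uniform bound is the mean value inequality on the segments, all of which lie in a
  compact set N where the derivative is bounded; the pointwise limit is the directional
  derivative.\<close>

lemma bdd_conv_difference_quotient:
  fixes f :: "'a::euclidean_space \<Rightarrow> 'b::real_normed_vector"
    and p v :: "'t::topological_space \<Rightarrow> 'a" and t :: "nat \<Rightarrow> real"
  assumes f: "Ck_on 1 U f" and N: "compact N" "N \<subseteq> U" and K: "compact K"
    and p: "continuous_on K p" and v: "continuous_on K v"
    and seg: "\<And>y s n. y \<in> K \<Longrightarrow> 0 \<le> s \<Longrightarrow> s \<le> t n \<Longrightarrow> p y + s *\<^sub>R v y \<in> N"
    and t: "t \<longlonglongrightarrow> 0" "\<And>n. t n > 0"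
  shows "bdd_conv K (\<lambda>n y. inverse (t n) *\<^sub>R (f (p y + t n *\<^sub>R v y) - f (p y)))
     (\<lambda>y. frechet_derivative f (at (p y)) (v y))"
proof -
  obtain c where c: "c \<ge> 0" "\<And>x v. x \<in> N \<Longrightarrow> norm (frechet_derivative f (at x) v) \<le> c * norm v"
    by (rule Ck1_bound_on_compact[OF f N]) blast
  have "bounded (v ` K)" using v K compact_continuous_image compact_imp_bounded by blast
  then obtain d where d: "\<And>y. y \<in> K \<Longrightarrow> norm (v y) \<le> d" by (auto simp: bounded_iff)
  have pN: "p y + t n *\<^sub>R v y \<in> N" "p y \<in> N" if "y \<in> K" for y n
    using seg[OF that, of "t n" n] seg[OF that, of 0 n] t(2)[of n] by auto
  have cf: "continuous_on N f" using continuous_on_subset[OF Ck_on_imp_continuous_on[OF f] N(2)] .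
  show ?thesis
  proof (rule bdd_convI)
    show "continuous_on K (\<lambda>y. inverse (t n) *\<^sub>R (f (p y + t n *\<^sub>R v y) - f (p y)))" for n
      using pN by (intro continuous_intros continuous_on_compose2[OF cf] p v) auto
    fix n y assume y: "y \<in> K"
    let ?g = "\<lambda>s. f (p y + s *\<^sub>R v y)"
    have "norm (?g (t n) - ?g 0) \<le> c * d * norm (t n - 0)"
    proof (rule differentiable_bound[of "{0..t n}" ?g "\<lambda>s r. frechet_derivative f (at (p y + s *\<^sub>R v y)) (r *\<^sub>R v y)"])
      fix s assume s: "s \<in> {0..t n}"
      then have xN: "p y + s *\<^sub>R v y \<in> N" using seg[OF y] by auto
      then have "(?g has_derivative (\<lambda>r. frechet_derivative f (at (p y + s *\<^sub>R v y)) (r *\<^sub>R v y))) (at s)"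
        by (intro has_derivative_compose[where g = f and f = "\<lambda>s. p y + s *\<^sub>R v y"] Ck1_has_derivative[OF f])
           (use N in \<open>auto intro!: derivative_eq_intros\<close>)
      then show "(?g has_derivative (\<lambda>r. frechet_derivative f (at (p y + s *\<^sub>R v y)) (r *\<^sub>R v y)))
          (at s within {0..t n})" by (rule has_derivative_at_withinI)
      show "onorm (\<lambda>r. frechet_derivative f (at (p y + s *\<^sub>R v y)) (r *\<^sub>R v y)) \<le> c * d"
      proof (rule onorm_le)
        fix r :: real
        have "norm (frechet_derivative f (at (p y + s *\<^sub>R v y)) (r *\<^sub>R v y)) \<le> c * norm (r *\<^sub>R v y)"
          by (rule c(2)[OF xN])
        also have "\<dots> \<le> c * d * norm r"
          using mult_left_mono[OF mult_right_mono[OF d[OF y] abs_ge_zero[of r]] c(1)]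
          by (simp add: ac_simps)
        finally show "norm (frechet_derivative f (at (p y + s *\<^sub>R v y)) (r *\<^sub>R v y)) \<le> c * d * norm r" .
      qed
    qed (use t(2)[of n] in auto)
    then show "norm (inverse (t n) *\<^sub>R (f (p y + t n *\<^sub>R v y) - f (p y))) \<le> c * d"
      using t(2)[of n] unfolding norm_scaleR by (simp add: field_simps)
  next
    fix y assume y: "y \<in> K"
    let ?D = "frechet_derivative f (at (p y))"
    have D: "(f has_derivative ?D) (at (p y))" using pN(2)[OF y] N by (intro Ck1_has_derivative[OF f]) auto
    have "((\<lambda>s. f (p y + s *\<^sub>R v y)) has_derivative (\<lambda>r. ?D (r *\<^sub>R v y))) (at 0)"
      by (rule has_derivative_compose[where g = f and g' = ?D]) (auto intro!: derivative_eq_intros D)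
    moreover have "?D (r *\<^sub>R v y) = r *\<^sub>R ?D (v y)" for r
      using linear_scale[OF has_derivative_linear[OF D]] .
    ultimately have "((\<lambda>s. norm (f (p y + s *\<^sub>R v y) - f (p y) - s *\<^sub>R ?D (v y)) / norm s) \<longlongrightarrow> 0) (at 0)"
      by (simp add: has_derivative_at)
    moreover have "filterlim t (at 0) sequentially"
      using t by (auto simp: filterlim_at less_imp_neq[symmetric] intro!: eventuallyI)
    ultimately have lim: "(\<lambda>n. norm (f (p y + t n *\<^sub>R v y) - f (p y) - t n *\<^sub>R ?D (v y)) / norm (t n)) \<longlonglongrightarrow> 0"
      by (rule filterlim_compose)
    have eq: "norm (f (p y + t n *\<^sub>R v y) - f (p y) - t n *\<^sub>R ?D (v y)) / norm (t n)
        = norm (inverse (t n) *\<^sub>R (f (p y + t n *\<^sub>R v y) - f (p y)) - ?D (v y))" for n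
    proof -
      have "inverse (t n) *\<^sub>R (f (p y + t n *\<^sub>R v y) - f (p y)) - ?D (v y)
          = inverse (t n) *\<^sub>R (f (p y + t n *\<^sub>R v y) - f (p y) - t n *\<^sub>R ?D (v y))"
        using t(2)[of n] by (simp add: scaleR_diff_right)
      then show ?thesis by (simp add: divide_inverse mult.commute)
    qed
    have "(\<lambda>n. inverse (t n) *\<^sub>R (f (p y + t n *\<^sub>R v y) - f (p y)) - ?D (v y)) \<longlonglongrightarrow> 0"
      by (rule tendsto_norm_zero_cancel) (rule lim[unfolded eq])
    then show "(\<lambda>n. inverse (t n) *\<^sub>R (f (p y + t n *\<^sub>R v y) - f (p y))) \<longlonglongrightarrow> ?D (v y)"
      by (rule LIM_zero_cancel)
  qed
qed

lemma bdd_conv_compose: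
  fixes g :: "'a::euclidean_space \<Rightarrow> 'b::real_normed_vector"
    and p v :: "'t::topological_space \<Rightarrow> 'a" and t :: "nat \<Rightarrow> real"
  assumes g: "continuous_on U g" and N: "compact N" "N \<subseteq> U"
    and p: "continuous_on K p" and v: "continuous_on K v"
    and seg: "\<And>y s n. y \<in> K \<Longrightarrow> 0 \<le> s \<Longrightarrow> s \<le> t n \<Longrightarrow> p y + s *\<^sub>R v y \<in> N"
    and t: "t \<longlonglongrightarrow> 0" "\<And>n. t n > 0"
  shows "bdd_conv K (\<lambda>n y. g (p y + t n *\<^sub>R v y)) (\<lambda>y. g (p y))"
proof -
  have cg: "continuous_on N g" using continuous_on_subset[OF g N(2)] .
  then have "bounded (g ` N)" using N compact_continuous_image compact_imp_bounded by blast
  then obtain c where c: "\<And>x. x \<in> N \<Longrightarrow> norm (g x) \<le> c" by (auto simp: bounded_iff)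
  have pN: "p y + t n *\<^sub>R v y \<in> N" "p y \<in> N" if "y \<in> K" for y n
    using seg[OF that, of "t n" n] seg[OF that, of 0 n] t(2)[of n] by auto
  show ?thesis
  proof (rule bdd_convI)
    show "continuous_on K (\<lambda>y. g (p y + t n *\<^sub>R v y))" for n
      using pN by (intro continuous_intros continuous_on_compose2[OF cg] p v) auto
    fix y assume y: "y \<in> K"
    show "norm (g (p y + t n *\<^sub>R v y)) \<le> c" for n using c pN(1)[OF y] by blast
    have "(\<lambda>n. p y + t n *\<^sub>R v y) \<longlonglongrightarrow> p y + 0 *\<^sub>R v y" by (intro tendsto_intros t)
    then show "(\<lambda>n. g (p y + t n *\<^sub>R v y)) \<longlonglongrightarrow> g (p y)"
      by (intro continuous_on_tendsto_compose[OF cg]) (use pN[OF y] in auto)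
  qed
qed

text \<open>V and the complement of K are open and cover the space, and on their intersection both
  prescriptions give 0.\<close>

lemma Ck1_extend_by_zero:
  fixes P :: "'a::euclidean_space \<Rightarrow> 'b::real_normed_vector"
  assumes V: "open V" and K: "compact K" "K \<subseteq> V" and P: "Ck_on 1 V P" "\<And>y. y \<in> V - K \<Longrightarrow> P y = 0"
  shows "Ck_on 1 UNIV (\<lambda>y. if y \<in> V then P y else 0)" (is "Ck_on 1 _ ?Q")
proof (rule Ck1I)
  let ?D = "\<lambda>y v. if y \<in> V then frechet_derivative P (at y) v else 0"
  have oK: "open (- K)" using K by (simp add: open_Compl compact_imp_closed)
  have z: "?Q y = 0" if "y \<in> - K" for y using that P(2) by auto
  have dz: "(?Q has_derivative (\<lambda>_. 0)) (at y)" if "y \<in> - K" for y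
    by (rule has_derivative_transform_within_open[of "\<lambda>_. 0" _ y UNIV "- K"]) (use that oK z in auto)
  have dV: "(?Q has_derivative frechet_derivative P (at y)) (at y)" if "y \<in> V" for y
    by (rule has_derivative_transform_within_open[OF Ck1_has_derivative[OF P(1) that] V that]) simp
  show "(?Q has_derivative ?D y) (at y)" for y
    using dV[of y] dz[of y] K by (cases "y \<in> V") auto
  have Dz: "?D y v = 0" if "y \<in> - K" for y v
    using has_derivative_unique[OF dV dz] that by (auto simp: fun_eq_iff)
  have "continuous_on (V \<union> - K) (\<lambda>y. ?D y v)" for v
  proof (rule continuous_on_open_Un[OF V oK])
    show "continuous_on V (\<lambda>y. ?D y v)"
      by (rule continuous_on_eq[OF Ck1_continuous_derivative[OF P(1), of v]]) simp
    show "continuous_on (- K) (\<lambda>y. ?D y v)"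
      by (rule continuous_on_eq[OF continuous_on_const[of _ 0]]) (use Dz in simp)
  qed
  moreover have "V \<union> - K = UNIV" using K by auto
  ultimately show "continuous_on UNIV (\<lambda>y. ?D y v)" for v by simp
qed

definition divergence :: "('a::euclidean_space \<Rightarrow> 'a) \<Rightarrow> 'a \<Rightarrow> real" where
  "divergence B y = (\<Sum>b\<in>Basis. frechet_derivative B (at y) b \<bullet> b)"

text \<open>The integrand is the sum over basis vectors b of the derivative in direction b of g
  times the b-component of B. Extended by zero, each of these products is a C^1 function with
  compact support, so its derivatives have integral 0.\<close>

lemma integration_by_parts:
  fixes g :: "'a::euclidean_space \<Rightarrow> real"
  assumes V: "open V" and K: "compact K" "K \<subseteq> V"
    and g: "Ck_on 1 V g" and B: "Ck_on 1 V B" "\<And>y. y \<in> V - K \<Longrightarrow> B y = 0"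
  shows "integrable lborel (\<lambda>y. indicator K y * (frechet_derivative g (at y) (B y) + g y * divergence B y))"
    and "(LINT y|lborel. indicator K y * (frechet_derivative g (at y) (B y) + g y * divergence B y)) = 0"
proof -
  let ?P = "\<lambda>b y. g y * (B y \<bullet> b)"
  let ?Q = "\<lambda>b y. if y \<in> V then ?P b y else 0"
  let ?D = "\<lambda>b y v. frechet_derivative (?Q b) (at y) v"
  have Bb: "Ck_on 1 V (\<lambda>y. B y \<bullet> b)" for b
    by (rule Ck1I, rule has_derivative_inner_left[OF Ck1_has_derivative[OF B(1)]])
       (auto intro!: continuous_intros Ck1_continuous_derivative[OF B(1)] simp del: Ck_on.simps)
  have Q: "Ck_on 1 UNIV (?Q b)" for b
    by (rule Ck1_extend_by_zero[OF V K Ck1_mult[OF g Bb]]) (use B in simp)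
  have QK: "?Q b y = 0" if "y \<notin> K" for b y using that B by auto
  have ib: "integrable lborel (\<lambda>y. ?D b y v)" "(LINT y|lborel. ?D b y v) = 0" for b v
    using integral_derivative_compact_support[of "?Q b" "?D b" K v, OF Ck1_has_derivative[OF Q]
        Ck1_continuous_derivative[OF Q] K(1) QK] by auto
  have "(\<Sum>b\<in>Basis. ?D b y b) = indicator K y * (frechet_derivative g (at y) (B y) + g y * divergence B y)" for y
  proof (cases "y \<in> K")
    case True
    then have y: "y \<in> V" using K by blast
    let ?g' = "frechet_derivative g (at y)" and ?B' = "frechet_derivative B (at y)"
    have l: "linear ?g'" using has_derivative_linear[OF Ck1_has_derivative[OF g y]] .
    have "?D b y v = g y * (?B' v \<bullet> b) + ?g' v * (B y \<bullet> b)" for b v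
    proof -
      have "(?P b has_derivative (\<lambda>v. g y * (?B' v \<bullet> b) + ?g' v * (B y \<bullet> b))) (at y)"
        by (intro has_derivative_mult has_derivative_inner_left Ck1_has_derivative[OF g y]
            Ck1_has_derivative[OF B(1) y])
      then have "(?Q b has_derivative (\<lambda>v. g y * (?B' v \<bullet> b) + ?g' v * (B y \<bullet> b))) (at y)"
        by (rule has_derivative_transform_within_open[OF _ V y]) simp
      from fun_cong[OF frechet_derivative_at[OF this]] show ?thesis by metis
    qed
    then have "(\<Sum>b\<in>Basis. ?D b y b) = g y * divergence B y + (\<Sum>b\<in>Basis. (B y \<bullet> b) * ?g' b)"
      by (simp add: sum.distrib divergence_def sum_distrib_left mult.commute)
    also have "(\<Sum>b\<in>Basis. (B y \<bullet> b) * ?g' b) = ?g' (\<Sum>b\<in>Basis. (B y \<bullet> b) *\<^sub>R b)"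
      by (simp add: linear_sum[OF l] linear_scale[OF l])
    finally show ?thesis using True by (simp add: euclidean_representation)
  next
    case False
    have oK: "open (- K)" using K by (simp add: open_Compl compact_imp_closed)
    have "(?Q b has_derivative (\<lambda>_. 0)) (at y)" for b
      by (rule has_derivative_transform_within_open[of "\<lambda>_. 0" _ y UNIV "- K"]) (use False oK QK in auto)
    from fun_cong[OF frechet_derivative_at[OF this]] have "?D b y v = 0" for b v by metis
    then show ?thesis using False by simp
  qed
  then have e: "(\<lambda>y. indicator K y * (frechet_derivative g (at y) (B y) + g y * divergence B y))
      = (\<lambda>y. \<Sum>b\<in>Basis. ?D b y b)" by simp
  show "integrable lborel (\<lambda>y. indicator K y * (frechet_derivative g (at y) (B y) + g y * divergence B y))"
    unfolding e using ib by simp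
  show "(LINT y|lborel. indicator K y * (frechet_derivative g (at y) (B y) + g y * divergence B y)) = 0"
    unfolding e using ib by (subst Bochner_Integration.integral_sum) auto
qed

lemma Ck1_inner:
  fixes f g :: "'a::euclidean_space \<Rightarrow> 'b::euclidean_space"
  assumes f: "Ck_on 1 S f" and g: "Ck_on 1 S g" shows "Ck_on 1 S (\<lambda>x. f x \<bullet> g x)"
proof (rule Ck1I)
  show "((\<lambda>x. f x \<bullet> g x) has_derivative (\<lambda>v. f x \<bullet> frechet_derivative g (at x) v
      + frechet_derivative f (at x) v \<bullet> g x)) (at x)" if "x \<in> S" for x
    using that by (intro has_derivative_inner Ck1_has_derivative[OF f] Ck1_has_derivative[OF g])
  show "continuous_on S (\<lambda>x. f x \<bullet> frechet_derivative g (at x) v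
      + frechet_derivative f (at x) v \<bullet> g x)" for v
    by (intro continuous_intros Ck1_continuous_derivative f g
        Ck_on_imp_continuous_on[OF f] Ck_on_imp_continuous_on[OF g])
qed

lemma Ck1_const: "Ck_on 1 S (\<lambda>x. c)"
  by (rule Ck1I[where f' = "\<lambda>_ _. 0"]) auto

lemma linear_inverse_fun:
  assumes "linear A" "\<And>w. A (B w) = w" "\<And>v. B (A v) = v"
  shows "linear B"
proof (rule linearI)
  show "B (v + w) = B v + B w" for v w
    using assms(3)[of "B v + B w"] by (simp add: linear_add[OF assms(1)] assms(2))
  show "B (c *\<^sub>R v) = c *\<^sub>R B v" for c v
    using assms(3)[of "c *\<^sub>R B v"] by (simp add: linear_scale[OF assms(1)] assms(2))
qed

lemma linear_euclidean_expand:
  fixes T :: "'a::euclidean_space \<Rightarrow> 'b::real_vector"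
  assumes "linear T" shows "T w = (\<Sum>b\<in>Basis. (w \<bullet> b) *\<^sub>R T b)"
proof -
  have "T (\<Sum>b\<in>Basis. (w \<bullet> b) *\<^sub>R b) = (\<Sum>b\<in>Basis. (w \<bullet> b) *\<^sub>R T b)"
    by (simp add: linear_sum[OF assms] linear_scale[OF assms])
  then show ?thesis by (simp add: euclidean_representation)
qed

text \<open>The field \<open>Y\<close> is the image of \<open>Z\<close> under \<open>F\<close>, and \<open>M x ` L\<close> is the horizontal space at \<open>x\<close>.\<close>

lemma weak_contact_local:
  fixes F Fi Z B Y :: "'e::euclidean_space \<Rightarrow> 'e" and M N :: "'e \<Rightarrow> 'e \<Rightarrow> 'e"
    and \<eta> :: "'e \<Rightarrow> 'e \<Rightarrow> real"
  defines "J \<equiv> \<lambda>y. frechet_derivative (\<lambda>z. \<eta> z (B y)) (at y) (Y y)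
    - frechet_derivative (\<lambda>z. \<eta> z (Y y)) (at y) (B y) - \<eta> y (Y y) * divergence B y"
  assumes U: "open U" and V: "open V"
    and F: "Ck_on 1 U F" "\<And>x. x \<in> U \<Longrightarrow> F x \<in> V \<and> Fi (F x) = x"
    and Fi: "Ck_on 1 V Fi" "\<And>y. y \<in> V \<Longrightarrow> Fi y \<in> U \<and> F (Fi y) = y"
    and Z: "Ck_on 1 U Z"
    and M: "\<And>h. Ck_on 1 U (\<lambda>x. M x h)" "\<And>x. x \<in> U \<Longrightarrow> linear (M x)"
    and N: "\<And>x w. x \<in> U \<Longrightarrow> M x (N x w) = w" "\<And>x h. x \<in> U \<Longrightarrow> N x (M x h) = h"
    and L: "subspace L"
    and contact: "\<And>x h. x \<in> U \<Longrightarrow> h \<in> L \<Longrightarrow>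
      \<exists>k\<in>L. frechet_derivative (\<lambda>x. M x h) (at x) (Z x) - frechet_derivative Z (at x) (M x h) = M x k"
    and \<eta>: "\<And>v. Ck_on 1 V (\<lambda>y. \<eta> y v)" "\<And>y. y \<in> V \<Longrightarrow> linear (\<eta> y)"
    and vert: "\<And>x h. x \<in> U \<Longrightarrow> h \<in> L \<Longrightarrow> \<eta> (F x) (frechet_derivative F (at x) (M x h)) = 0"
    and K: "compact K" "K \<subseteq> V" and B: "Ck_on 1 V B" "\<And>y. y \<in> V - K \<Longrightarrow> B y = 0"
    and Bhor: "\<And>y. y \<in> V \<Longrightarrow> \<exists>h\<in>L. B y = frechet_derivative F (at (Fi y)) (M (Fi y) h)"
    and Y: "\<And>y. y \<in> V \<Longrightarrow> Y y = frechet_derivative F (at (Fi y)) (Z (Fi y))"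
  shows "integrable lborel (\<lambda>y. indicator K y * J y)" "(LINT y|lborel. indicator K y * J y) = 0"
proof -
  let ?DF = "\<lambda>x. frechet_derivative F (at x)" and ?DZ = "\<lambda>x. frechet_derivative Z (at x)"
  let ?DM = "\<lambda>x h. frechet_derivative (\<lambda>x. M x h) (at x)"
  have FD: "(F has_derivative ?DF x) (at x)" if "x \<in> U" for x by (rule Ck1_has_derivative[OF F(1) that])
  have ZD: "(Z has_derivative ?DZ x) (at x)" if "x \<in> U" for x by (rule Ck1_has_derivative[OF Z that])
  have DF_lin: "linear (?DF x)" if "x \<in> U" for x using has_derivative_linear[OF FD[OF that]] .
  have DZ_lin: "linear (?DZ x)" if "x \<in> U" for x using has_derivative_linear[OF ZD[OF that]] .
  have pU: "Fi y \<in> U" if "y \<in> V" for y using Fi(2) that by blast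
  have pc: "continuous_on V Fi" by (rule Ck_on_imp_continuous_on[OF Fi(1)])
  have via_p: "continuous_on V (\<lambda>y. g (Fi y))" if "continuous_on U g" for g :: "'e \<Rightarrow> 'e"
    using pU by (intro continuous_on_compose2[OF that pc]) auto
  have N_lin: "linear (N x)" if "x \<in> U" for x
    by (rule linear_inverse_fun[OF M(2)[OF that] N(1)[OF that] N(2)[OF that]])
  have Nc: "continuous_on V (\<lambda>y. N (Fi y) (g y))" if "continuous_on V g" for g
  proof (rule continuous_on_linear_apply[where A = "\<lambda>y. N (Fi y)"])
    show "linear (N (Fi y))" if "y \<in> V" for y by (rule N_lin[OF pU[OF that]])
    have "continuous_on U (\<lambda>x. N x v)" for v
      by (rule continuous_on_inverse_apply[where A = M, OF M(2) Ck_on_imp_continuous_on[OF M(1)] N])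
    then show "continuous_on V (\<lambda>y. N (Fi y) v)" for v by (rule via_p)
  qed (rule that)
  have Mc: "continuous_on V (\<lambda>y. M (Fi y) (g y))" if "continuous_on V g" for g
    by (rule continuous_on_linear_apply[where A = "\<lambda>y. M (Fi y)", OF M(2)[OF pU]
          via_p[OF Ck_on_imp_continuous_on[OF M(1)]] that])

  \<comment> \<open>The Riesz vector of the 1-form: \<eta> becomes an inner product, to which the
    rules for \<open>bdd_conv\<close> and for C^1 functions apply.\<close>
  define e where "e y = (\<Sum>b\<in>Basis. \<eta> y b *\<^sub>R b)" for y
  have e\<eta>: "e y \<bullet> v = \<eta> y v" if "y \<in> V" for y v
  proof -
    have "\<eta> y v = (\<Sum>b\<in>Basis. (v \<bullet> b) *\<^sub>R \<eta> y b)" by (rule linear_euclidean_expand[OF \<eta>(2)[OF that]])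
    then show ?thesis by (simp add: e_def inner_sum_right inner_commute[of _ v] mult.commute)
  qed
  have e1: "Ck_on 1 V e" unfolding e_def by (intro Ck1_sum Ck1_scaleR \<eta>(1) Ck1_const)
  let ?De = "\<lambda>y. frechet_derivative e (at y)"
  have eD: "(e has_derivative ?De y) (at y)" if "y \<in> V" for y by (rule Ck1_has_derivative[OF e1 that])
  have De: "frechet_derivative (\<lambda>z. \<eta> z w) (at y) v = ?De y v \<bullet> w" if "y \<in> V" for y v w
  proof -
    have "frechet_derivative (\<lambda>z. \<eta> z w) (at y) = frechet_derivative (\<lambda>z. e z \<bullet> w) (at y)"
      by (rule frechet_derivative_cong_open[OF V that]) (simp add: e\<eta>)
    also have "\<dots> = (\<lambda>v. ?De y v \<bullet> w)"
      by (rule frechet_derivative_at[symmetric]) (intro has_derivative_inner_left eD that)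
    finally show ?thesis by simp
  qed

  \<comment> \<open>B pulled back to the source. It is horizontal there, with coordinates
    \<open>h\<close> in the frame \<open>M\<close>; computing \<open>h\<close> through
    \<open>N\<close> instead of choosing it at each point makes it continuous.\<close>
  define X where "X y = frechet_derivative Fi (at y) (B y)" for y
  define h where "h y = N (Fi y) (X y)" for y
  have Xc: "continuous_on V X" unfolding X_def
    by (rule continuous_on_linear_apply[where A = "\<lambda>y. frechet_derivative Fi (at y)",
        OF has_derivative_linear[OF Ck1_has_derivative[OF Fi(1)]]
        Ck1_continuous_derivative[OF Fi(1)] Ck_on_imp_continuous_on[OF B(1)]])
  have hc: "continuous_on V h" unfolding h_def by (rule Nc[OF Xc])
  have h: "h y \<in> L" "B y = ?DF (Fi y) (M (Fi y) (h y))" "X y = M (Fi y) (h y)" if y: "y \<in> V" for y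
  proof -
    obtain h' where h': "h' \<in> L" "B y = ?DF (Fi y) (M (Fi y) h')" using Bhor[OF y] by blast
    have "((\<lambda>x. Fi (F x)) has_derivative (\<lambda>v. frechet_derivative Fi (at y) (?DF (Fi y) v))) (at (Fi y))"
      using Fi(2)[OF y] by (intro has_derivative_compose[OF FD]) (auto intro: Ck1_has_derivative[OF Fi(1) y])
    then have "((\<lambda>x. x) has_derivative (\<lambda>v. frechet_derivative Fi (at y) (?DF (Fi y) v))) (at (Fi y))"
      by (rule has_derivative_transform_within_open[OF _ U pU[OF y]]) (use F(2) in blast)
    from has_derivative_unique[OF this has_derivative_ident]
    have "frechet_derivative Fi (at y) (?DF (Fi y) v) = v" for v by (simp add: fun_eq_iff)
    then have X: "X y = M (Fi y) h'" using h' by (simp add: X_def)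
    then have "h y = h'" using N(2)[OF pU[OF y]] by (simp add: h_def)
    then show "h y \<in> L" "B y = ?DF (Fi y) (M (Fi y) (h y))" "X y = M (Fi y) (h y)" using h' X by auto
  qed
  \<comment> \<open>Removes the contribution of the identity when \<open>F (x n y) - y\<close> is
    differentiated along B below.\<close>
  have eB: "e y \<bullet> B y = 0" if y: "y \<in> V" for y
    using vert[OF pU[OF y] h(1)[OF y]] Fi(2)[OF y] by (simp add: e\<eta>[OF y] flip: h(2)[OF y])

  have DM_expand: "?DM x w v = (\<Sum>b\<in>Basis. (w \<bullet> b) *\<^sub>R ?DM x b v)" if x: "x \<in> U" for x w v
  proof -
    have "frechet_derivative (\<lambda>x. M x w) (at x) = frechet_derivative (\<lambda>x. \<Sum>b\<in>Basis. (w \<bullet> b) *\<^sub>R M x b) (at x)"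
      by (rule frechet_derivative_cong_open[OF U x linear_euclidean_expand[OF M(2)]])
    also have "\<dots> = (\<lambda>v. \<Sum>b\<in>Basis. (w \<bullet> b) *\<^sub>R ?DM x b v)"
      by (rule frechet_derivative_at[symmetric])
         (intro has_derivative_sum has_derivative_scaleR_right Ck1_has_derivative[OF M(1) x])
    finally show ?thesis by simp
  qed
  define v where "v y = Z (Fi y)" for y
  have vc: "continuous_on V v" unfolding v_def by (rule via_p[OF Ck_on_imp_continuous_on[OF Z]])
  \<comment> \<open>The bracket of Z with the field of constant coordinates \<open>h y\<close> in
    the frame. It is horizontal by the contact condition, and its coordinates \<open>k\<close> are
    continuous since they are obtained through \<open>N\<close>.\<close>
  define w where "w y = ?DM (Fi y) (h y) (v y) - ?DZ (Fi y) (X y)" for y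
  define k where "k y = N (Fi y) (w y)" for y
  have DZXc: "continuous_on V (\<lambda>y. ?DZ (Fi y) (X y))"
    by (rule continuous_on_linear_apply[where A = "\<lambda>y. ?DZ (Fi y)", OF DZ_lin[OF pU]
          via_p[OF Ck1_continuous_derivative[OF Z]] Xc])
  have "continuous_on V (\<lambda>y. \<Sum>b\<in>Basis. (h y \<bullet> b) *\<^sub>R ?DM (Fi y) b (v y))"
  proof (intro continuous_intros hc)
    fix b :: 'e
    show "continuous_on V (\<lambda>y. ?DM (Fi y) b (v y))"
      by (rule continuous_on_linear_apply[where A = "\<lambda>y. ?DM (Fi y) b",
            OF has_derivative_linear[OF Ck1_has_derivative[OF M(1) pU]]
            via_p[OF Ck1_continuous_derivative[OF M(1)]] vc])
  qed
  then have DMc: "continuous_on V (\<lambda>y. ?DM (Fi y) (h y) (v y))"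
    by (rule continuous_on_eq) (rule DM_expand[OF pU, symmetric])
  have kc: "continuous_on V k" unfolding k_def
    by (rule Nc) (unfold w_def, intro continuous_on_diff DMc DZXc)
  have k: "k y \<in> L" "M (Fi y) (k y) = w y" if y: "y \<in> V" for y
  proof -
    obtain k' where k': "k' \<in> L" "w y = M (Fi y) k'"
      using contact[OF pU[OF y] h(1)[OF y]] by (auto simp: w_def v_def h(3)[OF y])
    then show "k y \<in> L" "M (Fi y) (k y) = w y" using N[OF pU[OF y]] by (auto simp: k_def)
  qed

  have Kp: "compact (Fi ` K)" using K pc continuous_on_subset compact_continuous_image by metis
  have "Fi ` K \<subseteq> U" using K pU by blast
  then obtain \<delta> where \<delta>: "\<delta> > 0" "(\<Union>x\<in>Fi ` K. cball x \<delta>) \<subseteq> U"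
    using compact_subset_open_imp_cball_epsilon_subset[OF Kp U] by metis
  \<comment> \<open>A compact set inside U that contains every segment from \<open>Fi y\<close> to
    the displaced point, so that bounds valid on compact sets hold along all of them.\<close>
  define C where "C = {x + u | x u. x \<in> Fi ` K \<and> u \<in> cball 0 \<delta>}"
  have C: "compact C" unfolding C_def by (intro compact_sums Kp compact_cball)
  have CU: "C \<subseteq> U"
  proof
    fix z assume "z \<in> C"
    then obtain x u where "x \<in> Fi ` K" "norm u \<le> \<delta>" "z = x + u" by (auto simp: C_def)
    then have "x \<in> Fi ` K" "z \<in> cball x \<delta>" by (auto simp: dist_norm)
    then show "z \<in> U" using \<delta>(2) by blast
  qed
  have "bounded (v ` K)" by (intro compact_imp_bounded compact_continuous_image K continuous_on_subset[OF vc])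
  then obtain D where D: "\<And>y. y \<in> K \<Longrightarrow> norm (v y) \<le> D" by (auto simp: bounded_iff)
  \<comment> \<open>Scaled so that the displacement t n times \<open>v y\<close> has norm at most
    \<delta>; the added 1 avoids a division by 0.\<close>
  define t where "t n = \<delta> / (\<bar>D\<bar> + 1) / real (Suc n)" for n
  have t0: "t n > 0" for n using \<delta> by (simp add: t_def add_nonneg_pos)
  have tle: "t n \<le> \<delta> / (\<bar>D\<bar> + 1)" for n
    unfolding t_def using \<delta> by (intro divide_le_eq[THEN iffD2]) (auto simp: add_nonneg_pos field_simps)
  have tD: "t n * D \<le> \<delta>" for n
  proof -
    have "t n * \<bar>D\<bar> \<le> \<delta> / (\<bar>D\<bar> + 1) * \<bar>D\<bar>" by (intro mult_right_mono tle) auto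
    also have "\<dots> \<le> \<delta>" using \<delta> by (simp add: field_simps add_nonneg_pos)
    finally show ?thesis using mult_left_mono[OF abs_ge_self[of D], of "t n"] t0[of n] by linarith
  qed
  have tl: "t \<longlonglongrightarrow> 0"
  proof -
    have "(\<lambda>n. \<delta> / (\<bar>D\<bar> + 1) * (1 / real (Suc n))) \<longlonglongrightarrow> \<delta> / (\<bar>D\<bar> + 1) * 0"
      by (intro tendsto_intros LIMSEQ_Suc[OF lim_1_over_n])
    then show ?thesis by (simp add: t_def[abs_def])
  qed
  have seg: "Fi y + s *\<^sub>R v y \<in> C" if "y \<in> K" "0 \<le> s" "s \<le> t n" for y s n
  proof -
    have "norm (s *\<^sub>R v y) \<le> t n * D" using that D[OF that(1)] by (auto intro!: mult_mono)
    then show ?thesis unfolding C_def using that(1) tD[of n] by fastforce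
  qed
  \<comment> \<open>The map id + t Z applied to \<open>Fi y\<close>, with t = t n; thus
    \<open>F (x n y)\<close> is the perturbed identity \<open>\<psi>\<^sub>t\<close> at y.\<close>
  define x where "x n y = Fi y + t n *\<^sub>R v y" for n y
  have xU: "x n y \<in> U" if "y \<in> K" for n y
    using seg[OF that, of "t n" n] t0[of n] CU by (auto simp: x_def)
  have pK: "continuous_on K Fi" and vK: "continuous_on K v"
    using pc vc K continuous_on_subset by blast+
  have comp: "bdd_conv K (\<lambda>n y. g (x n y)) (\<lambda>y. g (Fi y))" if "continuous_on U g" for g :: "'e \<Rightarrow> 'e"
    unfolding x_def by (rule bdd_conv_compose[OF that C CU pK vK seg tl t0])
  have quot: "bdd_conv K (\<lambda>n y. inverse (t n) *\<^sub>R (g (x n y) - g (Fi y)))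
      (\<lambda>y. frechet_derivative g (at (Fi y)) (v y))" if "Ck_on 1 U g" for g :: "'e \<Rightarrow> 'e"
    unfolding x_def by (rule bdd_conv_difference_quotient[OF that C CU K(1) pK vK seg tl t0])
  have const: "bdd_conv K (\<lambda>n. g) g" if "continuous_on V g" for g :: "'e \<Rightarrow> 'b::real_normed_vector"
    by (rule bdd_conv_const[OF K(1) continuous_on_subset[OF that K(2)]])
  have DF_conv: "bdd_conv K (\<lambda>n y. ?DF (x n y) (q n y)) (\<lambda>y. ?DF (Fi y) (q' y))"
    if "bdd_conv K q q'" for q q'
    by (rule bdd_conv_linear[where A = "\<lambda>n y. ?DF (x n y)" and A' = "\<lambda>y. ?DF (Fi y)",
          OF comp[OF Ck1_continuous_derivative[OF F(1)]] that DF_lin[OF xU] DF_lin[OF pU[OF subsetD[OF K(2)]]]])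
  have eF1: "Ck_on 1 U (\<lambda>x. e (F x))" by (rule Ck1_compose[OF F(1) e1]) (use F(2) in blast)
  have eF: "frechet_derivative (\<lambda>x. e (F x)) (at (Fi y)) u = ?De y (?DF (Fi y) u)" if y: "y \<in> V" for y u
  proof -
    have "((\<lambda>x. e (F x)) has_derivative (\<lambda>u. ?De y (?DF (Fi y) u))) (at (Fi y))"
      using Fi(2)[OF y] by (intro has_derivative_compose[OF FD]) (auto intro: eD y)
    from frechet_derivative_at[OF this] show ?thesis by metis
  qed

  \<comment> \<open>1 / t times the difference of two vectors at the displaced point: the image of
    \<open>X y\<close> under the derivative of id + t Z, called \<open>W n y\<close> below, and the
    horizontal vector with coordinates \<open>h y - t n *\<^sub>R k y\<close>. By the definition of
    \<open>w\<close> and \<open>k\<close> the limit is 0; this is where the contact condition on Z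
    enters.\<close>
  define q where "q n y = (?DZ (Fi y) (X y) + M (x n y) (k y))
    - inverse (t n) *\<^sub>R (M (x n y) (h y) - M (Fi y) (h y))" for n y
  define A where "A n y = e (F (x n y)) \<bullet> ?DF (x n y) (q n y)" for n y
  have "bdd_conv K q (\<lambda>y. (?DZ (Fi y) (X y) + M (Fi y) (k y)) - ?DM (Fi y) (h y) (v y))"
    unfolding q_def
  proof (intro bdd_conv_diff bdd_conv_add const DZXc)
    show "bdd_conv K (\<lambda>n y. M (x n y) (k y)) (\<lambda>y. M (Fi y) (k y))"
      by (rule bdd_conv_linear[where A = "\<lambda>n y. M (x n y)" and A' = "\<lambda>y. M (Fi y)",
            OF comp[OF Ck_on_imp_continuous_on[OF M(1)]] const[OF kc] M(2)[OF xU]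
            M(2)[OF pU[OF subsetD[OF K(2)]]]])
    have "bdd_conv K (\<lambda>n y. \<Sum>b\<in>Basis. (h y \<bullet> b) *\<^sub>R (inverse (t n) *\<^sub>R (M (x n y) b - M (Fi y) b)))
        (\<lambda>y. \<Sum>b\<in>Basis. (h y \<bullet> b) *\<^sub>R ?DM (Fi y) b (v y))"
      by (intro bdd_conv_sum bdd_conv_scaleR const quot M(1) continuous_intros hc)
    then show "bdd_conv K (\<lambda>n y. inverse (t n) *\<^sub>R (M (x n y) (h y) - M (Fi y) (h y)))
        (\<lambda>y. ?DM (Fi y) (h y) (v y))"
    proof (rule bdd_conv_cong)
      fix n y assume y: "y \<in> K"
      then have y': "y \<in> V" using K by blast
      show "(\<Sum>b\<in>Basis. (h y \<bullet> b) *\<^sub>R (inverse (t n) *\<^sub>R (M (x n y) b - M (Fi y) b)))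
          = inverse (t n) *\<^sub>R (M (x n y) (h y) - M (Fi y) (h y))"
        unfolding linear_euclidean_expand[OF M(2)[OF xU[OF y]], of n "h y"]
          linear_euclidean_expand[OF M(2)[OF pU[OF y']], of "h y"]
        by (simp add: scaleR_sum_right scaleR_diff_right sum_subtractf mult.commute)
    next
      fix y assume "y \<in> K"
      then show "(\<Sum>b\<in>Basis. (h y \<bullet> b) *\<^sub>R ?DM (Fi y) b (v y)) = ?DM (Fi y) (h y) (v y)"
        by (intro DM_expand[symmetric] pU subsetD[OF K(2)])
    qed
  qed
  then have q: "bdd_conv K q (\<lambda>y. 0)"
    by (rule bdd_conv_cong) (use k(2) K in \<open>auto simp: w_def\<close>)
  have "bdd_conv K A (\<lambda>y. e (F (Fi y)) \<bullet> ?DF (Fi y) 0)"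
    unfolding A_def by (intro bdd_conv_inner comp Ck_on_imp_continuous_on[OF eF1] DF_conv q)
  then have A: "bdd_conv K A (\<lambda>y. 0)"
    by (rule bdd_conv_cong) (use linear_0[OF DF_lin[OF pU]] K in auto)

  define W where "W n y = X y + t n *\<^sub>R ?DZ (Fi y) (X y)" for n y
  have W: "bdd_conv K W X"
  proof -
    have "bdd_conv K (\<lambda>n y. t n) (\<lambda>y. 0)"
    proof (rule bdd_convI)
      show "norm (t n) \<le> \<delta> / (\<bar>D\<bar> + 1)" for n
        using tle[of n] t0[of n] by simp
    qed (use tl in auto)
    then have "bdd_conv K W (\<lambda>y. X y + 0 *\<^sub>R ?DZ (Fi y) (X y))"
      unfolding W_def by (intro bdd_conv_add bdd_conv_scaleR const Xc DZXc)
    then show ?thesis by simp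
  qed
  \<comment> \<open>The subtracted vector is horizontal at \<open>x n y\<close>, so its image under
    F is annihilated by \<eta>. What remains is 1 / t times \<eta> at \<open>F (x n y)\<close>,
    evaluated on the derivative of \<open>\<psi>\<^sub>t\<close> along B.\<close>
  have A_eq: "A n y = inverse (t n) * (e (F (x n y)) \<bullet> ?DF (x n y) (W n y))" if y: "y \<in> K" for n y
  proof -
    have yV: "y \<in> V" using y K by blast
    let ?x = "x n y"
    have Mk: "M ?x (h y - t n *\<^sub>R k y) = M ?x (h y) - t n *\<^sub>R M ?x (k y)"
      by (simp add: linear_diff[OF M(2)[OF xU[OF y]]] linear_scale[OF M(2)[OF xU[OF y]]])
    have q: "q n y = inverse (t n) *\<^sub>R (W n y - M ?x (h y - t n *\<^sub>R k y))"
      unfolding q_def W_def Mk h(3)[OF yV] using t0[of n]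
      by (simp add: scaleR_diff_right scaleR_add_right)
    have "h y - t n *\<^sub>R k y \<in> L"
      by (intro subspace_diff[OF L] subspace_scale[OF L] h(1) k(1) yV)
    then have "\<eta> (F ?x) (?DF ?x (M ?x (h y - t n *\<^sub>R k y))) = 0" by (intro vert xU y)
    then have z: "e (F ?x) \<bullet> ?DF ?x (M ?x (h y - t n *\<^sub>R k y)) = 0" using e\<eta> F(2) xU[OF y] by simp
    have "A n y = inverse (t n) * (e (F ?x) \<bullet> (?DF ?x (W n y) - ?DF ?x (M ?x (h y - t n *\<^sub>R k y))))"
      unfolding A_def q by (simp only: linear_scale[OF DF_lin[OF xU[OF y]]] linear_diff[OF DF_lin[OF xU[OF y]]] inner_scaleR_right)
    then show ?thesis using z by (simp add: inner_diff_right)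
  qed

  \<comment> \<open>\<open>A\<close> minus 1 / t times the integrand of
    \<open>integration_by_parts\<close> for the function \<open>g n\<close> below. The derivative of
    F survives only in the first summand, where it is multiplied by a difference quotient of e; the
    other summands contain difference quotients of F itself. Everything therefore converges although
    F is only C^1.\<close>
  define R where "R n y = (inverse (t n) *\<^sub>R (e (F (x n y)) - e (F (Fi y)))) \<bullet> ?DF (x n y) (W n y)
    - ?De y (B y) \<bullet> (inverse (t n) *\<^sub>R (F (x n y) - F (Fi y)))
    - (e y \<bullet> (inverse (t n) *\<^sub>R (F (x n y) - F (Fi y)))) * divergence B y" for n y
  have divc: "continuous_on V (divergence B)" unfolding divergence_def
    by (intro continuous_intros Ck1_continuous_derivative[OF B(1)])
  have DeBc: "continuous_on V (\<lambda>y. ?De y (B y))"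
    by (rule continuous_on_linear_apply[where A = ?De, OF has_derivative_linear[OF eD]
        Ck1_continuous_derivative[OF e1] Ck_on_imp_continuous_on[OF B(1)]])
  have "bdd_conv K R (\<lambda>y. frechet_derivative (\<lambda>x. e (F x)) (at (Fi y)) (v y) \<bullet> ?DF (Fi y) (X y)
      - ?De y (B y) \<bullet> ?DF (Fi y) (v y) - (e y \<bullet> ?DF (Fi y) (v y)) * divergence B y)"
    unfolding R_def
    by (intro bdd_conv_diff bdd_conv_mult bdd_conv_inner const quot DF_conv W eF1 F(1) DeBc divc
        Ck_on_imp_continuous_on[OF e1])
  \<comment> \<open>By the chain rule the limit is d\<eta>(Y, B), written with frozen arguments,
    minus \<eta>(Y) times the divergence of B.\<close>
  then have R: "bdd_conv K R J"
  proof (rule bdd_conv_cong)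
    fix y assume "y \<in> K"
    then have y: "y \<in> V" using K by blast
    show "frechet_derivative (\<lambda>x. e (F x)) (at (Fi y)) (v y) \<bullet> ?DF (Fi y) (X y)
      - ?De y (B y) \<bullet> ?DF (Fi y) (v y) - (e y \<bullet> ?DF (Fi y) (v y)) * divergence B y = J y"
      unfolding J_def De[OF y] eF[OF y] using Y[OF y] h(2,3)[OF y] e\<eta>[OF y] by (simp add: v_def)
  qed simp

  \<comment> \<open>The derivative of g along B contains e y paired with the derivative of
    \<open>\<psi>\<^sub>t\<close> along B, which is the part of \<open>A\<close> that has to be
    integrated by parts.\<close>
  define g where "g n y = e y \<bullet> (F (x n y) - y)" for n y
  have parts: "(LINT y|lborel. indicator K y * (frechet_derivative (g n) (at y) (B y) + g n y * divergence B y)) = 0"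
    "integrable lborel (\<lambda>y. indicator K y * (frechet_derivative (g n) (at y) (B y) + g n y * divergence B y))"
    and g': "\<And>y. y \<in> K \<Longrightarrow> frechet_derivative (g n) (at y) (B y)
      = ?De y (B y) \<bullet> (F (x n y) - y) + e y \<bullet> ?DF (x n y) (W n y)" for n
  proof -
    \<comment> \<open>The displaced point is known to lie in U only for y in K, so one works on the
      open neighbourhood of K where it does.\<close>
    let ?V = "V \<inter> x n -` U"
    have xn: "Ck_on 1 V (x n)" unfolding x_def[abs_def] v_def
      by (intro Ck1_add Ck1_scaleR Ck1_const Fi(1) Ck1_compose[OF Fi(1) Z]) (use pU in blast)
    have oV: "open ?V" by (rule continuous_open_preimage[OF Ck_on_imp_continuous_on[OF xn] V U])
    have KV: "K \<subseteq> ?V" using K xU by auto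
    have Fx: "Ck_on 1 ?V (\<lambda>y. F (x n y))"
      by (rule Ck1_compose[OF Ck_on_subset[OF xn] F(1)]) auto
    have id: "Ck_on 1 ?V (\<lambda>y. - y)" by (rule Ck1I[where f' = "\<lambda>_ v. - v"]) (auto intro!: derivative_eq_intros)
    have "Ck_on 1 ?V (\<lambda>y. e y \<bullet> (F (x n y) + - y))"
      by (intro Ck1_inner Ck1_add id Fx Ck_on_subset[OF e1]) auto
    then have g1: "Ck_on 1 ?V (g n)" by (simp add: g_def[abs_def] del: Ck_on.simps)
    have "Ck_on 1 ?V B" by (rule Ck_on_subset[OF B(1)]) auto
    from integration_by_parts[OF oV K(1) KV g1 this] B(2)
    show "(LINT y|lborel. indicator K y * (frechet_derivative (g n) (at y) (B y) + g n y * divergence B y)) = 0"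
      "integrable lborel (\<lambda>y. indicator K y * (frechet_derivative (g n) (at y) (B y) + g n y * divergence B y))"
      by auto
    fix y assume yK: "y \<in> K"
    then have y: "y \<in> V" using K by blast
    have xD: "(x n has_derivative (\<lambda>u. frechet_derivative Fi (at y) u
        + t n *\<^sub>R ?DZ (Fi y) (frechet_derivative Fi (at y) u))) (at y)"
      unfolding x_def[abs_def] v_def
      by (intro has_derivative_add has_derivative_scaleR_right Ck1_has_derivative[OF Fi(1) y]
          has_derivative_compose[OF Ck1_has_derivative[OF Fi(1) y] ZD[OF pU[OF y]]])
    have "(g n has_derivative (\<lambda>u. e y \<bullet> (?DF (x n y) (frechet_derivative Fi (at y) u
        + t n *\<^sub>R ?DZ (Fi y) (frechet_derivative Fi (at y) u)) - u) + ?De y u \<bullet> (F (x n y) - y))) (at y)"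
      unfolding g_def[abs_def]
      by (intro has_derivative_inner has_derivative_diff has_derivative_ident eD[OF y]
          has_derivative_compose[OF xD FD[OF xU[OF yK]]])
    from fun_cong[OF frechet_derivative_at[OF this], of "B y"]
    show "frechet_derivative (g n) (at y) (B y)
      = ?De y (B y) \<bullet> (F (x n y) - y) + e y \<bullet> ?DF (x n y) (W n y)"
      using eB[OF y] by (simp add: W_def X_def inner_diff_right)
  qed
  have RA: "indicator K y * R n y = indicator K y * A n y
      - inverse (t n) * (indicator K y * (frechet_derivative (g n) (at y) (B y) + g n y * divergence B y))" for n y
  proof (cases "y \<in> K")
    case True
    then have Fy: "F (Fi y) = y" using Fi(2) K by blast
    show ?thesis unfolding A_eq[OF True] g'[OF True] R_def g_def Fy
      using True by (simp add: inner_diff_left algebra_simps)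
  qed simp
  have int: "(LINT y|lborel. indicator K y * R n y) = (LINT y|lborel. indicator K y * A n y)" for n
    unfolding RA using parts[of n] bdd_conv_integral(2)[OF K(1) A, of n] by simp
  show "integrable lborel (\<lambda>y. indicator K y * J y)" by (rule bdd_conv_integral(1)[OF K(1) R])
  have "(\<lambda>n. LINT y|lborel. indicator K y * R n y) \<longlonglongrightarrow> (LINT y|lborel. indicator K y * J y)"
    by (rule bdd_conv_integral(3)[OF K(1) R])
  moreover have "(\<lambda>n. LINT y|lborel. indicator K y * R n y) \<longlonglongrightarrow> 0"
    unfolding int using bdd_conv_integral(3)[OF K(1) A] by simp
  ultimately show "(LINT y|lborel. indicator K y * J y) = 0" by (rule LIMSEQ_unique)
qed

section \<open>Exterior derivative and Lie bracket under coordinate changes\<close>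

text \<open>Every identity in the definition of \<open>alt_form\<close> holds in a neighbourhood of
  u, so both of its sides have the same derivative there.\<close>

lemma alt_form_derivative:
  fixes \<alpha> :: "'a::euclidean_space \<Rightarrow> 'e::real_vector list \<Rightarrow> real"
  assumes S: "open S" "u \<in> S" and a: "\<And>x. x \<in> S \<Longrightarrow> alt_form k (\<alpha> x)"
    and d: "\<And>ws. ((\<lambda>x. \<alpha> x ws) has_derivative \<alpha>' ws) (at u)"
  shows "alt_form k (\<lambda>ws. \<alpha>' ws h)"
proof -
  have uniq: "\<alpha>' ws = D" if "\<And>x. x \<in> S \<Longrightarrow> \<alpha> x ws = f x" "(f has_derivative D) (at u)" for ws f D
    by (rule has_derivative_unique[OF d]) (rule has_derivative_transform_within_open[OF that(2) S], simp add: that)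
  have z: "\<alpha>' ws h = 0" if "\<And>x. x \<in> S \<Longrightarrow> \<alpha> x ws = 0" for ws
    using uniq[of ws "\<lambda>_. 0" "\<lambda>_. 0"] that by simp
  show ?thesis unfolding alt_form_def
  proof (intro conjI allI impI)
    fix ws :: "'e list" assume "length ws \<noteq> k"
    then show "\<alpha>' ws h = 0" using alt_form_length[OF a] by (intro z)
  next
    fix ws :: "'e list" and i j assume "length ws = k \<and> i < j \<and> j < k \<and> ws ! i = ws ! j"
    then show "\<alpha>' ws h = 0" using alt_form_repeat[OF a] by (intro z) blast
  next
    fix ws :: "'e list" and i assume i: "length ws = k \<and> i < k"
    have l: "linear (\<lambda>v. \<alpha> x (ws[i := v]))" if "x \<in> S" for x
      using alt_form_linear[OF a[OF that]] i by blast
    show "linear (\<lambda>v. \<alpha>' (ws[i := v]) h)"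
    proof (rule linearI)
      fix v w
      have "\<alpha>' (ws[i := v + w]) = (\<lambda>h. \<alpha>' (ws[i := v]) h + \<alpha>' (ws[i := w]) h)"
        by (rule uniq[of _ "\<lambda>x. \<alpha> x (ws[i := v]) + \<alpha> x (ws[i := w])"])
           (auto simp: linear_add[OF l] intro!: has_derivative_add d)
      then show "\<alpha>' (ws[i := v + w]) h = \<alpha>' (ws[i := v]) h + \<alpha>' (ws[i := w]) h" by simp
    next
      fix c v
      have "\<alpha>' (ws[i := c *\<^sub>R v]) = (\<lambda>h. c * \<alpha>' (ws[i := v]) h)"
        by (rule uniq[of _ "\<lambda>x. c * \<alpha> x (ws[i := v])"])
           (auto simp: linear_scale[OF l] intro!: has_derivative_mult_right d)
      then show "\<alpha>' (ws[i := c *\<^sub>R v]) h = c *\<^sub>R \<alpha>' (ws[i := v]) h" by simp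
    qed
  qed
qed

lemma alt_form_expand_slot:
  fixes \<alpha> :: "'e::euclidean_space list \<Rightarrow> real"
  assumes a: "alt_form k \<alpha>" and l: "length (pre @ v # post) = k"
  shows "\<alpha> (pre @ v # post) = (\<Sum>b\<in>Basis. (v \<bullet> b) * \<alpha> (pre @ b # post))"
proof -
  have "linear (\<lambda>v. \<alpha> ((pre @ v # post)[length pre := v]))"
    using alt_form_linear[OF a l, of "length pre"] l by simp
  then have L: "linear (\<lambda>v. \<alpha> (pre @ v # post))" by simp
  have "\<alpha> (pre @ (\<Sum>b\<in>Basis. (v \<bullet> b) *\<^sub>R b) # post) = (\<Sum>b\<in>Basis. (v \<bullet> b) * \<alpha> (pre @ b # post))"
    using linear_sum[OF L, of "\<lambda>b. (v \<bullet> b) *\<^sub>R b" Basis] linear_scale[OF L] by simp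
  then show ?thesis by (simp add: euclidean_representation)
qed

text \<open>The product rule for all slots at once. In the induction the first varying argument is
  expanded in the basis, and the basis vectors join the constant arguments
  \<open>pre\<close>.\<close>

lemma has_derivative_alt_form_map:
  fixes \<alpha> :: "'a::euclidean_space \<Rightarrow> 'e::euclidean_space list \<Rightarrow> real"
  assumes S: "open S" "u \<in> S" and a: "\<And>x. x \<in> S \<Longrightarrow> alt_form k (\<alpha> x)"
    and d: "\<And>ws. ((\<lambda>x. \<alpha> x ws) has_derivative \<alpha>' ws) (at u)"
    and A: "\<And>w. ((\<lambda>x. A x w) has_derivative A' w) (at u)"
    and l: "length (pre @ ws) = k"
  shows "((\<lambda>x. \<alpha> x (pre @ map (A x) ws)) has_derivative
    (\<lambda>h. \<alpha>' (pre @ map (A u) ws) h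
      + (\<Sum>j<length ws. \<alpha> u ((pre @ map (A u) ws)[length pre + j := A' (ws ! j) h])))) (at u)"
  using l
proof (induction ws arbitrary: pre)
  case Nil
  then show ?case using d by simp
next
  case (Cons w ws)
  let ?r = "\<lambda>x. map (A x) ws"
  have a': "alt_form k (\<lambda>ws. \<alpha>' ws h)" for h by (rule alt_form_derivative[OF S a d])
  define F' where "F' b h = \<alpha>' (pre @ b # ?r u) h
      + (\<Sum>j<length ws. \<alpha> u ((pre @ b # ?r u)[Suc (length pre + j) := A' (ws ! j) h]))" for b h
  have IH: "((\<lambda>x. \<alpha> x (pre @ b # ?r x)) has_derivative F' b) (at u)" for b
    using Cons.IH[of "pre @ [b]"] Cons.prems by (simp add: F'_def[abs_def])
  have "((\<lambda>x. \<Sum>b\<in>Basis. (A x w \<bullet> b) * \<alpha> x (pre @ b # ?r x)) has_derivative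
      (\<lambda>h. \<Sum>b\<in>Basis. (A u w \<bullet> b) * F' b h + (A' w h \<bullet> b) * \<alpha> u (pre @ b # ?r u))) (at u)"
    by (intro has_derivative_sum has_derivative_mult has_derivative_inner_left A IH)
  then have D: "((\<lambda>x. \<alpha> x (pre @ map (A x) (w # ws))) has_derivative
      (\<lambda>h. \<Sum>b\<in>Basis. (A u w \<bullet> b) * F' b h + (A' w h \<bullet> b) * \<alpha> u (pre @ b # ?r u))) (at u)"
    by (rule has_derivative_transform_within_open[OF _ S], unfold list.map)
       (rule alt_form_expand_slot[OF a, symmetric], use Cons.prems in simp_all)
  have "(\<Sum>b\<in>Basis. (A u w \<bullet> b) * F' b h + (A' w h \<bullet> b) * \<alpha> u (pre @ b # ?r u))
      = \<alpha>' (pre @ map (A u) (w # ws)) h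
      + (\<Sum>j<length (w # ws). \<alpha> u ((pre @ map (A u) (w # ws))[length pre + j := A' ((w # ws) ! j) h]))" for h
  proof -
    have len: "length (pre @ x # ?r u) = k" for x using Cons.prems by simp
    have upd: "(pre @ x # ?r u)[Suc (length pre + j) := y] = pre @ x # (?r u)[j := y]" for x y j
      by (simp add: list_update_append)
    have e: "(\<Sum>b\<in>Basis. (A u w \<bullet> b) * \<alpha> u ((pre @ b # ?r u)[Suc (length pre + j) := y]))
        = \<alpha> u ((pre @ A u w # ?r u)[Suc (length pre + j) := y])" for j y
      unfolding upd
      by (rule alt_form_expand_slot[OF a[OF S(2)], symmetric]) (use Cons.prems in simp)
    have "(\<Sum>b\<in>Basis. (A u w \<bullet> b) * F' b h)
        = (\<Sum>b\<in>Basis. (A u w \<bullet> b) * \<alpha>' (pre @ b # ?r u) h)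
        + (\<Sum>j<length ws. \<Sum>b\<in>Basis. (A u w \<bullet> b) * \<alpha> u ((pre @ b # ?r u)[Suc (length pre + j) := A' (ws ! j) h]))"
      unfolding F'_def
      by (simp add: distrib_left sum.distrib sum_distrib_left) (rule sum.swap)
    also have "(\<Sum>b\<in>Basis. (A u w \<bullet> b) * \<alpha>' (pre @ b # ?r u) h) = \<alpha>' (pre @ A u w # ?r u) h"
      by (rule alt_form_expand_slot[OF a' len, symmetric])
    finally have 1: "(\<Sum>b\<in>Basis. (A u w \<bullet> b) * F' b h) = \<alpha>' (pre @ A u w # ?r u) h
        + (\<Sum>j<length ws. \<alpha> u ((pre @ A u w # ?r u)[Suc (length pre + j) := A' (ws ! j) h]))"
      by (simp only: e)
    have 2: "(\<Sum>b\<in>Basis. (A' w h \<bullet> b) * \<alpha> u (pre @ b # ?r u)) = \<alpha> u (pre @ A' w h # ?r u)"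
      by (rule alt_form_expand_slot[OF a[OF S(2)] len, symmetric])
    have 3: "(pre @ A u w # ?r u)[length pre := A' w h] = pre @ A' w h # ?r u" by simp
    show ?thesis
      unfolding sum.distrib 1 2 length_Cons sum.lessThan_Suc_shift by (simp add: 3)
  qed
  then show ?case using D by simp
qed

text \<open>The cancellation behind the naturality of the exterior derivative, with S a second
  derivative. The terms for (i, j) and (j, i) arise from one list that carries the same vector in
  both slots by deleting one of these slots, so \<open>alt_form_omit_repeat\<close> applies.\<close>

lemma alt_form_symmetric_cancel:
  assumes b: "alt_form k \<beta>" and l: "length vs = Suc k" and sym: "\<And>v w. S v w = S w v"
  shows "(\<Sum>i<Suc k. (-1) ^ i * (\<Sum>j<k. \<beta> ((map A (omit i vs))[j := S (omit i vs ! j) (vs ! i)]))) = 0"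
proof -
  let ?a = "map A vs"
  define t where "t i j = (-1) ^ i * \<beta> (omit i (?a[j := S (vs ! j) (vs ! i)]))" for i j
  have inner: "(-1) ^ i * (\<Sum>j<k. \<beta> ((map A (omit i vs))[j := S (omit i vs ! j) (vs ! i)]))
      = (\<Sum>j\<in>{..<Suc k} - {i}. t i j)" if i: "i < Suc k" for i
  proof -
    \<comment> \<open>Translates positions after the deletion of entry i back into positions in
      \<open>vs\<close>, so that both summations range over the same index set.\<close>
    let ?f = "\<lambda>j. if j < i then j else Suc j"
    have bij: "bij_betw ?f {..<k} ({..<Suc k} - {i})"
    proof (rule bij_betw_imageI)
      show "inj_on ?f {..<k}" by (auto simp: inj_on_def split: if_splits)
      show "?f ` {..<k} = {..<Suc k} - {i}"
      proof
        show "{..<Suc k} - {i} \<subseteq> ?f ` {..<k}"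
        proof
          fix j assume j: "j \<in> {..<Suc k} - {i}"
          then show "j \<in> ?f ` {..<k}"
            using i by (cases "j < i") (auto simp: image_iff intro: bexI[of _ j] bexI[of _ "j - 1"])
        qed
      qed (use i in auto)
    qed
    have "(-1) ^ i * \<beta> ((map A (omit i vs))[j := S (omit i vs ! j) (vs ! i)]) = t i (?f j)" if j: "j < k" for j
    proof -
      have n: "omit i vs ! j = vs ! ?f j" using nth_omit[of i vs j] l i j by simp
      have "(omit i ?a)[j := y] = omit i (?a[?f j := y])" for y
        using omit_update_less[of j i ?a y] omit_update_greater[of i "Suc j" ?a y] l i j
        by (cases "j < i") auto
      then show ?thesis by (simp only: t_def n map_omit)
    qed
    then have "(-1) ^ i * (\<Sum>j<k. \<beta> ((map A (omit i vs))[j := S (omit i vs ! j) (vs ! i)]))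
        = (\<Sum>j<k. t i (?f j))" by (simp add: sum_distrib_left)
    also have "\<dots> = (\<Sum>j\<in>{..<Suc k} - {i}. t i j)" by (rule sum.reindex_bij_betw[OF bij])
    finally show ?thesis .
  qed
  have anti: "t i j + t j i = 0" if ij: "i < Suc k" "j < Suc k" "i < j" for i j
  proof -
    let ?w = "S (vs ! j) (vs ! i)"
    let ?c = "?a[i := ?w, j := ?w]"
    have c: "?c = ?a[j := ?w, i := ?w]" using ij by (simp add: list_update_swap)
    have "omit i ?c = omit i (?a[j := ?w])" unfolding c by (rule omit_update_same)
    moreover have "omit j ?c = omit j (?a[i := ?w])" by (rule omit_update_same)
    moreover have "(-1) ^ i * \<beta> (omit i ?c) + (-1) ^ j * \<beta> (omit j ?c) = 0"
      using ij l by (intro alt_form_omit_repeat[OF b]) auto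
    ultimately show ?thesis unfolding t_def sym[of "vs ! i" "vs ! j"] by simp
  qed
  have anti: "t i j + t j i = 0" if ij: "i < Suc k" "j < Suc k" "i \<noteq> j" for i j
    using anti[of i j] anti[of j i] ij by (cases "i < j") auto
  let ?P = "Sigma {..<Suc k} (\<lambda>i. {..<Suc k} - {i})"
  have "(\<Sum>i<Suc k. \<Sum>j\<in>{..<Suc k} - {i}. t i j) = (\<Sum>(i, j)\<in>?P. t i j)"
    by (rule sum.Sigma) auto
  moreover have "(\<Sum>(i, j)\<in>?P. t i j) = (\<Sum>(i, j)\<in>?P. t j i)"
    by (rule sum.reindex_bij_witness[of _ prod.swap prod.swap]) auto
  moreover have "(\<Sum>(i, j)\<in>?P. t i j) + (\<Sum>(i, j)\<in>?P. t j i) = 0"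
    unfolding sum.distrib[symmetric] by (intro sum.neutral) (auto simp: anti)
  ultimately have "(\<Sum>i<Suc k. \<Sum>j\<in>{..<Suc k} - {i}. t i j) = 0" by linarith
  then show ?thesis using inner by simp
qed

text \<open>\<open>ext_deriv\<close> read in one fixed chart: no chart is selected at the point, so
  the expression can be pulled back along chart changes.\<close>

definition ext_d :: "('e::euclidean_space \<Rightarrow> 'e list \<Rightarrow> real) \<Rightarrow> 'e \<Rightarrow> 'e list \<Rightarrow> real" where
  "ext_d \<omega> u vs = (\<Sum>i<length vs. (-1) ^ i * frechet_derivative (\<lambda>u. \<omega> u (omit i vs)) (at u) (vs ! i))"

lemma alt_form_ext_d:
  fixes \<omega> :: "'e::euclidean_space \<Rightarrow> 'e list \<Rightarrow> real"
  assumes S: "open S" "u \<in> S" and a: "\<And>x. x \<in> S \<Longrightarrow> alt_form k (\<omega> x)"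
    and d: "\<And>ws. (\<lambda>x. \<omega> x ws) differentiable (at u)"
  shows "alt_form (Suc k) (ext_d \<omega> u)"
proof -
  let ?D = "\<lambda>ws. frechet_derivative (\<lambda>x. \<omega> x ws) (at u)"
  have D: "((\<lambda>x. \<omega> x ws) has_derivative ?D ws) (at u)" for ws
    using d frechet_derivative_works by blast
  have a': "alt_form k (\<lambda>ws. ?D ws v)" for v by (rule alt_form_derivative[OF S a D])
  have "alt_form (Suc k) (\<lambda>vs. if length vs = Suc k
      then \<Sum>i<length vs. (-1) ^ i * ?D (omit i vs) (vs ! i) else 0)"
    by (rule alt_form_antisymmetrize[where \<Phi> = "\<lambda>v ws. ?D ws v", OF a' has_derivative_linear[OF D]])
  moreover have "ext_d \<omega> u vs = 0" if "length vs \<noteq> Suc k" for vs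
    unfolding ext_d_def
  proof (intro sum.neutral ballI)
    fix i assume "i \<in> {..<length vs}"
    then have "length (omit i vs) \<noteq> k" using that by (auto simp: length_omit)
    then show "(-1) ^ i * ?D (omit i vs) (vs ! i) = 0" using alt_form_length[OF a'] by simp
  qed
  then have "ext_d \<omega> u = (\<lambda>vs. if length vs = Suc k
      then \<Sum>i<length vs. (-1) ^ i * ?D (omit i vs) (vs ! i) else 0)"
    by (auto simp: ext_d_def fun_eq_iff)
  ultimately show ?thesis by simp
qed

text \<open>Differentiating the pulled-back coefficients yields the pulled-back derivative plus
  terms with the second derivative of \<tau>, which cancel by its symmetry. On lists of the wrong
  length both sides are 0.\<close>

lemma ext_d_pullback:
  fixes \<tau> :: "'e::euclidean_space \<Rightarrow> 'e" and \<omega> :: "'e \<Rightarrow> 'e list \<Rightarrow> real"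
  assumes S: "open S" "u \<in> S" and \<tau>: "Ck_on 2 S \<tau>" and T: "open T" "\<tau> ` S \<subseteq> T"
    and a: "\<And>x. x \<in> T \<Longrightarrow> alt_form k (\<omega> x)"
    and d: "\<And>ws. (\<lambda>x. \<omega> x ws) differentiable (at (\<tau> u))"
    and \<omega>': "\<And>x ws. x \<in> S \<Longrightarrow> \<omega>' x ws = \<omega> (\<tau> x) (map (frechet_derivative \<tau> (at x)) ws)"
  shows "(\<lambda>x. \<omega>' x ws) differentiable (at u)"
    and "ext_d \<omega>' u vs = ext_d \<omega> (\<tau> u) (map (frechet_derivative \<tau> (at u)) vs)"
proof -
  let ?A = "\<lambda>x. frechet_derivative \<tau> (at x)"
  let ?A' = "\<lambda>w. frechet_derivative (\<lambda>x. ?A x w) (at u)"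
  let ?D = "\<lambda>ws. frechet_derivative (\<lambda>x. \<omega> x ws) (at (\<tau> u))"
  have \<tau>1: "Ck_on 1 S \<tau>" by (rule Ck_on_mono[OF \<tau>]) simp
  have \<tau>D: "(\<tau> has_derivative ?A u) (at u)" by (rule Ck1_has_derivative[OF \<tau>1 S(2)])
  have A2: "Ck_on 1 S (\<lambda>x. ?A x w)" for w using \<tau> by (simp add: numeral_2_eq_2)
  have A': "((\<lambda>x. ?A x w) has_derivative ?A' w) (at u)" for w by (rule Ck1_has_derivative[OF A2 S(2)])
  have D: "((\<lambda>x. \<omega> x ws) has_derivative ?D ws) (at (\<tau> u))" for ws
    using d frechet_derivative_works by blast
  have a\<tau>: "alt_form k (\<omega> (\<tau> x))" if "x \<in> S" for x using a T that by blast
  have d\<tau>: "((\<lambda>x. \<omega> (\<tau> x) ws) has_derivative (\<lambda>h. ?D ws (?A u h))) (at u)" for ws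
    by (rule has_derivative_compose[OF \<tau>D D])
  let ?P = "\<lambda>ws h. ?D (map (?A u) ws) (?A u h)
      + (\<Sum>j<length ws. \<omega> (\<tau> u) ((map (?A u) ws)[j := ?A' (ws ! j) h]))"
  have main: "((\<lambda>x. \<omega>' x ws) has_derivative ?P ws) (at u)" if "length ws = k" for ws
  proof -
    have "((\<lambda>x. \<omega> (\<tau> x) (map (?A x) ws)) has_derivative ?P ws) (at u)"
      using has_derivative_alt_form_map[where \<alpha> = "\<lambda>x. \<omega> (\<tau> x)" and pre = "[]" and A = ?A and ws = ws,
          OF S a\<tau> d\<tau> A'] that by simp
    then show ?thesis by (rule has_derivative_transform_within_open[OF _ S]) (simp add: \<omega>')
  qed
  have zero: "((\<lambda>x. \<omega>' x ws) has_derivative (\<lambda>_. 0)) (at u)" if "length ws \<noteq> k" for ws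
    by (rule has_derivative_transform_within_open[of "\<lambda>_. 0", OF _ S])
       (use \<omega>' alt_form_length[OF a\<tau>] that in auto)
  show "(\<lambda>x. \<omega>' x ws) differentiable (at u)" using main zero unfolding differentiable_def by blast
  show "ext_d \<omega>' u vs = ext_d \<omega> (\<tau> u) (map (?A u) vs)"
  proof (cases "length vs = Suc k")
    case True
    have fd: "frechet_derivative (\<lambda>x. \<omega>' x (omit i vs)) (at u) = ?P (omit i vs)" if "i < Suc k" for i
      by (rule frechet_derivative_at[symmetric], rule main) (use that True in \<open>simp add: length_omit\<close>)
    have "ext_d \<omega>' u vs = (\<Sum>i<Suc k. (-1) ^ i * ?P (omit i vs) (vs ! i))"
      unfolding ext_d_def True using fd by (intro sum.cong) auto
    also have "\<dots> = (\<Sum>i<Suc k. (-1) ^ i * ?D (map (?A u) (omit i vs)) (?A u (vs ! i)))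
        + (\<Sum>i<Suc k. (-1) ^ i * (\<Sum>j<k. \<omega> (\<tau> u) ((map (?A u) (omit i vs))[j := ?A' (omit i vs ! j) (vs ! i)])))"
      unfolding sum.distrib[symmetric] using True by (intro sum.cong) (auto simp: length_omit distrib_left)
    also have "(\<Sum>i<Suc k. (-1) ^ i * (\<Sum>j<k. \<omega> (\<tau> u) ((map (?A u) (omit i vs))[j := ?A' (omit i vs ! j) (vs ! i)]))) = 0"
      by (rule alt_form_symmetric_cancel[OF a\<tau>[OF S(2)] True symmetric_second_derivative[OF S \<tau>]])
    also have "(\<Sum>i<Suc k. (-1) ^ i * ?D (map (?A u) (omit i vs)) (?A u (vs ! i))) = ext_d \<omega> (\<tau> u) (map (?A u) vs)"
      unfolding ext_d_def length_map True by (intro sum.cong) (auto simp: map_omit True)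
    finally show ?thesis by simp
  next
    case False
    have fd: "frechet_derivative (\<lambda>x. \<omega>' x (omit i vs)) (at u) = (\<lambda>_. 0)" if "i < length vs" for i
      by (rule frechet_derivative_at[symmetric], rule zero) (use that False in \<open>simp add: length_omit\<close>)
    then have "ext_d \<omega>' u vs = 0" unfolding ext_d_def by (intro sum.neutral) auto
    moreover have "alt_form (Suc k) (ext_d \<omega> (\<tau> u))"
      using alt_form_ext_d[OF T(1) _ a d] S T by blast
    then have "ext_d \<omega> (\<tau> u) (map (?A u) vs) = 0" using alt_form_length False by (metis length_map)
    ultimately show ?thesis by simp
  qed
qed

text \<open>Differentiating the relation between X and X' along Y, and the one between Y and Y'
  along X, produces the second derivative of \<tau> on the pair in both orders; by symmetry it drops
  out of the bracket.\<close>

lemma bracket_pushforward: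
  fixes \<tau> X Y X' Y' :: "'e::euclidean_space \<Rightarrow> 'e"
  assumes S: "open S" "u \<in> S" and \<tau>: "Ck_on 2 S \<tau>"
    and X: "X differentiable (at u)" "X' differentiable (at (\<tau> u))"
      "\<And>x. x \<in> S \<Longrightarrow> X' (\<tau> x) = frechet_derivative \<tau> (at x) (X x)"
    and Y: "Y differentiable (at u)" "Y' differentiable (at (\<tau> u))"
      "\<And>x. x \<in> S \<Longrightarrow> Y' (\<tau> x) = frechet_derivative \<tau> (at x) (Y x)"
  shows "frechet_derivative Y' (at (\<tau> u)) (X' (\<tau> u)) - frechet_derivative X' (at (\<tau> u)) (Y' (\<tau> u))
    = frechet_derivative \<tau> (at u) (frechet_derivative Y (at u) (X u) - frechet_derivative X (at u) (Y u))"
proof -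
  let ?A = "\<lambda>x. frechet_derivative \<tau> (at x)"
  let ?A' = "\<lambda>w. frechet_derivative (\<lambda>x. ?A x w) (at u)"
  have \<tau>1: "Ck_on 1 S \<tau>" by (rule Ck_on_mono[OF \<tau>]) simp
  have \<tau>D: "(\<tau> has_derivative ?A x) (at x)" if "x \<in> S" for x by (rule Ck1_has_derivative[OF \<tau>1 that])
  have lA: "linear (?A x)" if "x \<in> S" for x using has_derivative_linear[OF \<tau>D[OF that]] .
  have A2: "Ck_on 1 S (\<lambda>x. ?A x w)" for w using \<tau> by (simp add: numeral_2_eq_2)
  have A': "((\<lambda>x. ?A x w) has_derivative ?A' w) (at u)" for w by (rule Ck1_has_derivative[OF A2 S(2)])
  have expand: "T w = (\<Sum>b\<in>Basis. (w \<bullet> b) *\<^sub>R T b)" if "linear T" for T :: "'e \<Rightarrow> 'e" and w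
  proof -
    have "T (\<Sum>b\<in>Basis. (w \<bullet> b) *\<^sub>R b) = (\<Sum>b\<in>Basis. (w \<bullet> b) *\<^sub>R T b)"
      by (simp add: linear_sum[OF that] linear_scale[OF that])
    then show ?thesis by (simp add: euclidean_representation)
  qed
  have A'_sum: "?A' w h = (\<Sum>b\<in>Basis. (w \<bullet> b) *\<^sub>R ?A' b h)" for w h
  proof -
    have "((\<lambda>x. \<Sum>b\<in>Basis. (w \<bullet> b) *\<^sub>R ?A x b) has_derivative (\<lambda>h. \<Sum>b\<in>Basis. (w \<bullet> b) *\<^sub>R ?A' b h)) (at u)"
      by (intro has_derivative_sum has_derivative_scaleR_right A')
    then have "((\<lambda>x. ?A x w) has_derivative (\<lambda>h. \<Sum>b\<in>Basis. (w \<bullet> b) *\<^sub>R ?A' b h)) (at u)"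
      by (rule has_derivative_transform_within_open[OF _ S]) (rule expand[OF lA, symmetric])
    from has_derivative_unique[OF A' this] show ?thesis by metis
  qed
  have D: "frechet_derivative X' (at (\<tau> u)) (?A u h) = ?A' (X u) h + ?A u (frechet_derivative X (at u) h)"
    if X: "X differentiable (at u)" "X' differentiable (at (\<tau> u))"
      "\<And>x. x \<in> S \<Longrightarrow> X' (\<tau> x) = ?A x (X x)" for X X' :: "'e \<Rightarrow> 'e" and h
  proof -
    let ?X = "frechet_derivative X (at u)"
    have XD: "(X has_derivative ?X) (at u)" using X(1) frechet_derivative_works by blast
    have "((\<lambda>x. \<Sum>b\<in>Basis. (X x \<bullet> b) *\<^sub>R ?A x b) has_derivative
        (\<lambda>h. \<Sum>b\<in>Basis. (X u \<bullet> b) *\<^sub>R ?A' b h + (?X h \<bullet> b) *\<^sub>R ?A u b)) (at u)"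
      by (intro has_derivative_sum has_derivative_scaleR has_derivative_inner_left XD A')
    then have 1: "((\<lambda>x. X' (\<tau> x)) has_derivative
        (\<lambda>h. \<Sum>b\<in>Basis. (X u \<bullet> b) *\<^sub>R ?A' b h + (?X h \<bullet> b) *\<^sub>R ?A u b)) (at u)"
      by (rule has_derivative_transform_within_open[OF _ S]) (simp add: X(3) expand[OF lA, symmetric])
    have "((\<lambda>x. X' (\<tau> x)) has_derivative (\<lambda>h. frechet_derivative X' (at (\<tau> u)) (?A u h))) (at u)"
      by (rule has_derivative_compose[OF \<tau>D[OF S(2)]]) (use X(2) frechet_derivative_works in blast)
    from fun_cong[OF has_derivative_unique[OF this 1], of h] show ?thesis
      by (simp add: sum.distrib flip: A'_sum expand[OF lA[OF S(2)]])
  qed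
  have s: "?A' v w = ?A' w v" for v w by (rule symmetric_second_derivative[OF S \<tau>])
  show ?thesis
    using D[OF X, of "Y u"] D[OF Y, of "X u"] X(3)[OF S(2)] Y(3)[OF S(2)] s[of "X u" "Y u"]
    by (simp add: linear_diff[OF lA[OF S(2)]])
qed

section \<open>Charts and left translations\<close>

text \<open>Differentiability with respect to arbitrary charts, as the charts selected by
  \<open>chart_at\<close> may jump from point to point. Continuity of f is included because the
  coordinate expression alone does not keep nearby values inside the domain of c'.\<close>

definition mdiff :: "('g::t2_space, 'e::euclidean_space) chart \<Rightarrow> ('g, 'e) chart \<Rightarrow> ('g \<Rightarrow> 'g) \<Rightarrow> 'g \<Rightarrow> bool" where
  "mdiff c c' f x \<longleftrightarrow> x \<in> fst c \<and> f x \<in> fst c' \<and> isCont f x \<and>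
     (snd c' \<circ> f \<circ> chart_inv c) differentiable (at (snd c x))"

definition dmap :: "('g, 'e::euclidean_space) chart \<Rightarrow> ('g, 'e) chart \<Rightarrow> ('g \<Rightarrow> 'g) \<Rightarrow> 'g \<Rightarrow> 'e \<Rightarrow> 'e" where
  "dmap c c' f x = frechet_derivative (snd c' \<circ> f \<circ> chart_inv c) (at (snd c x))"

lemma mdiff_has_derivative:
  "mdiff c c' f x \<Longrightarrow> (snd c' \<circ> f \<circ> chart_inv c has_derivative dmap c c' f x) (at (snd c x))"
  unfolding mdiff_def dmap_def using frechet_derivative_works by blast

lemma linear_dmap: "mdiff c c' f x \<Longrightarrow> linear (dmap c c' f x)"
  using mdiff_has_derivative has_derivative_linear by blast

lemma representation_image_sum:
  assumes "independent (e ` I)" "inj_on e I" "finite I" "a \<in> I"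
  shows "representation (e ` I) (\<Sum>b\<in>I. c b *\<^sub>R e b) (e a) = c a"
proof -
  have s: "e b \<in> span (e ` I)" if "b \<in> I" for b using that by (intro span_base) auto
  have "representation (e ` I) (\<Sum>b\<in>I. c b *\<^sub>R e b) = (\<lambda>v. \<Sum>b\<in>I. representation (e ` I) (c b *\<^sub>R e b) v)"
    by (rule representation_sum[OF assms(1)]) (auto intro: span_scale s)
  also have "\<dots> = (\<lambda>v. \<Sum>b\<in>I. c b * representation (e ` I) (e b) v)"
    using representation_scale[OF assms(1) s] by (auto intro!: sum.cong ext)
  finally have "representation (e ` I) (\<Sum>b\<in>I. c b *\<^sub>R e b) (e a) = (\<Sum>b\<in>I. c b * representation (e ` I) (e b) (e a))"
    by simp
  also have "\<dots> = (\<Sum>b\<in>I. if b = a then c a else 0)"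
  proof (intro sum.cong refl)
    fix b assume b: "b \<in> I"
    have "representation (e ` I) (e b) = (\<lambda>v. if v = e b then 1 else 0)"
      using representation_basis[OF assms(1)] b by blast
    then show "c b * representation (e ` I) (e b) (e a) = (if b = a then c a else 0)"
      using inj_on_eq_iff[OF assms(2) assms(4) b] by auto
  qed
  also have "\<dots> = c a" using assms by simp
  finally show ?thesis .
qed

text \<open>\<open>frame_coeff\<close> is defined by \<open>representation\<close> over an image
  set, so injectivity of the family has to accompany independence of the set; on coefficients the
  two together become one condition.\<close>

lemma independent_image_iff:
  assumes "finite I"
  shows "inj_on e I \<and> independent (e ` I) \<longleftrightarrow> (\<forall>c. (\<Sum>b\<in>I. c b *\<^sub>R e b) = 0 \<longrightarrow> (\<forall>b\<in>I. c b = 0))"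
    (is "?l \<longleftrightarrow> ?r")
proof
  assume l: ?l
  show ?r
  proof (intro allI impI ballI)
    fix c b assume c: "(\<Sum>b\<in>I. c b *\<^sub>R e b) = 0" and b: "b \<in> I"
    have "representation (e ` I) (\<Sum>b\<in>I. c b *\<^sub>R e b) (e b) = c b"
      by (rule representation_image_sum) (use l assms b in auto)
    then show "c b = 0" unfolding c by (simp add: representation_zero)
  qed
next
  assume r: ?r
  have inj: "inj_on e I"
  proof (rule inj_onI, rule ccontr)
    fix a b assume ab: "a \<in> I" "b \<in> I" "e a = e b" "a \<noteq> b"
    let ?c = "\<lambda>i. (if i = a then 1 else 0) - (if i = b then 1 else (0::real))"
    have "(\<Sum>i\<in>I. ?c i *\<^sub>R e i) = (\<Sum>i\<in>I. (if i = a then e a else 0) - (if i = b then e b else 0))"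
      by (intro sum.cong) (auto simp: scaleR_diff_left)
    also have "\<dots> = 0" using ab assms by (simp add: sum_subtractf)
    finally have "(\<Sum>i\<in>I. ?c i *\<^sub>R e i) = 0" .
    from r[rule_format, OF this ab(1)] have "?c a = 0" .
    then show False using ab(4) by simp
  qed
  have "\<not> dependent (e ` I)"
  proof
    assume "dependent (e ` I)"
    then obtain u v where u: "v \<in> e ` I" "u v \<noteq> 0" "(\<Sum>v\<in>e ` I. u v *\<^sub>R v) = 0"
      using dependent_finite[of "e ` I"] assms by auto
    then have "(\<Sum>b\<in>I. u (e b) *\<^sub>R e b) = 0" by (simp add: sum.reindex[OF inj])
    then have "\<forall>b\<in>I. u (e b) = 0" using r[rule_format, of "\<lambda>b. u (e b)"] by blast
    then show False using u by auto
  qed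
  with inj show ?l by simp
qed

lemma alt_form_1:
  assumes "linear f"
  shows "alt_form 1 (\<lambda>vs. if length vs = 1 then f (hd vs) else 0)"
  using assms by (auto simp: alt_form_def length_Suc_conv)

locale carnot_space =
  fixes G :: "('g::{t2_space, second_countable_topology}, 'e::euclidean_space) carnot_struct"
  assumes carnot: "carnot_group G"
begin

lemma lie: "lie_group G" and strat: "stratified G" and adapted: "adapted_frame G"
  using carnot by (simp_all add: carnot_group_def)

lemma grp: "group G" and carrier_UNIV: "carrier G = UNIV" and atlas: "smooth_atlas (atlas G)"
  and mult_cont: "continuous_on UNIV (\<lambda>(x, y). x \<otimes>\<^bsub>G\<^esub> y)"
  using lie by (simp_all add: lie_group_def)

lemma mul_one: "x \<otimes>\<^bsub>G\<^esub> \<one>\<^bsub>G\<^esub> = x" "\<one>\<^bsub>G\<^esub> \<otimes>\<^bsub>G\<^esub> x = x"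
  using monoid.r_one[OF group.is_monoid[OF grp]] monoid.l_one[OF group.is_monoid[OF grp]]
  by (simp_all add: carrier_UNIV)

lemma mul_inv_cancel: "inv\<^bsub>G\<^esub> x \<otimes>\<^bsub>G\<^esub> (x \<otimes>\<^bsub>G\<^esub> y) = y" "x \<otimes>\<^bsub>G\<^esub> (inv\<^bsub>G\<^esub> x \<otimes>\<^bsub>G\<^esub> y) = y"
  using monoid.m_assoc[OF group.is_monoid[OF grp], of "inv\<^bsub>G\<^esub> x" x y]
    monoid.m_assoc[OF group.is_monoid[OF grp], of x "inv\<^bsub>G\<^esub> x" y]
    group.l_inv[OF grp, of x] group.r_inv[OF grp, of x] mul_one by (simp_all add: carrier_UNIV)

lemma inv_mul: "inv\<^bsub>G\<^esub> x \<otimes>\<^bsub>G\<^esub> x = \<one>\<^bsub>G\<^esub>"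
  using group.l_inv[OF grp, of x] by (simp add: carrier_UNIV)

lemma chart_at: "chart_at G x \<in> atlas G" "x \<in> fst (chart_at G x)"
proof -
  have "\<exists>c. c \<in> atlas G \<and> x \<in> fst c" using atlas unfolding smooth_atlas_def by blast
  from someI_ex[OF this] show "chart_at G x \<in> atlas G" "x \<in> fst (chart_at G x)"
    by (simp_all add: chart_at_def)
qed

context
  fixes c :: "('g, 'e) chart"
  assumes c: "c \<in> atlas G"
begin

lemma chart_homeo: "homeomorphism (fst c) (snd c ` fst c) (snd c) (chart_inv c)"
  and open_dom: "open (fst c)" and open_img: "open (snd c ` fst c)"
  using atlas c by (simp_all add: smooth_atlas_def)

lemma chart_left: "x \<in> fst c \<Longrightarrow> chart_inv c (snd c x) = x"
  using homeomorphism_apply1[OF chart_homeo] .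

lemma chart_right: "u \<in> snd c ` fst c \<Longrightarrow> snd c (chart_inv c u) = u"
  using homeomorphism_apply2[OF chart_homeo] .

lemma chart_inv_in: "u \<in> snd c ` fst c \<Longrightarrow> chart_inv c u \<in> fst c"
  by (rule inv_into_into)

lemma chart_cont: "continuous_on (fst c) (snd c)" "continuous_on (snd c ` fst c) (chart_inv c)"
  using homeomorphism_cont1[OF chart_homeo] homeomorphism_cont2[OF chart_homeo] by blast+

lemma chart_image: "snd c ` (W \<inter> fst c) = snd c ` fst c \<inter> chart_inv c -` W"
proof
  show "snd c ` fst c \<inter> chart_inv c -` W \<subseteq> snd c ` (W \<inter> fst c)"
  proof
    fix u assume u: "u \<in> snd c ` fst c \<inter> chart_inv c -` W"
    then have "u = snd c (chart_inv c u)" "chart_inv c u \<in> W \<inter> fst c"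
      using chart_right chart_inv_in by auto
    then show "u \<in> snd c ` (W \<inter> fst c)" by (rule image_eqI)
  qed
qed (use chart_left in auto)

lemma chart_image_open: "open W \<Longrightarrow> open (snd c ` (W \<inter> fst c))"
  unfolding chart_image by (intro continuous_open_preimage chart_cont open_img)

end

lemma transition_Ck:
  assumes "c \<in> atlas G" "c' \<in> atlas G"
  shows "Ck_on k (snd c ` (fst c \<inter> fst c')) (snd c' \<circ> chart_inv c)"
    and "open (snd c ` (fst c \<inter> fst c'))"
  using atlas assms chart_image_open[OF assms(1) open_dom[OF assms(2)]]
  by (simp_all add: smooth_atlas_def smooth_on_def Int_commute)

lemma mdiff_chain:
  assumes c: "c \<in> atlas G" "c' \<in> atlas G"
    and f: "mdiff c c' f x" and g: "mdiff c' c'' g (f x)"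
  shows "mdiff c c'' (g \<circ> f) x" "dmap c c'' (g \<circ> f) x v = dmap c' c'' g (f x) (dmap c c' f x v)"
proof -
  have x: "x \<in> fst c" "f x \<in> fst c'" "isCont f x" using f by (auto simp: mdiff_def)
  have fx: "(snd c' \<circ> f \<circ> chart_inv c) (snd c x) = snd c' (f x)" using chart_left[OF c(1) x(1)] by simp
  \<comment> \<open>By continuity f stays in the domain of c' near x; only there do the coordinate
    expressions compose.\<close>
  obtain N where N: "open N" "x \<in> N" "\<And>y. y \<in> N \<Longrightarrow> f y \<in> fst c'"
    using x(2,3) open_dom[OF c(2)] unfolding continuous_at_open by metis
  have "((\<lambda>u. (snd c'' \<circ> g \<circ> chart_inv c') ((snd c' \<circ> f \<circ> chart_inv c) u)) has_derivative
      (\<lambda>v. dmap c' c'' g (f x) (dmap c c' f x v))) (at (snd c x))"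
    by (rule has_derivative_compose[OF mdiff_has_derivative[OF f]])
       (unfold fx, rule mdiff_has_derivative[OF g])
  then have D: "(snd c'' \<circ> (g \<circ> f) \<circ> chart_inv c has_derivative
      (\<lambda>v. dmap c' c'' g (f x) (dmap c c' f x v))) (at (snd c x))"
  proof (rule has_derivative_transform_within_open[where s = "snd c ` (N \<inter> fst c)"])
    show "open (snd c ` (N \<inter> fst c))" by (rule chart_image_open[OF c(1) N(1)])
    show "snd c x \<in> snd c ` (N \<inter> fst c)" using N x by blast
    fix u assume "u \<in> snd c ` (N \<inter> fst c)"
    then have "f (chart_inv c u) \<in> fst c'" using N(3) chart_left[OF c(1)] by auto
    then show "(snd c'' \<circ> g \<circ> chart_inv c') ((snd c' \<circ> f \<circ> chart_inv c) u) = (snd c'' \<circ> (g \<circ> f) \<circ> chart_inv c) u"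
      using chart_left[OF c(2)] by simp
  qed
  from fun_cong[OF frechet_derivative_at[OF D]]
  show "dmap c c'' (g \<circ> f) x v = dmap c' c'' g (f x) (dmap c c' f x v)" unfolding dmap_def by metis
  show "mdiff c c'' (g \<circ> f) x"
    using D x g by (auto simp: mdiff_def differentiable_def intro: continuous_at_compose)
qed

lemma mdiff_id:
  assumes "c \<in> atlas G" "c' \<in> atlas G" "x \<in> fst c" "x \<in> fst c'"
  shows "mdiff c c' id x" "dmap c c' id x = change_coords c c' x"
proof -
  have "Ck_on 1 (snd c ` (fst c \<inter> fst c')) (snd c' \<circ> chart_inv c)" by (rule transition_Ck[OF assms(1,2)])
  then show "mdiff c c' id x" using assms by (auto simp: mdiff_def)
  show "dmap c c' id x = change_coords c c' x" by (simp add: dmap_def change_coords_def)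
qed

lemma change_coords_compose:
  assumes "c \<in> atlas G" "c' \<in> atlas G" "c'' \<in> atlas G" "x \<in> fst c" "x \<in> fst c'" "x \<in> fst c''"
  shows "change_coords c' c'' x (change_coords c c' x v) = change_coords c c'' x v"
  using mdiff_chain(2)[of c c' id x c'' id v] mdiff_id assms by simp

lemma change_coords_id:
  assumes "c \<in> atlas G" "x \<in> fst c"
  shows "change_coords c c x v = v"
proof -
  have "((\<lambda>u. u) has_derivative (\<lambda>v. v)) (at (snd c x))" by (rule has_derivative_ident)
  then have "((snd c \<circ> chart_inv c) has_derivative (\<lambda>v. v)) (at (snd c x))"
    by (rule has_derivative_transform_within_open[OF _ open_img[OF assms(1)]])
       (use assms chart_right in auto)
  from fun_cong[OF frechet_derivative_at[OF this], of v] show ?thesis by (simp add: change_coords_def)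
qed

lemma change_coords_inverse:
  assumes "c \<in> atlas G" "c' \<in> atlas G" "x \<in> fst c" "x \<in> fst c'"
  shows "change_coords c' c x (change_coords c c' x v) = v"
  using change_coords_compose[of c c' c x v] change_coords_id[of c x v] assms by simp

lemma linear_change_coords:
  assumes "c \<in> atlas G" "c' \<in> atlas G" "x \<in> fst c" "x \<in> fst c'"
  shows "linear (change_coords c c' x)"
  using linear_dmap[OF mdiff_id(1)[OF assms]] mdiff_id(2)[OF assms] by simp

text \<open>Composition with the identity map, read in two different charts, on either side of
  f.\<close>

lemma mdiff_change:
  assumes c: "c \<in> atlas G" "c' \<in> atlas G" and d: "d \<in> atlas G" "d' \<in> atlas G"
    and f: "mdiff c c' f x" and x: "x \<in> fst d" "f x \<in> fst d'"
  shows "mdiff d d' f x"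
    and "dmap d d' f x (change_coords c d x v) = change_coords c' d' (f x) (dmap c c' f x v)"
proof -
  have xc: "x \<in> fst c" "f x \<in> fst c'" using f by (auto simp: mdiff_def)
  have m1: "mdiff d c id x" and m2: "mdiff c' d' id (f x)" and m3: "mdiff c d id x"
    by (auto intro!: mdiff_id c d x xc)
  have "mdiff d c' (f \<circ> id) x" by (rule mdiff_chain(1)[OF d(1) c(1) m1]) (use f in simp)
  then have "mdiff d c' f x" by (simp only: comp_id)
  from mdiff_chain(1)[OF d(1) c(2) this m2] show m: "mdiff d d' f x" by (simp only: id_comp)
  have "dmap c d' (f \<circ> id) x v = dmap d d' f (id x) (dmap c d id x v)"
    by (rule mdiff_chain(2)[OF c(1) d(1) m3]) (use m in simp)
  moreover have "dmap c d' (id \<circ> f) x v = dmap c' d' id (f x) (dmap c c' f x v)"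
    by (rule mdiff_chain(2)[OF c(1) c(2) f m2])
  ultimately show "dmap d d' f x (change_coords c d x v) = change_coords c' d' (f x) (dmap c c' f x v)"
    using mdiff_id(2)[OF c(1) d(1) xc(1) x(1)] mdiff_id(2)[OF c(2) d(2) xc(2) x(2)] by simp
qed

lemma Ck_map_mdiff:
  assumes "open W" "Ck_map 1 G W f" "c \<in> atlas G" "c' \<in> atlas G" "x \<in> W" "x \<in> fst c" "f x \<in> fst c'"
  shows "mdiff c c' f x"
proof -
  have "isCont f x" using assms continuous_on_eq_continuous_at by (auto simp: Ck_map_def)
  moreover have "Ck_on 1 (snd c ` (W \<inter> fst c \<inter> f -` fst c')) (snd c' \<circ> f \<circ> chart_inv c)"
    using assms by (auto simp: Ck_map_def simp del: Ck_on.simps)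
  ultimately show ?thesis using assms by (auto simp: mdiff_def)
qed

section \<open>Left translations in charts\<close>

lemma mult_chart:
  assumes c: "c1 \<in> atlas G" "c2 \<in> atlas G" "c3 \<in> atlas G"
  defines "S \<equiv> {(snd c1 x, snd c2 y) | x y. x \<in> fst c1 \<and> y \<in> fst c2 \<and> x \<otimes>\<^bsub>G\<^esub> y \<in> fst c3}"
  shows "Ck_on k S (\<lambda>(u, w). snd c3 (chart_inv c1 u \<otimes>\<^bsub>G\<^esub> chart_inv c2 w))" "open S"
proof -
  show "Ck_on k S (\<lambda>(u, w). snd c3 (chart_inv c1 u \<otimes>\<^bsub>G\<^esub> chart_inv c2 w))"
    using lie c by (auto simp: lie_group_def smooth_on_def S_def)
  let ?P = "\<lambda>p. chart_inv c1 (fst p) \<otimes>\<^bsub>G\<^esub> chart_inv c2 (snd p)"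
  let ?I = "snd c1 ` fst c1 \<times> snd c2 ` fst c2"
  have "continuous_on ?I (\<lambda>p. (\<lambda>(x, y). x \<otimes>\<^bsub>G\<^esub> y) (chart_inv c1 (fst p), chart_inv c2 (snd p)))"
    by (intro continuous_on_compose2[OF mult_cont] continuous_on_Pair
        continuous_on_compose2[OF chart_cont(2)[OF c(1)]] continuous_on_compose2[OF chart_cont(2)[OF c(2)]]
        continuous_intros) auto
  then have "open (?I \<inter> ?P -` fst c3)"
    by (intro continuous_open_preimage open_Times open_img open_dom c) simp
  moreover have "S = ?I \<inter> ?P -` fst c3"
  proof
    show "S \<subseteq> ?I \<inter> ?P -` fst c3" using chart_left[OF c(1)] chart_left[OF c(2)] by (auto simp: S_def)
    show "?I \<inter> ?P -` fst c3 \<subseteq> S"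
    proof
      fix p assume p: "p \<in> ?I \<inter> ?P -` fst c3"
      then have "p = (snd c1 (chart_inv c1 (fst p)), snd c2 (chart_inv c2 (snd p)))"
        using chart_right[OF c(1)] chart_right[OF c(2)] by auto
      moreover have "chart_inv c1 (fst p) \<in> fst c1" "chart_inv c2 (snd p) \<in> fst c2" "?P p \<in> fst c3"
        using p chart_inv_in[OF c(1)] chart_inv_in[OF c(2)] by auto
      ultimately show "p \<in> S" unfolding S_def by blast
    qed
  qed
  ultimately show "open S" by simp
qed

text \<open>The differential of a left translation is a partial derivative of the multiplication
  map, which gives access to its dependence on x.\<close>

lemma left_translation_derivative:
  assumes c: "c1 \<in> atlas G" "c \<in> atlas G" "c' \<in> atlas G"
    and x: "x \<in> fst c1" "y \<in> fst c" "x \<otimes>\<^bsub>G\<^esub> y \<in> fst c'"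
  shows "mdiff c c' ((\<otimes>\<^bsub>G\<^esub>) x) y"
    and "dmap c c' ((\<otimes>\<^bsub>G\<^esub>) x) y v
      = frechet_derivative (\<lambda>(u, w). snd c' (chart_inv c1 u \<otimes>\<^bsub>G\<^esub> chart_inv c w)) (at (snd c1 x, snd c y)) (0, v)"
proof -
  let ?m = "\<lambda>(u, w). snd c' (chart_inv c1 u \<otimes>\<^bsub>G\<^esub> chart_inv c w)"
  let ?S = "{(snd c1 x, snd c y) | x y. x \<in> fst c1 \<and> y \<in> fst c \<and> x \<otimes>\<^bsub>G\<^esub> y \<in> fst c'}"
  have "(snd c1 x, snd c y) \<in> ?S" using x by blast
  then have "(?m has_derivative frechet_derivative ?m (at (snd c1 x, snd c y))) (at (snd c1 x, snd c y))"
    by (rule Ck1_has_derivative[OF mult_chart(1)[OF c]])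
  from has_derivative_slice(2)[OF this]
  have D: "((snd c' \<circ> (\<otimes>\<^bsub>G\<^esub>) x \<circ> chart_inv c) has_derivative
      (\<lambda>v. frechet_derivative ?m (at (snd c1 x, snd c y)) (0, v))) (at (snd c y))"
    using chart_left[OF c(1) x(1)] by (simp add: o_def)
  have "continuous_on UNIV (\<lambda>y. (\<lambda>(x, y). x \<otimes>\<^bsub>G\<^esub> y) (x, y))"
    by (intro continuous_on_compose2[OF mult_cont] continuous_intros) auto
  then have "isCont ((\<otimes>\<^bsub>G\<^esub>) x) y" by (simp add: continuous_on_eq_continuous_at)
  then show "mdiff c c' ((\<otimes>\<^bsub>G\<^esub>) x) y" using D x by (auto simp: mdiff_def differentiable_def)
  from fun_cong[OF frechet_derivative_at[OF D], of v]
  show "dmap c c' ((\<otimes>\<^bsub>G\<^esub>) x) y v = frechet_derivative ?m (at (snd c1 x, snd c y)) (0, v)"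
    unfolding dmap_def by simp
qed

text \<open>The matrix of the left-invariant fields in the chart c: applied to v it gives the value
  at x of the field generated by v. In the selected chart this is \<open>left_field\<close>; in a
  fixed chart it is smooth in x.\<close>

definition left_mat :: "('g, 'e) chart \<Rightarrow> 'g \<Rightarrow> 'e \<Rightarrow> 'e" where
  "left_mat c x = dmap (chart_at G \<one>\<^bsub>G\<^esub>) c ((\<otimes>\<^bsub>G\<^esub>) x) \<one>\<^bsub>G\<^esub>"

definition left_mat_inv :: "('g, 'e) chart \<Rightarrow> 'g \<Rightarrow> 'e \<Rightarrow> 'e" where
  "left_mat_inv c x = dmap c (chart_at G \<one>\<^bsub>G\<^esub>) ((\<otimes>\<^bsub>G\<^esub>) (inv\<^bsub>G\<^esub> x)) x"

lemma left_mat_mdiff: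
  assumes "c \<in> atlas G" "x \<in> fst c"
  shows "mdiff (chart_at G \<one>\<^bsub>G\<^esub>) c ((\<otimes>\<^bsub>G\<^esub>) x) \<one>\<^bsub>G\<^esub>"
    and "mdiff c (chart_at G \<one>\<^bsub>G\<^esub>) ((\<otimes>\<^bsub>G\<^esub>) (inv\<^bsub>G\<^esub> x)) x"
proof -
  show "mdiff (chart_at G \<one>\<^bsub>G\<^esub>) c ((\<otimes>\<^bsub>G\<^esub>) x) \<one>\<^bsub>G\<^esub>"
    by (rule left_translation_derivative(1)[OF chart_at(1)[of x]]) (use assms chart_at mul_one in auto)
  show "mdiff c (chart_at G \<one>\<^bsub>G\<^esub>) ((\<otimes>\<^bsub>G\<^esub>) (inv\<^bsub>G\<^esub> x)) x"
    by (rule left_translation_derivative(1)[OF chart_at(1)[of "inv\<^bsub>G\<^esub> x"]]) (use assms chart_at inv_mul in auto)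
qed

lemma linear_left_mat: "c \<in> atlas G \<Longrightarrow> x \<in> fst c \<Longrightarrow> linear (left_mat c x)"
  unfolding left_mat_def by (rule linear_dmap[OF left_mat_mdiff(1)])

lemma left_mat_inverse:
  assumes c: "c \<in> atlas G" "x \<in> fst c"
  shows "left_mat_inv c x (left_mat c x v) = v" "left_mat c x (left_mat_inv c x w) = w"
proof -
  let ?o = "\<one>\<^bsub>G\<^esub>" and ?c1 = "chart_at G \<one>\<^bsub>G\<^esub>"
  have i1: "(\<otimes>\<^bsub>G\<^esub>) (inv\<^bsub>G\<^esub> x) \<circ> (\<otimes>\<^bsub>G\<^esub>) x = id" and i2: "(\<otimes>\<^bsub>G\<^esub>) x \<circ> (\<otimes>\<^bsub>G\<^esub>) (inv\<^bsub>G\<^esub> x) = id"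
    by (auto simp: fun_eq_iff mul_inv_cancel)
  let ?l = "(\<otimes>\<^bsub>G\<^esub>) x" and ?i = "(\<otimes>\<^bsub>G\<^esub>) (inv\<^bsub>G\<^esub> x)"
  have "dmap ?c1 ?c1 (?i \<circ> ?l) ?o v = dmap c ?c1 ?i (?l ?o) (dmap ?c1 c ?l ?o v)"
    by (rule mdiff_chain(2)[OF chart_at(1) c(1) left_mat_mdiff(1)[OF c]])
       (simp add: mul_one left_mat_mdiff(2)[OF c])
  moreover have "dmap ?c1 ?c1 id ?o v = v"
    unfolding mdiff_id(2)[OF chart_at(1) chart_at(1) chart_at(2) chart_at(2)]
    by (rule change_coords_id[OF chart_at])
  ultimately show "left_mat_inv c x (left_mat c x v) = v"
    unfolding i1 by (simp add: left_mat_inv_def left_mat_def mul_one)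
  have "dmap c c (?l \<circ> ?i) x w = dmap ?c1 c ?l (?i x) (dmap c ?c1 ?i x w)"
    by (rule mdiff_chain(2)[OF c(1) chart_at(1) left_mat_mdiff(2)[OF c]])
       (simp add: inv_mul left_mat_mdiff(1)[OF c])
  moreover have "dmap c c id x w = w"
    unfolding mdiff_id(2)[OF c(1) c(1) c(2) c(2)] by (rule change_coords_id[OF c])
  ultimately show "left_mat c x (left_mat_inv c x w) = w"
    unfolding i2 by (simp add: left_mat_inv_def left_mat_def inv_mul)
qed

lemma left_field_eq: "left_field G v x = left_mat (chart_at G x) x v"
  by (simp add: left_field_def differential_def left_mat_def dmap_def mul_one)

lemma change_coords_left_mat:
  assumes "c \<in> atlas G" "x \<in> fst c" "c' \<in> atlas G" "x \<in> fst c'"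
  shows "change_coords c c' x (left_mat c x v) = left_mat c' x v"
proof -
  have "dmap (chart_at G \<one>\<^bsub>G\<^esub>) c' (id \<circ> (\<otimes>\<^bsub>G\<^esub>) x) \<one>\<^bsub>G\<^esub> v
      = dmap c c' id (x \<otimes>\<^bsub>G\<^esub> \<one>\<^bsub>G\<^esub>) (dmap (chart_at G \<one>\<^bsub>G\<^esub>) c ((\<otimes>\<^bsub>G\<^esub>) x) \<one>\<^bsub>G\<^esub> v)"
    by (rule mdiff_chain(2)[OF chart_at(1) assms(1) left_mat_mdiff(1)[OF assms(1,2)]])
       (simp add: mul_one mdiff_id assms)
  then show ?thesis by (simp add: left_mat_def mul_one mdiff_id(2) assms)
qed

text \<open>A partial derivative of the smooth multiplication map, restricted to the slice through
  the identity.\<close>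

lemma left_mat_smooth:
  assumes c: "c \<in> atlas G"
  shows "Ck_on k (snd c ` fst c) (\<lambda>u. left_mat c (chart_inv c u) v)"
proof -
  let ?c1 = "chart_at G \<one>\<^bsub>G\<^esub>" and ?w = "snd (chart_at G \<one>\<^bsub>G\<^esub>) \<one>\<^bsub>G\<^esub>"
  let ?m = "\<lambda>(u, w). snd c (chart_inv c u \<otimes>\<^bsub>G\<^esub> chart_inv ?c1 w)"
  let ?S = "{(snd c x, snd ?c1 y) | x y. x \<in> fst c \<and> y \<in> fst ?c1 \<and> x \<otimes>\<^bsub>G\<^esub> y \<in> fst c}"
  have "Ck_on k ?S (\<lambda>p. frechet_derivative ?m (at p) (0, v))"
    using mult_chart(1)[OF c chart_at(1) c, of "Suc k"] by auto
  from Ck_on_slice[OF mult_chart(2)[OF c chart_at(1) c] this]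
  have "Ck_on k {u. (u, ?w) \<in> ?S} (\<lambda>u. frechet_derivative ?m (at (u, ?w)) (0, v))" .
  moreover have "snd c ` fst c \<subseteq> {u. (u, ?w) \<in> ?S}" using chart_at(2) mul_one by force
  ultimately have "Ck_on k (snd c ` fst c) (\<lambda>u. frechet_derivative ?m (at (u, ?w)) (0, v))"
    by (rule Ck_on_subset)
  then show ?thesis
  proof (rule Ck_on_cong[OF open_img[OF c], rotated])
    fix u assume u: "u \<in> snd c ` fst c"
    then show "frechet_derivative ?m (at (u, ?w)) (0, v) = left_mat c (chart_inv c u) v"
      using left_translation_derivative(2)[OF c chart_at(1) c chart_inv_in[OF c u] chart_at(2), where v = v]
        chart_inv_in[OF c u] chart_right[OF c u] by (simp add: left_mat_def mul_one)
  qed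
qed

section \<open>Fields, brackets and forms in a fixed chart\<close>

lemma field_in_chart_eq:
  "c \<in> atlas G \<Longrightarrow> x \<in> fst c \<Longrightarrow> field_in_chart G c X (snd c x) = change_coords (chart_at G x) c x (X x)"
  by (simp add: field_in_chart_def chart_left Let_def)

lemma field_in_chart_left_field:
  assumes c: "c \<in> atlas G" and u: "u \<in> snd c ` fst c"
  shows "field_in_chart G c (left_field G v) u = left_mat c (chart_inv c u) v"
  using chart_inv_in[OF c u] c
  by (simp add: field_in_chart_def Let_def left_field_eq change_coords_left_mat chart_at)

lemma smooth_left_field: "smooth_field G W (left_field G v)"
  unfolding smooth_field_def Ck_field_def
proof (intro allI ballI)
  fix k c assume c: "c \<in> atlas G"
  have "Ck_on k (snd c ` fst c) (field_in_chart G c (left_field G v))"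
    by (rule Ck_on_cong[OF open_img[OF c] _ left_mat_smooth[OF c]]) (simp add: field_in_chart_left_field[OF c])
  then show "Ck_on k (snd c ` (W \<inter> fst c)) (field_in_chart G c (left_field G v))"
    by (rule Ck_on_subset) auto
qed

lemma horizontal_iff: "w \<in> horizontal G x \<longleftrightarrow> (\<exists>h\<in>layer G 1. w = left_mat (chart_at G x) x h)"
  by (auto simp: horizontal_def left_field_eq)

text \<open>\<open>field_bracket\<close> is computed in the chart selected at x; naturality of the
  bracket under the transition map moves the formula to c.\<close>

lemma field_bracket_in_chart:
  assumes c: "c \<in> atlas G" "x \<in> fst c" and W: "open W" "x \<in> W"
    and X: "Ck_field 1 G W X" and Y: "Ck_field 1 G W Y"
  shows "change_coords (chart_at G x) c x (field_bracket G X Y x)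
    = frechet_derivative (field_in_chart G c Y) (at (snd c x)) (field_in_chart G c X (snd c x))
    - frechet_derivative (field_in_chart G c X) (at (snd c x)) (field_in_chart G c Y (snd c x))"
proof -
  let ?c0 = "chart_at G x" and ?\<tau> = "snd c \<circ> chart_inv (chart_at G x)"
  let ?S = "snd ?c0 ` ((W \<inter> fst c) \<inter> fst ?c0)"
  have c0: "?c0 \<in> atlas G" "x \<in> fst ?c0" by (rule chart_at)+
  have S: "open ?S" "snd ?c0 x \<in> ?S"
    using chart_image_open[OF c0(1) open_Int[OF W(1) open_dom[OF c(1)]]] c W c0 by auto
  have \<tau>: "Ck_on 2 ?S ?\<tau>" by (rule Ck_on_subset[OF transition_Ck(1)[OF c0(1) c(1)]]) auto
  have \<tau>x: "?\<tau> (snd ?c0 x) = snd c x" using chart_left[OF c0] by simp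
  have tr: "field_in_chart G c X (?\<tau> u) = frechet_derivative ?\<tau> (at u) (field_in_chart G ?c0 X u)"
    if u: "u \<in> ?S" for X u
  proof -
    obtain y where y: "u = snd ?c0 y" "y \<in> fst ?c0" "y \<in> fst c" using u by blast
    then show ?thesis using c0 c chart_left[OF c0(1) y(2)]
      by (simp add: field_in_chart_eq change_coords_compose chart_at flip: change_coords_def)
  qed
  have d: "field_in_chart G d X differentiable (at (snd d x))" if "d \<in> atlas G" "x \<in> fst d" "Ck_field 1 G W X" for d X
    using that W by (auto simp: Ck_field_def)
  have "field_bracket G X Y x
      = frechet_derivative (field_in_chart G ?c0 Y) (at (snd ?c0 x)) (field_in_chart G ?c0 X (snd ?c0 x))
      - frechet_derivative (field_in_chart G ?c0 X) (at (snd ?c0 x)) (field_in_chart G ?c0 Y (snd ?c0 x))"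
    using c0 by (simp add: field_bracket_def Let_def field_in_chart_eq change_coords_id)
  moreover have "change_coords ?c0 c x = frechet_derivative ?\<tau> (at (snd ?c0 x))"
    by (simp add: change_coords_def)
  ultimately show ?thesis
    using bracket_pushforward[OF S \<tau>, of "field_in_chart G ?c0 X" "field_in_chart G c X"
        "field_in_chart G ?c0 Y" "field_in_chart G c Y"] d[OF c0 X] d[OF c0 Y] d[OF c X] d[OF c Y] tr
    unfolding \<tau>x by simp
qed

text \<open>The contact condition tested on the left-invariant field generated by h, in the form
  that \<open>weak_contact_local\<close> takes as its hypothesis.\<close>

lemma contact_field_in_chart:
  assumes U: "open U" "x \<in> U" and Z: "contact_field G U Z" and c: "c \<in> atlas G" "x \<in> fst c"
    and h: "h \<in> layer G 1"
  shows "\<exists>k\<in>layer G 1. frechet_derivative (\<lambda>u. left_mat c (chart_inv c u) h) (at (snd c x)) (field_in_chart G c Z (snd c x))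
    - frechet_derivative (field_in_chart G c Z) (at (snd c x)) (left_mat c x h) = left_mat c x k"
proof -
  let ?X = "left_field G h"
  have hor: "\<forall>x\<in>U. ?X x \<in> horizontal G x" using h by (auto simp: horizontal_iff left_field_eq)
  have "\<forall>x\<in>U. field_bracket G Z ?X x \<in> horizontal G x"
    using Z U(1) smooth_left_field[of U h] hor unfolding contact_field_def by blast
  then obtain k where k: "k \<in> layer G 1" "field_bracket G Z ?X x = left_mat (chart_at G x) x k"
    using U(2) horizontal_iff by blast
  have "Ck_field 1 G U Z" using Z by (simp add: contact_field_def)
  moreover have "Ck_field 1 G U ?X" using smooth_left_field[of U h] by (simp add: smooth_field_def)
  ultimately have "change_coords (chart_at G x) c x (field_bracket G Z ?X x)
    = frechet_derivative (field_in_chart G c ?X) (at (snd c x)) (field_in_chart G c Z (snd c x))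
    - frechet_derivative (field_in_chart G c Z) (at (snd c x)) (field_in_chart G c ?X (snd c x))"
    by (rule field_bracket_in_chart[OF c U])
  moreover have "frechet_derivative (field_in_chart G c ?X) (at (snd c x))
      = frechet_derivative (\<lambda>u. left_mat c (chart_inv c u) h) (at (snd c x))"
    by (rule frechet_derivative_cong_open[OF open_img[OF c(1)]])
       (use c in \<open>auto simp: field_in_chart_left_field[OF c(1)]\<close>)
  moreover have "field_in_chart G c ?X (snd c x) = left_mat c x h"
    using field_in_chart_left_field[OF c(1)] c chart_left[OF c] by simp
  ultimately show ?thesis
    using change_coords_left_mat[OF chart_at c, of k] unfolding k(2)
    by (intro bexI[OF _ k(1)]) simp
qed

lemma form_in_chart_eq:
  "c \<in> atlas G \<Longrightarrow> x \<in> fst c \<Longrightarrow>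
    form_in_chart G c \<omega> (snd c x) vs = \<omega> x (map (change_coords c (chart_at G x) x) vs)"
  by (simp add: form_in_chart_def chart_left Let_def)

lemma alt_form_in_chart:
  assumes "c \<in> atlas G" "x \<in> fst c" "alt_form k (\<omega> x)"
  shows "alt_form k (form_in_chart G c \<omega> (snd c x))"
proof -
  have "alt_form k (\<lambda>vs. \<omega> x (map (change_coords c (chart_at G x) x) vs))"
    by (intro alt_form_map assms linear_change_coords chart_at)
  then show ?thesis using form_in_chart_eq[OF assms(1,2)] by (metis (no_types, lifting) ext)
qed

text \<open>The coordinate expressions of a form in two charts are related by pullback along the
  transition map, so \<open>ext_d_pullback\<close> applies.\<close>

lemma form_pullback:
  assumes c: "c \<in> atlas G" "x \<in> fst c" and d: "d \<in> atlas G" "x \<in> fst d" and W: "open W" "x \<in> W"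
    and \<omega>: "\<And>x. x \<in> W \<Longrightarrow> alt_form k (\<omega> x)"
    and diff: "\<And>vs. (\<lambda>u. form_in_chart G c \<omega> u vs) differentiable (at (snd c x))"
  shows "(\<lambda>u. form_in_chart G d \<omega> u vs) differentiable (at (snd d x))"
    and "ext_d (form_in_chart G d \<omega>) (snd d x) vs
      = ext_d (form_in_chart G c \<omega>) (snd c x) (map (change_coords d c x) vs)"
proof -
  let ?\<tau> = "snd c \<circ> chart_inv d"
  let ?S = "snd d ` ((W \<inter> fst c) \<inter> fst d)"
  let ?T = "snd c ` (W \<inter> fst c)"
  have S: "open ?S" "snd d x \<in> ?S"
    using chart_image_open[OF d(1) open_Int[OF W(1) open_dom[OF c(1)]]] c W d by auto
  have T: "open ?T" "?\<tau> ` ?S \<subseteq> ?T" using chart_image_open[OF c(1) W(1)] chart_left[OF d(1)] by auto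
  have \<tau>: "Ck_on 2 ?S ?\<tau>" by (rule Ck_on_subset[OF transition_Ck(1)[OF d(1) c(1)]]) auto
  have \<tau>x: "?\<tau> (snd d x) = snd c x" using chart_left[OF d] by simp
  have alt: "alt_form k (form_in_chart G c \<omega> u)" if "u \<in> ?T" for u
    using that alt_form_in_chart[OF c(1)] \<omega> by auto
  have tr: "form_in_chart G d \<omega> u ws = form_in_chart G c \<omega> (?\<tau> u) (map (frechet_derivative ?\<tau> (at u)) ws)"
    if u: "u \<in> ?S" for u ws
  proof -
    obtain y where y: "u = snd d y" "y \<in> fst d" "y \<in> fst c" using u by blast
    have m: "map (change_coords c (chart_at G y) y) (map (change_coords d c y) ws) = map (change_coords d (chart_at G y) y) ws"
      by (simp add: change_coords_compose[OF d(1) c(1) chart_at(1) y(2,3) chart_at(2)])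
    have e: "?\<tau> u = snd c y" using chart_left[OF d(1) y(2)] y(1) by simp
    have fd: "frechet_derivative ?\<tau> (at u) = change_coords d c y" by (simp add: change_coords_def y(1))
    show ?thesis unfolding e fd unfolding y(1) form_in_chart_eq[OF d(1) y(2)] form_in_chart_eq[OF c(1) y(3)] m ..
  qed
  have diff': "(\<lambda>u. form_in_chart G c \<omega> u vs) differentiable (at (?\<tau> (snd d x)))" for vs
    unfolding \<tau>x by (rule diff)
  note * = ext_d_pullback[where \<omega>' = "form_in_chart G d \<omega>", OF S \<tau> T alt diff' tr]
  show "(\<lambda>u. form_in_chart G d \<omega> u vs) differentiable (at (snd d x))" by (rule *(1))
  show "ext_d (form_in_chart G d \<omega>) (snd d x) vs
      = ext_d (form_in_chart G c \<omega>) (snd c x) (map (change_coords d c x) vs)"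
    using *(2)[of vs] unfolding \<tau>x change_coords_def .
qed

lemma ext_deriv_in_chart:
  assumes "c \<in> atlas G" "x \<in> fst c" "open W" "x \<in> W"
    and "\<And>x. x \<in> W \<Longrightarrow> alt_form k (\<omega> x)"
    and "\<And>vs. (\<lambda>u. form_in_chart G c \<omega> u vs) differentiable (at (snd c x))"
  shows "ext_deriv G \<omega> x vs
    = ext_d (form_in_chart G c \<omega>) (snd c x) (map (change_coords (chart_at G x) c x) vs)"
  using form_pullback(2)[OF assms(1,2) chart_at assms(3-6)]
  by (simp add: ext_deriv_def ext_d_def omit_def Let_def)

section \<open>The adapted frame, its dual coframe and the volume form\<close>

definition frame_vec :: "nat \<times> nat \<Rightarrow> 'e" where
  "frame_vec a = frame G (fst a) (snd a)"

definition coef :: "nat \<times> nat \<Rightarrow> 'e \<Rightarrow> real" where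
  "coef a v = representation (frame_vec ` set (frame_index G)) v (frame_vec a)"

lemma set_frame_index: "set (frame_index G) = Sigma {1..step G} (\<lambda>l. {1..dim (layer G l)})"
  by (auto simp: frame_index_def atLeastLessThanSuc_atLeastAtMost image_iff simp del: upt_Suc)

lemma distinct_frame_index: "distinct (frame_index G)"
proof -
  have "distinct (concat (map (\<lambda>l. map (Pair l) [1..<Suc (d l)]) ls))" if "distinct ls" for ls and d :: "nat \<Rightarrow> nat"
    using that by (induction ls) (auto simp: distinct_map inj_on_def simp del: upt_Suc)
  from this[of "[1..<Suc (step G)]" "\<lambda>l. dim (layer G l)"] show ?thesis
    by (simp add: frame_index_def del: upt_Suc)
qed

lemma frame_vec_layer:
  assumes "a \<in> set (frame_index G)" shows "frame_vec a \<in> layer G (fst a)"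
proof -
  obtain l v where a: "a = (l, v)" "l \<in> {1..step G}" "v \<in> {1..dim (layer G l)}"
    using assms by (auto simp: set_frame_index)
  have "frame G l v \<in> span (frame G l ` {1..dim (layer G l)})" using a by (intro span_base imageI)
  then show ?thesis using adapted a by (simp add: adapted_frame_def frame_vec_def)
qed

text \<open>Grouped by layers, the combination is a decomposition of 0, and by uniqueness it is the
  zero decomposition; inside one layer the frame is independent.\<close>

lemma frame_vec_combination_0:
  assumes "(\<Sum>a\<in>set (frame_index G). c a *\<^sub>R frame_vec a) = 0" and a: "a \<in> set (frame_index G)"
  shows "c a = 0"
proof -
  define p where "p l = (if l \<in> {1..step G} then \<Sum>v\<in>{1..dim (layer G l)}. c (l, v) *\<^sub>R frame G l v else 0)" for l
  have pl: "p l \<in> layer G l" if l: "l \<in> {1..step G}" for l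
  proof -
    have "subspace (layer G l)" using strat l by (simp add: stratified_def)
    moreover have "frame G l v \<in> layer G l" if "v \<in> {1..dim (layer G l)}" for v
      using frame_vec_layer[of "(l, v)"] l that by (simp add: set_frame_index frame_vec_def)
    ultimately show ?thesis using l by (auto simp: p_def intro!: subspace_sum subspace_scale)
  qed
  have "(\<Sum>l = 1..step G. p l) = (\<Sum>l = 1..step G. \<Sum>v\<in>{1..dim (layer G l)}. c (l, v) *\<^sub>R frame G l v)"
    by (intro sum.cong) (auto simp: p_def)
  also have "\<dots> = (\<Sum>a\<in>set (frame_index G). c a *\<^sub>R frame_vec a)"
    unfolding set_frame_index by (subst sum.Sigma) (auto simp: frame_vec_def intro!: sum.cong)
  finally have ps: "(\<Sum>l = 1..step G. p l) = 0" using assms by simp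
  let ?P = "\<lambda>p. (\<forall>l\<in>{1..step G}. p l \<in> layer G l) \<and> (\<forall>l. l \<notin> {1..step G} \<longrightarrow> p l = 0) \<and>
        0 = (\<Sum>l = 1..step G. p l)"
  have "\<exists>!p. ?P p" using strat unfolding stratified_def by blast
  then obtain q where "?P q" and q: "\<forall>p. ?P p \<longrightarrow> p = q" by (rule ex1E)
  have Pp: "?P p" using pl ps by (auto simp: p_def)
  have P0: "?P (\<lambda>_. 0)" using strat by (simp add: stratified_def subspace_0)
  have p0: "p = (\<lambda>_. 0)" using mp[OF spec[OF q] Pp] mp[OF spec[OF q] P0] by (rule trans[OF _ sym])
  obtain l v where lv: "a = (l, v)" "l \<in> {1..step G}" "v \<in> {1..dim (layer G l)}"
    using a by (auto simp: set_frame_index)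
  have "(\<Sum>v\<in>{1..dim (layer G l)}. c (l, v) *\<^sub>R frame G l v) = 0"
    using fun_cong[OF p0, of l] lv by (simp add: p_def)
  moreover have "inj_on (frame G l) {1..dim (layer G l)} \<and> independent (frame G l ` {1..dim (layer G l)})"
    using adapted lv by (simp add: adapted_frame_def)
  ultimately have "c (l, v) = 0"
    using independent_image_iff[of "{1..dim (layer G l)}" "frame G l", OF finite_atLeastAtMost, THEN iffD1,
        rule_format, of "\<lambda>v. c (l, v)" v] lv(3) by blast
  then show ?thesis using lv by blast
qed

lemma frame_vec_basis: "inj_on frame_vec (set (frame_index G))" "independent (frame_vec ` set (frame_index G))"
  using independent_image_iff[of "set (frame_index G)" frame_vec] frame_vec_combination_0 by auto

lemma span_frame_vec: "span (frame_vec ` set (frame_index G)) = UNIV"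
proof -
  have "w \<in> span (frame_vec ` set (frame_index G))" for w
  proof -
    obtain p where p: "\<forall>l\<in>{1..step G}. p l \<in> layer G l" "w = (\<Sum>l = 1..step G. p l)"
      using strat unfolding stratified_def by blast
    have "p l \<in> span (frame_vec ` set (frame_index G))" if l: "l \<in> {1..step G}" for l
    proof -
      have "p l \<in> span (frame G l ` {1..dim (layer G l)})" using p(1) l adapted by (simp add: adapted_frame_def)
      moreover have "frame G l ` {1..dim (layer G l)} \<subseteq> frame_vec ` set (frame_index G)"
        using l by (force simp: set_frame_index frame_vec_def)
      ultimately show ?thesis using span_mono by blast
    qed
    then show ?thesis unfolding p(2) by (intro span_sum)
  qed
  then show ?thesis by blast
qed

lemma length_frame_index: "length (frame_index G) = DIM('e)"
proof -
  have "card (frame_vec ` set (frame_index G)) = dim (UNIV :: 'e set)"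
    using basis_card_eq_dim[of "frame_vec ` set (frame_index G)" UNIV] frame_vec_basis(2) span_frame_vec by simp
  then show ?thesis
    using card_image[OF frame_vec_basis(1)] distinct_card[OF distinct_frame_index] by (simp add: dim_UNIV)
qed

lemma coef_frame_vec:
  assumes "a \<in> set (frame_index G)" "b \<in> set (frame_index G)"
  shows "coef a (frame_vec b) = (if a = b then 1 else 0)"
  using representation_basis[OF frame_vec_basis(2), of "frame_vec b"] inj_on_eq_iff[OF frame_vec_basis(1) assms] assms
  by (auto simp: coef_def)

lemma linear_coef: "linear (coef a)"
  by (rule linearI)
     (simp_all add: coef_def representation_add[OF frame_vec_basis(2)] representation_scale[OF frame_vec_basis(2)] span_frame_vec)

lemma coef_expand: "(\<Sum>a\<in>set (frame_index G). coef a v *\<^sub>R frame_vec a) = v"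
proof -
  have "(\<Sum>b\<in>frame_vec ` set (frame_index G). representation (frame_vec ` set (frame_index G)) v b *\<^sub>R b) = v"
    by (rule sum_representation_eq[OF frame_vec_basis(2)]) (auto simp: span_frame_vec)
  then show ?thesis by (simp add: sum.reindex[OF frame_vec_basis(1)] coef_def)
qed

lemma subspace_layer_1: "subspace (layer G 1)" and step_ge_1: "1 \<le> step G"
  using strat by (auto simp: stratified_def)

lemma layer_1I:
  assumes "\<And>a. a \<in> set (frame_index G) \<Longrightarrow> fst a \<noteq> 1 \<Longrightarrow> coef a v = 0"
  shows "v \<in> layer G 1"
proof -
  have "coef a v *\<^sub>R frame_vec a \<in> layer G 1" if "a \<in> set (frame_index G)" for a
    using frame_vec_layer[OF that] assms[OF that] subspace_layer_1
    by (cases "fst a = 1") (auto intro: subspace_scale subspace_0)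
  then have "(\<Sum>a\<in>set (frame_index G). coef a v *\<^sub>R frame_vec a) \<in> layer G 1"
    by (intro subspace_sum subspace_layer_1)
  then show ?thesis by (simp add: coef_expand)
qed

lemma frame_field_eq: "frame_field G a x = left_mat (chart_at G x) x (frame_vec a)"
  by (simp add: frame_field_def frame_vec_def left_field_eq split: prod.split)

text \<open>Left translation is linear and injective, so it carries the frame at the identity to an
  independent family and preserves coefficients. Hence \<open>coef\<close> computes all
  \<open>frame_coeff\<close> independently of the point.\<close>

lemma frame_coeff_left_mat:
  assumes a: "a \<in> set (frame_index G)"
  shows "frame_coeff G a x (left_mat (chart_at G x) x v) = coef a v"
proof -
  let ?I = "set (frame_index G)" and ?L = "left_mat (chart_at G x) x"
  let ?e = "\<lambda>b. ?L (frame_vec b)"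
  have l: "linear ?L" by (rule linear_left_mat[OF chart_at])
  have comb: "(\<Sum>b\<in>?I. c b *\<^sub>R ?e b) = ?L (\<Sum>b\<in>?I. c b *\<^sub>R frame_vec b)" for c
    by (simp add: linear_sum[OF l] linear_scale[OF l])
  have "inj_on ?e ?I \<and> independent (?e ` ?I)"
  proof (rule independent_image_iff[THEN iffD2], simp, intro allI impI ballI)
    fix c b assume c: "(\<Sum>b\<in>?I. c b *\<^sub>R ?e b) = 0" and b: "b \<in> ?I"
    have "(\<Sum>b\<in>?I. c b *\<^sub>R frame_vec b) = left_mat_inv (chart_at G x) x (?L (\<Sum>b\<in>?I. c b *\<^sub>R frame_vec b))"
      by (rule left_mat_inverse(1)[OF chart_at, symmetric])
    also have "\<dots> = left_mat_inv (chart_at G x) x (?L 0)" using c by (simp add: comb linear_0[OF l])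
    also have "\<dots> = 0" by (rule left_mat_inverse(1)[OF chart_at])
    finally show "c b = 0" using b by (rule frame_vec_combination_0)
  qed
  then have "representation (?e ` ?I) (\<Sum>b\<in>?I. coef b v *\<^sub>R ?e b) (?e a) = coef a v"
    by (intro representation_image_sum a) auto
  then show ?thesis unfolding comb coef_expand by (simp add: frame_coeff_def frame_field_eq)
qed

lemma frame_coeff_eq:
  assumes a: "a \<in> set (frame_index G)" and c: "c \<in> atlas G" "x \<in> fst c"
  shows "frame_coeff G a x w = coef a (left_mat_inv c x (change_coords (chart_at G x) c x w))"
proof -
  have "change_coords (chart_at G x) c x w = left_mat c x (left_mat_inv c x (change_coords (chart_at G x) c x w))"
    by (simp add: left_mat_inverse(2)[OF c])
  from arg_cong[OF this, of "change_coords c (chart_at G x) x"]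
  have "w = left_mat (chart_at G x) x (left_mat_inv c x (change_coords (chart_at G x) c x w))"
    by (simp add: change_coords_inverse change_coords_left_mat chart_at c)
  then show ?thesis using frame_coeff_left_mat[OF a] by metis
qed

lemma linear_frame_coeff: "a \<in> set (frame_index G) \<Longrightarrow> linear (frame_coeff G a x)"
proof -
  assume a: "a \<in> set (frame_index G)"
  have "linear (left_mat_inv (chart_at G x) x)"
    by (rule linear_inverse_fun[OF linear_left_mat[OF chart_at] left_mat_inverse(2)[OF chart_at] left_mat_inverse(1)[OF chart_at]])
  moreover have "frame_coeff G a x = coef a \<circ> left_mat_inv (chart_at G x) x"
    by (rule ext) (simp add: frame_coeff_eq[OF a chart_at] change_coords_id[OF chart_at])
  ultimately show ?thesis using linear_compose[OF _ linear_coef[of a]] by simp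
qed

lemma frame_coeff_frame_field:
  "a \<in> set (frame_index G) \<Longrightarrow> b \<in> set (frame_index G) \<Longrightarrow>
    frame_coeff G a x (frame_field G b x) = (if a = b then 1 else 0)"
  by (simp add: frame_field_eq frame_coeff_left_mat coef_frame_vec)

lemma alt_form_coframe: "a \<in> set (frame_index G) \<Longrightarrow> alt_form 1 (coframe G a x)"
  unfolding coframe_def by (intro alt_form_1 linear_frame_coeff)

abbreviation frames :: "'g \<Rightarrow> 'e list" where
  "frames x \<equiv> map (\<lambda>a. frame_field G a x) (frame_index G)"

lemma alt_form_coframes:
  assumes "\<alpha> \<in> set (map (\<lambda>a. coframe G a x) as)" "set as \<subseteq> set (frame_index G)"
  shows "alt_form 1 \<alpha>"
proof -
  obtain a where "a \<in> set as" "\<alpha> = coframe G a x" using assms(1) by (metis imageE list.set_map)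
  then show ?thesis using alt_form_coframe assms(2) by blast
qed

lemma alt_form_volume_form: "alt_form DIM('e) (volume_form G x)"
proof -
  have "alt_form (length (map (\<lambda>a. coframe G a x) (frame_index G))) (volume_form G x)"
    unfolding volume_form_def by (rule alt_form_wedge_list, erule alt_form_coframes) simp
  then show ?thesis by (simp add: length_frame_index)
qed

lemma volume_form_frames: "volume_form G x (frames x) = 1"
  unfolding volume_form_def
proof (rule wedge_list_dual)
  fix i j assume "i < length (map (\<lambda>a. coframe G a x) (frame_index G))" "j < length (map (\<lambda>a. coframe G a x) (frame_index G))"
  then show "(map (\<lambda>a. coframe G a x) (frame_index G) ! i) [frames x ! j] = (if i = j then 1 else 0)"
    using distinct_frame_index by (simp add: coframe_def frame_coeff_frame_field nth_eq_iff_index_eq)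
next
  fix i assume "i < length (map (\<lambda>a. coframe G a x) (frame_index G))"
  then show "alt_form 1 (map (\<lambda>a. coframe G a x) (frame_index G) ! i)"
    by (intro alt_form_coframes[OF nth_mem]) auto
qed simp

text \<open>After the deletion the list still contains the frame vector with index (1, i), on which
  every factor of \<open>hat_coframe G i\<close> vanishes.\<close>

lemma hat_coframe_omit_frames:
  assumes i: "i \<in> {1..dim (layer G 1)}" and j: "j < DIM('e)" "frame_index G ! j \<noteq> (1, i)"
  shows "hat_coframe G i x (omit j (frames x)) = 0"
  unfolding hat_coframe_def
proof (rule wedge_list_eq_0)
  have "(1, i) \<in> set (frame_index G)" using i step_ge_1 by (simp add: set_frame_index)
  then obtain m where m: "m < DIM('e)" "frame_index G ! m = (1, i)"
    unfolding in_set_conv_nth length_frame_index by blast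
  define m' where "m' = (if m < j then m else m - 1)"
  have "m \<noteq> j" using m j by auto
  then have "omit j (frames x) ! m' = frame_field G (1, i) x" "m' < length (omit j (frames x))"
    using m j by (auto simp: m'_def nth_omit length_omit length_frame_index)
  then show "frame_field G (1, i) x \<in> set (omit j (frames x))" by (metis nth_mem)
  fix \<alpha> assume \<alpha>: "\<alpha> \<in> set (map (\<lambda>a. coframe G a x) (filter (\<lambda>a. a \<noteq> (1, i)) (frame_index G)))"
  then show "alt_form 1 \<alpha>" by (rule alt_form_coframes) auto
  obtain a where a: "a \<in> set (frame_index G)" "a \<noteq> (1, i)" "\<alpha> = coframe G a x"
    using \<alpha> unfolding set_map set_filter by blast
  show "\<alpha> [frame_field G (1, i) x] = 0"
    using frame_coeff_frame_field[OF a(1) \<open>(1, i) \<in> set (frame_index G)\<close>] a(2)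
    unfolding a(3) coframe_def by simp
qed

abbreviation chart_frames :: "('g, 'e) chart \<Rightarrow> 'g \<Rightarrow> 'e list" where
  "chart_frames c x \<equiv> map (\<lambda>a. left_mat c x (frame_vec a)) (frame_index G)"

lemma frames_eq:
  assumes "c \<in> atlas G" "x \<in> fst c"
  shows "frames x = map (change_coords c (chart_at G x) x) (chart_frames c x)"
  by (simp add: frame_field_eq change_coords_left_mat chart_at assms)

text \<open>Kept with its sign, in contrast to the density of \<open>volume_measure\<close>: values
  of forms on the frame and in coordinates are compared through the signed quantity.\<close>

definition vol_density :: "('g, 'e) chart \<Rightarrow> 'e \<Rightarrow> real" where
  "vol_density c u = form_in_chart G c (volume_form G) u basis_list"

lemma volume_form_chart_frames:
  assumes c: "c \<in> atlas G" "x \<in> fst c"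
  shows "form_in_chart G c (volume_form G) (snd c x) (chart_frames c x) = 1"
  unfolding form_in_chart_eq[OF c] frames_eq[OF c, symmetric] by (rule volume_form_frames)

text \<open>Top forms are proportional and the volume form is 1 on the frame, so
  \<open>vol_density\<close> is the factor between values on the frame and values on the Euclidean
  basis.\<close>

lemma top_form_chart_frames:
  assumes c: "c \<in> atlas G" "x \<in> fst c" and a: "alt_form DIM('e) \<alpha>"
  shows "\<alpha> (chart_frames c x) * vol_density c (snd c x) = \<alpha> basis_list"
  using alt_form_top_proportional[OF a alt_form_in_chart[where \<omega> = "volume_form G", OF c alt_form_volume_form], of "chart_frames c x"]
  by (simp add: vol_density_def volume_form_chart_frames[OF c])

text \<open>The density is the reciprocal of the determinant of the frame in coordinates, and this
  determinant is continuous because \<open>left_mat\<close> is; the coframe itself never has to be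
  differentiated.\<close>

lemma vol_density_continuous:
  assumes c: "c \<in> atlas G"
  shows "continuous_on (snd c ` fst c) (vol_density c)" "\<And>u. u \<in> snd c ` fst c \<Longrightarrow> vol_density c u \<noteq> 0"
proof -
  have "length (map frame_vec (frame_index G)) = DIM('e)" by (simp add: length_frame_index)
  then obtain P where P: "linear P" "map P (basis_list :: 'e list) = map frame_vec (frame_index G)"
    by (rule linear_map_basis_list)
  let ?d = "\<lambda>u. lin_det (\<lambda>v. left_mat c (chart_inv c u) (P v))"
  have d: "?d u * vol_density c u = 1" if "u \<in> snd c ` fst c" for u
  proof -
    let ?x = "chart_inv c u"
    have x: "?x \<in> fst c" "snd c ?x = u" using chart_inv_in[OF c that] chart_right[OF c that] by auto
    have l: "linear (\<lambda>v. left_mat c ?x (P v))"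
      using linear_compose[OF P(1) linear_left_mat[OF c x(1)]] by (simp add: o_def)
    have "map (\<lambda>v. left_mat c ?x (P v)) basis_list = map (left_mat c ?x) (map P basis_list)" by simp
    also have "\<dots> = chart_frames c ?x" unfolding P(2) by simp
    finally show ?thesis
      using alt_form_linear_image[OF alt_form_in_chart[where \<omega> = "volume_form G", OF c x(1) alt_form_volume_form] l]
        volume_form_chart_frames[OF c x(1)] by (simp add: vol_density_def x(2))
  qed
  then show nz: "vol_density c u \<noteq> 0" if "u \<in> snd c ` fst c" for u using that by fastforce
  have "continuous_on (snd c ` fst c) ?d"
    by (rule continuous_on_lin_det) (rule Ck_on_imp_continuous_on[OF left_mat_smooth[OF c]])
  then have "continuous_on (snd c ` fst c) (\<lambda>u. inverse (?d u))"
    using d by (intro continuous_on_inverse) fastforce+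
  then show "continuous_on (snd c ` fst c) (vol_density c)"
    by (rule continuous_on_eq) (rule inverse_unique[OF d])
qed

end

section \<open>The volume measure\<close>

context carnot_space begin

lemma vol_density_change:
  assumes c: "c \<in> atlas G" "x \<in> fst c" and d: "d \<in> atlas G" "x \<in> fst d"
  shows "vol_density c (snd c x) = lin_det (change_coords c d x) * vol_density d (snd d x)"
proof -
  have m: "map (change_coords d (chart_at G x) x) (map (change_coords c d x) vs) = map (change_coords c (chart_at G x) x) vs" for vs
    by (simp add: change_coords_compose[OF c(1) d(1) chart_at(1) c(2) d(2) chart_at(2)])
  have "vol_density c (snd c x) = form_in_chart G d (volume_form G) (snd d x) (map (change_coords c d x) basis_list)"
    unfolding vol_density_def form_in_chart_eq[OF c] form_in_chart_eq[OF d] m ..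
  then show ?thesis
    unfolding vol_density_def
    using alt_form_linear_image[OF alt_form_in_chart[where \<omega> = "volume_form G", OF d alt_form_volume_form]
        linear_change_coords[OF c(1) d(1) c(2) d(2)]] by simp
qed

text \<open>This and the next two definitions extend chart data by default values, so that they are
  Borel measurable functions on whole types.\<close>

definition abs_density :: "('g, 'e) chart \<Rightarrow> 'e \<Rightarrow> real" where
  "abs_density c u = (if u \<in> snd c ` fst c then \<bar>vol_density c u\<bar> else 0)"

definition chart_ext :: "('g, 'e) chart \<Rightarrow> 'g \<Rightarrow> 'e" where
  "chart_ext c x = (if x \<in> fst c then snd c x else 0)"

definition chart_inv_ext :: "('g, 'e) chart \<Rightarrow> 'e \<Rightarrow> 'g" where
  "chart_inv_ext c u = (if u \<in> snd c ` fst c then chart_inv c u else \<one>\<^bsub>G\<^esub>)"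

definition chart_measure :: "('g, 'e) chart \<Rightarrow> 'g measure" where
  "chart_measure c = distr (density lborel (\<lambda>u. ennreal (abs_density c u))) borel (chart_inv_ext c)"

lemma chart_measurable:
  assumes c: "c \<in> atlas G"
  shows "abs_density c \<in> borel_measurable borel" "chart_inv_ext c \<in> borel_measurable borel"
    "chart_ext c \<in> borel_measurable borel"
proof -
  have "continuous_on (snd c ` fst c) (\<lambda>u. \<bar>vol_density c u\<bar>)"
    by (intro continuous_intros vol_density_continuous c)
  then show "abs_density c \<in> borel_measurable borel"
    unfolding abs_density_def[abs_def]
    by (intro borel_measurable_continuous_on_if borel_open open_img c continuous_on_const)
  show "chart_inv_ext c \<in> borel_measurable borel"
    unfolding chart_inv_ext_def[abs_def]
    by (intro borel_measurable_continuous_on_if borel_open open_img c continuous_on_const chart_cont)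
  show "chart_ext c \<in> borel_measurable borel"
    unfolding chart_ext_def[abs_def]
    by (intro borel_measurable_continuous_on_if borel_open open_dom c continuous_on_const chart_cont)
qed

lemma chart_image_borel:
  assumes c: "c \<in> atlas G" and S: "S \<in> sets borel" "S \<subseteq> fst c"
  shows "snd c ` S \<in> sets borel" "snd c ` S = snd c ` fst c \<inter> chart_inv_ext c -` S"
proof -
  have "S = S \<inter> fst c" using S by blast
  then show e: "snd c ` S = snd c ` fst c \<inter> chart_inv_ext c -` S"
    using chart_image[OF c, of S] by (auto simp: chart_inv_ext_def)
  have "chart_inv_ext c -` S \<in> sets borel" using measurable_sets[OF chart_measurable(2)[OF c] S(1)] by simp
  then show "snd c ` S \<in> sets borel" unfolding e using open_img[OF c] by simp
qed

lemma emeasure_chart_measure: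
  assumes c: "c \<in> atlas G" and S: "S \<in> sets borel"
  shows "emeasure (chart_measure c) S
    = (\<integral>\<^sup>+u. ennreal \<bar>vol_density c u\<bar> * indicator (snd c ` (S \<inter> fst c)) u \<partial>lborel)"
proof -
  have "emeasure (chart_measure c) S = emeasure (density lborel (\<lambda>u. ennreal (abs_density c u))) (chart_inv_ext c -` S)"
    unfolding chart_measure_def using S chart_measurable(2)[OF c] by (subst emeasure_distr) auto
  also have "\<dots> = (\<integral>\<^sup>+u. ennreal (abs_density c u) * indicator (chart_inv_ext c -` S) u \<partial>lborel)"
    using measurable_sets[OF chart_measurable(2)[OF c] S] chart_measurable(1)[OF c]
    by (intro emeasure_density) auto
  also have "\<dots> = (\<integral>\<^sup>+u. ennreal \<bar>vol_density c u\<bar> * indicator (snd c ` (S \<inter> fst c)) u \<partial>lborel)"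
    unfolding chart_image[OF c]
    by (intro nn_integral_cong) (auto simp: abs_density_def chart_inv_ext_def indicator_def)
  finally show ?thesis .
qed

lemma emeasure_chart_measure_subset:
  assumes "c \<in> atlas G" "S \<in> sets borel" "S \<subseteq> fst c"
  shows "emeasure (chart_measure c) S = (\<integral>\<^sup>+u. ennreal \<bar>vol_density c u\<bar> * indicator (snd c ` S) u \<partial>lborel)"
  using emeasure_chart_measure[OF assms(1,2)] assms(3) by (simp add: Int_absorb2)

text \<open>Change of variables along the transition map, whose Jacobian is the factor in
  \<open>vol_density_change\<close>.\<close>

lemma chart_measure_compatible:
  assumes c: "c \<in> atlas G" and d: "d \<in> atlas G" and S: "S \<in> sets borel" "S \<subseteq> fst c" "S \<subseteq> fst d"
  shows "emeasure (chart_measure c) S = emeasure (chart_measure d) S"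
proof -
  let ?\<tau> = "snd d \<circ> chart_inv c" and ?k = "snd c \<circ> chart_inv d"
  let ?X = "snd c ` (fst c \<inter> fst d)" and ?Y = "snd d ` (fst d \<inter> fst c)"
  have im: "?\<tau> ` (snd c ` S) = snd d ` S"
  proof -
    have "?\<tau> (snd c x) = snd d x" if "x \<in> S" for x using chart_left[OF c] that S by auto
    then show ?thesis by (auto simp: image_iff intro!: bexI)
  qed
  have "(\<integral>\<^sup>+y. ennreal (abs_density d y) * indicator (?\<tau> ` (snd c ` S)) y \<partial>lborel)
      = (\<integral>\<^sup>+u. ennreal (abs_density d (?\<tau> u)) * ennreal \<bar>lin_det (frechet_derivative ?\<tau> (at u))\<bar> * indicator (snd c ` S) u \<partial>lborel)"
  proof (rule nn_integral_change_of_variables)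
    show "open ?X" "open ?Y" using transition_Ck(2) c d by blast+
    show "Ck_on 1 ?X ?\<tau>" by (rule transition_Ck(1)[OF c d])
    show "continuous_on ?Y ?k" by (rule Ck_on_imp_continuous_on[OF transition_Ck(1)[OF d c, of 0]])
    show "?\<tau> u \<in> ?Y \<and> ?k (?\<tau> u) = u" if "u \<in> ?X" for u
      using that chart_left[OF c] chart_left[OF d] by auto
    show "?k y \<in> ?X \<and> ?\<tau> (?k y) = y" if "y \<in> ?Y" for y
      using that chart_left[OF c] chart_left[OF d] by auto
    show "snd c ` S \<in> sets borel" by (rule chart_image_borel(1)[OF c S(1,2)])
    show "snd c ` S \<subseteq> ?X" using S by blast
    show "(\<lambda>y. ennreal (abs_density d y)) \<in> borel_measurable borel"
      using chart_measurable(1)[OF d] by measurable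
  qed
  also have "\<dots> = (\<integral>\<^sup>+u. ennreal \<bar>vol_density c u\<bar> * indicator (snd c ` S) u \<partial>lborel)"
  proof (intro nn_integral_cong)
    fix u
    show "ennreal (abs_density d (?\<tau> u)) * ennreal \<bar>lin_det (frechet_derivative ?\<tau> (at u))\<bar> * indicator (snd c ` S) u
        = ennreal \<bar>vol_density c u\<bar> * indicator (snd c ` S) u"
    proof (cases "u \<in> snd c ` S")
      case True
      then obtain x where x: "x \<in> S" "u = snd c x" by blast
      then have xc: "x \<in> fst c" "x \<in> fst d" using S by auto
      have "?\<tau> u = snd d x" using chart_left[OF c xc(1)] x(2) by simp
      moreover have "frechet_derivative ?\<tau> (at u) = change_coords c d x" by (simp add: change_coords_def x(2))
      ultimately show ?thesis
        using xc vol_density_change[OF c xc(1) d xc(2)] x(2)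
        by (simp add: abs_density_def abs_mult mult.commute ennreal_mult[symmetric])
    qed simp
  qed
  also have "\<dots> = emeasure (chart_measure c) S" by (rule emeasure_chart_measure_subset[OF c S(1,2), symmetric])
  finally have 1: "emeasure (chart_measure c) S = (\<integral>\<^sup>+y. ennreal (abs_density d y) * indicator (snd d ` S) y \<partial>lborel)"
    unfolding im by simp
  also have "\<dots> = emeasure (chart_measure d) S"
    unfolding emeasure_chart_measure_subset[OF d S(1,3)]
    using S(3) by (intro nn_integral_cong) (auto simp: abs_density_def indicator_def)
  finally show ?thesis .
qed

text \<open>The Lindelof property, from second countability of the type.\<close>

lemma countable_atlas:
  obtains cs :: "nat \<Rightarrow> ('g, 'e) chart" where "\<And>n. cs n \<in> atlas G" "(\<Union>n. fst (cs n)) = UNIV"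
proof -
  have o: "open S" if "S \<in> fst ` atlas G" for S using that open_dom by blast
  obtain F where F: "F \<subseteq> fst ` atlas G" "countable F" "\<Union>F = \<Union>(fst ` atlas G)"
    by (rule Lindelof[OF o])
  have U: "\<Union>F = UNIV" using F(3) chart_at by blast
  then have ne: "F \<noteq> {}" by auto
  have "\<forall>n. \<exists>c. c \<in> atlas G \<and> fst c = from_nat_into F n"
    using from_nat_into[OF ne] F(1) by blast
  then obtain cs where cs: "\<And>n. cs n \<in> atlas G" "\<And>n. fst (cs n) = from_nat_into F n" by metis
  have "(\<Union>n. fst (cs n)) = \<Union>F" unfolding cs(2) using range_from_nat_into[OF ne F(2)] by simp
  with cs(1) U show ?thesis by (intro that) auto
qed

text \<open>Countably many chart domains are made disjoint and the chart measures are added over the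
  pieces. Compatibility makes the result correct in every chart, and the same pieces force the
  uniqueness that the definite description in \<open>volume_measure\<close> relies on.\<close>

lemma ex_volume_measure:
  "\<exists>!\<mu>. sets \<mu> = sets borel \<and> (\<forall>c\<in>atlas G. \<forall>S\<in>sets borel. S \<subseteq> fst c \<longrightarrow> emeasure \<mu> S = emeasure (chart_measure c) S)"
    (is "\<exists>!\<mu>. ?P \<mu>")
proof -
  obtain cs :: "nat \<Rightarrow> ('g, 'e) chart" where cs: "\<And>n. cs n \<in> atlas G" "(\<Union>n. fst (cs n)) = UNIV"
    by (rule countable_atlas) blast
  define D where "D = disjointed (\<lambda>n. fst (cs n))"
  have D: "disjoint_family D" "(\<Union>n. D n) = UNIV" "\<And>n. D n \<subseteq> fst (cs n)"
    unfolding D_def UN_disjointed_eq by (rule disjoint_family_disjointed cs(2) disjointed_subset)+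
  have DB: "D n \<in> sets borel" for n
    unfolding D_def disjointed_def using open_dom[OF cs(1)] by auto
  have dis: "disjoint_family (\<lambda>n. S \<inter> D n)" for S
    using D(1) by (auto simp: disjoint_family_on_def)
  have UD: "(\<Union>n. S \<inter> D n) = S" for S using D(2) by blast
  let ?m = "\<lambda>n S. emeasure (chart_measure (cs n)) (S \<inter> D n)"
  \<comment> \<open>The sum over the pieces is written as an integral for counting measure, so that
    countable additivity becomes an exchange of sum and integral.\<close>
  define M where "M S = (\<integral>\<^sup>+n. ?m n S \<partial>count_space UNIV)" for S
  define \<mu> where "\<mu> = measure_of UNIV (sets borel) M"
  have cm: "sets (chart_measure c) = sets borel" for c by (simp add: chart_measure_def)
  have sets_\<mu>: "sets \<mu> = sets borel" unfolding \<mu>_def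
    using sets.sigma_sets_eq[of borel] by (simp add: sets_measure_of)
  have em: "emeasure \<mu> S = M S" if S: "S \<in> sets borel" for S
  proof (rule emeasure_measure_of[OF \<mu>_def])
    show "positive (sets \<mu>) M" by (simp add: positive_def M_def)
    show "countably_additive (sets \<mu>) M"
      unfolding countably_additive_def sets_\<mu>
    proof (intro allI impI)
      fix A :: "nat \<Rightarrow> 'g set" assume A: "range A \<subseteq> sets borel" "disjoint_family A"
      have "(\<Sum>i. ?m n (A i)) = ?m n (\<Union>i. A i)" for n
      proof -
        have "(\<Sum>i. emeasure (chart_measure (cs n)) (A i \<inter> D n)) = emeasure (chart_measure (cs n)) (\<Union>i. A i \<inter> D n)"
          by (rule suminf_emeasure) (use A DB cm in \<open>auto simp: disjoint_family_on_def\<close>)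
        moreover have "(\<Union>i. A i \<inter> D n) = (\<Union>i. A i) \<inter> D n" by blast
        ultimately show ?thesis by simp
      qed
      then show "(\<Sum>i. M (A i)) = M (\<Union>i. A i)"
        unfolding M_def by (subst nn_integral_suminf[symmetric]) auto
    qed
  qed (use S sets_\<mu> in auto)
  have P: "?P \<mu>"
  proof (intro conjI sets_\<mu> ballI impI)
    fix c S assume c: "c \<in> atlas G" and S: "S \<in> sets (borel :: 'g measure)" "S \<subseteq> fst c"
    have "emeasure \<mu> S = (\<Sum>n. emeasure (chart_measure (cs n)) (S \<inter> D n))"
      unfolding em[OF S(1)] M_def by (rule nn_integral_count_space_nat)
    also have "\<dots> = (\<Sum>n. emeasure (chart_measure c) (S \<inter> D n))"
      by (intro suminf_cong chart_measure_compatible cs c) (use S DB D(3) in auto)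
    also have "\<dots> = emeasure (chart_measure c) (\<Union>n. S \<inter> D n)"
      by (rule suminf_emeasure) (use S DB cm dis in auto)
    finally show "emeasure \<mu> S = emeasure (chart_measure c) S" unfolding UD .
  qed
  have uniq: "\<nu> = \<mu>" if \<nu>: "?P \<nu>" for \<nu>
  proof (rule measure_eqI)
    show "sets \<nu> = sets \<mu>" using \<nu> sets_\<mu> by simp
    fix S assume "S \<in> sets \<nu>"
    then have S: "S \<in> sets borel" using \<nu> by simp
    have "emeasure \<nu> S = emeasure \<nu> (\<Union>n. S \<inter> D n)" by (simp only: UD)
    also have "\<dots> = (\<Sum>n. emeasure \<nu> (S \<inter> D n))"
      by (rule suminf_emeasure[symmetric]) (use S DB \<nu> dis in auto)
    also have "\<dots> = (\<Sum>n. emeasure (chart_measure (cs n)) (S \<inter> D n))"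
      by (intro suminf_cong conjunct2[OF \<nu>, rule_format] cs) (use S DB D(3) in auto)
    also have "\<dots> = emeasure \<mu> S" unfolding em[OF S] M_def by (rule nn_integral_count_space_nat[symmetric])
    finally show "emeasure \<nu> S = emeasure \<mu> S" .
  qed
  show ?thesis by (rule ex1I[of ?P, OF P uniq])
qed

lemma volume_measure:
  shows sets_volume_measure: "sets (volume_measure G) = sets borel"
    and emeasure_volume_measure: "c \<in> atlas G \<Longrightarrow> S \<in> sets borel \<Longrightarrow> S \<subseteq> fst c \<Longrightarrow>
      emeasure (volume_measure G) S = (\<integral>\<^sup>+u. ennreal \<bar>vol_density c u\<bar> * indicator (snd c ` S) u \<partial>lborel)"
proof -
  let ?Q = "\<lambda>\<mu>. sets \<mu> = sets borel \<and> (\<forall>c\<in>atlas G. \<forall>S\<in>sets borel. S \<subseteq> fst c \<longrightarrow>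
        emeasure \<mu> S = (\<integral>\<^sup>+u. ennreal \<bar>vol_density c u\<bar> * indicator (snd c ` S) u \<partial>lborel))"
  have "\<exists>!\<mu>. ?Q \<mu>" using ex_volume_measure by (simp add: emeasure_chart_measure_subset cong: ball_cong imp_cong)
  from theI'[OF this] have "?Q (volume_measure G)"
    unfolding volume_measure_def vol_density_def .
  then show "sets (volume_measure G) = sets borel"
    and "c \<in> atlas G \<Longrightarrow> S \<in> sets borel \<Longrightarrow> S \<subseteq> fst c \<Longrightarrow>
      emeasure (volume_measure G) S = (\<integral>\<^sup>+u. ennreal \<bar>vol_density c u\<bar> * indicator (snd c ` S) u \<partial>lborel)"
    by blast+
qed

lemma volume_measure_restrict:
  assumes c: "c \<in> atlas G" and S: "S \<in> sets borel" "S \<subseteq> fst c"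
  shows "density (volume_measure G) (indicator S)
    = distr (density lborel (\<lambda>u. ennreal (abs_density c u * indicator (snd c ` S) u))) borel (chart_inv_ext c)"
proof (rule measure_eqI)
  fix B assume "B \<in> sets (density (volume_measure G) (indicator S))"
  then have B: "B \<in> sets borel" by (simp add: sets_volume_measure)
  have m: "(\<lambda>u. ennreal (abs_density c u * indicator (snd c ` S) u)) \<in> borel_measurable lborel"
    using chart_measurable(1)[OF c] chart_image_borel(1)[OF c S] by measurable
  have "emeasure (density (volume_measure G) (indicator S)) B = emeasure (volume_measure G) (S \<inter> B)"
  proof -
    have "emeasure (density (volume_measure G) (indicator S)) B = (\<integral>\<^sup>+x. indicator S x * indicator B x \<partial>volume_measure G)"
      using S B by (intro emeasure_density borel_measurable_indicator) (simp_all add: sets_volume_measure)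
    also have "\<dots> = (\<integral>\<^sup>+x. indicator (S \<inter> B) x \<partial>volume_measure G)" by (simp only: indicator_inter_arith)
    also have "\<dots> = emeasure (volume_measure G) (S \<inter> B)"
      using S B by (intro nn_integral_indicator) (auto simp: sets_volume_measure)
    finally show ?thesis .
  qed
  also have "\<dots> = (\<integral>\<^sup>+u. ennreal \<bar>vol_density c u\<bar> * indicator (snd c ` (S \<inter> B)) u \<partial>lborel)"
    using S B by (intro emeasure_volume_measure c) auto
  also have "\<dots> = (\<integral>\<^sup>+u. ennreal (abs_density c u * indicator (snd c ` S) u) * indicator (chart_inv_ext c -` B) u \<partial>lborel)"
  proof (intro nn_integral_cong)
    fix u
    have "u \<in> snd c ` (S \<inter> B) \<longleftrightarrow> u \<in> snd c ` S \<and> chart_inv_ext c u \<in> B"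
      using chart_left[OF c] S(2) by (auto simp: chart_inv_ext_def)
    moreover have "u \<in> snd c ` S \<Longrightarrow> u \<in> snd c ` fst c" using S(2) by blast
    ultimately show "ennreal \<bar>vol_density c u\<bar> * indicator (snd c ` (S \<inter> B)) u
        = ennreal (abs_density c u * indicator (snd c ` S) u) * indicator (chart_inv_ext c -` B) u"
      by (auto simp: indicator_def abs_density_def)
  qed
  also have "\<dots> = emeasure (density lborel (\<lambda>u. ennreal (abs_density c u * indicator (snd c ` S) u))) (chart_inv_ext c -` B)"
    using measurable_sets[OF chart_measurable(2)[OF c] B] m by (intro emeasure_density[symmetric]) auto
  also have "\<dots> = emeasure (distr (density lborel (\<lambda>u. ennreal (abs_density c u * indicator (snd c ` S) u))) borel (chart_inv_ext c)) B"
    using B chart_measurable(2)[OF c] by (subst emeasure_distr) auto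
  finally show "emeasure (density (volume_measure G) (indicator S)) B
    = emeasure (distr (density lborel (\<lambda>u. ennreal (abs_density c u * indicator (snd c ` S) u))) borel (chart_inv_ext c)) B" .
qed (simp add: sets_volume_measure)

text \<open>Measurability comes from the coordinate side: on S the function h agrees with
  \<open>h'\<close>, which is built from k, the density and the chart in their Borel extensions;
  division by the density is harmless since it is nonzero on the chart.\<close>

lemma volume_measure_integral:
  fixes h :: "'g \<Rightarrow> real"
  assumes c: "c \<in> atlas G" and S: "S \<in> sets borel" "S \<subseteq> fst c"
    and h: "\<And>x. x \<in> S \<Longrightarrow> h x * \<bar>vol_density c (snd c x)\<bar> = k (snd c x)"
    and k: "integrable lborel (\<lambda>u. indicator (snd c ` S) u * k u)"
  shows "set_integrable (volume_measure G) S h"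
    and "set_lebesgue_integral (volume_measure G) S h = (LINT u|lborel. indicator (snd c ` S) u * k u)"
proof -
  let ?\<mu> = "volume_measure G" and ?d = "\<lambda>u. abs_density c u * indicator (snd c ` S) u"
  define q where "q u = indicator (snd c ` S) u * k u / abs_density c u" for u
  define h' where "h' x = indicator S x * q (chart_ext c x)" for x
  have km: "(\<lambda>u. indicator (snd c ` S) u * k u) \<in> borel_measurable borel"
    using borel_measurable_integrable[OF k] by simp
  have qm: "q \<in> borel_measurable borel"
    unfolding q_def[abs_def] by (intro borel_measurable_divide km chart_measurable(1) c)
  have h'm: "h' \<in> borel_measurable borel"
    unfolding h'_def[abs_def]
    by (intro borel_measurable_times borel_measurable_indicator S measurable_compose[OF chart_measurable(3)[OF c] qm])
  have h'h: "indicator S x *\<^sub>R h x = indicator S x *\<^sub>R h' x" for x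
  proof (cases "x \<in> S")
    case True
    then have x: "x \<in> fst c" using S by blast
    then have nz: "vol_density c (snd c x) \<noteq> 0" by (intro vol_density_continuous(2)[OF c]) blast
    have "h' x = k (snd c x) / \<bar>vol_density c (snd c x)\<bar>"
      using True x by (simp add: h'_def q_def chart_ext_def abs_density_def)
    also have "\<dots> = h x" using nz by (simp flip: h[OF True])
    finally show ?thesis by simp
  qed simp
  have sm: "h' \<in> borel_measurable ?\<mu>" "(indicator S :: 'g \<Rightarrow> ennreal) \<in> borel_measurable ?\<mu>"
    "(indicator S :: 'g \<Rightarrow> real) \<in> borel_measurable ?\<mu>"
    using h'm S(1) by (auto simp: sets_volume_measure cong: measurable_cong_sets)
  have dm: "?d \<in> borel_measurable lborel"
    using chart_measurable(1)[OF c] chart_image_borel(1)[OF c S] by measurable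
  have d0: "AE u in lborel. 0 \<le> ?d u" by (simp add: abs_density_def)
  have ind: "(\<lambda>x. ennreal (indicator S x)) = (indicator S :: 'g \<Rightarrow> ennreal)"
    by (auto simp: indicator_def)
  have im: "chart_inv_ext c \<in> measurable (density lborel (\<lambda>u. ennreal (?d u))) borel"
    using chart_measurable(2)[OF c] by (simp cong: measurable_cong_sets)
  have cm: "(\<lambda>u. h' (chart_inv_ext c u)) \<in> borel_measurable lborel"
    using measurable_compose[OF chart_measurable(2)[OF c] h'm] by simp
  have fin: "?d u *\<^sub>R h' (chart_inv_ext c u) = indicator (snd c ` S) u * k u" for u
  proof (cases "u \<in> snd c ` S")
    case True
    then obtain x where x: "x \<in> S" "u = snd c x" by blast
    then have xc: "x \<in> fst c" using S by blast
    have "chart_inv_ext c u = x" using x xc chart_left[OF c] by (simp add: chart_inv_ext_def)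
    moreover have "abs_density c u \<noteq> 0"
      using vol_density_continuous(2)[OF c, of u] x xc by (simp add: abs_density_def)
    ultimately show ?thesis using True x xc by (simp add: h'_def q_def chart_ext_def)
  qed simp
  have "integrable lborel (\<lambda>u. ?d u *\<^sub>R h' (chart_inv_ext c u))" unfolding fin by (rule k)
  then have "integrable (density lborel (\<lambda>u. ennreal (?d u))) (\<lambda>u. h' (chart_inv_ext c u))"
    by (subst integrable_density[OF cm dm d0])
  then have "integrable (density ?\<mu> (indicator S)) h'"
    unfolding volume_measure_restrict[OF c S] by (subst integrable_distr_eq[OF im h'm])
  then have "integrable ?\<mu> (\<lambda>x. indicator S x *\<^sub>R h' x)"
    using integrable_density[OF sm(1) sm(3)] unfolding ind by simp
  then show "set_integrable ?\<mu> S h" unfolding set_integrable_def h'h .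
  have "set_lebesgue_integral ?\<mu> S h = (LINT x|?\<mu>. indicator S x *\<^sub>R h' x)"
    unfolding set_lebesgue_integral_def h'h ..
  also have "\<dots> = (LINT x|density ?\<mu> (indicator S). h' x)"
    using integral_density[OF sm(1) sm(3)] unfolding ind by simp
  also have "\<dots> = (LINT u|density lborel (\<lambda>u. ennreal (?d u)). h' (chart_inv_ext c u))"
    unfolding volume_measure_restrict[OF c S] by (rule integral_distr[OF im h'm])
  also have "\<dots> = (LINT u|lborel. ?d u *\<^sub>R h' (chart_inv_ext c u))"
    by (rule integral_density[OF cm dm d0])
  finally show "set_lebesgue_integral ?\<mu> S h = (LINT u|lborel. indicator (snd c ` S) u * k u)" unfolding fin .
qed

text \<open>The density vanishes nowhere on a chart, and nonempty open sets of a Euclidean space are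
  not negligible. This turns almost-everywhere statements about continuous forms into pointwise
  ones.\<close>

lemma volume_measure_open_pos:
  assumes "open S" "x \<in> S"
  shows "emeasure (volume_measure G) S \<noteq> 0"
proof
  assume z: "emeasure (volume_measure G) S = 0"
  let ?c = "chart_at G x"
  have c: "?c \<in> atlas G" "x \<in> fst ?c" by (rule chart_at)+
  let ?T = "S \<inter> fst ?c" and ?Im = "snd ?c ` (S \<inter> fst ?c)"
  have T: "?T \<in> sets borel" "?T \<subseteq> fst ?c" using assms open_dom[OF c(1)] by auto
  have "emeasure (volume_measure G) ?T \<le> emeasure (volume_measure G) S"
    using assms(1) by (intro emeasure_mono) (auto simp: sets_volume_measure)
  then have "(\<integral>\<^sup>+u. ennreal \<bar>vol_density ?c u\<bar> * indicator ?Im u \<partial>lborel) = 0"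
    using z emeasure_volume_measure[OF c(1) T] by simp
  then have 0: "(\<integral>\<^sup>+u. ennreal (abs_density ?c u) * indicator ?Im u \<partial>lborel) = 0"
    by (subst (asm) nn_integral_cong[where v = "\<lambda>u. ennreal (abs_density ?c u) * indicator ?Im u"])
       (auto simp: abs_density_def indicator_def)
  have oO: "open ?Im" by (rule chart_image_open[OF c(1) assms(1)])
  have "AE u in lborel. ennreal (abs_density ?c u) * indicator ?Im u = 0"
    using 0 chart_measurable(1)[OF c(1)] oO by (subst (asm) nn_integral_0_iff_AE) auto
  then have "AE u in lborel. u \<notin> ?Im"
  proof eventually_elim
    case (elim u)
    show ?case
    proof
      assume u: "u \<in> ?Im"
      then have "abs_density ?c u > 0"
        using vol_density_continuous(2)[OF c(1), of u] by (auto simp: abs_density_def)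
      then show False using elim u by simp
    qed
  qed
  then have "?Im \<in> null_sets lborel" using oO by (subst (asm) AE_iff_null_sets[symmetric]) auto
  then have "negligible ?Im" by (simp add: negligible_iff_null_sets null_sets_completionI)
  moreover have "?Im \<noteq> {}" using c assms by blast
  ultimately show False using open_not_negligible[OF oO] by blast
qed

lemma volume_measure_locally_finite:
  obtains W where "open W" "x \<in> W" "emeasure (volume_measure G) W < \<infinity>"
proof -
  let ?c = "chart_at G x"
  have c: "?c \<in> atlas G" "x \<in> fst ?c" by (rule chart_at)+
  obtain r where r: "r > 0" "cball (snd ?c x) r \<subseteq> snd ?c ` fst ?c"
    using open_img[OF c(1)] c(2) open_contains_cball by blast
  let ?K = "cball (snd ?c x) r" and ?B = "ball (snd ?c x) r"
  have "compact (vol_density ?c ` ?K)"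
    using vol_density_continuous(1)[OF c(1)] r(2) by (intro compact_continuous_image) (auto elim: continuous_on_subset)
  then obtain C where C: "\<And>u. u \<in> ?K \<Longrightarrow> \<bar>vol_density ?c u\<bar> \<le> C"
    using compact_imp_bounded by (fastforce simp: bounded_iff)
  let ?Im = "fst ?c \<inter> snd ?c -` ?B"
  have oO: "open ?Im" by (intro continuous_open_preimage chart_cont open_dom c open_ball)
  have "emeasure (volume_measure G) ?Im = (\<integral>\<^sup>+u. ennreal \<bar>vol_density ?c u\<bar> * indicator (snd ?c ` ?Im) u \<partial>lborel)"
    using oO by (intro emeasure_volume_measure c) auto
  also have "\<dots> \<le> (\<integral>\<^sup>+u. ennreal C * indicator ?K u \<partial>lborel)"
    using C by (intro nn_integral_mono) (auto simp: indicator_def intro!: ennreal_leI)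
  also have "\<dots> = ennreal C * emeasure lborel ?K" by (simp add: nn_integral_cmult_indicator)
  also have "\<dots> < \<infinity>"
  proof -
    have "emeasure lborel ?K < \<infinity>" by (rule emeasure_bounded_finite[OF bounded_cball])
    then show ?thesis by (simp add: ennreal_mult_less_top)
  qed
  finally show ?thesis using that[of ?Im] oO c r by auto
qed

lemma volume_measure_compact_finite:
  assumes "compact K" shows "emeasure (volume_measure G) K < \<infinity>"
proof -
  have "\<exists>W. open W \<and> x \<in> W \<and> emeasure (volume_measure G) W < \<infinity>" for x
    using volume_measure_locally_finite[of x] by metis
  then obtain N where N: "\<And>x. open (N x)" "\<And>x. x \<in> N x" "\<And>x. emeasure (volume_measure G) (N x) < \<infinity>" by metis
  obtain X where X: "finite X" "K \<subseteq> (\<Union>x\<in>X. N x)"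
    using compactE_image[OF assms, of UNIV N] N(1,2) by (metis UNIV_I UN_I subsetI)
  have "emeasure (volume_measure G) K \<le> emeasure (volume_measure G) (\<Union>x\<in>X. N x)"
    using X N(1) by (intro emeasure_mono) (auto simp: sets_volume_measure)
  also have "\<dots> \<le> (\<Sum>x\<in>X. emeasure (volume_measure G) (N x))"
    using X N(1) by (intro emeasure_subadditive_finite) (auto simp: sets_volume_measure)
  also have "\<dots> < \<infinity>" using X N(3) by simp
  finally show ?thesis .
qed

lemma set_integrable_continuous:
  fixes h :: "'g \<Rightarrow> real"
  assumes K: "compact K" and h: "continuous_on K h"
  shows "set_integrable (volume_measure G) K h"
proof -
  have KB: "K \<in> sets borel" using K compact_imp_closed borel_closed by blast
  have "bounded (h ` K)" by (intro compact_imp_bounded compact_continuous_image h K)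
  then obtain C where C: "\<And>x. x \<in> K \<Longrightarrow> \<bar>h x\<bar> \<le> C" by (auto simp: bounded_iff)
  have "(\<lambda>x. indicator K x *\<^sub>R h x) \<in> borel_measurable borel"
    by (rule borel_measurable_continuous_on_indicator[OF KB h])
  then have m: "(\<lambda>x. indicator K x *\<^sub>R h x) \<in> borel_measurable (volume_measure G)"
    by (simp add: sets_volume_measure cong: measurable_cong_sets)
  show ?thesis unfolding set_integrable_def
    by (rule integrableI_bounded_set[where A = K and B = C])
       (use KB m C volume_measure_compact_finite[OF K] in \<open>auto simp: sets_volume_measure indicator_def\<close>)
qed

end

section \<open>The wedge terms in a chart\<close>

context carnot_space begin

text \<open>A horizontal vector with nonzero value extends to a left-invariant field, on which
  \<eta> stays nonzero near x by continuity; that neighbourhood has positive measure.\<close>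

lemma vertical_form_everywhere:
  assumes W: "open W" "x \<in> W" and \<eta>: "smooth_form G 1 W \<eta>" and vert: "vertical_form G W \<eta>"
    and w: "w \<in> horizontal G x"
  shows "\<eta> x [w] = 0"
proof (rule ccontr)
  assume nz: "\<eta> x [w] \<noteq> 0"
  let ?c = "chart_at G x"
  have c: "?c \<in> atlas G" "x \<in> fst ?c" by (rule chart_at)+
  obtain h where h: "h \<in> layer G 1" "w = left_mat ?c x h" using w horizontal_iff by blast
  let ?S = "snd ?c ` (W \<inter> fst ?c)"
  let ?q = "\<lambda>u. form_in_chart G ?c \<eta> u [left_mat ?c (chart_inv ?c u) h]"
  have oS: "open ?S" by (rule chart_image_open[OF c(1) W(1)])
  have lin: "linear (\<lambda>v. form_in_chart G ?c \<eta> u [v])" if u: "u \<in> ?S" for u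
  proof -
    obtain y where y: "y \<in> W" "y \<in> fst ?c" "u = snd ?c y" using u by blast
    have "alt_form 1 (form_in_chart G ?c \<eta> u)"
      unfolding y(3) using \<eta> y by (intro alt_form_in_chart c) (auto simp: smooth_form_def)
    from alt_form_linear[OF this, of "[0]" 0] show ?thesis by simp
  qed
  have "continuous_on ?S ?q"
  proof (rule continuous_on_linear_apply[where A = "\<lambda>u v. form_in_chart G ?c \<eta> u [v]", OF lin])
    have "Ck_on 0 ?S (\<lambda>u. form_in_chart G ?c \<eta> u [v])" for v
      using \<eta> c(1) unfolding smooth_form_def smooth_on_def by blast
    then show "continuous_on ?S (\<lambda>u. form_in_chart G ?c \<eta> u [v])" for v by simp
    have "continuous_on (snd ?c ` fst ?c) (\<lambda>u. left_mat ?c (chart_inv ?c u) h)"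
      by (rule Ck_on_imp_continuous_on[OF left_mat_smooth[OF c(1)]])
    then show "continuous_on ?S (\<lambda>u. left_mat ?c (chart_inv ?c u) h)"
      by (rule continuous_on_subset) blast
  qed
  then have oT: "open (?S \<inter> ?q -` (- {0}))" by (intro continuous_open_preimage oS) auto
  have eq: "?q (snd ?c y) = \<eta> y [left_field G h y]" if "y \<in> fst ?c" for y
    using that c chart_left[OF c(1) that]
    by (simp add: form_in_chart_eq change_coords_left_mat chart_at left_field_eq)
  let ?N = "fst ?c \<inter> snd ?c -` (?S \<inter> ?q -` (- {0}))"
  have oN: "open ?N" by (rule continuous_open_preimage[OF chart_cont(1)[OF c(1)] open_dom[OF c(1)] oT])
  have xN: "x \<in> ?N" using c W nz eq[OF c(2)] h(2) by (auto simp: left_field_eq)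
  have bad: "y \<in> W \<and> \<not> (\<forall>w\<in>horizontal G y. \<eta> y [w] = 0)" if yN: "y \<in> ?N" for y
  proof -
    have y: "y \<in> fst ?c" using yN by blast
    have "snd ?c y \<in> ?S" using yN by (simp only: Int_iff vimage_eq)
    then obtain z where "snd ?c y = snd ?c z" "z \<in> W \<inter> fst ?c" by (rule imageE)
    then have z: "z \<in> W" "z \<in> fst ?c" "snd ?c y = snd ?c z" by blast+
    have "y = z"
      using arg_cong[OF z(3), of "chart_inv ?c"] unfolding chart_left[OF c(1) y] chart_left[OF c(1) z(2)] .
    moreover have "\<eta> y [left_field G h y] \<noteq> 0" using yN unfolding eq[OF y, symmetric] by simp
    moreover have "left_field G h y \<in> horizontal G y" using h(1) by (simp add: horizontal_def)
    ultimately show ?thesis using z(1) by blast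
  qed
  have "AE y in volume_measure G. y \<in> W \<longrightarrow> (\<forall>w\<in>horizontal G y. \<eta> y [w] = 0)"
    using vert by (simp add: vertical_form_def)
  then have "AE y in volume_measure G. y \<notin> ?N" by eventually_elim (use bad in blast)
  then have "?N \<in> null_sets (volume_measure G)"
    using oN by (subst AE_iff_null_sets) (auto simp: sets_volume_measure)
  then show False using volume_measure_open_pos[OF oN xN] by (simp add: null_setsD1)
qed

lemma DIM_Suc: "Suc (DIM('e) - 1) = DIM('e)"
  using DIM_positive[where 'a = 'e] by simp

text \<open>In the chart \<open>c\<close> the \<open>(n - 1)\<close>-form \<open>\<gamma>\<close> is the contraction of the Euclidean volume form
  with this vector field.\<close>

definition dual_field :: "('g, 'e) chart \<Rightarrow> ('g \<Rightarrow> 'e list \<Rightarrow> real) \<Rightarrow> 'e \<Rightarrow> 'e" where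
  "dual_field c \<gamma> u = (\<Sum>i<DIM('e). ((-1) ^ i * form_in_chart G c \<gamma> u (omit i basis_list)) *\<^sub>R basis_list ! i)"

text \<open>The sum is the top form \<phi> \<and> \<gamma> on the frame. Multiplied by
  \<open>vol_density\<close> it becomes the value on the Euclidean basis, which is \<phi> of the
  dual field by the choice of coefficients in \<open>dual_field\<close>.\<close>

lemma top_form_contraction:
  assumes c: "c \<in> atlas G" "x \<in> fst c" and \<phi>: "linear \<phi>" and \<gamma>: "alt_form (DIM('e) - 1) (\<gamma> x)"
  shows "(\<Sum>i<DIM('e). (-1) ^ i * (\<phi> (chart_frames c x ! i) * \<gamma> x (omit i (frames x)))) * vol_density c (snd c x)
    = \<phi> (dual_field c \<gamma> (snd c x))"
proof -
  let ?k = "DIM('e) - 1" and ?\<beta> = "form_in_chart G c \<gamma> (snd c x)"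
  let ?T = "\<lambda>vs. if length vs = Suc ?k then \<Sum>i<length vs. (-1) ^ i * (\<phi> (vs ! i) * ?\<beta> (omit i vs)) else 0"
  have b: "alt_form ?k ?\<beta>" by (rule alt_form_in_chart[where \<omega> = \<gamma>, OF c \<gamma>])
  have "alt_form (Suc ?k) ?T"
  proof (rule alt_form_antisymmetrize[where \<Phi> = "\<lambda>v ws. \<phi> v * ?\<beta> ws"])
    show "alt_form ?k (\<lambda>ws. \<phi> v * ?\<beta> ws)" for v
      using alt_form_sum[of "{()}" ?k "\<lambda>_. ?\<beta>" "\<lambda>_. \<phi> v"] b by simp
    show "linear (\<lambda>v. \<phi> v * ?\<beta> ws)" for ws
      using linear_comp_real[OF \<phi>, of "?\<beta> ws"] by (simp add: mult.commute)
  qed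
  then have "?T (chart_frames c x) * vol_density c (snd c x) = ?T basis_list"
    unfolding DIM_Suc by (rule top_form_chart_frames[OF c])
  moreover have "?T basis_list = \<phi> (dual_field c \<gamma> (snd c x))"
    using DIM_Suc
    by (simp add: length_basis_list dual_field_def linear_sum[OF \<phi>] linear_scale[OF \<phi>] mult.commute mult.left_commute)
  moreover have "?\<beta> (omit i (chart_frames c x)) = \<gamma> x (omit i (frames x))" for i
    by (simp only: form_in_chart_eq[OF c] map_omit frames_eq[OF c])
  ultimately show ?thesis using DIM_Suc by (simp add: length_frame_index)
qed

text \<open>It suffices that the coefficients outside the first layer vanish. For \<phi> such a
  coefficient, the only term of the contraction with \<phi> nonzero omits a frame vector outside the
  first layer, and then every \<open>hat_coframe\<close> is 0.\<close>

lemma dual_field_horizontal: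
  assumes c: "c \<in> atlas G" "x \<in> fst c" and \<gamma>: "alt_form (DIM('e) - 1) (\<gamma> x)"
    and w: "\<gamma> x = (\<lambda>vs. \<Sum>i = 1..dim (layer G 1). b i x * hat_coframe G i x vs)"
  shows "\<exists>h\<in>layer G 1. dual_field c \<gamma> (snd c x) = left_mat c x h"
proof (rule bexI)
  let ?B = "dual_field c \<gamma> (snd c x)"
  show "?B = left_mat c x (left_mat_inv c x ?B)" by (rule left_mat_inverse(2)[OF c, symmetric])
  show "left_mat_inv c x ?B \<in> layer G 1"
  proof (rule layer_1I)
    fix a assume a: "a \<in> set (frame_index G)" "fst a \<noteq> 1"
    have "linear (left_mat_inv c x)"
      by (rule linear_inverse_fun[OF linear_left_mat[OF c] left_mat_inverse(2)[OF c] left_mat_inverse(1)[OF c]])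
    from linear_compose[OF this linear_coef[of a]]
    have l: "linear (\<lambda>v. coef a (left_mat_inv c x v))" by (simp add: o_def)
    have "(\<Sum>i<DIM('e). (-1) ^ i * (coef a (left_mat_inv c x (chart_frames c x ! i)) * \<gamma> x (omit i (frames x)))) = 0"
    proof (intro sum.neutral ballI)
      fix i assume "i \<in> {..<DIM('e)}"
      then have i: "i < DIM('e)" by simp
      have ii: "frame_index G ! i \<in> set (frame_index G)" using i by (simp add: length_frame_index)
      have e: "coef a (left_mat_inv c x (chart_frames c x ! i)) = (if a = frame_index G ! i then 1 else 0)"
        using i coef_frame_vec[OF a(1) ii] by (simp add: length_frame_index left_mat_inverse(1)[OF c])
      show "(-1) ^ i * (coef a (left_mat_inv c x (chart_frames c x ! i)) * \<gamma> x (omit i (frames x))) = 0"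
      proof (cases "a = frame_index G ! i")
        case True
        have "hat_coframe G m x (omit i (frames x)) = 0" if "m \<in> {1..dim (layer G 1)}" for m
          by (rule hat_coframe_omit_frames[OF that i]) (use True a(2) in force)
        then show ?thesis unfolding w by (simp del: One_nat_def)
      next
        case False
        then show ?thesis unfolding e by simp
      qed
    qed
    with top_form_contraction[where \<phi> = "\<lambda>v. coef a (left_mat_inv c x v)" and \<gamma> = \<gamma>, OF c l \<gamma>]
    show "coef a (left_mat_inv c x ?B) = 0" by simp
  qed
qed

text \<open>The integrand that \<open>form_integral\<close> extracts from the first wedge product in
  \<open>weak_contact_field\<close>; \<open>wedge_term_2\<close> belongs to the second.\<close>

definition wedge_term_1 :: "('g \<Rightarrow> 'e) \<Rightarrow> ('g \<Rightarrow> 'e list \<Rightarrow> real) \<Rightarrow> ('g \<Rightarrow> 'e list \<Rightarrow> real) \<Rightarrow> 'g \<Rightarrow> real" where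
  "wedge_term_1 Y \<eta> \<gamma> x = wedge 1 (DIM('e) - 1) (interior_mult Y (ext_deriv G \<eta>) x) (\<gamma> x) (frames x)"

definition wedge_term_2 :: "('g \<Rightarrow> 'e) \<Rightarrow> ('g \<Rightarrow> 'e list \<Rightarrow> real) \<Rightarrow> ('g \<Rightarrow> 'e list \<Rightarrow> real) \<Rightarrow> 'g \<Rightarrow> real" where
  "wedge_term_2 Y \<eta> \<gamma> x = wedge 0 DIM('e) (interior_mult Y \<eta> x) (ext_deriv G \<gamma> x) (frames x)"

lemma wedge_term_1_eq:
  assumes "alt_form (DIM('e) - 1) (\<gamma> x)"
  shows "wedge_term_1 Y \<eta> \<gamma> x
    = (\<Sum>i<DIM('e). (-1) ^ i * (ext_deriv G \<eta> x [Y x, frames x ! i] * \<gamma> x (omit i (frames x))))"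
  unfolding wedge_term_1_def interior_mult_def
  using wedge_1_eq[OF assms, of "frames x"] DIM_Suc by (simp add: length_frame_index)

text \<open>\<open>top_form_contraction\<close> with \<phi> the contraction of d\<eta> with
  Y.\<close>

lemma wedge_term_1_in_chart:
  assumes c: "c \<in> atlas G" "x \<in> fst c" and W: "open W" "x \<in> W"
    and \<eta>: "\<And>x. x \<in> W \<Longrightarrow> alt_form 1 (\<eta> x)"
      "\<And>vs. (\<lambda>u. form_in_chart G c \<eta> u vs) differentiable (at (snd c x))"
    and \<gamma>: "alt_form (DIM('e) - 1) (\<gamma> x)"
  shows "wedge_term_1 Y \<eta> \<gamma> x * vol_density c (snd c x)
    = ext_d (form_in_chart G c \<eta>) (snd c x) [field_in_chart G c Y (snd c x), dual_field c \<gamma> (snd c x)]"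
proof -
  let ?Y = "field_in_chart G c Y (snd c x)"
  let ?S = "snd c ` (W \<inter> fst c)"
  have "alt_form (Suc 1) (ext_d (form_in_chart G c \<eta>) (snd c x))"
  proof (rule alt_form_ext_d[where S = ?S])
    show "open ?S" by (rule chart_image_open[OF c(1) W(1)])
    show "alt_form 1 (form_in_chart G c \<eta> u)" if "u \<in> ?S" for u
      using that \<eta>(1) alt_form_in_chart[OF c(1)] by blast
  qed (use c W \<eta>(2) in auto)
  from alt_form_linear[OF this, of "[?Y, 0]" 1]
  have l: "linear (\<lambda>v. ext_d (form_in_chart G c \<eta>) (snd c x) [?Y, v])" by simp
  have "ext_deriv G \<eta> x [Y x, frames x ! i] = ext_d (form_in_chart G c \<eta>) (snd c x) [?Y, chart_frames c x ! i]"
    if "i < DIM('e)" for i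
    using that ext_deriv_in_chart[OF c W \<eta>, of "[Y x, frames x ! i]"]
    by (simp add: field_in_chart_eq[OF c] length_frame_index frame_field_eq change_coords_left_mat chart_at c)
  then have "wedge_term_1 Y \<eta> \<gamma> x = (\<Sum>i<DIM('e). (-1) ^ i
      * (ext_d (form_in_chart G c \<eta>) (snd c x) [?Y, chart_frames c x ! i] * \<gamma> x (omit i (frames x))))"
    unfolding wedge_term_1_eq[where \<gamma> = \<gamma>, OF \<gamma>] by simp
  then show ?thesis
    using top_form_contraction[where \<gamma> = \<gamma> and \<phi> = "\<lambda>v. ext_d (form_in_chart G c \<eta>) (snd c x) [?Y, v]", OF c l \<gamma>] by simp
qed

lemma alt_form_ext_deriv:
  assumes c: "c \<in> atlas G" "x \<in> fst c" and W: "open W" "x \<in> W"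
    and \<gamma>: "\<And>x. x \<in> W \<Longrightarrow> alt_form k (\<gamma> x)"
      "\<And>vs. (\<lambda>u. form_in_chart G c \<gamma> u vs) differentiable (at (snd c x))"
  shows "alt_form (Suc k) (ext_d (form_in_chart G c \<gamma>) (snd c x))" "alt_form (Suc k) (ext_deriv G \<gamma> x)"
proof -
  let ?S = "snd c ` (W \<inter> fst c)"
  show a: "alt_form (Suc k) (ext_d (form_in_chart G c \<gamma>) (snd c x))"
  proof (rule alt_form_ext_d[where S = ?S])
    show "open ?S" by (rule chart_image_open[OF c(1) W(1)])
    show "alt_form k (form_in_chart G c \<gamma> u)" if "u \<in> ?S" for u
      using that \<gamma>(1) alt_form_in_chart[OF c(1)] by blast
  qed (use c W \<gamma>(2) in auto)
  have "ext_deriv G \<gamma> x = (\<lambda>vs. ext_d (form_in_chart G c \<gamma>) (snd c x) (map (change_coords (chart_at G x) c x) vs))"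
    by (rule ext) (rule ext_deriv_in_chart[OF c W \<gamma>])
  then show "alt_form (Suc k) (ext_deriv G \<gamma> x)"
    using alt_form_map[OF a linear_change_coords[OF chart_at(1) c(1) chart_at(2) c(2)]] by simp
qed

text \<open>The exterior derivative of the volume form contracted with a field is the divergence
  times the volume form.\<close>

lemma divergence_dual_field:
  assumes "\<And>vs. (\<lambda>u. form_in_chart G c \<gamma> u vs) differentiable (at u)"
  shows "divergence (dual_field c \<gamma>) u = ext_d (form_in_chart G c \<gamma>) u basis_list"
proof -
  let ?bs = "basis_list :: 'e list"
  let ?D = "\<lambda>vs. frechet_derivative (\<lambda>u. form_in_chart G c \<gamma> u vs) (at u)"
  have D: "((\<lambda>u. form_in_chart G c \<gamma> u vs) has_derivative ?D vs) (at u)" for vs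
    using assms frechet_derivative_works by blast
  have "(dual_field c \<gamma> has_derivative (\<lambda>v. \<Sum>i<DIM('e). ((-1) ^ i * ?D (omit i ?bs) v) *\<^sub>R ?bs ! i)) (at u)"
    unfolding dual_field_def[abs_def]
    by (intro has_derivative_sum has_derivative_scaleR_left has_derivative_mult_right D)
  note fd = frechet_derivative_at[OF this]
  have "divergence (dual_field c \<gamma>) u = (\<Sum>b\<in>Basis. (\<Sum>i<DIM('e). ((-1) ^ i * ?D (omit i ?bs) b) *\<^sub>R ?bs ! i) \<bullet> b)"
    unfolding divergence_def fd[symmetric] ..
  also have "\<dots> = (\<Sum>i<DIM('e). \<Sum>b\<in>Basis. (-1) ^ i * ?D (omit i ?bs) b * (?bs ! i \<bullet> b))"
    unfolding inner_sum_left inner_scaleR_left by (rule sum.swap)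
  also have "\<dots> = (\<Sum>i<DIM('e). (-1) ^ i * ?D (omit i ?bs) (?bs ! i))"
  proof (intro sum.cong refl)
    fix i assume "i \<in> {..<DIM('e)}"
    then have i: "?bs ! i \<in> Basis" using nth_mem[of i ?bs] by (simp add: length_basis_list basis_list)
    have "(\<Sum>b\<in>Basis. (-1) ^ i * ?D (omit i ?bs) b * (?bs ! i \<bullet> b))
        = (\<Sum>b\<in>Basis. if b = ?bs ! i then (-1) ^ i * ?D (omit i ?bs) (?bs ! i) else 0)"
      by (intro sum.cong) (auto simp: inner_Basis i)
    then show "(\<Sum>b\<in>Basis. (-1) ^ i * ?D (omit i ?bs) b * (?bs ! i \<bullet> b)) = (-1) ^ i * ?D (omit i ?bs) (?bs ! i)"
      using i by simp
  qed
  finally show ?thesis by (simp add: ext_d_def length_basis_list)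
qed

lemma wedge_term_2_eq:
  assumes "alt_form DIM('e) (ext_deriv G \<gamma> x)"
  shows "wedge_term_2 Y \<eta> \<gamma> x = \<eta> x [Y x] * ext_deriv G \<gamma> x (frames x)"
  unfolding wedge_term_2_def interior_mult_def
  using wedge_0_eq[OF assms, of "frames x"] by (simp add: length_frame_index)

lemma wedge_term_2_in_chart:
  assumes c: "c \<in> atlas G" "x \<in> fst c" and W: "open W" "x \<in> W"
    and \<gamma>: "\<And>x. x \<in> W \<Longrightarrow> alt_form (DIM('e) - 1) (\<gamma> x)"
      "\<And>vs. (\<lambda>u. form_in_chart G c \<gamma> u vs) differentiable (at (snd c x))"
  shows "wedge_term_2 Y \<eta> \<gamma> x * vol_density c (snd c x)
    = form_in_chart G c \<eta> (snd c x) [field_in_chart G c Y (snd c x)] * divergence (dual_field c \<gamma>) (snd c x)"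
proof -
  let ?d = "ext_d (form_in_chart G c \<gamma>) (snd c x)"
  have a: "alt_form DIM('e) ?d" "alt_form DIM('e) (ext_deriv G \<gamma> x)"
    using alt_form_ext_deriv[OF c W \<gamma>] unfolding DIM_Suc by auto
  have m: "map (change_coords (chart_at G x) c x) (frames x) = chart_frames c x"
    by (simp add: frame_field_eq change_coords_left_mat chart_at c)
  have "ext_deriv G \<gamma> x (frames x) = ?d (chart_frames c x)"
    using ext_deriv_in_chart[OF c W \<gamma>, of "frames x"] unfolding m .
  moreover have "?d (chart_frames c x) * vol_density c (snd c x) = divergence (dual_field c \<gamma>) (snd c x)"
    unfolding divergence_dual_field[OF \<gamma>(2)] by (rule top_form_chart_frames[OF c a(1)])
  moreover have "form_in_chart G c \<eta> (snd c x) [field_in_chart G c Y (snd c x)] = \<eta> x [Y x]"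
    by (simp add: form_in_chart_eq[OF c] field_in_chart_eq[OF c] change_coords_inverse chart_at c)
  ultimately show ?thesis unfolding wedge_term_2_eq[where \<gamma> = \<gamma>, OF a(2)] by (simp add: mult.assoc)
qed

lemma form_zero_near:
  assumes d: "d \<in> atlas G" "x \<in> fst d" and W: "open W" "x \<in> W" and z: "\<And>x. x \<in> W \<Longrightarrow> \<gamma> x = (\<lambda>vs. 0)"
  shows "((\<lambda>u. form_in_chart G d \<gamma> u vs) has_derivative (\<lambda>_. 0)) (at (snd d x))"
proof (rule has_derivative_transform_within_open[of "\<lambda>_. 0"])
  show "open (snd d ` (W \<inter> fst d))" by (rule chart_image_open[OF d(1) W(1)])
  fix u assume "u \<in> snd d ` (W \<inter> fst d)"
  then show "0 = form_in_chart G d \<gamma> u vs" using z form_in_chart_eq[OF d(1)] by auto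
qed (use d W in auto)

text \<open>Vanishing is assumed on an open set because \<open>ext_deriv\<close> depends on a
  neighbourhood of the point.\<close>

lemma wedge_terms_zero:
  assumes W: "open W" "x \<in> W" and z: "\<And>x. x \<in> W \<Longrightarrow> \<gamma> x = (\<lambda>vs. 0)"
  shows "wedge_term_1 Y \<eta> \<gamma> x = 0" "wedge_term_2 Y \<eta> \<gamma> x = 0"
proof -
  show "wedge_term_1 Y \<eta> \<gamma> x = 0" by (simp add: wedge_term_1_def z[OF W(2)] wedge_def)
  have "frechet_derivative (\<lambda>u. form_in_chart G (chart_at G x) \<gamma> u vs) (at (snd (chart_at G x) x)) = (\<lambda>_. 0)" for vs
    by (rule frechet_derivative_at[OF form_zero_near[OF chart_at W z], symmetric])
  then have "ext_deriv G \<gamma> x = (\<lambda>vs. 0)" by (simp add: ext_deriv_def Let_def fun_eq_iff)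
  then show "wedge_term_2 Y \<eta> \<gamma> x = 0" by (simp add: wedge_term_2_def wedge_def)
qed

end

section \<open>The contact diffeomorphism and its differential in charts\<close>

locale contact_map = carnot_space G for G :: "('g::{t2_space, second_countable_topology}, 'e::euclidean_space) carnot_struct" +
  fixes U V :: "'g set" and f :: "'g \<Rightarrow> 'g" and Z :: "'g \<Rightarrow> 'e"
  assumes open_U: "open U" and open_V: "open V" and contact_diffeo: "contact_diffeo G U V f"
    and contact_field: "contact_field G U Z"
begin

abbreviation "fi \<equiv> inv_into U f"
abbreviation "Y \<equiv> push_forward G U f Z"

lemma f_bij: "bij_betw f U V" and f_Ck: "Ck_map 1 G U f" and fi_Ck: "Ck_map 1 G V fi"
  using contact_diffeo by (simp_all add: contact_diffeo_def)

lemma f_contact: "x \<in> U \<Longrightarrow> w \<in> horizontal G x \<Longrightarrow> differential G f x w \<in> horizontal G (f x)"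
  using contact_diffeo unfolding contact_diffeo_def by blast

lemma fi_f: "x \<in> U \<Longrightarrow> fi (f x) = x"
  by (rule bij_betw_inv_into_left[OF f_bij])

lemma f_in: "x \<in> U \<Longrightarrow> f x \<in> V"
  using bij_betwE[OF f_bij] by blast

lemma f_fi: "y \<in> V \<Longrightarrow> f (fi y) = y"
  by (rule bij_betw_inv_into_right[OF f_bij])

lemma fi_in: "y \<in> V \<Longrightarrow> fi y \<in> U"
  using bij_betwE[OF bij_betw_inv_into[OF f_bij]] by blast

lemma dmap_f:
  assumes "d \<in> atlas G" "c \<in> atlas G" "x \<in> U" "x \<in> fst d" "f x \<in> fst c"
  shows "dmap d c f x (change_coords (chart_at G x) d x w)
    = change_coords (chart_at G (f x)) c (f x) (differential G f x w)"
  using mdiff_change(2)[OF chart_at(1) chart_at(1) assms(1,2)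
      Ck_map_mdiff[OF open_U f_Ck chart_at(1) chart_at(1) assms(3) chart_at(2) chart_at(2)] assms(4,5)]
  by (simp add: dmap_def differential_def)

text \<open>The first form serves to evaluate vertical forms at the image point, the second to
  compare coordinates in the first layer.\<close>

lemma dmap_f_horizontal:
  assumes "d \<in> atlas G" "c \<in> atlas G" "x \<in> U" "x \<in> fst d" "f x \<in> fst c" "h \<in> layer G 1"
  shows "\<exists>w\<in>horizontal G (f x). dmap d c f x (left_mat d x h) = change_coords (chart_at G (f x)) c (f x) w"
    and "\<exists>k\<in>layer G 1. dmap d c f x (left_mat d x h) = left_mat c (f x) k"
proof -
  have "left_mat d x h = change_coords (chart_at G x) d x (left_field G h x)"
    by (simp add: left_field_eq change_coords_left_mat chart_at assms)
  then have e: "dmap d c f x (left_mat d x h)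
      = change_coords (chart_at G (f x)) c (f x) (differential G f x (left_field G h x))"
    using dmap_f[OF assms(1-5)] by simp
  have w: "differential G f x (left_field G h x) \<in> horizontal G (f x)"
    by (rule f_contact[OF assms(3)]) (use assms(6) in \<open>simp add: horizontal_def\<close>)
  with e show "\<exists>w\<in>horizontal G (f x). dmap d c f x (left_mat d x h) = change_coords (chart_at G (f x)) c (f x) w"
    by blast
  obtain k where "k \<in> layer G 1" "differential G f x (left_field G h x) = left_mat (chart_at G (f x)) (f x) k"
    using w horizontal_iff by blast
  then show "\<exists>k\<in>layer G 1. dmap d c f x (left_mat d x h) = left_mat c (f x) k"
    using e change_coords_left_mat[OF chart_at assms(2,5)] by auto
qed

end

section \<open>Bump functions and the push-forward in charts\<close>

lemma derivative_left_inverse: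
  fixes F :: "'a::euclidean_space \<Rightarrow> 'b::euclidean_space"
  assumes "open U" "x \<in> U" "Ck_on 1 U F" "Ck_on 1 V Fi" "F x \<in> V" "\<And>x. x \<in> U \<Longrightarrow> Fi (F x) = x"
  shows "frechet_derivative Fi (at (F x)) (frechet_derivative F (at x) v) = v"
proof -
  have "((\<lambda>x. Fi (F x)) has_derivative (\<lambda>v. frechet_derivative Fi (at (F x)) (frechet_derivative F (at x) v))) (at x)"
    by (rule has_derivative_compose[OF Ck1_has_derivative[OF assms(3,2)] Ck1_has_derivative[OF assms(4,5)]])
  then have "((\<lambda>x. x) has_derivative (\<lambda>v. frechet_derivative Fi (at (F x)) (frechet_derivative F (at x) v))) (at x)"
    by (rule has_derivative_transform_within_open[OF _ assms(1,2)]) (rule assms(6))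
  from fun_cong[OF has_derivative_unique[OF this has_derivative_ident], of v] show ?thesis .
qed

text \<open>The contact condition only provides an inclusion of horizontal spaces. Applied to the
  differential of f in horizontal coordinates, the dimension count gives equality, so that a
  horizontal field on V is the image of a horizontal field on U.\<close>

lemma linear_inj_invariant_subspace:
  fixes \<theta> :: "'a::euclidean_space \<Rightarrow> 'a"
  assumes "linear \<theta>" "inj \<theta>" "subspace L" "\<theta> ` L \<subseteq> L"
  shows "\<theta> ` L = L"
proof (rule subspace_dim_equal)
  show "subspace (\<theta> ` L)" by (rule linear_subspace_image[OF assms(1,3)])
  have "dim (\<theta> ` L) = dim L" by (rule dim_image_eq[OF assms(1)]) (use assms(2) inj_on_subset in blast)
  then show "dim L \<le> dim (\<theta> ` L)" by simp
qed (use assms in auto)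

lemma Ck1_Un:
  assumes "open S" "open T" "Ck_on 1 S f" "Ck_on 1 T f"
  shows "Ck_on 1 (S \<union> T) f"
  using assms(3,4) by (auto intro: continuous_on_open_Un[OF assms(1,2)])

text \<open>Squaring the positive part makes the function C^1, the regularity that
  \<open>weak_contact_in_chart\<close> asks of a localised form.\<close>

definition bump :: "real \<Rightarrow> 'a::euclidean_space \<Rightarrow> 'a \<Rightarrow> real" where
  "bump r v0 v = (max 0 (r\<^sup>2 - (v - v0) \<bullet> (v - v0)))\<^sup>2"

lemma bump_nonneg: "bump r v0 v \<ge> 0"
  by (simp add: bump_def)

lemma bump_pos: "v \<in> ball v0 r \<Longrightarrow> bump r v0 v > 0"
proof -
  assume "v \<in> ball v0 r"
  then have "(v - v0) \<bullet> (v - v0) < r\<^sup>2"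
    using power_strict_mono[of "norm (v - v0)" r 2] by (simp add: dist_norm norm_minus_commute power2_norm_eq_inner)
  then show ?thesis by (simp add: bump_def)
qed

lemma bump_zero: "v \<notin> cball v0 r \<Longrightarrow> r > 0 \<Longrightarrow> bump r v0 v = 0"
proof -
  assume "v \<notin> cball v0 r" "r > 0"
  then have "r\<^sup>2 < (v - v0) \<bullet> (v - v0)"
    using power_strict_mono[of r "norm (v - v0)" 2] by (simp add: dist_norm norm_minus_commute power2_norm_eq_inner)
  then show ?thesis by (simp add: bump_def)
qed

lemma has_real_derivative_max_0_power2: "((\<lambda>t. (max 0 t)\<^sup>2) has_real_derivative 2 * max 0 t) (at (t::real))"
proof -
  consider "t < 0" | "t = 0" | "t > 0" by linarith
  then show ?thesis
  proof cases
    case 1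
    have "((\<lambda>t. 0) has_real_derivative 2 * max 0 t) (at t)" using 1 by simp
    then show ?thesis
      by (rule has_field_derivative_transform_within_open[where S = "{..<0}"]) (use 1 in auto)
  next
    case 2
    \<comment> \<open>At 0 the difference quotient is either 0 or h.\<close>
    have "((\<lambda>h. ((max 0 (0 + h))\<^sup>2 - (max 0 0)\<^sup>2) / h) \<longlongrightarrow> 0) (at (0::real))"
    proof (rule Lim_null_comparison)
      show "\<forall>\<^sub>F h in at 0. norm (((max 0 (0 + h))\<^sup>2 - (max 0 0)\<^sup>2) / h) \<le> \<bar>h::real\<bar>"
        by (intro always_eventually allI) (auto simp: max_def power2_eq_square)
      show "((\<lambda>h. \<bar>h\<bar>) \<longlongrightarrow> 0) (at (0::real))" using tendsto_rabs[OF tendsto_ident_at[of 0 UNIV]] by simp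
    qed
    then show ?thesis using 2 by (simp add: DERIV_def)
  next
    case 3
    have "((\<lambda>t. t\<^sup>2) has_real_derivative 2 * max 0 t) (at t)" using 3 by (auto intro!: derivative_eq_intros)
    then show ?thesis
      by (rule has_field_derivative_transform_within_open[where S = "{0<..}"]) (use 3 in auto)
  qed
qed

lemma bump_Ck1: "Ck_on 1 S (bump r v0)"
proof (rule Ck1I)
  fix v
  let ?g = "\<lambda>v. r\<^sup>2 - (v - v0) \<bullet> (v - v0)"
  have "(?g has_derivative (\<lambda>w. - (2 * ((v - v0) \<bullet> w)))) (at v)"
    by (auto intro!: derivative_eq_intros simp: inner_commute)
  from has_derivative_compose[OF this has_real_derivative_max_0_power2[THEN has_field_derivative_imp_has_derivative]]
  show "(bump r v0 has_derivative (\<lambda>w. 2 * max 0 (?g v) * - (2 * ((v - v0) \<bullet> w)))) (at v)"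
    by (simp add: bump_def[abs_def])
qed (intro continuous_intros)

context carnot_space begin

definition chart_bump :: "('g, 'e) chart \<Rightarrow> real \<Rightarrow> 'e \<Rightarrow> 'g \<Rightarrow> real" where
  "chart_bump c r v x = (if x \<in> fst c then bump r v (snd c x) else 0)"

lemma compact_chart_preimage:
  assumes c: "c \<in> atlas G" and "compact C" "C \<subseteq> snd c ` fst c"
  shows "compact (chart_inv c ` C)"
  by (intro compact_continuous_image assms continuous_on_subset[OF chart_cont(2)[OF c]])

text \<open>In another chart e the overlap with c and the complement of the closed ball's preimage
  cover the domain. That preimage is compact, hence closed in a Hausdorff space, and off it the
  function is 0.\<close>

lemma chart_bump_Ck1:
  assumes c: "c \<in> atlas G" and r: "r > 0" "cball v r \<subseteq> snd c ` fst c" and e: "e \<in> atlas G"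
  shows "Ck_on 1 (snd e ` fst e) (\<lambda>u. chart_bump c r v (chart_inv e u))"
proof -
  let ?C = "chart_inv c ` cball v r"
  let ?S = "snd e ` (fst e \<inter> fst c)" and ?T = "snd e ` (- ?C \<inter> fst e)"
  have "closed ?C" by (intro compact_imp_closed compact_chart_preimage c r compact_cball)
  then have oT: "open ?T" by (intro chart_image_open e) (simp add: open_Compl)
  have oS: "open ?S" by (rule transition_Ck(2)[OF e c])
  have "Ck_on 1 ?S (\<lambda>u. bump r v ((snd c \<circ> chart_inv e) u))"
    by (rule Ck1_compose[OF transition_Ck(1)[OF e c] bump_Ck1[of UNIV]]) simp
  then have S: "Ck_on 1 ?S (\<lambda>u. chart_bump c r v (chart_inv e u))"
    by (rule Ck_on_cong[OF oS, rotated]) (auto simp: chart_bump_def chart_left[OF e])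
  have T: "Ck_on 1 ?T (\<lambda>u. chart_bump c r v (chart_inv e u))"
  proof (rule Ck_on_cong[OF oT _ Ck1_const])
    fix u assume "u \<in> ?T"
    then obtain x where x: "u = snd e x" "x \<in> fst e" "x \<notin> ?C" by blast
    have "bump r v (snd c x) = 0" if "x \<in> fst c"
    proof (rule bump_zero[OF _ r(1)])
      show "snd c x \<notin> cball v r" using x(3) chart_left[OF c that] by (metis imageI)
    qed
    then show "0 = chart_bump c r v (chart_inv e u)" using x chart_left[OF e x(2)] by (simp add: chart_bump_def)
  qed
  have "snd e ` fst e \<subseteq> ?S \<union> ?T"
  proof
    fix u assume "u \<in> snd e ` fst e"
    then obtain x where x: "u = snd e x" "x \<in> fst e" by blast
    have "x \<in> fst c" if "x \<in> ?C" using that r(2) chart_inv_in[OF c] by blast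
    then show "u \<in> ?S \<union> ?T" using x by blast
  qed
  then show ?thesis using Ck_on_subset[OF Ck1_Un[OF oS oT S T]] by blast
qed

end

context contact_map begin

text \<open>\<open>dom_V\<close> and \<open>dom_U\<close> are the largest parts of V and U between
  which f and its inverse have coordinate expressions in the charts d and c.\<close>

definition dom_V :: "('g, 'e) chart \<Rightarrow> ('g, 'e) chart \<Rightarrow> 'g set" where
  "dom_V c d = V \<inter> fst c \<inter> fi -` fst d"

definition dom_U :: "('g, 'e) chart \<Rightarrow> ('g, 'e) chart \<Rightarrow> 'g set" where
  "dom_U c d = U \<inter> fst d \<inter> f -` fst c"

context
  fixes c d :: "('g, 'e) chart"
  assumes c: "c \<in> atlas G" and d: "d \<in> atlas G"
begin

lemma open_dom_V: "open (dom_V c d)" and open_dom_U: "open (dom_U c d)"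
proof -
  have "continuous_on V fi" using fi_Ck by (simp add: Ck_map_def)
  then have "continuous_on (V \<inter> fst c) fi" by (rule continuous_on_subset) (rule Int_lower1)
  then show "open (dom_V c d)" unfolding dom_V_def
    by (intro continuous_open_preimage open_Int open_V open_dom c d)
  have "continuous_on U f" using f_Ck by (simp add: Ck_map_def)
  then have "continuous_on (U \<inter> fst d) f" by (rule continuous_on_subset) (rule Int_lower1)
  then show "open (dom_U c d)" unfolding dom_U_def
    by (intro continuous_open_preimage open_Int open_U open_dom c d)
qed

lemma dom_subset: "dom_V c d \<subseteq> V" "dom_V c d \<subseteq> fst c" "dom_U c d \<subseteq> U" "dom_U c d \<subseteq> fst d"
  by (auto simp: dom_V_def dom_U_def)

lemma open_image_dom_V: "open (snd c ` dom_V c d)" and open_image_dom_U: "open (snd d ` dom_U c d)"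
  using chart_image_open[OF c open_dom_V] chart_image_open[OF d open_dom_U] dom_subset
  by (simp_all add: Int_absorb2)

lemma map_Ck1: "Ck_on 1 (snd d ` dom_U c d) (snd c \<circ> f \<circ> chart_inv d)"
  and map_inv_Ck1: "Ck_on 1 (snd c ` dom_V c d) (snd d \<circ> fi \<circ> chart_inv c)"
  using f_Ck fi_Ck c d by (auto simp: Ck_map_def dom_U_def dom_V_def simp del: Ck_on.simps)

lemma dom_maps:
  "x \<in> dom_U c d \<Longrightarrow> f x \<in> dom_V c d" "y \<in> dom_V c d \<Longrightarrow> fi y \<in> dom_U c d"
  using f_in fi_f fi_in f_fi by (auto simp: dom_U_def dom_V_def)

lemma chart_map_eq:
  "x \<in> dom_U c d \<Longrightarrow> (snd c \<circ> f \<circ> chart_inv d) (snd d x) = snd c (f x)"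
  "y \<in> dom_V c d \<Longrightarrow> (snd d \<circ> fi \<circ> chart_inv c) (snd c y) = snd d (fi y)"
  using chart_left[OF c] chart_left[OF d] by (auto simp: dom_U_def dom_V_def)

lemma Y_in_chart:
  assumes y: "y \<in> dom_V c d"
  shows "field_in_chart G c Y (snd c y) = dmap d c f (fi y) (field_in_chart G d Z (snd d (fi y)))"
proof -
  have yy: "y \<in> V" "y \<in> fst c" "fi y \<in> fst d" using y by (auto simp: dom_V_def)
  have "field_in_chart G c Y (snd c y) = change_coords (chart_at G y) c y (differential G f (fi y) (Z (fi y)))"
    by (simp add: field_in_chart_eq[OF c yy(2)] push_forward_def Let_def)
  also have "\<dots> = dmap d c f (fi y) (change_coords (chart_at G (fi y)) d (fi y) (Z (fi y)))"
    using dmap_f[OF d c fi_in[OF yy(1)] yy(3), of "Z (fi y)"] yy f_fi by simp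
  finally show ?thesis by (simp add: field_in_chart_eq[OF d yy(3)])
qed

lemma Z_Ck1: "Ck_on 1 (snd d ` dom_U c d) (field_in_chart G d Z)"
proof -
  have "Ck_on 1 (snd d ` (U \<inter> fst d)) (field_in_chart G d Z)"
    using contact_field d by (simp add: contact_field_def Ck_field_def del: Ck_on.simps)
  then show ?thesis by (rule Ck_on_subset) (auto simp: dom_U_def)
qed

lemma Y_chart_continuous: "continuous_on (snd c ` dom_V c d) (field_in_chart G c Y)"
proof -
  let ?F = "snd c \<circ> f \<circ> chart_inv d" and ?Fi = "snd d \<circ> fi \<circ> chart_inv c"
  have im: "?Fi ` (snd c ` dom_V c d) \<subseteq> snd d ` dom_U c d"
    using chart_map_eq(2) dom_maps(2) by auto
  have Fi: "continuous_on (snd c ` dom_V c d) ?Fi" by (rule Ck_on_imp_continuous_on[OF map_inv_Ck1])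
  have via: "continuous_on (snd c ` dom_V c d) (\<lambda>u. g (?Fi u))" if "continuous_on (snd d ` dom_U c d) g" for g :: "'e \<Rightarrow> 'e"
    by (rule continuous_on_compose2[OF that Fi im])
  have "continuous_on (snd c ` dom_V c d) (\<lambda>u. frechet_derivative ?F (at (?Fi u)) (field_in_chart G d Z (?Fi u)))"
  proof (rule continuous_on_linear_apply[where A = "\<lambda>u. frechet_derivative ?F (at (?Fi u))"])
    show "linear (frechet_derivative ?F (at (?Fi u)))" if "u \<in> snd c ` dom_V c d" for u
      using has_derivative_linear[OF Ck1_has_derivative[OF map_Ck1]] im that by blast
  qed (intro via Ck1_continuous_derivative[OF map_Ck1] Ck_on_imp_continuous_on[OF Z_Ck1])+
  then show ?thesis
  proof (rule continuous_on_eq)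
    fix u assume "u \<in> snd c ` dom_V c d"
    then obtain y where y: "y \<in> dom_V c d" "u = snd c y" by blast
    show "frechet_derivative ?F (at (?Fi u)) (field_in_chart G d Z (?Fi u)) = field_in_chart G c Y u"
      unfolding y(2) chart_map_eq(2)[OF y(1)] Y_in_chart[OF y(1)] dmap_def ..
  qed
qed

end

text \<open>Passing to frame coefficients inverts the matrix of left-invariant fields, and the
  inverse depends continuously on the point by \<open>continuous_on_inverse_apply\<close>.\<close>

lemma frame_coeff_Y_continuous:
  assumes a: "a \<in> set (frame_index G)"
  shows "continuous_on V (\<lambda>y. frame_coeff G a y (Y y))"
  unfolding continuous_on_eq_continuous_at[OF open_V]
proof
  fix y assume y: "y \<in> V"
  let ?c = "chart_at G y" and ?d = "chart_at G (fi y)"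
  have c: "?c \<in> atlas G" and d: "?d \<in> atlas G" by (rule chart_at)+
  let ?W = "dom_V ?c ?d" and ?I = "snd ?c ` dom_V ?c ?d"
  have yW: "y \<in> ?W" using y chart_at(2) by (simp add: dom_V_def)
  have "continuous_on ?I (\<lambda>u. left_mat_inv ?c (chart_inv ?c u) (field_in_chart G ?c Y u))"
  proof (rule continuous_on_linear_apply[where A = "\<lambda>u. left_mat_inv ?c (chart_inv ?c u)"])
    have dc: "chart_inv ?c u \<in> fst ?c" if "u \<in> ?I" for u
      using that dom_subset(2)[OF c d] chart_inv_in[OF c] by blast
    show "linear (left_mat_inv ?c (chart_inv ?c u))" if "u \<in> ?I" for u
      by (rule linear_inverse_fun[OF linear_left_mat[OF c dc[OF that]]
            left_mat_inverse(2)[OF c dc[OF that]] left_mat_inverse(1)[OF c dc[OF that]]])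
    show "continuous_on ?I (\<lambda>u. left_mat_inv ?c (chart_inv ?c u) v)" for v
    proof (rule continuous_on_inverse_apply[where A = "\<lambda>u. left_mat ?c (chart_inv ?c u)"])
      show "continuous_on ?I (\<lambda>u. left_mat ?c (chart_inv ?c u) v)" for v
        by (rule continuous_on_subset[OF Ck_on_imp_continuous_on[OF left_mat_smooth[OF c]]])
           (use dom_subset(2)[OF c d] in blast)
    qed (use linear_left_mat[OF c dc] left_mat_inverse[OF c dc] in auto)
  qed (rule Y_chart_continuous[OF c d])
  then have "continuous_on ?I (\<lambda>u. coef a (left_mat_inv ?c (chart_inv ?c u) (field_in_chart G ?c Y u)))"
    by (rule bounded_linear.continuous_on[OF linear_conv_bounded_linear[THEN iffD1, OF linear_coef]])
  then have "continuous_on ?W (\<lambda>x. coef a (left_mat_inv ?c (chart_inv ?c (snd ?c x)) (field_in_chart G ?c Y (snd ?c x))))"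
    by (rule continuous_on_compose2[OF _ continuous_on_subset[OF chart_cont(1)[OF c] dom_subset(2)[OF c d]]]) simp
  then have "continuous_on ?W (\<lambda>x. frame_coeff G a x (Y x))"
  proof (rule continuous_on_eq)
    fix x assume "x \<in> ?W"
    then have x: "x \<in> fst ?c" using dom_subset(2)[OF c d] by blast
    show "coef a (left_mat_inv ?c (chart_inv ?c (snd ?c x)) (field_in_chart G ?c Y (snd ?c x))) = frame_coeff G a x (Y x)"
      by (simp add: chart_left[OF c x] field_in_chart_eq[OF c x] frame_coeff_eq[OF a c x])
  qed
  then show "isCont (\<lambda>y. frame_coeff G a y (Y y)) y"
    using continuous_on_eq_continuous_at[OF open_dom_V[OF c d]] yW by blast
qed

lemma L1_loc: "L1_loc_field G V Y"
  unfolding L1_loc_field_def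
proof (intro ballI conjI allI impI)
  fix a assume a: "a \<in> set (frame_index G)"
  show "set_borel_measurable borel V (\<lambda>x. frame_coeff G a x (Y x))"
    unfolding set_borel_measurable_def
    by (rule borel_measurable_continuous_on_indicator[OF borel_open[OF open_V] frame_coeff_Y_continuous[OF a]])
  fix K assume "compact K \<and> K \<subseteq> V"
  then show "set_integrable (volume_measure G) K (\<lambda>x. frame_coeff G a x (Y x))"
    using continuous_on_subset[OF frame_coeff_Y_continuous[OF a]] by (intro set_integrable_continuous) auto
qed

text \<open>\<open>weak_contact_local\<close> for the coordinate expressions, transported back
  through the two wedge terms in the chart. The constant s acts as the sign of the density on K: the
  measure uses the absolute value, the forms use the value itself.\<close>

lemma weak_contact_in_chart:
  assumes c: "c \<in> atlas G" and d: "d \<in> atlas G"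
    and \<eta>: "smooth_form G 1 V \<eta>" "vertical_form G V \<eta>"
    and \<gamma>: "\<And>x. x \<in> V \<Longrightarrow> alt_form (DIM('e) - 1) (\<gamma> x)" "codegree_one_weight G V \<gamma>"
      "\<And>vs. Ck_on 1 (snd c ` (V \<inter> fst c)) (\<lambda>u. form_in_chart G c \<gamma> u vs)"
    and K: "compact K" "K \<subseteq> dom_V c d" "\<And>x. x \<in> V - K \<Longrightarrow> \<gamma> x = (\<lambda>vs. 0)"
    and s: "\<And>x. x \<in> K \<Longrightarrow> \<bar>vol_density c (snd c x)\<bar> = s * vol_density c (snd c x)"
  shows "set_integrable (volume_measure G) V (wedge_term_1 Y \<eta> \<gamma>)"
    and "set_integrable (volume_measure G) V (wedge_term_2 Y \<eta> \<gamma>)"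
    and "set_lebesgue_integral (volume_measure G) V (wedge_term_1 Y \<eta> \<gamma>)
       = set_lebesgue_integral (volume_measure G) V (wedge_term_2 Y \<eta> \<gamma>)"
proof -
  let ?VV = "snd c ` dom_V c d" and ?UU = "snd d ` dom_U c d" and ?KK = "snd c ` K"
  let ?F = "snd c \<circ> f \<circ> chart_inv d" and ?Fi = "snd d \<circ> fi \<circ> chart_inv c"
  let ?\<eta> = "form_in_chart G c \<eta>" and ?Y = "field_in_chart G c Y" and ?B = "dual_field c \<gamma>"
  have sub: "?VV \<subseteq> snd c ` (V \<inter> fst c)" by (auto simp: dom_V_def)
  have \<eta>1: "Ck_on 1 (snd c ` (V \<inter> fst c)) (\<lambda>u. ?\<eta> u vs)" for vs
    using \<eta>(1) c unfolding smooth_form_def smooth_on_def by blast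
  have \<eta>alt: "alt_form 1 (\<eta> x)" if "x \<in> V" for x using \<eta>(1) that by (simp add: smooth_form_def)
  have \<eta>lin: "linear (\<lambda>v. ?\<eta> (snd c x) [v])" if "x \<in> V" "x \<in> fst c" for x
    using alt_form_linear[OF alt_form_in_chart[where \<omega> = \<eta>, OF c that(2) \<eta>alt[OF that(1)]], of "[0]" 0] by simp
  have B1: "Ck_on 1 (snd c ` (V \<inter> fst c)) ?B"
    unfolding dual_field_def[abs_def] by (intro Ck1_sum Ck1_scaleR Ck1_mult Ck1_const \<gamma>(3))
  obtain b where b: "\<And>x. x \<in> V \<Longrightarrow> \<gamma> x = (\<lambda>vs. \<Sum>i = 1..dim (layer G 1). b i x * hat_coframe G i x vs)"
    using \<gamma>(2) unfolding codegree_one_weight_def by blast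
  have KK: "compact ?KK" "?KK \<subseteq> ?VV"
    using K dom_subset(2)[OF c d] chart_cont(1)[OF c]
    by (auto intro!: compact_continuous_image continuous_on_subset[OF chart_cont(1)[OF c]])
  have Bz: "?B u = 0" if u: "u \<in> ?VV - ?KK" for u
  proof -
    obtain x where x: "x \<in> dom_V c d" "u = snd c x" using u by blast
    then have "x \<in> V - K" "x \<in> fst c" using u dom_subset[OF c d] by auto
    then show ?thesis unfolding x(2) dual_field_def form_in_chart_eq[OF c \<open>x \<in> fst c\<close>] K(3)[OF \<open>x \<in> V - K\<close>] by simp
  qed
  have FD: "frechet_derivative ?F (at (snd d x)) = dmap d c f x" for x by (simp add: dmap_def)
  have inv_d: "chart_inv d (snd d x) = x" if "x \<in> dom_U c d" for x
    using chart_left[OF d] that dom_subset(4)[OF c d] by blast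
  define j1 where "j1 u = ext_d ?\<eta> u [?Y u, ?B u]" for u
  define j2 where "j2 u = ?\<eta> u [?Y u] * divergence ?B u" for u
  \<comment> \<open>On a pair of vectors the alternating sum \<open>ext_d\<close> of a 1-form is the
    difference of two directional derivatives with frozen arguments.\<close>
  have J: "frechet_derivative (\<lambda>z. ?\<eta> z [?B u]) (at u) (?Y u) - frechet_derivative (\<lambda>z. ?\<eta> z [?Y u]) (at u) (?B u)
      - ?\<eta> u [?Y u] * divergence ?B u = j1 u - j2 u" for u
    by (simp add: j1_def j2_def ext_d_def omit_def numeral_2_eq_2)
  have main: "integrable lborel (\<lambda>u. indicator ?KK u * (j1 u - j2 u))"
      "(LINT u|lborel. indicator ?KK u * (j1 u - j2 u)) = 0"
  proof -
    note * = weak_contact_local[where U = ?UU and V = ?VV and F = ?F and Fi = ?Fi and Z = "field_in_chart G d Z"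
        and M = "\<lambda>u. left_mat d (chart_inv d u)" and N = "\<lambda>u. left_mat_inv d (chart_inv d u)"
        and L = "layer G 1" and \<eta> = "\<lambda>u v. ?\<eta> u [v]" and K = ?KK and B = ?B and Y = ?Y, unfolded J,
        OF open_image_dom_U[OF c d] open_image_dom_V[OF c d] map_Ck1[OF c d] _ map_inv_Ck1[OF c d] _ Z_Ck1[OF c d]
          _ _ _ _ subspace_layer_1 _ Ck_on_subset[OF \<eta>1 sub] _ _ KK Ck_on_subset[OF B1 sub] Bz]
    have p1: "?F u \<in> ?VV \<and> ?Fi (?F u) = u" if u: "u \<in> ?UU" for u
    proof -
      obtain x where x: "x \<in> dom_U c d" "u = snd d x" using u by blast
      have fx: "f x \<in> dom_V c d" by (rule dom_maps(1)[OF c d x(1)])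
      have "fi (f x) = x" using fi_f x(1) dom_subset(3)[OF c d] by blast
      then show ?thesis unfolding x(2) chart_map_eq(1)[OF c d x(1)] chart_map_eq(2)[OF c d fx] using fx by simp
    qed
    have p2: "?Fi u \<in> ?UU \<and> ?F (?Fi u) = u" if u: "u \<in> ?VV" for u
    proof -
      obtain y where y: "y \<in> dom_V c d" "u = snd c y" using u by blast
      have fy: "fi y \<in> dom_U c d" by (rule dom_maps(2)[OF c d y(1)])
      have "f (fi y) = y" using f_fi y(1) dom_subset(1)[OF c d] by blast
      then show ?thesis unfolding y(2) chart_map_eq(2)[OF c d y(1)] chart_map_eq(1)[OF c d fy] using fy by simp
    qed
    have p3: "Ck_on 1 ?UU (\<lambda>u. left_mat d (chart_inv d u) h)" for h
      by (rule Ck_on_subset[OF left_mat_smooth[OF d]]) (use dom_subset(4)[OF c d] in blast)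
    have ud: "chart_inv d u \<in> fst d" if "u \<in> ?UU" for u
      using that dom_subset(4)[OF c d] chart_inv_in[OF d] by blast
    have p4: "linear (left_mat d (chart_inv d u))" if "u \<in> ?UU" for u by (rule linear_left_mat[OF d ud[OF that]])
    have p5: "left_mat d (chart_inv d u) (left_mat_inv d (chart_inv d u) w) = w" if "u \<in> ?UU" for u w
      by (rule left_mat_inverse(2)[OF d ud[OF that]])
    have p6: "left_mat_inv d (chart_inv d u) (left_mat d (chart_inv d u) w) = w" if "u \<in> ?UU" for u w
      by (rule left_mat_inverse(1)[OF d ud[OF that]])
    have p7: "\<exists>k\<in>layer G 1. frechet_derivative (\<lambda>u. left_mat d (chart_inv d u) h) (at u) (field_in_chart G d Z u)
        - frechet_derivative (field_in_chart G d Z) (at u) (left_mat d (chart_inv d u) h) = left_mat d (chart_inv d u) k"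
      if u: "u \<in> ?UU" and h: "h \<in> layer G 1" for u h
    proof -
      obtain x where x: "x \<in> dom_U c d" "u = snd d x" using u by blast
      then have "x \<in> U" "x \<in> fst d" using dom_subset[OF c d] by blast+
      from contact_field_in_chart[OF open_U this(1) contact_field d this(2) h]
      show ?thesis unfolding x(2) inv_d[OF x(1)] .
    qed
    have p8: "linear (\<lambda>v. ?\<eta> u [v])" if u: "u \<in> ?VV" for u
      using u \<eta>lin dom_subset[OF c d] by blast
    have p9: "?\<eta> (?F u) [frechet_derivative ?F (at u) (left_mat d (chart_inv d u) h)] = 0"
      if u: "u \<in> ?UU" and h: "h \<in> layer G 1" for u h
    proof -
      obtain x where x: "x \<in> dom_U c d" "u = snd d x" using u by blast
      then have xx: "x \<in> U" "x \<in> fst d" "f x \<in> fst c" by (auto simp: dom_U_def)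
      obtain w where w: "w \<in> horizontal G (f x)" "dmap d c f x (left_mat d x h) = change_coords (chart_at G (f x)) c (f x) w"
        using dmap_f_horizontal(1)[OF d c xx h] by blast
      have "?\<eta> (snd c (f x)) [dmap d c f x (left_mat d x h)] = \<eta> (f x) [w]"
        unfolding w(2) by (simp add: form_in_chart_eq[OF c xx(3)] change_coords_inverse chart_at c xx)
      also have "\<dots> = 0" by (rule vertical_form_everywhere[OF open_V f_in[OF xx(1)] \<eta> w(1)])
      finally show ?thesis unfolding x(2) chart_map_eq(1)[OF c d x(1)] FD inv_d[OF x(1)] .
    qed
    \<comment> \<open>The dual field is horizontal at y. Read in horizontal coordinates as \<theta>,
      the differential of f maps the first layer into itself, injectively because f has a
      differentiable inverse, hence onto; this produces the horizontal preimage.\<close>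
    have p10: "\<exists>h\<in>layer G 1. ?B u = frechet_derivative ?F (at (?Fi u)) (left_mat d (chart_inv d (?Fi u)) h)"
      if u: "u \<in> ?VV" for u
    proof -
      obtain y where y: "y \<in> dom_V c d" "u = snd c y" using u by blast
      then have yy: "y \<in> V" "y \<in> fst c" using dom_subset[OF c d] by blast+
      let ?x = "fi y"
      have x: "?x \<in> dom_U c d" by (rule dom_maps(2)[OF c d y(1)])
      then have xx: "?x \<in> U" "?x \<in> fst d" "f ?x \<in> fst c" by (auto simp: dom_U_def)
      have fx: "f ?x = y" by (rule f_fi[OF yy(1)])
      define \<theta> where "\<theta> h = left_mat_inv c y (dmap d c f ?x (left_mat d ?x h))" for h
      have lD: "linear (dmap d c f ?x)"
        by (rule linear_dmap[OF Ck_map_mdiff[OF open_U f_Ck d c xx]])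
      have lN: "linear (left_mat_inv c y)"
        by (rule linear_inverse_fun[OF linear_left_mat[OF c yy(2)] left_mat_inverse(2)[OF c yy(2)] left_mat_inverse(1)[OF c yy(2)]])
      have l: "linear \<theta>"
        using linear_compose[OF linear_compose[OF linear_left_mat[OF d xx(2)] lD] lN] by (simp add: \<theta>_def[abs_def] o_def)
      have inj: "inj \<theta>"
      proof (rule injI)
        fix h h' assume "\<theta> h = \<theta> h'"
        then have "left_mat c y (\<theta> h) = left_mat c y (\<theta> h')" by simp
        then have e: "dmap d c f ?x (left_mat d ?x h) = dmap d c f ?x (left_mat d ?x h')"
          unfolding \<theta>_def left_mat_inverse(2)[OF c yy(2)] .
        have "frechet_derivative ?Fi (at (?F (snd d ?x))) (dmap d c f ?x v) = v" for v
          unfolding FD[symmetric]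
          by (rule derivative_left_inverse[OF open_image_dom_U[OF c d] _ map_Ck1[OF c d] map_inv_Ck1[OF c d]])
             (use p1 x in blast)+
        then have "left_mat d ?x h = left_mat d ?x h'" using e by metis
        then show "h = h'" using left_mat_inverse(1)[OF d xx(2)] by metis
      qed
      have "\<theta> ` layer G 1 \<subseteq> layer G 1"
      proof
        fix k assume "k \<in> \<theta> ` layer G 1"
        then obtain h where h: "h \<in> layer G 1" "k = \<theta> h" by blast
        obtain k' where k': "k' \<in> layer G 1" "dmap d c f ?x (left_mat d ?x h) = left_mat c (f ?x) k'"
          using dmap_f_horizontal(2)[OF d c xx h(1)] by blast
        show "k \<in> layer G 1"
          using k'(1) unfolding h(2) \<theta>_def k'(2) fx left_mat_inverse(1)[OF c yy(2)] .
      qed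
      then have im: "\<theta> ` layer G 1 = layer G 1" by (rule linear_inj_invariant_subspace[OF l inj subspace_layer_1])
      obtain h' where h': "h' \<in> layer G 1" "?B (snd c y) = left_mat c y h'"
        using dual_field_horizontal[where \<gamma> = \<gamma> and b = b, OF c yy(2) \<gamma>(1)[OF yy(1)] b[OF yy(1)]] by blast
      obtain h where h: "h \<in> layer G 1" "h' = \<theta> h" using h'(1) im by blast
      have "?B u = dmap d c f ?x (left_mat d ?x h)"
        unfolding y(2) h'(2) h(2) \<theta>_def by (rule left_mat_inverse(2)[OF c yy(2)])
      then show ?thesis
        using h(1) unfolding y(2) chart_map_eq(2)[OF c d y(1)] FD inv_d[OF x] by blast
    qed
    have p11: "?Y u = frechet_derivative ?F (at (?Fi u)) (field_in_chart G d Z (?Fi u))" if u: "u \<in> ?VV" for u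
    proof -
      obtain y where y: "y \<in> dom_V c d" "u = snd c y" using u by blast
      show ?thesis unfolding y(2) chart_map_eq(2)[OF c d y(1)] FD by (rule Y_in_chart[OF c d y(1)])
    qed
    show "integrable lborel (\<lambda>u. indicator ?KK u * (j1 u - j2 u))"
      by (rule *(1); (rule p1 p2 p3 p4 p5 p6 p7 p8 p9 p10 p11; assumption)?)
    show "(LINT u|lborel. indicator ?KK u * (j1 u - j2 u)) = 0"
      by (rule *(2); (rule p1 p2 p3 p4 p5 p6 p7 p8 p9 p10 p11; assumption)?)
  qed
  \<comment> \<open>So far only the difference \<open>j1 - j2\<close> is integrable; continuity of
    \<open>j2\<close> on the compact support separates the two integrals.\<close>
  have "continuous_on ?VV j2"
    unfolding j2_def[abs_def]
  proof (intro continuous_on_mult)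
    show "continuous_on ?VV (\<lambda>u. ?\<eta> u [?Y u])"
      by (rule continuous_on_linear_apply[where A = "\<lambda>u v. ?\<eta> u [v]", OF _ _ Y_chart_continuous[OF c d]])
         (use \<eta>lin dom_subset[OF c d] continuous_on_subset[OF Ck_on_imp_continuous_on[OF \<eta>1] sub] in blast)+
    show "continuous_on ?VV (divergence ?B)" unfolding divergence_def
      by (intro continuous_intros continuous_on_subset[OF Ck1_continuous_derivative[OF B1] sub])
  qed
  from borel_integrable_compact[OF KK(1) continuous_on_subset[OF this KK(2)]]
  have i2: "integrable lborel (\<lambda>u. indicator ?KK u * j2 u)" by simp
  have e1: "indicator ?KK u * j1 u = indicator ?KK u * (j1 u - j2 u) + indicator ?KK u * j2 u" for u :: 'e
    by (simp add: algebra_simps)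
  have i1: "integrable lborel (\<lambda>u. indicator ?KK u * j1 u)" unfolding e1 by (intro Bochner_Integration.integrable_add main i2)
  have int: "(LINT u|lborel. indicator ?KK u * j1 u) = (LINT u|lborel. indicator ?KK u * j2 u)"
    unfolding e1 using main i2 by simp
  have KB: "K \<in> sets borel" "K \<subseteq> fst c" "K \<subseteq> V"
    using K(1,2) compact_imp_closed borel_closed dom_subset[OF c d] by blast+
  have diff: "(\<lambda>u. ?\<eta> u vs) differentiable (at (snd c x))" "(\<lambda>u. form_in_chart G c \<gamma> u vs) differentiable (at (snd c x))"
    if "x \<in> K" for x vs
    using \<eta>1[of vs] \<gamma>(3)[of vs] that KB by auto
  have h1: "wedge_term_1 Y \<eta> \<gamma> x * \<bar>vol_density c (snd c x)\<bar> = s * j1 (snd c x)" if "x \<in> K" for x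
  proof -
    have x: "x \<in> fst c" "x \<in> V" using that KB by auto
    have "wedge_term_1 Y \<eta> \<gamma> x * vol_density c (snd c x) = j1 (snd c x)"
      unfolding j1_def by (rule wedge_term_1_in_chart[where \<eta> = \<eta> and \<gamma> = \<gamma> and Y = Y, OF c x(1) open_V x(2) \<eta>alt diff(1)[OF that] \<gamma>(1)[OF x(2)]])
    then show ?thesis unfolding s[OF that] by (simp add: mult.left_commute)
  qed
  have h2: "wedge_term_2 Y \<eta> \<gamma> x * \<bar>vol_density c (snd c x)\<bar> = s * j2 (snd c x)" if "x \<in> K" for x
  proof -
    have x: "x \<in> fst c" "x \<in> V" using that KB by auto
    have "wedge_term_2 Y \<eta> \<gamma> x * vol_density c (snd c x) = j2 (snd c x)"
      unfolding j2_def by (rule wedge_term_2_in_chart[where \<eta> = \<eta> and \<gamma> = \<gamma> and Y = Y, OF c x(1) open_V x(2) \<gamma>(1) diff(2)[OF that]])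
    then show ?thesis unfolding s[OF that] by (simp add: mult.left_commute)
  qed
  have ij: "integrable lborel (\<lambda>u. indicator ?KK u * (s * j1 u))" "integrable lborel (\<lambda>u. indicator ?KK u * (s * j2 u))"
    using i1 i2 by (simp_all add: mult.left_commute)
  note v1 = volume_measure_integral[where k = "\<lambda>u. s * j1 u", OF c KB(1,2) h1 ij(1)] and v2 = volume_measure_integral[where k = "\<lambda>u. s * j2 u", OF c KB(1,2) h2 ij(2)]
  have "closed K" using K(1) by (rule compact_imp_closed)
  then have oK: "open (V - K)" using open_V by blast
  have z: "wedge_term_1 Y \<eta> \<gamma> x = 0" "wedge_term_2 Y \<eta> \<gamma> x = 0" if "x \<in> V - K" for x
    using wedge_terms_zero[where \<gamma> = \<gamma>, OF oK that K(3)] by blast+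
  have VK: "indicator V x *\<^sub>R wedge_term_1 Y \<eta> \<gamma> x = indicator K x *\<^sub>R wedge_term_1 Y \<eta> \<gamma> x"
    "indicator V x *\<^sub>R wedge_term_2 Y \<eta> \<gamma> x = indicator K x *\<^sub>R wedge_term_2 Y \<eta> \<gamma> x" for x
    using z[of x] KB(3) by (auto simp: indicator_def)
  show "set_integrable (volume_measure G) V (wedge_term_1 Y \<eta> \<gamma>)"
    "set_integrable (volume_measure G) V (wedge_term_2 Y \<eta> \<gamma>)"
    using v1(1) v2(1) unfolding set_integrable_def VK by simp_all
  show "set_lebesgue_integral (volume_measure G) V (wedge_term_1 Y \<eta> \<gamma>)
       = set_lebesgue_integral (volume_measure G) V (wedge_term_2 Y \<eta> \<gamma>)"
    using v1(2) v2(2) int unfolding set_lebesgue_integral_def VK by (simp add: mult.left_commute)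
qed

end

section \<open>Partition of unity\<close>

context carnot_space begin

text \<open>Additivity in the (n - 1)-form. The decomposition has to hold on an open set because the
  second term differentiates it.\<close>

lemma wedge_terms_sum:
  assumes W: "open W" "x \<in> W" and X: "finite X"
    and alt: "\<And>i x. i \<in> X \<Longrightarrow> x \<in> W \<Longrightarrow> alt_form (DIM('e) - 1) (g i x)"
    and \<gamma>: "\<And>x. x \<in> W \<Longrightarrow> \<gamma> x = (\<lambda>vs. \<Sum>i\<in>X. g i x vs)"
    and diff: "\<And>i vs. i \<in> X \<Longrightarrow>
      (\<lambda>u. form_in_chart G (chart_at G x) (g i) u vs) differentiable (at (snd (chart_at G x) x))"
  shows "wedge_term_1 Y \<eta> \<gamma> x = (\<Sum>i\<in>X. wedge_term_1 Y \<eta> (g i) x)"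
    and "wedge_term_2 Y \<eta> \<gamma> x = (\<Sum>i\<in>X. wedge_term_2 Y \<eta> (g i) x)"
proof -
  let ?c = "chart_at G x"
  have c: "?c \<in> atlas G" "x \<in> fst ?c" by (rule chart_at)+
  have a: "alt_form (DIM('e) - 1) (\<gamma> z)" if "z \<in> W" for z
    using alt_form_sum[OF X alt[OF _ that], where c = "\<lambda>_. 1"] by (simp add: \<gamma>[OF that])
  show "wedge_term_1 Y \<eta> \<gamma> x = (\<Sum>i\<in>X. wedge_term_1 Y \<eta> (g i) x)"
    unfolding wedge_term_1_eq[where \<gamma> = \<gamma>, OF a[OF W(2)]] \<gamma>[OF W(2)] sum_distrib_left
    by (subst sum.swap) (intro sum.cong refl wedge_term_1_eq[symmetric] alt W)
  have d: "((\<lambda>u. form_in_chart G ?c \<gamma> u vs) has_derivative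
      (\<lambda>v. \<Sum>i\<in>X. frechet_derivative (\<lambda>u. form_in_chart G ?c (g i) u vs) (at (snd ?c x)) v)) (at (snd ?c x))" for vs
  proof (rule has_derivative_transform_within_open[of "\<lambda>u. \<Sum>i\<in>X. form_in_chart G ?c (g i) u vs"])
    show "((\<lambda>u. \<Sum>i\<in>X. form_in_chart G ?c (g i) u vs) has_derivative
      (\<lambda>v. \<Sum>i\<in>X. frechet_derivative (\<lambda>u. form_in_chart G ?c (g i) u vs) (at (snd ?c x)) v)) (at (snd ?c x))"
      using diff by (intro has_derivative_sum) (simp add: frechet_derivative_works)
    show "open (snd ?c ` (W \<inter> fst ?c))" by (rule chart_image_open[OF c(1) W(1)])
    show "snd ?c x \<in> snd ?c ` (W \<inter> fst ?c)" using W c by blast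
    fix u assume "u \<in> snd ?c ` (W \<inter> fst ?c)"
    then obtain z where z: "z \<in> W" "z \<in> fst ?c" "u = snd ?c z" by blast
    show "(\<Sum>i\<in>X. form_in_chart G ?c (g i) u vs) = form_in_chart G ?c \<gamma> u vs"
      unfolding z(3) form_in_chart_eq[OF c(1) z(2)] \<gamma>[OF z(1)] ..
  qed
  have fd: "frechet_derivative (\<lambda>u. form_in_chart G ?c \<gamma> u vs) (at (snd ?c x)) v
      = (\<Sum>i\<in>X. frechet_derivative (\<lambda>u. form_in_chart G ?c (g i) u vs) (at (snd ?c x)) v)" for vs v
    by (rule fun_cong[OF frechet_derivative_at[OF d, symmetric]])
  have e: "ext_deriv G \<gamma> x vs = (\<Sum>i\<in>X. ext_deriv G (g i) x vs)" for vs
    unfolding ext_deriv_def Let_def fd sum_distrib_left by (rule sum.swap)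
  have "alt_form (Suc (DIM('e) - 1)) (ext_deriv G \<gamma> x)"
    by (rule alt_form_ext_deriv(2)[where \<gamma> = \<gamma>, OF c W a differentiableI[OF d]])
  then have a1: "alt_form DIM('e) (ext_deriv G \<gamma> x)" by (simp add: DIM_Suc)
  have a2: "alt_form DIM('e) (ext_deriv G (g i) x)" if "i \<in> X" for i
    using alt_form_ext_deriv(2)[where \<gamma> = "g i", OF c W alt[OF that] diff[OF that]] by (simp add: DIM_Suc)
  have "wedge_term_2 Y \<eta> \<gamma> x = (\<Sum>i\<in>X. \<eta> x [Y x] * ext_deriv G (g i) x (frames x))"
    unfolding wedge_term_2_eq[where \<gamma> = \<gamma>, OF a1] e sum_distrib_left ..
  also have "\<dots> = (\<Sum>i\<in>X. wedge_term_2 Y \<eta> (g i) x)"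
    by (intro sum.cong refl wedge_term_2_eq[symmetric] a2)
  finally show "wedge_term_2 Y \<eta> \<gamma> x = (\<Sum>i\<in>X. wedge_term_2 Y \<eta> (g i) x)" .
qed

text \<open>Finitely many bumps are divided by their sum \<Phi>. Positivity of \<Phi> is available
  on the union Q of the open balls, hence regularity is stated on Q, while the sum equals 1 on
  K.\<close>

lemma partition_of_unity:
  assumes K: "compact K" and N: "\<And>y. y \<in> K \<Longrightarrow> open (N y)" "\<And>y. y \<in> K \<Longrightarrow> y \<in> N y"
  obtains X Q C h where "finite X" "X \<subseteq> K" "open Q" "K \<subseteq> Q"
    "\<And>y. y \<in> X \<Longrightarrow> compact (C y)" "\<And>y. y \<in> X \<Longrightarrow> C y \<subseteq> N y \<inter> fst (chart_at G y)"
    "\<And>x y. y \<in> X \<Longrightarrow> x \<notin> C y \<Longrightarrow> h y x = (0::real)"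
    "\<And>x. x \<in> K \<Longrightarrow> (\<Sum>y\<in>X. h y x) = 1"
    "\<And>y e. y \<in> X \<Longrightarrow> e \<in> atlas G \<Longrightarrow> Ck_on 1 (snd e ` (Q \<inter> fst e)) (\<lambda>u. h y (chart_inv e u))"
proof -
  let ?c = "chart_at G"
  have c: "?c y \<in> atlas G" "y \<in> fst (?c y)" for y by (rule chart_at)+
  have "\<exists>r>0. cball (snd (?c y) y) r \<subseteq> snd (?c y) ` (N y \<inter> fst (?c y))" if "y \<in> K" for y
  proof -
    have "open (snd (?c y) ` (N y \<inter> fst (?c y)))" by (rule chart_image_open[OF c(1) N(1)[OF that]])
    then show ?thesis using open_contains_cball N(2)[OF that] c(2)[of y] by blast
  qed
  then obtain r where r: "\<And>y. y \<in> K \<Longrightarrow> r y > 0"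
      "\<And>y. y \<in> K \<Longrightarrow> cball (snd (?c y) y) (r y) \<subseteq> snd (?c y) ` (N y \<inter> fst (?c y))"
    by metis
  define P where "P y = fst (?c y) \<inter> snd (?c y) -` ball (snd (?c y) y) (r y)" for y
  have oP: "open (P y)" for y
    unfolding P_def by (rule continuous_open_preimage[OF chart_cont(1)[OF c(1)] open_dom[OF c(1)] open_ball])
  have "K \<subseteq> (\<Union>y\<in>K. P y)" using r(1) c(2) by (force simp: P_def)
  then obtain X where X: "X \<subseteq> K" "finite X" "K \<subseteq> (\<Union>y\<in>X. P y)" by (rule compactE_image[OF K oP])
  define b where "b y = chart_bump (?c y) (r y) (snd (?c y) y)" for y
  define \<Phi> where "\<Phi> x = (\<Sum>y\<in>X. b y x)" for x
  have b0: "b y x \<ge> 0" for x y by (simp add: b_def chart_bump_def bump_nonneg)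
  have \<Phi>: "\<Phi> x > 0" if "x \<in> (\<Union>y\<in>X. P y)" for x
  proof -
    obtain y where y: "y \<in> X" "x \<in> P y" using \<open>x \<in> (\<Union>y\<in>X. P y)\<close> by blast
    have "b y x > 0" using y(2) by (simp add: b_def chart_bump_def P_def bump_pos)
    then show ?thesis unfolding \<Phi>_def by (rule sum_pos2[OF X(2) y(1) _ b0])
  qed
  have r': "cball (snd (?c y) y) (r y) \<subseteq> snd (?c y) ` fst (?c y)" if "y \<in> X" for y
    using r(2) X(1) that by blast
  have bC: "Ck_on 1 (snd e ` fst e) (\<lambda>u. b y (chart_inv e u))" if "y \<in> X" "e \<in> atlas G" for y e
    unfolding b_def using X(1) that by (intro chart_bump_Ck1 c r(1) r') blast+
  show thesis
  proof
    let ?C = "\<lambda>y. chart_inv (?c y) ` cball (snd (?c y) y) (r y)"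
    show "compact (?C y)" if "y \<in> X" for y by (rule compact_chart_preimage[OF c(1) compact_cball r'[OF that]])
    show "?C y \<subseteq> N y \<inter> fst (?c y)" if y: "y \<in> X" for y
    proof
      fix x assume "x \<in> ?C y"
      then obtain u where u: "u \<in> cball (snd (?c y) y) (r y)" "x = chart_inv (?c y) u" by blast
      then obtain z where "z \<in> N y \<inter> fst (?c y)" "u = snd (?c y) z" using r(2) X(1) y by blast
      then show "x \<in> N y \<inter> fst (?c y)" using u(2) chart_left[OF c(1)] by simp
    qed
    show "inverse (\<Phi> x) * b y x = 0" if y: "y \<in> X" and x: "x \<notin> ?C y" for x y
    proof -
      have "bump (r y) (snd (?c y) y) (snd (?c y) x) = 0" if xx: "x \<in> fst (?c y)"
      proof (rule bump_zero)
        show "snd (?c y) x \<notin> cball (snd (?c y) y) (r y)"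
          using x chart_left[OF c(1) xx] by (metis imageI)
        show "r y > 0" using r(1) X(1) y by blast
      qed
      then show ?thesis by (simp add: b_def chart_bump_def)
    qed
    show "(\<Sum>y\<in>X. inverse (\<Phi> x) * b y x) = 1" if "x \<in> K" for x
    proof -
      have "\<Phi> x \<noteq> 0" using \<Phi>[of x] X(3) that by force
      then show ?thesis unfolding sum_distrib_left[symmetric] \<Phi>_def[symmetric] by simp
    qed
    show "Ck_on 1 (snd e ` ((\<Union>y\<in>X. P y) \<inter> fst e)) (\<lambda>u. inverse (\<Phi> (chart_inv e u)) * b y (chart_inv e u))"
      if y: "y \<in> X" and e: "e \<in> atlas G" for y e
    proof -
      let ?S = "snd e ` ((\<Union>y\<in>X. P y) \<inter> fst e)"
      have sub: "?S \<subseteq> snd e ` fst e" by blast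
      have "Ck_on 1 ?S (\<lambda>u. \<Phi> (chart_inv e u))"
        unfolding \<Phi>_def by (intro Ck1_sum Ck_on_subset[OF bC sub] e)
      moreover have "\<Phi> (chart_inv e u) \<noteq> 0" if "u \<in> ?S" for u
      proof -
        obtain x where x: "x \<in> (\<Union>y\<in>X. P y)" "x \<in> fst e" "u = snd e x" using \<open>u \<in> ?S\<close> by blast
        show ?thesis using \<Phi>[OF x(1)] chart_left[OF e x(2)] x(3) by simp
      qed
      ultimately show ?thesis by (intro Ck1_mult Ck1_inverse Ck_on_subset[OF bC[OF y e] sub])
    qed
  qed (use X oP in auto)
qed

end

context contact_map begin

text \<open>Multiplying \<beta> by a function preserves the weight and does not enlarge the support,
  so each piece satisfies the hypotheses of \<open>weak_contact_in_chart\<close>; both wedge terms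
  are additive in the pieces.\<close>

lemma weak_contact:
  assumes \<eta>: "smooth_form G 1 V \<eta>" "vertical_form G V \<eta>"
    and \<beta>: "smooth_form G (DIM('e) - 1) V \<beta>" "compact_support_form V \<beta>" "codegree_one_weight G V \<beta>"
  shows "set_lebesgue_integral (volume_measure G) V (wedge_term_1 Y \<eta> \<beta>)
       = set_lebesgue_integral (volume_measure G) V (wedge_term_2 Y \<eta> \<beta>)"
proof -
  obtain K where K: "compact K" "K \<subseteq> V" "\<And>x. x \<in> V - K \<Longrightarrow> \<beta> x = (\<lambda>vs. 0)"
    using \<beta>(2) unfolding compact_support_form_def by blast
  let ?c = "chart_at G" and ?d = "\<lambda>y. chart_at G (fi y)"
  have c: "?c y \<in> atlas G" "y \<in> fst (?c y)" and d: "?d y \<in> atlas G" for y by (rule chart_at)+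
  define w where "w y x = vol_density (?c y) (snd (?c y) x)" for y x
  \<comment> \<open>Besides lying in the chart domains, the points of \<open>N y\<close> have a
    density of the same sign as at y, so that the sign is constant on each piece.\<close>
  define N where "N y = dom_V (?c y) (?d y) \<inter> (fst (?c y) \<inter> (\<lambda>x. sgn (w y y) * w y x) -` {0<..})" for y
  have w0: "w y y \<noteq> 0" for y unfolding w_def using vol_density_continuous(2)[OF c(1)] c(2) by blast
  have "open (N y)" for y
    unfolding N_def w_def
    by (intro open_Int open_dom_V c d continuous_open_preimage open_dom open_greaterThan continuous_intros
        continuous_on_compose2[OF vol_density_continuous(1) chart_cont(1)] subset_refl)
  then have oN: "\<And>y. y \<in> K \<Longrightarrow> open (N y)" .
  have yN: "y \<in> N y" if "y \<in> K" for y
    using that K(2) c(2) chart_at(2) w0[of y] by (auto simp: N_def dom_V_def sgn_if)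
  obtain X Q C h where X: "finite X" "X \<subseteq> K" and Q: "open Q" "K \<subseteq> Q"
    and C: "\<And>y. y \<in> X \<Longrightarrow> compact (C y)" "\<And>y. y \<in> X \<Longrightarrow> C y \<subseteq> N y \<inter> fst (?c y)"
    and h: "\<And>x y. y \<in> X \<Longrightarrow> x \<notin> C y \<Longrightarrow> h y x = (0::real)"
      "\<And>x. x \<in> K \<Longrightarrow> (\<Sum>y\<in>X. h y x) = 1"
      "\<And>y e. y \<in> X \<Longrightarrow> e \<in> atlas G \<Longrightarrow> Ck_on 1 (snd e ` (Q \<inter> fst e)) (\<lambda>u. h y (chart_inv e u))"
  proof (rule partition_of_unity[OF K(1) oN yN], goal_cases)
    case (3 X Q C h)
    show ?case by (rule 3(1)[of X Q C h]) (fact 3)+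
  qed
  define \<gamma> where "\<gamma> y x = (\<lambda>vs. h y x * \<beta> x vs)" for y x
  have \<beta>alt: "alt_form (DIM('e) - 1) (\<beta> x)" if "x \<in> V" for x
    using \<beta>(1) that by (simp add: smooth_form_def)
  have \<gamma>alt: "alt_form (DIM('e) - 1) (\<gamma> y x)" if "x \<in> V" for x y
    using alt_form_sum[of "{()}" "DIM('e) - 1" "\<lambda>_. \<beta> x" "\<lambda>_. h y x"] \<beta>alt[OF that] by (simp add: \<gamma>_def)
  have oVK: "open (V - K)" using open_V compact_imp_closed[OF K(1)] by blast
  \<comment> \<open>The cut-off function is C^1 only on Q, but off K the form \<beta> is 0; the two
    open sets cover V.\<close>
  have \<gamma>C: "Ck_on 1 (snd e ` (V \<inter> fst e)) (\<lambda>u. form_in_chart G e (\<gamma> y) u vs)" if y: "y \<in> X" and e: "e \<in> atlas G" for y e vs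
  proof -
    let ?S = "snd e ` ((V \<inter> Q) \<inter> fst e)" and ?T = "snd e ` ((V - K) \<inter> fst e)"
    have oS: "open ?S" by (intro chart_image_open e open_Int open_V Q)
    have oT: "open ?T" by (intro chart_image_open e oVK)
    have S: "Ck_on 1 ?S (\<lambda>u. form_in_chart G e (\<gamma> y) u vs)"
    proof -
      have "Ck_on 1 (snd e ` (V \<inter> fst e)) (\<lambda>u. form_in_chart G e \<beta> u vs)"
        using \<beta>(1) e unfolding smooth_form_def smooth_on_def by blast
      then have b: "Ck_on 1 ?S (\<lambda>u. form_in_chart G e \<beta> u vs)" by (rule Ck_on_subset) blast
      have a: "Ck_on 1 ?S (\<lambda>u. h y (chart_inv e u))" by (rule Ck_on_subset[OF h(3)[OF y e]]) blast
      show ?thesis using Ck1_mult[OF a b] by (simp add: form_in_chart_def \<gamma>_def Let_def del: Ck_on.simps)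
    qed
    have T: "Ck_on 1 ?T (\<lambda>u. form_in_chart G e (\<gamma> y) u vs)"
    proof (rule Ck_on_cong[OF oT _ Ck1_const])
      fix u assume "u \<in> ?T"
      then obtain x where x: "x \<in> V - K" "x \<in> fst e" "u = snd e x" by blast
      show "0 = form_in_chart G e (\<gamma> y) u vs"
        unfolding x(3) form_in_chart_eq[OF e x(2)] \<gamma>_def K(3)[OF x(1)] by simp
    qed
    have "snd e ` (V \<inter> fst e) \<subseteq> ?S \<union> ?T" using Q(2) by blast
    then show ?thesis using Ck_on_subset[OF Ck1_Un[OF oS oT S T]] by blast
  qed
  have cod: "codegree_one_weight G V (\<gamma> y)" for y
  proof -
    obtain b where b: "\<And>x. x \<in> V \<Longrightarrow> \<beta> x = (\<lambda>vs. \<Sum>i = 1..dim (layer G 1). b i x * hat_coframe G i x vs)"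
      using \<beta>(3) unfolding codegree_one_weight_def by blast
    show ?thesis unfolding codegree_one_weight_def
    proof (intro exI ballI)
      fix x assume "x \<in> V"
      show "\<gamma> y x = (\<lambda>vs. \<Sum>i = 1..dim (layer G 1). (h y x * b i x) * hat_coframe G i x vs)"
        unfolding \<gamma>_def b[OF \<open>x \<in> V\<close>] by (simp add: sum_distrib_left mult.assoc)
    qed
  qed
  have local: "set_integrable (volume_measure G) V (wedge_term_1 Y \<eta> (\<gamma> y)) \<and>
      set_integrable (volume_measure G) V (wedge_term_2 Y \<eta> (\<gamma> y)) \<and>
      set_lebesgue_integral (volume_measure G) V (wedge_term_1 Y \<eta> (\<gamma> y))
       = set_lebesgue_integral (volume_measure G) V (wedge_term_2 Y \<eta> (\<gamma> y))" if y: "y \<in> X" for y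
  proof -
    have k1: "compact (K \<inter> C y)" by (rule compact_Int[OF K(1) C(1)[OF y]])
    have k2: "K \<inter> C y \<subseteq> dom_V (?c y) (?d y)" using C(2)[OF y] by (auto simp: N_def)
    have k3: "\<gamma> y x = (\<lambda>vs. 0)" if "x \<in> V - (K \<inter> C y)" for x
      using that K(3)[of x] h(1)[OF y, of x] by (cases "x \<in> K") (auto simp: \<gamma>_def)
    have k4: "\<bar>vol_density (?c y) (snd (?c y) x)\<bar> = sgn (w y y) * vol_density (?c y) (snd (?c y) x)" if "x \<in> K \<inter> C y" for x
    proof -
      have "sgn (w y y) * w y x > 0" using that C(2)[OF y] by (auto simp: N_def)
      then show ?thesis unfolding w_def by (auto simp: sgn_if split: if_splits)
    qed
    note * = weak_contact_in_chart[where \<gamma> = "\<gamma> y" and s = "sgn (w y y)",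
        OF c(1) d \<eta> \<gamma>alt cod \<gamma>C[OF y c(1)] k1 k2 k3 k4]
    show ?thesis by (intro conjI *)
  qed
  have sum: "wedge_term_1 Y \<eta> \<beta> x = (\<Sum>y\<in>X. wedge_term_1 Y \<eta> (\<gamma> y) x)"
      "wedge_term_2 Y \<eta> \<beta> x = (\<Sum>y\<in>X. wedge_term_2 Y \<eta> (\<gamma> y) x)" if x: "x \<in> V" for x
  proof -
    have s: "\<beta> z = (\<lambda>vs. \<Sum>y\<in>X. \<gamma> y z vs)" if "z \<in> V" for z
    proof (cases "z \<in> K")
      case True
      then show ?thesis unfolding \<gamma>_def sum_distrib_right[symmetric] h(2)[OF True] by simp
    next
      case False
      then show ?thesis using K(3)[of z] that by (simp add: \<gamma>_def)
    qed
    have dd: "(\<lambda>u. form_in_chart G (?c x) (\<gamma> y) u vs) differentiable (at (snd (?c x) x))" if "y \<in> X" for y vs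
      using \<gamma>C[OF that c(1)[of x], of vs] x c(2)[of x] by auto
    show "wedge_term_1 Y \<eta> \<beta> x = (\<Sum>y\<in>X. wedge_term_1 Y \<eta> (\<gamma> y) x)"
      "wedge_term_2 Y \<eta> \<beta> x = (\<Sum>y\<in>X. wedge_term_2 Y \<eta> (\<gamma> y) x)"
      by (rule wedge_terms_sum[where g = \<gamma> and \<gamma> = \<beta>, OF open_V x X(1) \<gamma>alt s dd]; assumption)+
  qed
  have V: "V \<in> sets (volume_measure G)" using borel_open[OF open_V] by (simp add: sets_volume_measure)
  have "set_lebesgue_integral (volume_measure G) V (wedge_term_1 Y \<eta> \<beta>)
      = set_lebesgue_integral (volume_measure G) V (\<lambda>x. \<Sum>y\<in>X. wedge_term_1 Y \<eta> (\<gamma> y) x)"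
    by (rule set_lebesgue_integral_cong[OF V]) (simp add: sum)
  also have "\<dots> = (\<Sum>y\<in>X. set_lebesgue_integral (volume_measure G) V (wedge_term_1 Y \<eta> (\<gamma> y)))"
    unfolding set_lebesgue_integral_def scaleR_sum_right
    by (rule Bochner_Integration.integral_sum) (use local in \<open>simp add: set_integrable_def\<close>)
  also have "\<dots> = (\<Sum>y\<in>X. set_lebesgue_integral (volume_measure G) V (wedge_term_2 Y \<eta> (\<gamma> y)))"
    using local by (intro sum.cong refl) blast
  also have "\<dots> = set_lebesgue_integral (volume_measure G) V (\<lambda>x. \<Sum>y\<in>X. wedge_term_2 Y \<eta> (\<gamma> y) x)"
    unfolding set_lebesgue_integral_def scaleR_sum_right
    by (rule Bochner_Integration.integral_sum[symmetric]) (use local in \<open>simp add: set_integrable_def\<close>)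
  also have "\<dots> = set_lebesgue_integral (volume_measure G) V (wedge_term_2 Y \<eta> \<beta>)"
    by (rule set_lebesgue_integral_cong[OF V]) (simp add: sum)
  finally show ?thesis .
qed

lemma weak_contact_push_forward: "weak_contact_field G V (push_forward G U f Z)"
  unfolding weak_contact_field_def form_integral_def
  using L1_loc weak_contact by (simp add: wedge_term_1_def[abs_def] wedge_term_2_def[abs_def])

end

theorem theorem5p1:
  fixes G :: "('g::{t2_space, second_countable_topology}, 'e::euclidean_space) carnot_struct"
    and U V :: "'g set" and f :: "'g \<Rightarrow> 'g" and Z :: "'g \<Rightarrow> 'e"
  assumes "carnot_group G"
    and "open U" and "open V"
    and "contact_diffeo G U V f"
    and "contact_field G U Z"
  shows "weak_contact_field G V (push_forward G U f Z)"
proof -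
  interpret contact_map G U V f Z by unfold_locales (fact assms)+
  show ?thesis by (rule weak_contact_push_forward)
qed

end
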